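(* Assume the setting in the context, with Condition 1 fulfilled and $\gamma_0(0)\ne0$. Let $u_\varepsilon$ be the solution of $i\partial_tu_\varepsilon=A_\varepsilon u_\varepsilon$, $u_\varepsilon(\cdot,0)=\Upsilon^{(+)}_\varepsilon f$ (i.e. $u_\varepsilon(\cdot,t)=e^{-itA_\varepsilon}\Upsilon^{(+)}_\varepsilon f$), and $u_0$ the solution of $i\partial_tu_0=A^{\mathrm{hom}}_0u_0$, $u_0(\cdot,0)=f$ (i.e. $u_0(\cdot,t)=e^{-itA^{\mathrm{hom}}_0}f$). Let $t\ne0$, $0\le q\le2$, $f\in H^q(\mathbb R)$. Then $$\|u_\varepsilon(\cdot,t)-e^{-it\varepsilon^{-2}\sigma_0}\varphi_0^\varepsilon u_0(\cdot,t)\|_{L_2(\mathbb R)}\le C(1+|t|^{q/4})\varepsilon^{q/2}\|f\|_{H^q(\mathbb R)}\quad\text{whenever }0<\varepsilon|t|^{-1/2}\le\mathfrak e,$$ with $C$ depending only on $q,\kappa,\|\varphi_0\|_{L_\infty},|\gamma_0(0)|,\|\theta_0\|_{M_\kappa(0)}$.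
   Context: Let $\check g$ be a real-valued measurable $1$-periodic function with $0<\alpha_0\le\check g\le\alpha_1<\infty$, $\omega$ a $1$-periodic function with $\|\omega\|_{L_2(0,1)}=1$, $0<\beta_0\le\omega\le\beta_1<\infty$, $g=\omega^2\check g$. $A$ is the selfadjoint operator in $L_2(\mathbb R)$ generated by the closed form $\int_{\mathbb R}g|\phi'|^2dx$, $u=\omega\phi$, $\phi\in H^1(\mathbb R)$ (formally $A=-\omega^{-1}\frac d{dx}g\frac d{dx}\omega^{-1}$). For $\varepsilon>0$, $A_\varepsilon=\varepsilon^{-2}T_\varepsilon^*AT_\varepsilon$ with $(T_\varepsilon u)(x)=\varepsilon^{1/2}u(\varepsilon x)$ (formally $A_\varepsilon=-(\omega^\varepsilon)^{-1}\frac d{dx}g^\varepsilon\frac d{dx}(\omega^\varepsilon)^{-1}$, where $F^\varepsilon(x)=F(x/\varepsilon)$). Let $\widetilde H^1(0,1)$ be the $f\in H^1(0,1)$ whose $1$-periodic extension is in $H^1_{\mathrm{loc}}(\mathbb R)$, $\widetilde{\mathcal H}^1(0,1)=\{f:\omega^{-1}f\in\widetilde H^1(0,1)\}$. For $k\in\mathbb R$, $A(k)$ is the selfadjoint operator in $L_2(0,1)$ generated by $\int_0^1g|\phi'+ik\phi|^2dx$, $\phi=\omega^{-1}u\in\widetilde H^1(0,1)$; $E_1(k)\le E_2(k)\le\dots$ are its eigenvalues (with multiplicity) and $\varphi_l(\cdot,k)$ normalized eigenfunctions, extended $1$-periodically in $x$, chosen so that $e^{ikx}\varphi_l(x,k)$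 is $2\pi$-periodic in $k\in\mathbb R$. Fix $s\in\mathbb N$, $E=E_s$, $\varphi=\varphi_s$. Condition 1: $s$ is odd and $(E_{s-1}(0),E(0))\ne\varnothing$ (with $E_0(0)=-\infty$). Under it, it is known that $E(k)=\sigma_0+b_0k^2+k^4\gamma_0(k)$ for $|k|\le\pi$, with $\sigma_0=E(0)$, $b_0>0$, $\gamma_0$ continuous and real-analytic for $|k|<\pi$, and $\varphi(x,k)=\varphi_0(x)+k\theta_0(x,k)$ for $|k|<\pi$, with $\varphi_0=\varphi(\cdot,0)$ (bounded, $1$-periodic) and $\theta_0(\cdot,k)$ real-analytic in $k$ with values in $\widetilde{\mathcal H}^1(0,1)$. Define $\tilde\gamma_0$ near $0$ by $(E(k)-\sigma_0)^{1/2}=b_0^{1/2}|k|+|k|^3\tilde\gamma_0(k)$ (with $\tilde\gamma_0(0)=\frac12b_0^{-1/2}\gamma_0(0)$). Fix $0<\kappa<\pi$ such that for $|k|\le\kappa$: $\frac12|\gamma_0(0)|\le|\gamma_0(k)|\le\frac32|\gamma_0(0)|$, $\frac12|\tilde\gamma_0(0)|\le|\tilde\gamma_0(k)|\le\frac32|\tilde\gamma_0(0)|$, $k^2|\tilde\gamma_0(k)|\le\frac12b_0^{1/2}$. $\|\theta_0\|_{M_\kappa(0)}=\operatorname{ess\,sup}_x\|\theta_0(x,\cdot)\|_{C^1[-\kappa,\kappa]}$, $\mathfrak e=(2\pi)^{-1/2}|\gamma_0(0)|^{1/2}\kappa^2$. $\Phi$ is the unitary Fourier transform, $(\Phi f)(k)=(2\pi)^{-1/2}\int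 e^{-ikx}f(x)dx$. Brillouin zones: $\widetilde\Omega_j=(-j\pi,-(j-1)\pi]\cup((j-1)\pi,j\pi]$, $j\in\mathbb N$. For $f\in L_2(\mathbb R)$, $(\Upsilon^{(+)}_\varepsilon f)(x)=(2\pi)^{-1/2}\int_{\mathbb R}(\Phi f)(k)\sum_{j=s}^\infty e^{ikx}\varphi_j(x/\varepsilon,\varepsilon k)\chi_{\widetilde\Omega_{j-s+1}}(\varepsilon k)\,dk$. $A^{\mathrm{hom}}_0=-b_0\frac{d^2}{dx^2}$ with domain $H^2(\mathbb R)$. *)

theory Defs
  imports "HOL-Analysis.Analysis" "HOL-Probability.Essential_Supremum"
begin

section \<open>Lebesgue spaces (functions are handled modulo a.e. equality)\<close>

type_synonym cfun = "real \<Rightarrow> complex"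

definition L2sp :: "real measure \<Rightarrow> cfun set" where
  "L2sp M = {f. f \<in> borel_measurable M \<and> integrable M (\<lambda>x. (cmod (f x))\<^sup>2)}"

definition L2norm :: "real measure \<Rightarrow> cfun \<Rightarrow> real" where
  "L2norm M f = sqrt (\<integral>x. (cmod (f x))\<^sup>2 \<partial>M)"

definition L2inner :: "real measure \<Rightarrow> cfun \<Rightarrow> cfun \<Rightarrow> complex" where
  "L2inner M f h = (\<integral>x. f x * cnj (h x) \<partial>M)"

definition cell :: "real measure" where
  "cell = restrict_space lborel {0..1}"

definition ess_sup :: "(real \<Rightarrow> real) \<Rightarrow> real" where
  "ess_sup h = real_of_ereal (esssup lborel (\<lambda>x. ereal (h x)))"

definition L2_lim :: "(real \<Rightarrow> cfun) \<Rightarrow> cfun \<Rightarrow> bool" where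
  "L2_lim F v \<longleftrightarrow> v \<in> L2sp lborel \<and> (\<forall>R. F R \<in> L2sp lborel) \<and>
     ((\<lambda>R. L2norm lborel (\<lambda>x. F R x - v x)) \<longlongrightarrow> 0) at_top"

definition fourier_trunc :: "cfun \<Rightarrow> real \<Rightarrow> cfun" where
  "fourier_trunc f R k = complex_of_real (1 / sqrt (2*pi)) *
      (LINT x:{-R..R}|lborel. exp (- \<i> * complex_of_real (k*x)) * f x)"

text \<open>Phi f: the (Plancherel) Fourier transform of f in L2, i.e. the L2-limit of the truncated
  Fourier integrals (determined up to a.e. equality).\<close>
definition Phi :: "cfun \<Rightarrow> cfun" where
  "Phi f = (SOME F. L2_lim (fourier_trunc f) F)"

definition Hq :: "real \<Rightarrow> cfun set" where
  "Hq q = {f. f \<in> L2sp lborel \<and>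
     integrable lborel (\<lambda>k. (1 + k\<^sup>2) powr q * (cmod (Phi f k))\<^sup>2)}"

definition Hq_norm :: "real \<Rightarrow> cfun \<Rightarrow> real" where
  "Hq_norm q f = sqrt (\<integral>k. (1 + k\<^sup>2) powr q * (cmod (Phi f k))\<^sup>2 \<partial>lborel)"

text \<open>phi in H^1(R) with weak derivative dphi (absolutely continuous representative).\<close>
definition H1 :: "cfun \<Rightarrow> cfun \<Rightarrow> bool" where
  "H1 phi dphi \<longleftrightarrow> phi \<in> L2sp lborel \<and> dphi \<in> L2sp lborel \<and>
     (\<forall>x. phi x = phi 0 + (LBINT y=0..x. dphi y))"

text \<open>phi in H~^1(0,1): 1-periodic function whose periodic extension lies in H^1_loc,
  with weak derivative dphi.\<close>
definition H1per :: "cfun \<Rightarrow> cfun \<Rightarrow> bool" where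
  "H1per phi dphi \<longleftrightarrow> (\<forall>x. phi (x+1) = phi x) \<and> (\<forall>x. dphi (x+1) = dphi x) \<and>
     dphi \<in> L2sp cell \<and> (\<forall>x. phi x = phi 0 + (LBINT y=0..x. dphi y))"

text \<open>Relation "A u = w" for the selfadjoint operator generated by a form a with domain given
  through representatives R u (the form domain is {u. R u \<noteq> {}}).\<close>
definition form_op :: "real measure \<Rightarrow> (cfun \<Rightarrow> 'r set) \<Rightarrow> ('r \<Rightarrow> 'r \<Rightarrow> complex)
    \<Rightarrow> cfun \<Rightarrow> cfun \<Rightarrow> bool" where
  "form_op M R a u w \<longleftrightarrow> u \<in> L2sp M \<and> w \<in> L2sp M \<and> R u \<noteq> {} \<and>
     (\<forall>v \<in> L2sp M. \<forall>r \<in> R u. \<forall>p \<in> R v. a r p = L2inner M w v)"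

definition opA :: "(real \<Rightarrow> real) \<Rightarrow> (real \<Rightarrow> real) \<Rightarrow> cfun \<Rightarrow> cfun \<Rightarrow> bool" where
  "opA g omega = form_op lborel
     (\<lambda>u. {(phi, dphi). H1 phi dphi \<and> (AE x in lborel. u x = complex_of_real (omega x) * phi x)})
     (\<lambda>(phi, dphi) (psi, dpsi). \<integral>x. complex_of_real (g x) * dphi x * cnj (dpsi x) \<partial>lborel)"

definition opAk :: "(real \<Rightarrow> real) \<Rightarrow> (real \<Rightarrow> real) \<Rightarrow> real \<Rightarrow> cfun \<Rightarrow> cfun \<Rightarrow> bool" where
  "opAk g omega k = form_op cell
     (\<lambda>u. {(phi, dphi). H1per phi dphi \<and> (AE x in cell. u x = complex_of_real (omega x) * phi x)})
     (\<lambda>(phi, dphi) (psi, dpsi). \<integral>x. complex_of_real (g x) * (dphi x + \<i> * k * phi x)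
          * cnj (dpsi x + \<i> * k * psi x) \<partial>cell)"

definition Tsc :: "real \<Rightarrow> cfun \<Rightarrow> cfun" where
  "Tsc eps u x = complex_of_real (sqrt eps) * u (eps * x)"

text \<open>A_eps = eps^-2 T_eps^* A T_eps (T_eps unitary): A_eps u = w iff A (T u) = eps^2 T w.\<close>
definition opAeps :: "(real \<Rightarrow> real) \<Rightarrow> (real \<Rightarrow> real) \<Rightarrow> real \<Rightarrow> cfun \<Rightarrow> cfun \<Rightarrow> bool" where
  "opAeps g omega eps u w \<longleftrightarrow> opA g omega (Tsc eps u) (\<lambda>x. complex_of_real (eps\<^sup>2) * Tsc eps w x)"

definition opAhom :: "real \<Rightarrow> cfun \<Rightarrow> cfun \<Rightarrow> bool" where
  "opAhom b0 u w \<longleftrightarrow> u \<in> L2sp lborel \<and> w \<in> L2sp lborel \<and>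
     (\<exists>phi d1 d2. H1 phi d1 \<and> H1 d1 d2 \<and> (AE x in lborel. u x = phi x) \<and>
        (AE x in lborel. w x = - complex_of_real b0 * d2 x))"

text \<open>U is a strongly continuous unitary group on L2(R) whose generator is -iA
  (for selfadjoint A this characterises U t = e^{-itA} uniquely, by Stone's theorem).\<close>
definition unitary_group_of :: "(cfun \<Rightarrow> cfun \<Rightarrow> bool) \<Rightarrow> (real \<Rightarrow> cfun \<Rightarrow> cfun) \<Rightarrow> bool" where
  "unitary_group_of A U \<longleftrightarrow>
     (\<forall>t. \<forall>u \<in> L2sp lborel. U t u \<in> L2sp lborel \<and> L2norm lborel (U t u) = L2norm lborel u) \<and>
     (\<forall>t a b. \<forall>u \<in> L2sp lborel. \<forall>v \<in> L2sp lborel.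
        AE x in lborel. U t (\<lambda>y. a * u y + b * v y) x = a * U t u x + b * U t v x) \<and>
     (\<forall>u \<in> L2sp lborel. AE x in lborel. U 0 u x = u x) \<and>
     (\<forall>s t. \<forall>u \<in> L2sp lborel. AE x in lborel. U (s + t) u x = U s (U t u) x) \<and>
     (\<forall>u \<in> L2sp lborel. \<forall>t0.
        ((\<lambda>t. L2norm lborel (\<lambda>x. U t u x - U t0 u x)) \<longlongrightarrow> 0) (at t0)) \<and>
     (\<forall>u w. A u w \<longrightarrow>
        ((\<lambda>h. L2norm lborel (\<lambda>x. (U h u x - u x) / complex_of_real h + \<i> * w x)) \<longlongrightarrow> 0) (at 0))"

definition expA :: "(cfun \<Rightarrow> cfun \<Rightarrow> bool) \<Rightarrow> real \<Rightarrow> cfun \<Rightarrow> cfun" where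
  "expA A = (SOME U. unitary_group_of A U)"

definition BZ :: "nat \<Rightarrow> real set" where
  "BZ j = {k. - real j * pi < k \<and> k \<le> - (real j - 1) * pi} \<union>
          {k. (real j - 1) * pi < k \<and> k \<le> real j * pi}"

definition Ups_trunc :: "(nat \<Rightarrow> real \<Rightarrow> real \<Rightarrow> complex) \<Rightarrow> nat \<Rightarrow> real \<Rightarrow> cfun \<Rightarrow> real \<Rightarrow> cfun" where
  "Ups_trunc phis s eps f R x = complex_of_real (1 / sqrt (2*pi)) *
     (LINT k:{-R..R}|lborel. Phi f k *
        (\<Sum>n. (let j = n + s in
           exp (\<i> * complex_of_real (k*x)) * phis j (x / eps) (eps * k) *
           complex_of_real (indicator (BZ (j - s + 1)) (eps * k)))))"

definition Ups :: "(nat \<Rightarrow> real \<Rightarrow> real \<Rightarrow> complex) \<Rightarrow> nat \<Rightarrow> real \<Rightarrow> cfun \<Rightarrow> cfun" where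
  "Ups phis s eps f = (SOME v. L2_lim (Ups_trunc phis s eps f) v)"

definition C1norm :: "real \<Rightarrow> (real \<Rightarrow> complex) \<Rightarrow> real" where
  "C1norm kap h = (SUP k\<in>{-kap..kap}. cmod (h k)) +
     (SUP k\<in>{-kap..kap}. cmod (vector_derivative h (at k within {-kap..kap})))"

definition Mnorm :: "real \<Rightarrow> (real \<Rightarrow> real \<Rightarrow> complex) \<Rightarrow> real" where
  "Mnorm kap theta = ess_sup (\<lambda>x. C1norm kap (theta x))"

text \<open>E l k = E_l(k), phis l x k = phi_l(x,k) (l \<ge> 1; index 0 unused).\<close>
definition setting :: "(real \<Rightarrow> real) \<Rightarrow> (real \<Rightarrow> real) \<Rightarrow> (nat \<Rightarrow> real \<Rightarrow> real) \<Rightarrow>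
    (nat \<Rightarrow> real \<Rightarrow> real \<Rightarrow> complex) \<Rightarrow> bool" where
  "setting gc omega E phis \<longleftrightarrow>
     gc \<in> borel_measurable lborel \<and> (\<forall>x. gc (x+1) = gc x) \<and>
     (\<exists>a0 a1. 0 < a0 \<and> (\<forall>x. a0 \<le> gc x \<and> gc x \<le> a1)) \<and>
     omega \<in> borel_measurable lborel \<and> (\<forall>x. omega (x+1) = omega x) \<and>
     (\<exists>b0 b1. 0 < b0 \<and> (\<forall>x. b0 \<le> omega x \<and> omega x \<le> b1)) \<and>
     (\<integral>x. (omega x)\<^sup>2 \<partial>cell) = 1 \<and>
     (\<forall>k. \<forall>l\<ge>1.
        opAk (\<lambda>x. (omega x)\<^sup>2 * gc x) omega k (\<lambda>x. phis l x k)
             (\<lambda>x. complex_of_real (E l k) * phis l x k) \<and>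
        E l k \<le> E (Suc l) k \<and>
        (\<forall>x. phis l (x+1) k = phis l x k) \<and>
        (\<forall>x. exp (\<i> * complex_of_real (x * (k + 2*pi))) * phis l x (k + 2*pi)
              = exp (\<i> * complex_of_real (x * k)) * phis l x k) \<and>
        (\<forall>m\<ge>1. L2inner cell (\<lambda>x. phis l x k) (\<lambda>x. phis m x k) = (if l = m then 1 else 0))) \<and>
     (\<forall>k. \<forall>u \<in> L2sp cell.
        (\<lambda>n. (cmod (L2inner cell u (\<lambda>x. phis (Suc n) x k)))\<^sup>2) sums (L2norm cell u)\<^sup>2) \<and>
     (\<forall>l. (\<lambda>(x, k). phis l x k) \<in> borel_measurable borel)"

definition condition1 :: "(nat \<Rightarrow> real \<Rightarrow> real) \<Rightarrow> nat \<Rightarrow> bool" where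
  "condition1 E s \<longleftrightarrow> 1 \<le> s \<and> odd s \<and> (s = 1 \<or> E (s - 1) 0 < E s 0)"

definition expansions :: "(nat \<Rightarrow> real \<Rightarrow> real) \<Rightarrow> (nat \<Rightarrow> real \<Rightarrow> real \<Rightarrow> complex) \<Rightarrow> nat \<Rightarrow>
    real \<Rightarrow> real \<Rightarrow> (real \<Rightarrow> real) \<Rightarrow> (real \<Rightarrow> real \<Rightarrow> complex) \<Rightarrow> (real \<Rightarrow> real) \<Rightarrow> real \<Rightarrow> bool" where
  "expansions E phis s sigma0 b0 gam0 theta0 gamt0 kap \<longleftrightarrow>
     sigma0 = E s 0 \<and> 0 < b0 \<and> continuous_on {-pi..pi} gam0 \<and>
     (\<forall>k. \<bar>k\<bar> \<le> pi \<longrightarrow> E s k = sigma0 + b0 * k\<^sup>2 + k^4 * gam0 k) \<and>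
     (\<forall>x k. \<bar>k\<bar> < pi \<longrightarrow> phis s x k = phis s x 0 + complex_of_real k * theta0 x k) \<and>
     0 < kap \<and> kap < pi \<and>
     (\<forall>x. (\<forall>k\<in>{-kap..kap}. theta0 x differentiable (at k within {-kap..kap})) \<and>
          continuous_on {-kap..kap} (\<lambda>k. vector_derivative (theta0 x) (at k within {-kap..kap}))) \<and>
     (\<exists>c. AE x in lborel. C1norm kap (theta0 x) \<le> c) \<and>
     gamt0 0 = 1/2 * b0 powr (-1/2) * gam0 0 \<and>
     (\<forall>k. \<bar>k\<bar> \<le> kap \<longrightarrow> sigma0 \<le> E s k \<and>
          sqrt (E s k - sigma0) = sqrt b0 * \<bar>k\<bar> + \<bar>k\<bar>^3 * gamt0 k) \<and>
     (\<forall>k. \<bar>k\<bar> \<le> kap \<longrightarrow>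
          1/2 * \<bar>gam0 0\<bar> \<le> \<bar>gam0 k\<bar> \<and> \<bar>gam0 k\<bar> \<le> 3/2 * \<bar>gam0 0\<bar> \<and>
          1/2 * \<bar>gamt0 0\<bar> \<le> \<bar>gamt0 k\<bar> \<and> \<bar>gamt0 k\<bar> \<le> 3/2 * \<bar>gamt0 0\<bar> \<and>
          k\<^sup>2 * \<bar>gamt0 k\<bar> \<le> 1/2 * sqrt b0)"

end

theory Submission
  imports Defs "HOL-Probability.Probability"
begin

text \<open>
  On the quasimomenta with \<open>\<bar>eps * k\<bar> \<le> kap\<close> the operator \<open>Ups\<close> only involves the band \<open>s\<close>, and both
  evolutions act on the resulting wave packets by multiplying \<open>Phi f k\<close> with the scalar phases
  \<open>exp (- i t E\<^sub>s(eps k) / eps\<^sup>2)\<close> and \<open>exp (- i t b0 k\<^sup>2)\<close>. After extracting \<open>exp (- i t sigma0 / eps\<^sup>2)\<close>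
  the phases differ by at most \<open>min 2 (\<bar>t\<bar> eps\<^sup>2 k\<^sup>4 \<bar>gam0\<bar>)\<close>, the Bloch functions \<open>phis s x (eps k)\<close> and
  \<open>phis s x 0\<close> differ by at most \<open>eps \<bar>k\<bar>\<close> times the norm of \<open>theta0\<close>, and on the remaining \<open>k\<close> the weight
  of the Sobolev norm is at least \<open>(kap / eps)^(q/2)\<close>; interpolating each of the three errors gives the rate
  \<open>eps^(q/2)\<close>. Integral operators with Bloch kernels are contractions of \<open>L\<^sub>2\<close> by orthonormality of the Bloch
  functions in a period cell.

  That the packets evolve in this way requires them to lie in the domain of the form operator. By
  selfadjointness it suffices to pair them with an arbitrary domain element: truncating a Bloch wave
  with a slowly varying cutoff produces a commutator error that vanishes in the limit. The unitary groups
  themselves are constructed by Yosida approximation.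
\<close>

section \<open>Unitary groups generated by selfadjoint operators\<close>

text \<open>\<open>Phi\<close>, \<open>Ups\<close> and \<open>expA\<close> are all introduced by
  choice (\<open>SOME\<close>), so nothing is known about them until an object with the defining
  property is exhibited; hence the L2 convergence of the truncated integrals and the existence of
  the groups have to be established in full. Afterwards only the defining property is known. It
  suffices for the groups because a norm-differentiable curve v in the domain with v' = -iAv is
  carried along by every group with this property. Such curves are taken among packets cut to |eps
  k| <= kap, where the multipliers are bounded; the remaining frequencies are never evolved
  explicitly, unitarity alone bounds their contribution. Fourier inversion enters since the
  homogenized group is applied to f itself while its packets are written through
  \<open>Phi f\<close>. The exponent q/4 on |t| comes from the phase error |t| eps^2 k^4 |gam|: its
  power q/4 produces eps^(q/2) together with the Sobolev weight (1 + k^2)^(q/2).\<close>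

lemma closed_subspace_projection:
  fixes M :: "'a::{real_inner,complete_space} set"
  assumes cl: "closed M" and sub: "subspace M"
  obtains p where "p \<in> M" "\<And>m. m \<in> M \<Longrightarrow> inner (x - p) m = 0"
proof -
  define D where "D = (INF m\<in>M. (norm (x - m))\<^sup>2)"
  have bdd: "bdd_below ((\<lambda>m. (norm (x - m))\<^sup>2) ` M)"
    by (rule bdd_belowI[of _ 0]) auto
  have ne: "M \<noteq> {}" using sub by (auto simp: subspace_def)
  have D_le: "D \<le> (norm (x - m))\<^sup>2" if "m \<in> M" for m
    unfolding D_def by (rule cINF_lower[OF bdd that])
  have "\<exists>m\<in>M. (norm (x - m))\<^sup>2 < D + 1 / real (Suc n)" for n
  proof -
    have "D < D + 1 / real (Suc n)" by simp
    then show ?thesis unfolding D_def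
      by (subst (asm) cINF_less_iff[OF ne bdd]) auto
  qed
  then obtain f where f: "\<And>n. f n \<in> M" "\<And>n. (norm (x - f n))\<^sup>2 < D + 1 / real (Suc n)"
    by metis
  \<comment> \<open>Parallelogram law for \<open>x - a\<close> and \<open>x - b\<close>: the
    midpoint of a and b lies in M, so its squared distance is at least D, and two near-minimisers
    must be close.\<close>
  have par: "(norm (a - b))\<^sup>2 \<le> 2 * (norm (x - a))\<^sup>2 + 2 * (norm (x - b))\<^sup>2 - 4 * D"
    if "a \<in> M" "b \<in> M" for a b
  proof -
    have "(1/2) *\<^sub>R (a + b) \<in> M" using sub that by (simp add: subspace_add subspace_scale)
    from D_le[OF this] have "4 * D \<le> 4 * (norm (x - (1/2) *\<^sub>R (a + b)))\<^sup>2" by simp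
    also have "\<dots> = 2 * (norm (x - a))\<^sup>2 + 2 * (norm (x - b))\<^sup>2 - (norm (a - b))\<^sup>2"
      by (simp add: power2_norm_eq_inner inner_simps inner_commute algebra_simps)
    finally show ?thesis by simp
  qed
  have cau: "(norm (f i - f j))\<^sup>2 \<le> 2 / real (Suc i) + 2 / real (Suc j)" for i j
    using par[OF f(1)[of i] f(1)[of j]] f(2)[of i] f(2)[of j] by simp
  have "Cauchy f"
  proof (rule metric_CauchyI)
    fix e :: real assume e: "e > 0"
    obtain N where N: "4 / e\<^sup>2 < real N" using reals_Archimedean2 by blast
    have Np: "real N > 0" using N e by (smt (verit) zero_less_divide_iff zero_less_power)
    show "\<exists>N. \<forall>i\<ge>N. \<forall>j\<ge>N. dist (f i) (f j) < e"
    proof (intro exI allI impI)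
      fix i j assume ij: "i \<ge> N" "j \<ge> N"
      have "2 / real (Suc i) < 2 / real N" "2 / real (Suc j) < 2 / real N"
        using ij Np by (auto intro!: divide_strict_left_mono)
      then have "(norm (f i - f j))\<^sup>2 < 4 / real N" using cau[of i j] by simp
      also have "\<dots> < e\<^sup>2" using N Np e by (simp add: field_simps)
      finally show "dist (f i) (f j) < e"
        using e by (simp add: dist_norm power2_less_imp_less)
    qed
  qed
  then obtain p where p: "f \<longlonglongrightarrow> p" using Cauchy_convergent_iff convergent_def by blast
  have pM: "p \<in> M" using closed_sequentially[OF cl] f(1) p by blast
  have "(\<lambda>n. (norm (x - f n))\<^sup>2) \<longlonglongrightarrow> (norm (x - p))\<^sup>2" by (intro tendsto_intros p)
  moreover have "(\<lambda>n. D + 1 / real (Suc n)) \<longlonglongrightarrow> D + 0"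
    using LIMSEQ_Suc[OF lim_inverse_n'] by (intro tendsto_intros) simp
  ultimately have pD: "(norm (x - p))\<^sup>2 \<le> D"
    using LIMSEQ_le[of _ _ "\<lambda>n. D + 1 / real (Suc n)" D] less_imp_le[OF f(2)] by auto
  have "inner (x - p) m = 0" if m: "m \<in> M" for m
  proof (cases "m = 0")
    case False
    \<comment> \<open>The minimiser along the line p + t m; minimality of p at this t forces the
      squared inner product to vanish.\<close>
    define t where "t = inner (x - p) m / (norm m)\<^sup>2"
    have "p + t *\<^sub>R m \<in> M" using sub pM m by (simp add: subspace_add subspace_scale)
    from D_le[OF this] pD have "(norm (x - p))\<^sup>2 \<le> (norm (x - (p + t *\<^sub>R m)))\<^sup>2" by (rule order_trans[rotated])
    also have "\<dots> = (norm (x - p))\<^sup>2 - 2 * t * inner (x - p) m + t\<^sup>2 * (norm m)\<^sup>2"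
    proof -
      have "(norm (y - t *\<^sub>R m))\<^sup>2 = (norm y)\<^sup>2 - 2 * t * inner y m + (t * t) * (norm m)\<^sup>2" for y
        by (simp add: power2_norm_eq_inner inner_simps inner_commute algebra_simps)
      from this[of "x - p"] show ?thesis by (simp add: power2_eq_square[of t] diff_diff_eq)
    qed
    finally have "2 * t * inner (x - p) m \<le> t\<^sup>2 * (norm m)\<^sup>2" by simp
    then have "(inner (x - p) m)\<^sup>2 / (norm m)\<^sup>2 \<le> 0"
      using False by (simp add: t_def power2_eq_square field_simps)
    then show ?thesis using False by (simp add: divide_le_0_iff)
  qed simp
  with pM that show thesis by blast
qed

section \<open>Bounded operators as a Banach algebra\<close>

typedef (overloaded) 'a bop = "UNIV :: ('a::real_normed_vector \<Rightarrow>\<^sub>L 'a) set"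
  morphisms of_bop to_bop by simp

setup_lifting type_definition_bop

text \<open>Composition as multiplication makes operators elements of a Banach algebra, so that
  \<open>exp\<close> with its derivative and commutation rules applies to them.
  \<open>perfect_space\<close> excludes the zero space, where the unit would not have norm
  1.\<close>

instantiation bop :: ("{real_normed_vector, perfect_space}") real_normed_algebra_1
begin
lift_definition zero_bop :: "'a bop" is 0 .
lift_definition one_bop :: "'a bop" is id_blinfun .
lift_definition plus_bop :: "'a bop \<Rightarrow> 'a bop \<Rightarrow> 'a bop" is "(+)" .
lift_definition minus_bop :: "'a bop \<Rightarrow> 'a bop \<Rightarrow> 'a bop" is "(-)" .
lift_definition uminus_bop :: "'a bop \<Rightarrow> 'a bop" is uminus .
lift_definition times_bop :: "'a bop \<Rightarrow> 'a bop \<Rightarrow> 'a bop" is "(o\<^sub>L)" .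
lift_definition scaleR_bop :: "real \<Rightarrow> 'a bop \<Rightarrow> 'a bop" is scaleR .
lift_definition norm_bop :: "'a bop \<Rightarrow> real" is norm .
definition "dist_bop (x::'a bop) y = norm (x - y)"
definition "sgn_bop (x::'a bop) = inverse (norm x) *\<^sub>R x"
definition "(uniformity :: ('a bop \<times> 'a bop) filter) = (INF e\<in>{0<..}. principal {(x, y). dist x y < e})"
definition "open_bop U = (\<forall>x\<in>U. \<forall>\<^sub>F (x', y) in uniformity. x' = x \<longrightarrow> y \<in> (U :: 'a bop set))"
instance
proof
  fix a b c :: "'a bop" and r s :: real
  show "a * b * c = a * (b * c)" by transfer (rule blinfun_eqI, simp)
  show "1 * a = a" "a * 1 = a" by (transfer, rule blinfun_eqI, simp)+
  show "(a + b) * c = a * c + b * c" "a * (b + c) = a * b + a * c"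
    by (transfer, rule blinfun_eqI, simp add: blinfun.bilinear_simps)+
  show "(r *\<^sub>R a) * b = r *\<^sub>R (a * b)" "a * (r *\<^sub>R b) = r *\<^sub>R (a * b)"
    by (transfer, rule blinfun_eqI, simp add: blinfun.bilinear_simps)+
  show "norm (a * b) \<le> norm a * norm b" by transfer (rule norm_blinfun_compose)
  show "norm (1 :: 'a bop) = 1" by transfer (rule norm_blinfun_id)
  show "(0::'a bop) \<noteq> 1" by transfer (metis norm_blinfun_id norm_zero zero_neq_one)
  show "a + b + c = a + (b + c)" by transfer simp
  show "a + b = b + a" by transfer simp
  show "0 + a = a" by transfer simp
  show "- a + a = 0" by transfer simp
  show "a - b = a + - b" by transfer simp
  show "r *\<^sub>R (a + b) = r *\<^sub>R a + r *\<^sub>R b" by transfer (rule scaleR_add_right)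
  show "(r + s) *\<^sub>R a = r *\<^sub>R a + s *\<^sub>R a" by transfer (rule scaleR_add_left)
  show "r *\<^sub>R s *\<^sub>R a = (r * s) *\<^sub>R a" by transfer simp
  show "1 *\<^sub>R a = a" by transfer simp
  show "(norm a = 0) = (a = 0)" by transfer simp
  show "norm (a + b) \<le> norm a + norm b" by transfer (rule norm_triangle_ineq)
  show "norm (r *\<^sub>R a) = \<bar>r\<bar> * norm a" by transfer simp
qed (simp_all add: dist_bop_def sgn_bop_def uniformity_bop_def open_bop_def)
end

instance bop :: ("{banach, perfect_space}") banach
proof
  fix X :: "nat \<Rightarrow> 'a bop" assume X: "Cauchy X"
  have d: "dist (of_bop x) (of_bop y) = dist x y" for x y :: "'a bop"
    by (simp add: dist_norm norm_bop.rep_eq minus_bop.rep_eq)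
  have "Cauchy (\<lambda>n. of_bop (X n))" using X by (simp add: Cauchy_def d)
  then obtain L where "(\<lambda>n. of_bop (X n)) \<longlonglongrightarrow> L"
    using Cauchy_convergent_iff convergent_def by blast
  then have "(\<lambda>n. dist (of_bop (X n)) (of_bop (to_bop L))) \<longlonglongrightarrow> 0"
    by (subst (asm) tendsto_dist_iff) (simp add: to_bop_inverse)
  then show "convergent X"
    unfolding convergent_def d by (auto simp: tendsto_dist_iff[of X])
qed

definition bap :: "'a::real_normed_vector bop \<Rightarrow> 'a \<Rightarrow> 'a" where
  "bap a = blinfun_apply (of_bop a)"

lemma bap_simps [simp]:
  fixes a b :: "'a::{real_normed_vector, perfect_space} bop"
  shows "bap (a + b) x = bap a x + bap b x" "bap (a - b) x = bap a x - bap b x"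
    "bap (r *\<^sub>R a) x = r *\<^sub>R bap a x" "bap (a * b) x = bap a (bap b x)" "bap 1 x = x"
    "bap 0 x = 0" "bap (- a) x = - bap a x"
    "bap a (x + y) = bap a x + bap a y" "bap a (x - y) = bap a x - bap a y"
    "bap a (r *\<^sub>R x) = r *\<^sub>R bap a x"
  by (simp_all add: bap_def plus_bop.rep_eq minus_bop.rep_eq scaleR_bop.rep_eq times_bop.rep_eq
      one_bop.rep_eq zero_bop.rep_eq uminus_bop.rep_eq blinfun.bilinear_simps)

lemma bap_bounded: "norm (bap a x) \<le> norm a * norm x"
  for a :: "'a::{real_normed_vector, perfect_space} bop"
  by (simp add: bap_def norm_bop.rep_eq norm_blinfun)

lemma bounded_linear_bap_left: "bounded_linear (\<lambda>a. bap a x)"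
  for x :: "'a::{real_normed_vector, perfect_space}"
  by (rule bounded_linear_intro[where K="norm x"]) (auto simp: bap_bounded mult.commute[of "norm x"])

lemma bop_eqI: "(\<And>x. bap a x = bap b x) \<Longrightarrow> a = b"
  by (metis bap_def blinfun_eqI of_bop_inject)

text \<open>Along the flow the derivative of the squared norm is 2 <Cf, f>, which skewness makes
  zero.\<close>

lemma exp_skew_isometry:
  fixes C :: "'a::{real_inner, banach, perfect_space} bop"
  assumes skew: "\<And>x y. inner (bap C x) y = - inner x (bap C y)"
  shows "norm (bap (exp (t *\<^sub>R C)) x) = norm x"
proof -
  let ?f = "\<lambda>t. bap (exp (t *\<^sub>R C)) x"
  have der: "(?f has_vector_derivative bap C (?f t)) (at t)" for t
    using bounded_linear.has_vector_derivative[OF bounded_linear_bap_left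
        exp_scaleR_has_vector_derivative_left] by simp
  have "((\<lambda>t. inner (?f t) (?f t)) has_vector_derivative 0) (at t)" for t
    using bounded_bilinear.has_vector_derivative[OF bounded_bilinear_inner der[of t] der[of t]]
    using skew[of "?f t" "?f t"] by (simp add: inner_commute)
  then have "inner (?f t) (?f t) = inner (?f 0) (?f 0)"
    using has_vector_derivative_zero_constant[of UNIV "\<lambda>t. inner (?f t) (?f t)"] by (metis UNIV_I convex_UNIV)
  then show ?thesis by (simp add: norm_eq_sqrt_inner)
qed

text \<open>Mean value inequality for s |-> exp(sC) x - s y, whose derivative is exp(sC) C x - y.
  Taking y = 0 controls the displacement of x; a y close to C x gives first-order expansions that do
  not involve the norm of C.\<close>

lemma exp_skew_bound:
  fixes C :: "'a::{real_inner, banach, perfect_space} bop"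
  assumes skew: "\<And>x y. inner (bap C x) y = - inner x (bap C y)"
    and B: "\<And>s. \<bar>s\<bar> \<le> \<bar>t\<bar> \<Longrightarrow> norm (bap (exp (s *\<^sub>R C)) (bap C x) - y) \<le> B"
  shows "norm (bap (exp (t *\<^sub>R C)) x - x - t *\<^sub>R y) \<le> \<bar>t\<bar> * B"
proof -
  let ?f = "\<lambda>t. bap (exp (t *\<^sub>R C)) x - t *\<^sub>R y"
  have der: "(?f has_vector_derivative (bap (exp (s *\<^sub>R C)) (bap C x) - y)) (at s within T)" for s T
    using bounded_linear.has_vector_derivative[OF bounded_linear_bap_left
        exp_scaleR_has_vector_derivative_right[of C s T], of x]
    by (auto intro!: derivative_eq_intros)
  have "norm (?f t - ?f 0) \<le> B * norm (t - 0)"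
  proof (rule differentiable_bound[of "closed_segment 0 t"])
    fix s assume s: "s \<in> closed_segment 0 t"
    show "(?f has_derivative (\<lambda>h. h *\<^sub>R (bap (exp (s *\<^sub>R C)) (bap C x) - y))) (at s within closed_segment 0 t)"
      using der[of s "closed_segment 0 t"] by (simp add: has_vector_derivative_def)
    have "\<bar>s\<bar> \<le> \<bar>t\<bar>" using s by (auto simp: closed_segment_eq_real_ivl split: if_splits)
    from B[OF this] show "onorm (\<lambda>h. h *\<^sub>R (bap (exp (s *\<^sub>R C)) (bap C x) - y)) \<le> B"
      by (simp add: onorm_scaleR_left bounded_linear_ident onorm_id)
  qed auto
  then show ?thesis by (simp add: algebra_simps)
qed

section \<open>The nonnegative selfadjoint operator of a closed form\<close>

locale closed_graph_form =
  fixes Gr :: "('a::{real_inner, banach, perfect_space} \<times> 'a) set" and I :: "'a \<Rightarrow> 'a"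
  assumes closed_Gr: "closed Gr" and subspace_Gr: "subspace Gr"
    and dense_Gr: "\<And>h. (\<And>u s. (u, s) \<in> Gr \<Longrightarrow> inner h u = 0) \<Longrightarrow> h = 0"
    and linear_I: "linear I" and inner_I: "\<And>x y. inner (I x) (I y) = inner x y"
    and I_I: "\<And>x. I (I x) = - x" and Gr_I: "\<And>u s. (u, s) \<in> Gr \<Longrightarrow> (I u, I s) \<in> Gr"
begin

text \<open>If \<open>Gr\<close> is the graph of a closed densely defined operator S, this is S
  followed by its adjoint, i.e. the operator of the form <Su, Sv>. The space is real;
  \<open>I\<close> is its complex structure (multiplication by i), which \<open>Gr\<close>
  respects.\<close>

definition A :: "'a \<Rightarrow> 'a \<Rightarrow> bool" where
  "A u w \<longleftrightarrow> (\<exists>s. (u, s) \<in> Gr \<and> (\<forall>v r. (v, r) \<in> Gr \<longrightarrow> inner s r = inner w v))"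

lemma inner_I_left: "inner (I x) y = - inner x (I y)"
  using inner_I[of "I x" y] by (simp add: I_I)

lemma norm_I: "norm (I x) = norm x" by (simp add: norm_eq_sqrt_inner inner_I)

lemmas I_lin = linear_add[OF linear_I] linear_diff[OF linear_I] linear_scale[OF linear_I] linear_neg[OF linear_I]

lemma A_sym: assumes "A u w" "A v y" shows "inner w v = inner u y"
proof -
  from assms obtain s s' where
    s: "(u, s) \<in> Gr" "\<And>v r. (v, r) \<in> Gr \<Longrightarrow> inner s r = inner w v" and
    s': "(v, s') \<in> Gr" "\<And>v r. (v, r) \<in> Gr \<Longrightarrow> inner s' r = inner y v"
    unfolding A_def by blast
  show ?thesis using s(2)[OF s'(1)] s'(2)[OF s(1)] by (simp add: inner_commute)
qed

lemma A_pos: assumes "A u w" shows "inner w u \<ge> 0"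
proof -
  from assms obtain s where
    s: "(u, s) \<in> Gr" "\<And>v r. (v, r) \<in> Gr \<Longrightarrow> inner s r = inner w v"
    unfolding A_def by blast
  show ?thesis using s(2)[OF s(1)] by (metis inner_ge_zero)
qed

lemma A_add: assumes "A u w" "A v y" shows "A (u + v) (w + y)"
proof -
  from assms obtain s s' where
    s: "(u, s) \<in> Gr" "\<And>v r. (v, r) \<in> Gr \<Longrightarrow> inner s r = inner w v" and
    s': "(v, s') \<in> Gr" "\<And>v r. (v, r) \<in> Gr \<Longrightarrow> inner s' r = inner y v"
    unfolding A_def by blast
  have "(u + v, s + s') \<in> Gr" using subspace_add[OF subspace_Gr s(1) s'(1)] by simp
  then show ?thesis unfolding A_def using s(2) s'(2) by (auto simp: inner_add_left)
qed

lemma A_scale: assumes "A u w" shows "A (c *\<^sub>R u) (c *\<^sub>R w)"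
proof -
  from assms obtain s where
    s: "(u, s) \<in> Gr" "\<And>v r. (v, r) \<in> Gr \<Longrightarrow> inner s r = inner w v"
    unfolding A_def by blast
  have "(c *\<^sub>R u, c *\<^sub>R s) \<in> Gr" using subspace_scale[OF subspace_Gr s(1), of c] by simp
  then show ?thesis unfolding A_def using s(2) by (auto simp: inner_scaleR_left)
qed

lemma A_diff: "A u w \<Longrightarrow> A v y \<Longrightarrow> A (u - v) (w - y)"
  using A_add[of u w "(-1) *\<^sub>R v" "(-1) *\<^sub>R y"] A_scale[of v y "-1"] by simp

lemma A_I: assumes "A u w" shows "A (I u) (I w)"
proof -
  from assms obtain s where
    s: "(u, s) \<in> Gr" "\<And>v r. (v, r) \<in> Gr \<Longrightarrow> inner s r = inner w v"
    unfolding A_def by blast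
  have "inner (I s) r = inner (I w) v" if "(v, r) \<in> Gr" for v r
    unfolding inner_I_left using s(2)[OF Gr_I[OF that]] by simp
  then show ?thesis unfolding A_def using Gr_I[OF s(1)] by blast
qed

lemma A_zero: "A 0 0"
  unfolding A_def using subspace_0[OF subspace_Gr] by (auto simp: zero_prod_def intro!: exI[of _ 0])

text \<open>The difference of two values is a value at 0; the element s attached to 0 there is
  orthogonal to itself, so the difference annihilates the dense form domain.\<close>

lemma A_unique: assumes "A u w" "A u w'" shows "w = w'"
proof -
  have "inner (w - w') v = 0" if "(v, r) \<in> Gr" for v r
  proof -
    have "A 0 (w - w')" using A_diff[OF assms] by simp
    then obtain s where s: "(0, s) \<in> Gr" "\<And>v r. (v, r) \<in> Gr \<Longrightarrow> inner s r = inner (w - w') v"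
      unfolding A_def by blast
    have "inner s s = 0" using s(2)[OF s(1)] by simp
    then show ?thesis using s(2)[OF that] by simp
  qed
  from dense_Gr[OF this] show ?thesis by simp
qed

text \<open>The point p = n (A + n)^-1 h is the first component of the orthogonal projection of (h,
  0) onto a rescaled graph: orthogonality of the residual is exactly the weak equation A p = n (h -
  p). The factor \<open>sqrt n\<close> moves the parameter into the graph.\<close>

lemma res_exists: assumes n: "n > 0" shows "\<exists>p. A p (n *\<^sub>R (h - p))"
proof -
  let ?T = "\<lambda>(u, s). (u, sqrt n *\<^sub>R s) :: 'a \<times> 'a"
  have linT: "linear ?T" by (auto intro!: linearI simp: algebra_simps)
  have "continuous_on UNIV ?T" by (auto simp: case_prod_beta intro!: continuous_intros)
  then have cl: "closed (?T -` Gr)" using closed_Gr by (simp add: closed_vimage continuous_on_eq_continuous_at)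
  have sub: "subspace (?T -` Gr)" using linear_subspace_vimage[OF linT subspace_Gr] .
  obtain p where p: "p \<in> ?T -` Gr" "\<And>m. m \<in> ?T -` Gr \<Longrightarrow> inner ((h, 0) - p) m = 0"
    using closed_subspace_projection[OF cl sub] by blast
  obtain u s where us: "p = (u, s)" by fastforce
  have "A u (n *\<^sub>R (h - u))" unfolding A_def
  proof (intro exI conjI allI impI)
    show "(u, sqrt n *\<^sub>R s) \<in> Gr" using p(1) us by simp
    fix v r assume vr: "(v, r) \<in> Gr"
    have "(v, (1 / sqrt n) *\<^sub>R r) \<in> ?T -` Gr" using vr n by simp
    from p(2)[OF this] have "inner (h - u) v = inner s r / sqrt n" by (simp add: us)
    then show "inner (sqrt n *\<^sub>R s) r = inner (n *\<^sub>R (h - u)) v"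
    proof -
      have "inner (sqrt n *\<^sub>R s) r = sqrt n * (sqrt n * inner (h - u) v)"
        using \<open>inner (h - u) v = inner s r / sqrt n\<close> n by simp
      also have "\<dots> = n * inner (h - u) v" using n by (simp flip: mult.assoc)
      finally show ?thesis by simp
    qed
  qed
  then show ?thesis by blast
qed

lemma res_unique:
  assumes n: "n > 0" and a: "A p (n *\<^sub>R (h - p))" "A p' (n *\<^sub>R (h - p'))" shows "p = p'"
proof -
  have "A (p - p') (- (n *\<^sub>R (p - p')))" using A_diff[OF a] by (simp add: algebra_simps)
  from A_pos[OF this] have "n * inner (p - p') (p - p') \<le> 0" by simp
  then have "inner (p - p') (p - p') \<le> 0" using n by (simp add: mult_le_0_iff)
  then show ?thesis by (metis inner_gt_zero_iff not_less right_minus_eq)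
qed

definition resolvent :: "real \<Rightarrow> 'a \<Rightarrow> 'a" where "resolvent n h = (THE p. A p (n *\<^sub>R (h - p)))"

lemma resolvent_A: "n > 0 \<Longrightarrow> A (resolvent n h) (n *\<^sub>R (h - resolvent n h))"
  unfolding resolvent_def by (rule theI') (use res_exists res_unique in blast)

lemma resolvent_eqI: "n > 0 \<Longrightarrow> A p (n *\<^sub>R (h - p)) \<Longrightarrow> resolvent n h = p"
  using resolvent_A res_unique by blast

context fixes n :: real assumes n: "n > 0" begin

lemma resolvent_add: "resolvent n (x + y) = resolvent n x + resolvent n y"
  using A_add[OF resolvent_A[OF n, of x] resolvent_A[OF n, of y]] by (intro resolvent_eqI n) (simp add: algebra_simps)

lemma resolvent_scale: "resolvent n (c *\<^sub>R x) = c *\<^sub>R resolvent n x"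
  using A_scale[OF resolvent_A[OF n, of x], of c] by (intro resolvent_eqI n) (simp add: algebra_simps)

lemma resolvent_diff: "resolvent n (x - y) = resolvent n x - resolvent n y"
  using resolvent_add[of "x - y" y] by simp

lemma resolvent_I: "resolvent n (I x) = I (resolvent n x)"
  using A_I[OF resolvent_A[OF n, of x]] by (intro resolvent_eqI n) (simp add: I_lin)

lemma resolvent_norm: "norm (resolvent n h) \<le> norm h"
proof -
  have "0 \<le> n * inner (h - resolvent n h) (resolvent n h)" using A_pos[OF resolvent_A[OF n, of h]] by simp
  then have "norm (resolvent n h) * norm (resolvent n h) \<le> inner h (resolvent n h)"
    using n by (simp add: zero_le_mult_iff inner_simps power2_norm_eq_inner[symmetric] power2_eq_square)
  also have "\<dots> \<le> norm h * norm (resolvent n h)" by (rule norm_cauchy_schwarz)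
  finally show ?thesis by (cases "resolvent n h = 0") (simp_all add: mult_le_cancel_right)
qed

lemma resolvent_sym: "inner (resolvent n x) y = inner x (resolvent n y)"
  using A_sym[OF resolvent_A[OF n, of x] resolvent_A[OF n, of y]] n by (simp add: inner_simps)

lemma resolvent_A_commute: assumes "A u w"
  shows "A (resolvent n u) (resolvent n w)" "resolvent n w = n *\<^sub>R (u - resolvent n u)"
proof -
  show 1: "resolvent n w = n *\<^sub>R (u - resolvent n u)"
    using A_scale[OF A_diff[OF assms resolvent_A[OF n, of u]], of n] by (intro resolvent_eqI n) (simp add: algebra_simps)
  show "A (resolvent n u) (resolvent n w)" unfolding 1 by (rule resolvent_A[OF n])
qed

end

lemma resolvent_commute: assumes n: "n > 0" and m: "m > 0" shows "resolvent n (resolvent m h) = resolvent m (resolvent n h)"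
proof -
  have "A (resolvent m (resolvent n h)) (resolvent m (n *\<^sub>R (h - resolvent n h)))" by (rule resolvent_A_commute[OF m resolvent_A[OF n]])
  then show ?thesis by (intro resolvent_eqI n) (simp add: resolvent_scale[OF m] resolvent_diff[OF m])
qed

text \<open>1 + A is onto, so x - p, with p the solution of (1 + A) p = x + x', is orthogonal to
  everything and x = p. This converts membership in the domain into a pairing with all domain
  elements.\<close>

lemma A_selfadjoint:
  assumes "\<And>z y. A z y \<Longrightarrow> inner x y = inner x' z" shows "A x x'"
proof -
  define p where "p = resolvent 1 (x + x')"
  have Ap: "A p (x + x' - p)" using resolvent_A[of 1 "x + x'"] by (simp add: p_def)
  have *: "inner (x - p) (y + z) = 0" if "A z y" for z y
    using assms[OF that] A_sym[OF Ap that] by (simp add: inner_simps)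
  have "inner (x - p) h = 0" for h using *[OF resolvent_A[of 1 h]] by simp
  then have "x - p = 0" by (metis inner_eq_zero_iff)
  then show ?thesis using Ap by simp
qed

lemma subspace_closure:
  fixes S :: "'b::real_normed_vector set"
  assumes "subspace S" shows "subspace (closure S)"
proof (rule subspaceI)
  show "0 \<in> closure S" using assms closure_subset subspace_0 by blast
next
  fix x y assume "x \<in> closure S" "y \<in> closure S"
  then obtain a b where "\<And>n. a n \<in> S" "a \<longlonglongrightarrow> x" "\<And>n. b n \<in> S" "b \<longlonglongrightarrow> y"
    unfolding closure_sequential by blast
  then show "x + y \<in> closure S" unfolding closure_sequential
    using assms by (auto intro!: exI[of _ "\<lambda>n. a n + b n"] tendsto_add subspace_add)
next
  fix c x assume "x \<in> closure S"
  then obtain a where "\<And>n. a n \<in> S" "a \<longlonglongrightarrow> x" unfolding closure_sequential by blast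
  then show "c *\<^sub>R x \<in> closure S" unfolding closure_sequential
    using assms by (auto intro!: exI[of _ "\<lambda>n. c *\<^sub>R a n"] tendsto_scaleR subspace_scale)
qed

text \<open>The component of h orthogonal to the domain is killed by the symmetric resolvent, whose
  range lies in the domain; so A has that component as a value at 0, and uniqueness of values makes
  it vanish.\<close>

lemma A_dense: assumes e: "e > 0" shows "\<exists>z y. A z y \<and> norm (h - z) < e"
proof -
  let ?D = "{z. \<exists>y. A z y}"
  have "subspace ?D" unfolding subspace_def using A_zero A_add A_scale by blast
  then have sub: "subspace (closure ?D)" by (rule subspace_closure)
  obtain p where p: "p \<in> closure ?D" "\<And>m. m \<in> closure ?D \<Longrightarrow> inner (h - p) m = 0"
    using closed_subspace_projection[OF closed_closure sub] by blast
  have "inner (resolvent 1 (h - p)) y = 0" for y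
  proof -
    have "resolvent 1 y \<in> ?D" using resolvent_A[of 1 y] by auto
    then have "resolvent 1 y \<in> closure ?D" using closure_subset by (rule rev_subsetD)
    then show ?thesis using p(2) by (simp add: resolvent_sym)
  qed
  then have "resolvent 1 (h - p) = 0" by (metis inner_eq_zero_iff)
  then have "A 0 (h - p)" using resolvent_A[of 1 "h - p"] by simp
  then have "h = p" using A_unique[OF _ A_zero] by fastforce
  then obtain z where "z \<in> ?D" "dist z h < e" using p(1) e by (metis closure_approachable)
  then show ?thesis by (auto simp: dist_norm norm_minus_commute)
qed

text \<open>On the domain z - R_n z = R_n (A z) / n with R_n a contraction; density extends the
  convergence to all x.\<close>

lemma resolvent_tendsto: "(\<lambda>n. resolvent (real (Suc n)) x) \<longlonglongrightarrow> x"
proof (rule LIMSEQ_I)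
  fix e :: real assume e: "e > 0"
  obtain z y where zy: "A z y" "norm (x - z) < e / 3" using A_dense[of "e/3" x] e by auto
  obtain N where N: "3 * norm y / e < real N" using reals_Archimedean2 by blast
  show "\<exists>N. \<forall>n\<ge>N. norm (resolvent (real (Suc n)) x - x) < e"
  proof (intro exI allI impI)
    fix n assume n: "n \<ge> N"
    let ?n = "real (Suc n)"
    have "?n * norm (z - resolvent ?n z) = norm (resolvent ?n y)" using resolvent_A_commute(2)[OF _ zy(1), of ?n] by simp
    also have "\<dots> \<le> norm y" by (rule resolvent_norm) simp
    also have "\<dots> < real N * (e / 3)" using N e by (simp add: field_simps)
    also have "\<dots> \<le> ?n * (e / 3)" using n e by (intro mult_right_mono) auto
    finally have 1: "norm (resolvent ?n z - z) < e / 3" by (simp add: norm_minus_commute)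
    have 2: "norm (resolvent ?n (x - z)) < e / 3" using resolvent_norm[of ?n "x - z"] zy(2) by simp
    have "resolvent ?n x - x = resolvent ?n (x - z) + (resolvent ?n z - z) - (x - z)" by (simp add: resolvent_diff)
    then have "norm (resolvent ?n x - x) \<le> norm (resolvent ?n (x - z)) + norm (resolvent ?n z - z) + norm (x - z)"
      using norm_triangle_ineq4[of "resolvent ?n (x - z) + (resolvent ?n z - z)" "x - z"]
        norm_triangle_ineq[of "resolvent ?n (x - z)" "resolvent ?n z - z"] by simp
    then show "norm (resolvent ?n x - x) < e" using 1 2 zy(2) by linarith
  qed
qed

text \<open>Since A R_n = n (1 - R_n) for the resolvent R_n, this bounded skew operator is -i A R_n,
  which tends to -iA on the domain. The index is shifted by one to keep the resolvent parameter
  positive.\<close>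

definition yosida :: "nat \<Rightarrow> 'a bop" where
  "yosida n = to_bop (Blinfun (\<lambda>x. - (real (Suc n) *\<^sub>R I (x - resolvent (real (Suc n)) x))))"

lemma bap_yosida: "bap (yosida n) x = - (real (Suc n) *\<^sub>R I (x - resolvent (real (Suc n)) x))"
proof -
  let ?n = "real (Suc n)"
  have "bounded_linear (\<lambda>x. - (?n *\<^sub>R I (x - resolvent ?n x)))"
  proof (rule bounded_linear_intro[where K="2 * ?n"])
    fix x
    have "norm (- (?n *\<^sub>R I (x - resolvent ?n x))) = ?n * norm (x - resolvent ?n x)" by (simp add: norm_I)
    also have "\<dots> \<le> ?n * (norm x + norm x)"
      using norm_triangle_ineq4[of x "resolvent ?n x"] resolvent_norm[of ?n x] by (intro mult_left_mono) auto
    finally show "norm (- (?n *\<^sub>R I (x - resolvent ?n x))) \<le> norm x * (2 * ?n)" by (simp add: algebra_simps)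
  qed (simp_all add: I_lin resolvent_add resolvent_scale resolvent_diff algebra_simps)
  then show ?thesis by (simp add: bap_def yosida_def to_bop_inverse bounded_linear_Blinfun_apply)
qed

lemma yosida_A: "A x w \<Longrightarrow> bap (yosida n) x = - I (resolvent (real (Suc n)) w)"
  using resolvent_A_commute(2)[of "real (Suc n)" x w] by (simp add: bap_yosida I_lin)

lemma yosida_skew: "inner (bap (yosida n) x) y = - inner x (bap (yosida n) y)"
  by (simp add: bap_yosida inner_I_left I_lin resolvent_I[symmetric] resolvent_sym inner_diff right_diff_distrib)

lemma yosida_yosida: "bap (yosida n) (bap (yosida m) x) = - ((real (Suc n) * real (Suc m)) *\<^sub>R
    (x - resolvent (real (Suc m)) x - resolvent (real (Suc n)) x + resolvent (real (Suc n)) (resolvent (real (Suc m)) x)))"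
proof -
  define a where "a = real (Suc n)"
  define b where "b = real (Suc m)"
  have a: "a > 0" by (simp add: a_def)
  define w where "w = x - resolvent b x"
  have "bap (yosida n) (bap (yosida m) x) = - (a *\<^sub>R I (- (b *\<^sub>R I w) - resolvent a (- (b *\<^sub>R I w))))"
    by (simp add: bap_yosida a_def b_def w_def)
  also have "resolvent a (- (b *\<^sub>R I w)) = - (b *\<^sub>R I (resolvent a w))"
    using resolvent_scale[OF a, of "- b" "I w"] by (simp add: resolvent_I[OF a])
  also have "- (a *\<^sub>R I (- (b *\<^sub>R I w) - - (b *\<^sub>R I (resolvent a w)))) = - ((a * b) *\<^sub>R (w - resolvent a w))"
    by (simp add: I_lin I_I algebra_simps)
  finally show ?thesis unfolding a_def[symmetric] b_def[symmetric] by (simp add: w_def resolvent_diff[OF a] algebra_simps)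
qed

lemma yosida_commute: "yosida n * yosida m = yosida m * yosida n"
  by (rule bop_eqI) (simp only: bap_simps(4) yosida_yosida resolvent_commute[of "real (Suc n)" "real (Suc m)", simplified]
    mult.commute[of "real (Suc n)" "real (Suc m)"], simp add: resolvent_commute[of "1 + real n" "1 + real m"] algebra_simps)

definition En :: "nat \<Rightarrow> real \<Rightarrow> 'a \<Rightarrow> 'a" where "En n t = bap (exp (t *\<^sub>R yosida n))"

lemma En_norm: "norm (En n t x) = norm x"
  unfolding En_def by (rule exp_skew_isometry) (rule yosida_skew)

lemma En_lin: "En n t (x + y) = En n t x + En n t y" "En n t (x - y) = En n t x - En n t y"
  "En n t (c *\<^sub>R x) = c *\<^sub>R En n t x" "En n t (- x) = - En n t x"
  using bap_simps(10)[of "exp (t *\<^sub>R yosida n)" "- 1" x] by (simp_all add: En_def)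

lemma En_group: "En n (s + t) x = En n s (En n t x)"
proof -
  have "exp ((s + t) *\<^sub>R yosida n) = exp (s *\<^sub>R yosida n) * exp (t *\<^sub>R yosida n)"
    by (subst exp_add_commuting[symmetric]) (simp_all add: scaleR_add_left)
  then show ?thesis by (simp add: En_def)
qed

text \<open>The limit group has to be complex linear although the space is only real; commutation
  with \<open>I\<close> passes from the generator to its powers and to the exponential
  series.\<close>

lemma En_I: "En n t (I x) = I (En n t x)"
proof -
  have bl: "bounded_linear I"
    using linear_I by (intro bounded_linear_intro[where K=1]) (auto simp: I_lin norm_I)
  define b where "b = to_bop (Blinfun I)"
  have b: "bap b x = I x" for x using bl by (simp add: b_def bap_def to_bop_inverse bounded_linear_Blinfun_apply)
  have "yosida n * b = b * yosida n" by (rule bop_eqI) (simp add: b bap_yosida I_lin resolvent_I[symmetric])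
  then have Zb: "(t *\<^sub>R yosida n) * b = b * (t *\<^sub>R yosida n)" by simp
  have "exp Z * b = b * exp Z" if Zb: "Z * b = b * Z" for Z
  proof -
    have "Z ^ k * b = b * Z ^ k" for k
    proof (induction k)
      case (Suc k)
      have "Z ^ Suc k * b = Z * (b * Z ^ k)" by (simp add: mult.assoc Suc)
      also have "\<dots> = b * Z ^ Suc k" using Zb by (simp flip: mult.assoc)
      finally show ?case .
    qed simp
    then show ?thesis unfolding exp_def by (simp add: suminf_mult[OF summable_exp_generic, symmetric]
        suminf_mult2[OF summable_exp_generic])
  qed
  from this[OF Zb] have "exp (t *\<^sub>R yosida n) * b = b * exp (t *\<^sub>R yosida n)" .
  then have "bap (exp (t *\<^sub>R yosida n) * b) x = bap (b * exp (t *\<^sub>R yosida n)) x" by simp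
  then show ?thesis by (simp add: En_def b)
qed

text \<open>Because the approximants commute, exp(t Y_n) = exp(t Y_m) exp(t (Y_n - Y_m)); the first
  factor is an isometry, so only the displacement under the skew operator Y_n - Y_m remains.\<close>

lemma En_diff_bound: "norm (En n t x - En m t x) \<le> \<bar>t\<bar> * norm (bap (yosida n) x - bap (yosida m) x)"
proof -
  let ?C = "yosida n - yosida m"
  have "exp (t *\<^sub>R yosida m) * exp (t *\<^sub>R ?C) = exp (t *\<^sub>R yosida m + t *\<^sub>R ?C)"
    by (rule exp_add_commuting[symmetric]) (simp add: algebra_simps yosida_commute)
  then have "En n t x = En m t (bap (exp (t *\<^sub>R ?C)) x)"
    by (simp add: En_def algebra_simps flip: bap_simps(4))
  then have "En n t x - En m t x = En m t (bap (exp (t *\<^sub>R ?C)) x - x)" by (simp add: En_lin)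
  then have "norm (En n t x - En m t x) = norm (bap (exp (t *\<^sub>R ?C)) x - x - t *\<^sub>R 0)" by (simp add: En_norm)
  also have "\<dots> \<le> \<bar>t\<bar> * norm (bap ?C x)"
  proof (rule exp_skew_bound)
    show sk: "inner (bap ?C x) y = - inner x (bap ?C y)" for x y
      by (simp add: inner_simps yosida_skew)
    show "norm (bap (exp (s *\<^sub>R ?C)) (bap ?C x) - 0) \<le> norm (bap ?C x)" for s
      using exp_skew_isometry[of ?C s "bap ?C x", OF sk] by simp
  qed
  finally show ?thesis by simp
qed

text \<open>On the domain the generators converge, hence so do the groups by
  \<open>En_diff_bound\<close>; an e/3 argument with isometries reaches every x.\<close>

lemma En_converges: "\<exists>L. (\<lambda>n. En n t x) \<longlonglongrightarrow> L"
proof -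
  have cauD: "Cauchy (\<lambda>n. En n t z)" if zy: "A z y" for z y
  proof -
    have "(\<lambda>n. bap (yosida n) z) \<longlonglongrightarrow> - I y"
      unfolding yosida_A[OF zy]
      using linear_I by (intro tendsto_minus bounded_linear.tendsto[of I] resolvent_tendsto
          bounded_linear_intro[where K=1]) (auto simp: I_lin norm_I)
    then have "Cauchy (\<lambda>n. bap (yosida n) z)" by (rule LIMSEQ_imp_Cauchy)
    show ?thesis
    proof (rule CauchyI)
      fix e :: real assume e: "e > 0"
      obtain N where N: "\<And>m n. m \<ge> N \<Longrightarrow> n \<ge> N \<Longrightarrow> norm (bap (yosida m) z - bap (yosida n) z) < e / (\<bar>t\<bar> + 1)"
        using CauchyD[OF \<open>Cauchy (\<lambda>n. bap (yosida n) z)\<close>, of "e / (\<bar>t\<bar> + 1)"] e by auto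
      show "\<exists>M. \<forall>m\<ge>M. \<forall>n\<ge>M. norm (En m t z - En n t z) < e"
      proof (intro exI allI impI)
        fix m n assume mn: "m \<ge> N" "n \<ge> N"
        have "norm (En m t z - En n t z) \<le> \<bar>t\<bar> * norm (bap (yosida m) z - bap (yosida n) z)" by (rule En_diff_bound)
        also have "\<dots> \<le> \<bar>t\<bar> * (e / (\<bar>t\<bar> + 1))" using N[OF mn] by (intro mult_left_mono) auto
        also have "\<dots> < e" using e by (simp add: field_simps)
        finally show "norm (En m t z - En n t z) < e" .
      qed
    qed
  qed
  have "Cauchy (\<lambda>n. En n t x)"
  proof (rule CauchyI)
    fix e :: real assume e: "e > 0"
    obtain z y where zy: "A z y" "norm (x - z) < e / 3" using A_dense[of "e/3" x] e by auto
    obtain N where N: "\<And>m n. m \<ge> N \<Longrightarrow> n \<ge> N \<Longrightarrow> norm (En m t z - En n t z) < e / 3"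
      using CauchyD[OF cauD[OF zy(1)], of "e/3"] e by auto
    show "\<exists>M. \<forall>m\<ge>M. \<forall>n\<ge>M. norm (En m t x - En n t x) < e"
    proof (intro exI allI impI)
      fix m n assume mn: "m \<ge> N" "n \<ge> N"
      have "En m t x - En n t x = En m t (x - z) + (En m t z - En n t z) - En n t (x - z)"
        by (simp add: En_lin)
      then have "norm (En m t x - En n t x) \<le> norm (x - z) + norm (En m t z - En n t z) + norm (x - z)"
        using norm_triangle_ineq4[of "En m t (x - z) + (En m t z - En n t z)" "En n t (x - z)"]
          norm_triangle_ineq[of "En m t (x - z)" "En m t z - En n t z"] by (simp add: En_norm)
      then show "norm (En m t x - En n t x) < e" using zy(2) N[OF mn] by simp
    qed
  qed
  then show ?thesis using Cauchy_convergent_iff convergent_def by blast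
qed

section \<open>The limiting unitary group\<close>

definition Ut :: "real \<Rightarrow> 'a \<Rightarrow> 'a" where "Ut t x = lim (\<lambda>n. En n t x)"

lemma Ut_lim: "(\<lambda>n. En n t x) \<longlonglongrightarrow> Ut t x"
  using En_converges[of t x] unfolding Ut_def by (auto simp: limI)

lemma Ut_norm: "norm (Ut t x) = norm x"
  using tendsto_norm[OF Ut_lim, of t x] by (simp add: En_norm LIMSEQ_const_iff)

lemma Ut_lin: "Ut t (x + y) = Ut t x + Ut t y" "Ut t (c *\<^sub>R x) = c *\<^sub>R Ut t x"
  "Ut t (I x) = I (Ut t x)"
proof -
  show "Ut t (x + y) = Ut t x + Ut t y"
    using LIMSEQ_unique[OF Ut_lim tendsto_add[OF Ut_lim Ut_lim, of t x t y, folded En_lin]] .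
  show "Ut t (c *\<^sub>R x) = c *\<^sub>R Ut t x"
    using LIMSEQ_unique[OF Ut_lim tendsto_scaleR[OF tendsto_const Ut_lim, of c t x, folded En_lin]] .
  have bl: "bounded_linear I"
    using linear_I by (intro bounded_linear_intro[where K=1]) (auto simp: I_lin norm_I)
  show "Ut t (I x) = I (Ut t x)"
    using LIMSEQ_unique[OF Ut_lim bounded_linear.tendsto[OF bl Ut_lim, of t x, folded En_I]] .
qed

lemma Ut_diff: "Ut t (x - y) = Ut t x - Ut t y"
  using Ut_lin(1)[of t "x - y" y] by simp

lemma Ut_0: "Ut 0 x = x"
  using Ut_lim[of 0 x] by (simp add: En_def LIMSEQ_const_iff)

lemma Ut_group: "Ut (s + t) x = Ut s (Ut t x)"
proof -
  have "(\<lambda>n. En n s (En n t x - Ut t x)) \<longlonglongrightarrow> 0"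
    by (rule tendsto_norm_zero_cancel)
      (simp only: En_norm, rule tendsto_norm_zero, rule LIM_zero, rule Ut_lim)
  then have "(\<lambda>n. En n s (En n t x - Ut t x) + En n s (Ut t x)) \<longlonglongrightarrow> 0 + Ut s (Ut t x)"
    by (intro tendsto_add Ut_lim)
  then have "(\<lambda>n. En n (s + t) x) \<longlonglongrightarrow> Ut s (Ut t x)" by (simp add: En_lin En_group)
  then show ?thesis using LIMSEQ_unique Ut_lim by blast
qed

lemma Ut_bound: assumes "A x w" shows "norm (Ut t x - x) \<le> \<bar>t\<bar> * norm w"
proof -
  have "norm (En n t x - x) \<le> \<bar>t\<bar> * norm w" for n
  proof -
    have "norm (En n t x - x - t *\<^sub>R 0) \<le> \<bar>t\<bar> * norm w" unfolding En_def
    proof (rule exp_skew_bound[OF yosida_skew])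
      fix s
      have "norm (bap (yosida n) x) \<le> norm w" using resolvent_norm[of "real (Suc n)" w] by (simp add: yosida_A[OF assms] norm_I)
      then show "norm (bap (exp (s *\<^sub>R yosida n)) (bap (yosida n) x) - 0) \<le> norm w"
        using exp_skew_isometry[OF yosida_skew, of s n "bap (yosida n) x"] by simp
    qed
    then show ?thesis by simp
  qed
  moreover have "(\<lambda>n. norm (En n t x - x)) \<longlonglongrightarrow> norm (Ut t x - x)" by (intro tendsto_intros Ut_lim)
  ultimately show ?thesis by (intro LIMSEQ_le_const2) auto
qed

lemma Ut_cont0: "((\<lambda>t. Ut t x) \<longlongrightarrow> x) (at 0)"
proof (rule LIM_I)
  fix e :: real assume e: "e > 0"
  obtain z y where zy: "A z y" "norm (x - z) < e / 3" using A_dense[of "e/3" x] e by auto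
  show "\<exists>s>0. \<forall>t. t \<noteq> 0 \<and> norm (t - 0) < s \<longrightarrow> norm (Ut t x - x) < e"
  proof (intro exI conjI allI impI)
    show "e / (3 * (norm y + 1)) > 0" using e by (simp add: add_nonneg_pos)
    fix t :: real assume t: "t \<noteq> 0 \<and> norm (t - 0) < e / (3 * (norm y + 1))"
    have ny: "norm y + 1 > 0" by (simp add: add_nonneg_pos)
    have "norm (Ut t z - z) \<le> \<bar>t\<bar> * norm y" by (rule Ut_bound[OF zy(1)])
    also have "\<dots> \<le> \<bar>t\<bar> * (norm y + 1)" by (intro mult_left_mono) auto
    also have "\<dots> < e / 3"
    proof -
      have "\<bar>t\<bar> * (3 * (norm y + 1)) < e" using t ny by (simp add: pos_less_divide_eq)
      then show ?thesis by (simp add: algebra_simps)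
    qed
    finally have 1: "norm (Ut t z - z) < e / 3" .
    have "Ut t x - x = Ut t (x - z) + (Ut t z - z) - (x - z)" by (simp add: Ut_diff)
    then have "norm (Ut t x - x) \<le> norm (x - z) + norm (Ut t z - z) + norm (x - z)"
      using norm_triangle_ineq4[of "Ut t (x - z) + (Ut t z - z)" "x - z"]
        norm_triangle_ineq[of "Ut t (x - z)" "Ut t z - z"] by (simp add: Ut_norm)
    then show "norm (Ut t x - x) < e" using 1 zy(2) by simp
  qed
qed

lemma Ut_cont: "((\<lambda>t. Ut t x) \<longlongrightarrow> Ut t0 x) (at t0)"
proof -
  have "norm (Ut (t0 + h) x - Ut t0 x) = norm (Ut h x - x)" for h
    by (simp add: Ut_group Ut_norm flip: Ut_diff)
  moreover have "((\<lambda>h. norm (Ut h x - x)) \<longlongrightarrow> 0) (at 0)"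
    using Ut_cont0[of x] by (simp add: tendsto_norm_zero_iff LIM_zero_iff)
  ultimately have "((\<lambda>h. norm (Ut (t0 + h) x - Ut t0 x)) \<longlongrightarrow> 0) (at 0)" by simp
  then have "((\<lambda>h. Ut (t0 + h) x) \<longlongrightarrow> Ut t0 x) (at 0)" by (simp add: tendsto_norm_zero_iff LIM_zero_iff)
  then show ?thesis by (simp add: LIM_offset_zero_iff[of t0])
qed

text \<open>The derivative of the approximating orbit is \<open>En n s\<close> applied to
  \<open>yosida n x\<close>, which is near -Iw only if \<open>En n s\<close> is close to the
  identity there. Since -Iw need not lie in the domain, a nearby z with \<open>A z v\<close> takes
  its place; its displacement is at most |s| |v| uniformly in n.\<close>

lemma Ut_generator: assumes "A x w"
  shows "((\<lambda>h. (1 / h) *\<^sub>R (Ut h x - x) + I w) \<longlongrightarrow> 0) (at 0)"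
proof (rule LIM_I)
  fix e :: real assume e: "e > 0"
  let ?y = "- I w"
  obtain z v where zv: "A z v" "norm (?y - z) < e / 4" using A_dense[of "e/4" ?y] e by auto
  have main: "norm (Ut t x - x - t *\<^sub>R ?y) \<le> \<bar>t\<bar> * (2 * norm (?y - z) + \<bar>t\<bar> * norm v)" for t
  proof -
    let ?d = "\<lambda>n. norm (bap (yosida n) x - ?y)"
    have "norm (En n t x - x - t *\<^sub>R ?y) \<le> \<bar>t\<bar> * (?d n + (2 * norm (?y - z) + \<bar>t\<bar> * norm v))" for n
      unfolding En_def
    proof (rule exp_skew_bound[OF yosida_skew])
      fix s :: real assume s: "\<bar>s\<bar> \<le> \<bar>t\<bar>"
      have "norm (En n s z - z - s *\<^sub>R 0) \<le> \<bar>s\<bar> * norm v" unfolding En_def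
      proof (rule exp_skew_bound[OF yosida_skew])
        fix s
        have "norm (bap (yosida n) z) \<le> norm v" using resolvent_norm[of "real (Suc n)" v] by (simp add: yosida_A[OF zv(1)] norm_I)
        then show "norm (bap (exp (s *\<^sub>R yosida n)) (bap (yosida n) z) - 0) \<le> norm v"
          using exp_skew_isometry[OF yosida_skew, of s n "bap (yosida n) z"] by simp
      qed
      also have "\<bar>s\<bar> * norm v \<le> \<bar>t\<bar> * norm v" using s by (intro mult_right_mono) auto
      finally have 1: "norm (En n s z - z) \<le> \<bar>t\<bar> * norm v" by simp
      have "En n s (bap (yosida n) x) - ?y = En n s (bap (yosida n) x - ?y) + (En n s (?y - z) + ((En n s z - z) - (?y - z)))"
        by (simp add: En_lin)
      also have "norm \<dots> \<le> ?d n + (norm (?y - z) + (norm (En n s z - z) + norm (?y - z)))"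
        using norm_triangle_ineq[of "En n s (bap (yosida n) x - ?y)" "En n s (?y - z) + ((En n s z - z) - (?y - z))"]
          norm_triangle_ineq[of "En n s (?y - z)" "(En n s z - z) - (?y - z)"]
          norm_triangle_ineq4[of "En n s z - z" "?y - z"] unfolding En_norm by linarith
      finally show "norm (bap (exp (s *\<^sub>R yosida n)) (bap (yosida n) x) - ?y) \<le> ?d n + (2 * norm (?y - z) + \<bar>t\<bar> * norm v)"
        using 1 by (simp add: En_def)
    qed
    moreover have "(\<lambda>n. norm (En n t x - x - t *\<^sub>R ?y)) \<longlonglongrightarrow> norm (Ut t x - x - t *\<^sub>R ?y)"
      by (intro tendsto_intros Ut_lim)
    moreover have "(\<lambda>n. \<bar>t\<bar> * (?d n + (2 * norm (?y - z) + \<bar>t\<bar> * norm v))) \<longlonglongrightarrow> \<bar>t\<bar> * (0 + (2 * norm (?y - z) + \<bar>t\<bar> * norm v))"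
    proof -
      have bl: "bounded_linear I"
        using linear_I by (intro bounded_linear_intro[where K=1]) (auto simp: I_lin norm_I)
      have "(\<lambda>n. bap (yosida n) x) \<longlonglongrightarrow> ?y" unfolding yosida_A[OF assms]
        by (intro tendsto_minus bounded_linear.tendsto[OF bl] resolvent_tendsto)
      then have "(\<lambda>n. ?d n) \<longlonglongrightarrow> 0" by (subst tendsto_norm_zero_iff) (rule LIM_zero)
      then show ?thesis by (intro tendsto_intros)
    qed
    ultimately show ?thesis by (auto intro!: LIMSEQ_le)
  qed
  show "\<exists>s>0. \<forall>t. t \<noteq> 0 \<and> norm (t - 0) < s \<longrightarrow> norm ((1 / t) *\<^sub>R (Ut t x - x) + I w - 0) < e"
  proof (intro exI conjI allI impI)
    show "e / (2 * (norm v + 1)) > 0" using e by (simp add: add_nonneg_pos)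
    fix t :: real assume t: "t \<noteq> 0 \<and> norm (t - 0) < e / (2 * (norm v + 1))"
    have nv: "norm v + 1 > 0" by (simp add: add_nonneg_pos)
    have "\<bar>t\<bar> * norm v \<le> \<bar>t\<bar> * (norm v + 1)" by (intro mult_left_mono) auto
    also have "\<dots> < e / 2"
    proof -
      have "\<bar>t\<bar> * (2 * (norm v + 1)) < e" using t nv by (simp add: pos_less_divide_eq)
      then show ?thesis by (simp add: algebra_simps)
    qed
    finally have 1: "\<bar>t\<bar> * norm v < e / 2" .
    have "(1 / t) *\<^sub>R (Ut t x - x) + I w = (1 / t) *\<^sub>R (Ut t x - x - t *\<^sub>R ?y)"
      using t by (simp add: algebra_simps)
    then have "norm ((1 / t) *\<^sub>R (Ut t x - x) + I w) = norm (Ut t x - x - t *\<^sub>R ?y) / \<bar>t\<bar>" by simp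
    also have "\<dots> \<le> 2 * norm (?y - z) + \<bar>t\<bar> * norm v"
      using main[of t] t by (simp add: pos_divide_le_eq mult.commute)
    also have "\<dots> < e" using 1 zv(2) by simp
    finally show "norm ((1 / t) *\<^sub>R (Ut t x - x) + I w - 0) < e" by simp
  qed
qed

end

section \<open>The Hilbert space of square integrable functions\<close>

lemma cnj_measurable [measurable]: "cnj \<in> borel_measurable borel"
  by (intro borel_measurable_continuous_onI continuous_intros)

lemma L2spD: assumes "f \<in> L2sp M" shows "f \<in> borel_measurable M" "integrable M (\<lambda>x. (cmod (f x))\<^sup>2)"
  using assms by (auto simp: L2sp_def)

lemma L2sp_cnj: assumes "f \<in> L2sp M" shows "(\<lambda>x. cnj (f x)) \<in> L2sp M"
proof -
  note [measurable] = L2spD(1)[OF assms]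
  show ?thesis using L2spD(2)[OF assms] by (simp add: L2sp_def)
qed

lemma L2norm_nonneg [simp]: "L2norm M f \<ge> 0"
  by (simp add: L2norm_def)

lemma L2norm_sq: "(L2norm M f)\<^sup>2 = (\<integral>x. (cmod (f x))\<^sup>2 \<partial>M)"
  by (simp add: L2norm_def)

lemma nn_L2norm: assumes "f \<in> L2sp M"
  shows "(\<integral>\<^sup>+x. ennreal ((cmod (f x))\<^sup>2) \<partial>M) = ennreal ((L2norm M f)\<^sup>2)"
  unfolding L2norm_sq by (rule nn_integral_eq_integral[OF L2spD(2)[OF assms]]) auto

lemma L2sp_nnI:
  assumes "f \<in> borel_measurable M" "(\<integral>\<^sup>+x. ennreal ((cmod (f x))\<^sup>2) \<partial>M) \<le> ennreal c" "c \<ge> 0"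
  shows "f \<in> L2sp M" "L2norm M f \<le> sqrt c"
proof -
  have "(\<integral>\<^sup>+x. ennreal ((cmod (f x))\<^sup>2) \<partial>M) < \<infinity>" using assms(2) by (simp add: order_le_less_trans)
  then show L: "f \<in> L2sp M"
    unfolding L2sp_def using assms(1) by (auto intro!: integrableI_bounded)
  show "L2norm M f \<le> sqrt c"
    using assms(2,3) unfolding nn_L2norm[OF L] by (simp add: real_le_rsqrt)
qed

lemma L2norm_mono:
  assumes "f \<in> L2sp M" "h \<in> L2sp M" "AE x in M. cmod (f x) \<le> cmod (h x)"
  shows "L2norm M f \<le> L2norm M h"
  unfolding L2norm_def using assms
  by (auto intro!: integral_mono_AE L2spD elim!: eventually_mono simp: power_mono)

lemma L2sp_bound:
  assumes "f \<in> borel_measurable M" "h \<in> L2sp M" "AE x in M. cmod (f x) \<le> cmod (h x)"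
  shows "f \<in> L2sp M"
  using assms unfolding L2sp_def
  by (auto intro: Bochner_Integration.integrable_bound[of M "\<lambda>x. (cmod (h x))\<^sup>2"] elim!: eventually_mono simp: power_mono)

lemma L2norm_cong_AE:
  assumes "f \<in> borel_measurable M" "h \<in> borel_measurable M" "AE x in M. f x = h x"
  shows "L2norm M f = L2norm M h"
  unfolding L2norm_def using assms by (auto intro!: arg_cong[of _ _ sqrt] integral_cong_AE)

lemma L2sp_cong_AE:
  assumes "f \<in> L2sp M" "h \<in> borel_measurable M" "AE x in M. f x = h x"
  shows "h \<in> L2sp M"
  by (rule L2sp_bound[OF assms(2,1)]) (use assms(3) in auto)

lemma L2sp_cmult [intro, simp]: "f \<in> L2sp M \<Longrightarrow> (\<lambda>x. c * f x) \<in> L2sp M"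
  by (auto simp: L2sp_def norm_mult power_mult_distrib)

lemma L2norm_cmult: "L2norm M (\<lambda>x. c * f x) = cmod c * L2norm M f"
  by (simp add: L2norm_def norm_mult power_mult_distrib real_sqrt_mult)

lemma L2sp_add [intro, simp]: assumes "f \<in> L2sp M" "h \<in> L2sp M" shows "(\<lambda>x. f x + h x) \<in> L2sp M"
proof -
  note [measurable] = L2spD(1)[OF assms(1)] L2spD(1)[OF assms(2)]
  have "(cmod (f x + h x))\<^sup>2 \<le> 2 * (cmod (f x))\<^sup>2 + 2 * (cmod (h x))\<^sup>2" for x
  proof -
    have "(cmod (f x + h x))\<^sup>2 \<le> (cmod (f x) + cmod (h x))\<^sup>2" by (intro power_mono norm_triangle_ineq) auto
    also have "\<dots> \<le> 2 * (cmod (f x))\<^sup>2 + 2 * (cmod (h x))\<^sup>2"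
      using sum_squares_bound[of "cmod (f x)" "cmod (h x)"] by (simp add: power2_sum)
    finally show ?thesis .
  qed
  then have b: "norm ((cmod (f x + h x))\<^sup>2) \<le> norm (2 * (cmod (f x))\<^sup>2 + 2 * (cmod (h x))\<^sup>2)" for x
    by (simp add: abs_of_nonneg)
  have "integrable M (\<lambda>x. 2 * (cmod (f x))\<^sup>2 + 2 * (cmod (h x))\<^sup>2)"
    using L2spD(2)[OF assms(1)] L2spD(2)[OF assms(2)] by simp
  then have "integrable M (\<lambda>x. (cmod (f x + h x))\<^sup>2)"
    by (rule Bochner_Integration.integrable_bound) (simp, rule AE_I2, rule b)
  then show ?thesis by (simp add: L2sp_def)
qed

lemma L2sp_minus [intro, simp]: "f \<in> L2sp M \<Longrightarrow> (\<lambda>x. - f x) \<in> L2sp M"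
  using L2sp_cmult[of f M "-1"] by simp

lemma L2sp_diff [intro, simp]: "f \<in> L2sp M \<Longrightarrow> h \<in> L2sp M \<Longrightarrow> (\<lambda>x. f x - h x) \<in> L2sp M"
  using L2sp_add[of f M "\<lambda>x. - h x"] by simp

lemma L2sp_zero [intro, simp]: "(\<lambda>x. 0) \<in> L2sp M" by (simp add: L2sp_def)

lemma L2sp_bdd_mult:
  assumes "f \<in> L2sp M" "b \<in> borel_measurable M" "AE x in M. cmod (b x) \<le> B"
  shows "(\<lambda>x. b x * f x) \<in> L2sp M" "L2norm M (\<lambda>x. b x * f x) \<le> \<bar>B\<bar> * L2norm M f"
proof -
  note [measurable] = L2spD(1)[OF assms(1)] assms(2)
  have ae: "AE x in M. cmod (b x * f x) \<le> cmod (complex_of_real \<bar>B\<bar> * f x)"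
    using assms(3) by eventually_elim (auto simp: norm_mult intro!: mult_right_mono)
  show 1: "(\<lambda>x. b x * f x) \<in> L2sp M"
    by (rule L2sp_bound[OF _ L2sp_cmult[OF assms(1)] ae]) simp
  show "L2norm M (\<lambda>x. b x * f x) \<le> \<bar>B\<bar> * L2norm M f"
    using L2norm_mono[OF 1 L2sp_cmult[OF assms(1)] ae] by (simp add: L2norm_cmult)
qed

text \<open>Cauchy-Schwarz is applied first to the extended nonnegative integrals, so that
  finiteness of the product integral, and thus integrability, comes out of the same
  inequality.\<close>

lemma L2_integrable_mult: assumes "f \<in> L2sp M" "h \<in> L2sp M"
  shows "integrable M (\<lambda>x. f x * h x)" "(\<integral>x. cmod (f x) * cmod (h x) \<partial>M) \<le> L2norm M f * L2norm M h"
    "cmod (\<integral>x. f x * h x \<partial>M) \<le> L2norm M f * L2norm M h"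
proof -
  note [measurable] = L2spD(1)[OF assms(1)] L2spD(1)[OF assms(2)]
  have cs: "(\<integral>\<^sup>+x. ennreal (cmod (f x)) * ennreal (cmod (h x)) \<partial>M)\<^sup>2
      \<le> ennreal ((L2norm M f * L2norm M h)\<^sup>2)"
    using Cauchy_Schwarz_nn_integral[of "\<lambda>x. ennreal (cmod (f x))" M "\<lambda>x. ennreal (cmod (h x))"]
    by (simp add: ennreal_power nn_L2norm[OF assms(1)] nn_L2norm[OF assms(2)] ennreal_mult power_mult_distrib)
  have "(\<integral>\<^sup>+x. ennreal (cmod (f x)) * ennreal (cmod (h x)) \<partial>M) < \<infinity>"
  proof (rule ccontr)
    assume "\<not> ?thesis"
    then have "(\<integral>\<^sup>+x. ennreal (cmod (f x)) * ennreal (cmod (h x)) \<partial>M) = \<infinity>" by (simp add: less_top[symmetric])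
    with cs show False by (simp add: power2_eq_square ennreal_mult_top top_unique)
  qed
  then have i: "integrable M (\<lambda>x. cmod (f x) * cmod (h x))"
    by (intro integrableI_bounded) (auto simp: ennreal_mult)
  have "(\<integral>\<^sup>+x. ennreal (cmod (f x)) * ennreal (cmod (h x)) \<partial>M) = ennreal (\<integral>x. cmod (f x) * cmod (h x) \<partial>M)"
    by (subst nn_integral_eq_integral[OF i, symmetric]) (auto simp: ennreal_mult)
  with cs have "(\<integral>x. cmod (f x) * cmod (h x) \<partial>M)\<^sup>2 \<le> (L2norm M f * L2norm M h)\<^sup>2"
    by (simp add: ennreal_power integral_nonneg)
  then show b: "(\<integral>x. cmod (f x) * cmod (h x) \<partial>M) \<le> L2norm M f * L2norm M h"
    by (rule power2_le_imp_le) simp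
  show "integrable M (\<lambda>x. f x * h x)"
    by (rule Bochner_Integration.integrable_bound[OF i]) (auto simp: norm_mult)
  show "cmod (\<integral>x. f x * h x \<partial>M) \<le> L2norm M f * L2norm M h"
    using integral_norm_bound[of M "\<lambda>x. f x * h x"] b by (simp add: norm_mult)
qed

lemma L2inner_integrable: "f \<in> L2sp M \<Longrightarrow> h \<in> L2sp M \<Longrightarrow> integrable M (\<lambda>x. f x * cnj (h x))"
  by (rule L2_integrable_mult(1)) (auto intro: L2sp_cnj)

lemma L2norm_cnj [simp]: "L2norm M (\<lambda>x. cnj (f x)) = L2norm M f" by (simp add: L2norm_def)

lemma L2inner_bound: "f \<in> L2sp M \<Longrightarrow> h \<in> L2sp M \<Longrightarrow> cmod (L2inner M f h) \<le> L2norm M f * L2norm M h"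
  unfolding L2inner_def using L2_integrable_mult(3)[of f M "\<lambda>x. cnj (h x)"] by (simp add: L2sp_cnj)

lemma L2inner_self: "L2inner M f f = complex_of_real ((L2norm M f)\<^sup>2)"
  by (simp add: L2inner_def L2norm_sq complex_norm_square[symmetric] flip: integral_complex_of_real of_real_power)

section \<open>The quotient Hilbert space and its completeness\<close>

definition l2rel :: "cfun \<Rightarrow> cfun \<Rightarrow> bool" where
  "l2rel f h \<longleftrightarrow> f \<in> L2sp lborel \<and> h \<in> L2sp lborel \<and> (AE x in lborel. f x = h x)"

quotient_type l2 = "cfun" / partial: l2rel morphisms rp cl
proof (rule part_equivpI)
  show "\<exists>x. l2rel x x" by (auto simp: l2rel_def intro!: exI[of _ "\<lambda>x. 0"])
  show "symp l2rel" by (auto simp: symp_def l2rel_def elim: eventually_mono)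
  show "transp l2rel" by (auto simp: transp_def l2rel_def)
qed

lemma rp_L2 [simp, intro]: "rp a \<in> L2sp lborel"
  using Quotient3_rep_reflp[OF Quotient3_l2, of a] by (simp add: l2rel_def)

lemma cl_rp [simp]: "cl (rp a) = a"
  by (rule Quotient3_abs_rep[OF Quotient3_l2])

lemma cl_eq_iff: "f \<in> L2sp lborel \<Longrightarrow> h \<in> L2sp lborel \<Longrightarrow> cl f = cl h \<longleftrightarrow> (AE x in lborel. f x = h x)"
  using Quotient3_rel[OF Quotient3_l2, of f h] by (auto simp: l2rel_def)

lemma cl_eqI: "f \<in> L2sp lborel \<Longrightarrow> h \<in> L2sp lborel \<Longrightarrow> (AE x in lborel. f x = h x) \<Longrightarrow> cl f = cl h"
  by (simp add: cl_eq_iff)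

lemma rp_cl: "f \<in> L2sp lborel \<Longrightarrow> AE x in lborel. rp (cl f) x = f x"
  using cl_eq_iff[of "rp (cl f)" f] by simp

lemma l2_cases: obtains f where "f \<in> L2sp lborel" "a = cl f"
  by (metis cl_rp rp_L2)

text \<open>The inner product is the real part of the complex one, so that the real theory of closed
  forms applies; \<open>Il2\<close> below carries the complex structure. Every operation goes
  through the representatives chosen by \<open>rp\<close>.\<close>

instantiation l2 :: real_inner
begin
definition "zero_l2 = cl (\<lambda>x. 0)"
definition "plus_l2 a b = cl (\<lambda>x. rp a x + rp b x)"
definition "minus_l2 a b = cl (\<lambda>x. rp a x - rp b x)"
definition "uminus_l2 a = cl (\<lambda>x. - rp a x)"
definition "scaleR_l2 r a = cl (\<lambda>x. complex_of_real r * rp a x)"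
definition "inner_l2 a b = Re (L2inner lborel (rp a) (rp b))"
definition "norm_l2 (a::l2) = sqrt (inner a a)"
definition "dist_l2 (x::l2) y = norm (x - y)"
definition "sgn_l2 (x::l2) = inverse (norm x) *\<^sub>R x"
definition "(uniformity :: (l2 \<times> l2) filter) = (INF e\<in>{0<..}. principal {(x, y). dist x y < e})"
definition "open_l2 U = (\<forall>x\<in>U. \<forall>\<^sub>F (x', y) in uniformity. x' = x \<longrightarrow> y \<in> (U :: l2 set))"

lemma cl_add: "f \<in> L2sp lborel \<Longrightarrow> h \<in> L2sp lborel \<Longrightarrow> cl f + cl h = cl (\<lambda>x. f x + h x)"
  unfolding plus_l2_def using rp_cl[of f] rp_cl[of h] by (intro cl_eqI) auto

lemma cl_diff: "f \<in> L2sp lborel \<Longrightarrow> h \<in> L2sp lborel \<Longrightarrow> cl f - cl h = cl (\<lambda>x. f x - h x)"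
  unfolding minus_l2_def using rp_cl[of f] rp_cl[of h] by (intro cl_eqI) auto

lemma cl_minus: "f \<in> L2sp lborel \<Longrightarrow> - cl f = cl (\<lambda>x. - f x)"
  unfolding uminus_l2_def using rp_cl[of f] by (intro cl_eqI) auto

lemma cl_scaleR: "f \<in> L2sp lborel \<Longrightarrow> r *\<^sub>R cl f = cl (\<lambda>x. complex_of_real r * f x)"
  unfolding scaleR_l2_def using rp_cl[of f] by (intro cl_eqI) auto

lemma inner_cl: assumes "f \<in> L2sp lborel" "h \<in> L2sp lborel"
  shows "inner (cl f) (cl h) = Re (L2inner lborel f h)"
proof -
  have "L2inner lborel (rp (cl f)) (rp (cl h)) = L2inner lborel f h"
    unfolding L2inner_def
  proof (rule integral_cong_AE)
    note [measurable] = L2spD(1)[OF assms(1)] L2spD(1)[OF assms(2)] L2spD(1)[OF rp_L2[of "cl f"]] L2spD(1)[OF rp_L2[of "cl h"]]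
    show "(\<lambda>x. rp (cl f) x * cnj (rp (cl h) x)) \<in> borel_measurable lborel"
      "(\<lambda>x. f x * cnj (h x)) \<in> borel_measurable lborel" by measurable
    show "AE x in lborel. rp (cl f) x * cnj (rp (cl h) x) = f x * cnj (h x)"
      using rp_cl[OF assms(1)] rp_cl[OF assms(2)] by eventually_elim simp
  qed
  then show ?thesis by (simp add: inner_l2_def)
qed

instance
proof
  fix a b c :: l2 and r s :: real
  obtain f where f: "f \<in> L2sp lborel" "a = cl f" by (rule l2_cases)
  obtain g where g: "g \<in> L2sp lborel" "b = cl g" by (rule l2_cases)
  obtain h where h: "h \<in> L2sp lborel" "c = cl h" by (rule l2_cases)
  note s = f g h cl_add cl_diff cl_minus cl_scaleR zero_l2_def
  show "a + b + c = a + (b + c)" by (simp add: s add.assoc)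
  show "a + b = b + a" by (simp add: s add.commute)
  show "0 + a = a" by (simp add: s)
  show "- a + a = 0" by (simp add: s)
  show "a - b = a + - b" by (simp add: s)
  show "r *\<^sub>R (a + b) = r *\<^sub>R a + r *\<^sub>R b" by (simp add: s algebra_simps)
  show "(r + s) *\<^sub>R a = r *\<^sub>R a + s *\<^sub>R a" by (simp add: s algebra_simps)
  show "r *\<^sub>R s *\<^sub>R a = (r * s) *\<^sub>R a" by (simp add: s algebra_simps)
  show "1 *\<^sub>R a = a" by (simp add: s)
  show "inner a b = inner b a"
  proof -
    have "L2inner lborel g f = cnj (L2inner lborel f g)"
      unfolding L2inner_def by (subst Bochner_Integration.integral_cnj[symmetric]) (simp add: mult.commute)
    then show ?thesis by (simp add: s inner_cl)
  qed
  show "inner (a + b) c = inner a c + inner b c"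
    using f g h by (simp add: s inner_cl L2inner_def distrib_right L2inner_integrable)
  show "inner (r *\<^sub>R a) b = r * inner a b"
    using f g by (simp add: s inner_cl L2inner_def mult.assoc)
  have aa: "inner a a = (L2norm lborel f)\<^sup>2" using f by (simp add: inner_cl L2inner_self)
  show "0 \<le> inner a a" by (simp add: aa)
  show "inner a a = 0 \<longleftrightarrow> a = 0"
  proof -
    have "(L2norm lborel f)\<^sup>2 = 0 \<longleftrightarrow> (AE x in lborel. (cmod (f x))\<^sup>2 = 0)"
      unfolding L2norm_sq by (rule integral_nonneg_eq_0_iff_AE[OF L2spD(2)[OF f(1)]]) simp
    then show ?thesis unfolding aa using f by (simp add: zero_l2_def cl_eq_iff)
  qed
qed (simp_all add: dist_l2_def sgn_l2_def uniformity_l2_def open_l2_def norm_l2_def)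
end

lemma norm_cl: "f \<in> L2sp lborel \<Longrightarrow> norm (cl f) = L2norm lborel f"
  by (simp add: norm_l2_def inner_cl L2inner_self)

lemma L2norm_triangle: assumes "f \<in> L2sp lborel" "h \<in> L2sp lborel"
  shows "L2norm lborel (\<lambda>x. f x + h x) \<le> L2norm lborel f + L2norm lborel h"
  using norm_triangle_ineq[of "cl f" "cl h"] assms by (simp add: cl_add norm_cl)

lemma L2norm_triangle4: assumes "f \<in> L2sp lborel" "h \<in> L2sp lborel"
  shows "L2norm lborel (\<lambda>x. f x - h x) \<le> L2norm lborel f + L2norm lborel h"
  using norm_triangle_ineq4[of "cl f" "cl h"] assms by (simp add: cl_diff norm_cl)

lemma L2norm_zero_AE: assumes "f \<in> L2sp lborel" "L2norm lborel f = 0" shows "AE x in lborel. f x = 0"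
proof -
  have "cl f = 0" using norm_cl[OF assms(1)] assms(2) by simp
  then show ?thesis using assms(1) by (simp add: zero_l2_def cl_eq_iff)
qed

lemma L2sp_indicator_Icc: "(\<lambda>x. complex_of_real (indicator {a..b} x)) \<in> L2sp lborel"
proof -
  have "(cmod (complex_of_real (indicator {a..b} x)))\<^sup>2 = indicator {a..b} x" for x :: real
    by (auto simp: indicator_def)
  then show ?thesis by (simp add: L2sp_def integrable_real_indicator emeasure_lborel_Icc_eq)
qed

lemma L2norm_indicator_Icc: "a \<le> b \<Longrightarrow> L2norm lborel (\<lambda>x. complex_of_real (indicator {a..b} x)) = sqrt (b - a)"
proof -
  assume "a \<le> b"
  have "(cmod (complex_of_real (indicator {a..b} x)))\<^sup>2 = indicator {a..b} x" for x :: real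
    by (auto simp: indicator_def)
  then show ?thesis using \<open>a \<le> b\<close> by (simp add: L2norm_def)
qed

lemma L2_set_integrable_Icc: assumes "f \<in> L2sp lborel"
  shows "set_integrable lborel {a..b::real} f"
    "a \<le> b \<Longrightarrow> (LINT x:{a..b}|lborel. cmod (f x)) \<le> sqrt (b - a) * L2norm lborel f"
proof -
  note m = L2_integrable_mult[OF L2sp_indicator_Icc assms, of a b]
  show "set_integrable lborel {a..b::real} f"
    using m(1) by (simp add: set_integrable_def scaleR_conv_of_real)
  assume "a \<le> b"
  have "(LINT x:{a..b}|lborel. cmod (f x)) = (\<integral>x. cmod (complex_of_real (indicator {a..b} x)) * cmod (f x) \<partial>lborel)"
    by (auto simp: set_lebesgue_integral_def indicator_def intro!: Bochner_Integration.integral_cong)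
  then show "(LINT x:{a..b}|lborel. cmod (f x)) \<le> sqrt (b - a) * L2norm lborel f"
    using m(2) by (simp add: L2norm_indicator_Icc[OF \<open>a \<le> b\<close>])
qed

text \<open>Riesz-Fischer: a subsequence with geometrically decreasing differences converges almost
  everywhere, and Fatou's lemma turns the pointwise limit into an L2 limit.\<close>

instance l2 :: banach
proof
  fix X :: "nat \<Rightarrow> l2" assume X: "Cauchy X"
  have "\<exists>N. \<forall>m\<ge>N. \<forall>n\<ge>N. norm (X m - X n) < (1/2) ^ k" for k
    using CauchyD[OF X, of "(1/2)^k"] by simp
  then obtain N where N: "\<And>k m n. m \<ge> N k \<Longrightarrow> n \<ge> N k \<Longrightarrow> norm (X m - X n) < (1/2) ^ k" by metis
  define r where "r k = (\<Sum>j\<le>k. N j)" for k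
  have rN: "r k \<ge> N k" for k unfolding r_def by (rule member_le_sum) auto
  have rmono: "r k \<le> r j" if "k \<le> j" for k j unfolding r_def using that by (intro sum_mono2) auto
  define f where "f k = rp (X (r k))" for k
  have f: "f k \<in> L2sp lborel" for k by (simp add: f_def)
  note [measurable] = L2spD(1)[OF f]
  have dist: "L2norm lborel (\<lambda>x. f j x - f k x) \<le> (1/2) ^ k" if "k \<le> j" for j k
  proof -
    have "L2norm lborel (\<lambda>x. f j x - f k x) = norm (X (r j) - X (r k))"
      using norm_cl[of "\<lambda>x. f j x - f k x"] cl_diff[OF f f, of j k] f by (simp add: f_def)
    also have "\<dots> < (1/2) ^ k" using rN[of k] rmono[OF that] by (intro N) auto
    finally show ?thesis by simp
  qed
  \<comment> \<open>L2 norms control L1 norms only on bounded windows, hence the detour through the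
    intervals from -n to n.\<close>
  have "AE x in lborel. x \<in> {-real n..real n} \<longrightarrow> summable (\<lambda>k. cmod (f (Suc k) x - f k x))" for n
  proof -
    have "(\<integral>\<^sup>+x. (\<Sum>k. ennreal (cmod (f (Suc k) x - f k x)) * indicator {-real n..real n} x) \<partial>lborel)
      = (\<Sum>k. \<integral>\<^sup>+x. ennreal (cmod (f (Suc k) x - f k x)) * indicator {-real n..real n} x \<partial>lborel)"
      by (rule nn_integral_suminf) simp
    also have "\<dots> \<le> (\<Sum>k. ennreal (sqrt (2 * real n) * (1/2) ^ k))"
    proof (rule suminf_le)
      fix k
      have d: "(\<lambda>x. f (Suc k) x - f k x) \<in> L2sp lborel" by (simp add: f)
      have i: "set_integrable lborel {-real n..real n} (\<lambda>x. cmod (f (Suc k) x - f k x))"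
        using L2_set_integrable_Icc(1)[OF d] by (rule set_integrable_norm)
      have "(\<integral>\<^sup>+x. ennreal (cmod (f (Suc k) x - f k x)) * indicator {-real n..real n} x \<partial>lborel)
        = ennreal (LINT x:{-real n..real n}|lborel. cmod (f (Suc k) x - f k x))"
        using i unfolding set_integrable_def set_lebesgue_integral_def
        by (subst nn_integral_eq_integral[symmetric]) (auto intro!: nn_integral_cong simp: indicator_def)
      also have "\<dots> \<le> ennreal (sqrt (2 * real n) * (1/2) ^ k)"
        using L2_set_integrable_Icc(2)[OF d, of "- real n" "real n"] dist[of k "Suc k"]
        by (intro ennreal_leI) (simp, meson mult_left_mono order_trans real_sqrt_ge_zero of_nat_0_le_iff mult_nonneg_nonneg zero_le_numeral)
      finally show "(\<integral>\<^sup>+x. ennreal (cmod (f (Suc k) x - f k x)) * indicator {-real n..real n} x \<partial>lborel) \<le> \<dots>" .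
    qed auto
    also have "\<dots> = ennreal (\<Sum>k. sqrt (2 * real n) * (1/2) ^ k)"
      by (intro suminf_ennreal2 summable_mult summable_geometric) auto
    also have "\<dots> < \<infinity>" by simp
    finally have "AE x in lborel. (\<Sum>k. ennreal (cmod (f (Suc k) x - f k x)) * indicator {-real n..real n} x) \<noteq> \<infinity>"
      by (intro nn_integral_noteq_infinite) auto
    then show ?thesis
    proof eventually_elim
      fix x assume a: "(\<Sum>k. ennreal (cmod (f (Suc k) x - f k x)) * indicator {-real n..real n} x) \<noteq> \<infinity>"
      show "x \<in> {-real n..real n} \<longrightarrow> summable (\<lambda>k. cmod (f (Suc k) x - f k x))"
      proof
        assume "x \<in> {-real n..real n}"
        then have "(\<Sum>k. ennreal (cmod (f (Suc k) x - f k x))) \<noteq> top" using a by simp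
        then show "summable (\<lambda>k. cmod (f (Suc k) x - f k x))"
          by (intro summable_suminf_not_top) auto
      qed
    qed
  qed
  then have ae: "AE x in lborel. \<forall>n. x \<in> {-real n..real n} \<longrightarrow> summable (\<lambda>k. cmod (f (Suc k) x - f k x))"
    by (subst AE_all_countable) blast
  define F where "F x = lim (\<lambda>k. f k x)" for x
  have lim: "AE x in lborel. (\<lambda>k. f k x) \<longlonglongrightarrow> F x"
    using ae
  proof eventually_elim
    fix x assume a: "\<forall>n. x \<in> {-real n..real n} \<longrightarrow> summable (\<lambda>k. cmod (f (Suc k) x - f k x))"
    obtain n where "\<bar>x\<bar> \<le> real n" using real_arch_simple by blast
    then have "summable (\<lambda>k. cmod (f (Suc k) x - f k x))" using a by (auto dest!: spec[of _ n])
    then have "summable (\<lambda>k. f (Suc k) x - f k x)" by (rule summable_norm_cancel)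
    then have "convergent (\<lambda>k. \<Sum>j<k. f (Suc j) x - f j x)" by (simp add: summable_iff_convergent)
    then have "convergent (\<lambda>k. f k x - f 0 x)" by (simp only: sum_lessThan_telescope[of "\<lambda>j. f j x"])
    then have "convergent (\<lambda>k. f k x)" using convergent_add_const_right_iff[of "\<lambda>k. f k x" "- f 0 x"] by simp
    then show "(\<lambda>k. f k x) \<longlonglongrightarrow> F x" unfolding F_def by (simp add: convergent_LIMSEQ_iff)
  qed
  have [measurable]: "F \<in> borel_measurable lborel" unfolding F_def by (rule borel_measurable_lim_metric) simp
  \<comment> \<open>Fatou in j with k fixed bounds the distance of the limit F to each member of the
    subsequence.\<close>
  have b: "(\<lambda>x. F x - f k x) \<in> L2sp lborel \<and> L2norm lborel (\<lambda>x. F x - f k x) \<le> (1/2) ^ k" for k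
  proof -
    have "(\<integral>\<^sup>+x. ennreal ((cmod (F x - f k x))\<^sup>2) \<partial>lborel)
      \<le> (\<integral>\<^sup>+x. liminf (\<lambda>j. ennreal ((cmod (f j x - f k x))\<^sup>2)) \<partial>lborel)"
    proof (rule nn_integral_mono_AE)
      show "AE x in lborel. ennreal ((cmod (F x - f k x))\<^sup>2) \<le> liminf (\<lambda>j. ennreal ((cmod (f j x - f k x))\<^sup>2))"
        using lim
      proof eventually_elim
        fix x assume "(\<lambda>k. f k x) \<longlonglongrightarrow> F x"
        then have "(\<lambda>j. ennreal ((cmod (f j x - f k x))\<^sup>2)) \<longlonglongrightarrow> ennreal ((cmod (F x - f k x))\<^sup>2)"
          by (intro tendsto_intros)
        then show "ennreal ((cmod (F x - f k x))\<^sup>2) \<le> liminf (\<lambda>j. ennreal ((cmod (f j x - f k x))\<^sup>2))"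
          using lim_imp_Liminf[OF trivial_limit_sequentially] by (metis order_refl)
      qed
    qed
    also have "\<dots> \<le> liminf (\<lambda>j. \<integral>\<^sup>+x. ennreal ((cmod (f j x - f k x))\<^sup>2) \<partial>lborel)"
      by (rule nn_integral_liminf) simp
    also have "\<dots> \<le> ennreal (((1/2) ^ k)\<^sup>2)"
    proof (rule Liminf_le)
      show "\<forall>\<^sub>F j in sequentially. (\<integral>\<^sup>+x. ennreal ((cmod (f j x - f k x))\<^sup>2) \<partial>lborel) \<le> ennreal (((1/2) ^ k)\<^sup>2)"
        using eventually_ge_at_top[of k]
        by eventually_elim (auto simp: nn_L2norm f intro!: ennreal_leI power_mono dist)
    qed simp
    finally show ?thesis
      using L2sp_nnI[of "\<lambda>x. F x - f k x" lborel "((1/2) ^ k)\<^sup>2"] by simp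
  qed
  have FL: "F \<in> L2sp lborel" using L2sp_add[OF conjunct1[OF b[of 0]] f[of 0]] by simp
  have "(\<lambda>k. norm (cl F - X (r k))) \<longlonglongrightarrow> 0"
  proof (rule tendsto_sandwich[of "\<lambda>_. 0"])
    have "norm (cl F - X (r k)) \<le> (1/2) ^ k" for k
      using b[of k] cl_diff[OF FL f[of k]] by (simp add: f_def norm_cl)
    then show "\<forall>\<^sub>F k in sequentially. norm (cl F - X (r k)) \<le> (1/2) ^ k" by simp
  qed (auto intro!: LIMSEQ_power_zero)
  then have lim2: "(\<lambda>k. X (r k)) \<longlonglongrightarrow> cl F"
    by (subst tendsto_dist_iff) (simp add: dist_norm norm_minus_commute)
  have "X \<longlonglongrightarrow> cl F"
  proof (rule LIMSEQ_I)
    fix e :: real assume e: "e > 0"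
    obtain k0 where k0: "(1/2::real) ^ k0 < e / 2" using real_arch_pow_inv[of "e/2" "1/2"] e by auto
    obtain k1 where k1: "\<And>k. k \<ge> k1 \<Longrightarrow> norm (X (r k) - cl F) < e / 2"
      using LIMSEQ_D[OF lim2, of "e/2"] e by auto
    let ?k = "max k0 k1"
    show "\<exists>no. \<forall>n\<ge>no. norm (X n - cl F) < e"
    proof (intro exI allI impI)
      fix n assume n: "n \<ge> N k0"
      have "norm (X n - X (r ?k)) < e / 2"
        using N[OF n, of "r ?k"] rN[of k0] rmono[of k0 ?k] k0 by simp
      moreover have "norm (X (r ?k) - cl F) < e / 2" by (rule k1) simp
      ultimately show "norm (X n - cl F) < e"
        using norm_triangle_ineq[of "X n - X (r ?k)" "X (r ?k) - cl F"] by simp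
    qed
  qed
  then show "convergent X" by (auto simp: convergent_def)
qed

text \<open>Required by the operator algebra \<open>bop\<close>; small multiples of one unit vector
  show that no point is isolated.\<close>

instance l2 :: perfect_space
proof
  fix x :: l2
  define v where "v = cl (\<lambda>x. complex_of_real (indicator {0..1} x))"
  have nv: "norm v = 1" by (simp add: v_def norm_cl L2sp_indicator_Icc L2norm_indicator_Icc)
  show "\<not> open {x}"
  proof
    assume "open {x}"
    then obtain e where e: "e > 0" "ball x e \<subseteq> {x}" by (meson openE singletonI)
    have "x + (e/2) *\<^sub>R v \<in> ball x e" using e nv by (simp add: dist_norm)
    then have "(e/2) *\<^sub>R v = 0" using e(2) by auto
    then show False using e(1) nv by auto
  qed
qed

definition Il2 :: "l2 \<Rightarrow> l2" where "Il2 a = cl (\<lambda>x. \<i> * rp a x)"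

lemma Il2_cl: "f \<in> L2sp lborel \<Longrightarrow> Il2 (cl f) = cl (\<lambda>x. \<i> * f x)"
  unfolding Il2_def using rp_cl[of f] by (intro cl_eqI) auto

lemma Il2_props: "linear Il2" "inner (Il2 a) (Il2 b) = inner a b" "Il2 (Il2 a) = - a"
proof -
  show "linear Il2"
  proof (rule linearI)
    fix a b :: l2 and r :: real
    obtain f where f: "f \<in> L2sp lborel" "a = cl f" by (rule l2_cases)
    obtain g where g: "g \<in> L2sp lborel" "b = cl g" by (rule l2_cases)
    show "Il2 (a + b) = Il2 a + Il2 b" using f g by (simp add: cl_add Il2_cl distrib_left)
    show "Il2 (r *\<^sub>R a) = r *\<^sub>R Il2 a" using f by (simp add: cl_scaleR Il2_cl mult.left_commute)
  qed
  obtain f where f: "f \<in> L2sp lborel" "a = cl f" by (rule l2_cases)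
  obtain g where g: "g \<in> L2sp lborel" "b = cl g" by (rule l2_cases)
  show "inner (Il2 a) (Il2 b) = inner a b" using f g by (simp add: inner_cl Il2_cl L2inner_def algebra_simps)
  show "Il2 (Il2 a) = - a" using f by (simp add: Il2_cl cl_minus flip: mult.assoc)
qed

text \<open>Convergence along a real parameter is reduced to the integers, where completeness
  applies; the rate b, which bounds all later differences, brings the limit back to real R.\<close>

lemma L2_lim_exists:
  assumes F: "\<And>R. F R \<in> L2sp lborel" and b: "(b \<longlongrightarrow> 0) at_top"
    and le: "\<And>R S. 0 \<le> R \<Longrightarrow> R \<le> S \<Longrightarrow> L2norm lborel (\<lambda>x. F S x - F R x) \<le> b R"
  shows "\<exists>v. L2_lim F v"
proof -
  have nrm: "norm (cl (F S) - cl (F R)) \<le> b R" if "0 \<le> R" "R \<le> S" for R S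
    using le[OF that] F by (simp add: cl_diff norm_cl)
  have bn: "(\<lambda>n. b (real n)) \<longlonglongrightarrow> 0"
    by (rule filterlim_compose[OF b filterlim_real_sequentially])
  have "Cauchy (\<lambda>n. cl (F (real n)))"
  proof (rule CauchyI)
    fix e :: real assume e: "e > 0"
    obtain N where N: "\<And>n. n \<ge> N \<Longrightarrow> norm (b (real n) - 0) < e" using LIMSEQ_D[OF bn e] by blast
    have "norm (cl (F (real m)) - cl (F (real n))) < e" if "n \<ge> N" "n \<le> m" for m n
      using nrm[of "real n" "real m"] N[of n] that by simp
    then show "\<exists>M. \<forall>m\<ge>M. \<forall>n\<ge>M. norm (cl (F (real m)) - cl (F (real n))) < e"
      by (metis nle_le norm_minus_commute)
  qed
  then obtain v where v: "(\<lambda>n. cl (F (real n))) \<longlonglongrightarrow> v" using Cauchy_convergent_iff convergent_def by blast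
  have bd: "norm (cl (F R) - v) \<le> b R" if "R \<ge> 0" for R
  proof (rule LIMSEQ_le_const2)
    show "(\<lambda>n. norm (cl (F R) - cl (F (real n)))) \<longlonglongrightarrow> norm (cl (F R) - v)" by (intro tendsto_intros v)
    obtain N where "R \<le> real N" using real_arch_simple by blast
    then show "\<exists>N. \<forall>n\<ge>N. norm (cl (F R) - cl (F (real n))) \<le> b R"
      using nrm[OF that] by (intro exI[of _ N]) (simp add: norm_minus_commute[of "cl (F R)"])
  qed
  have eq: "L2norm lborel (\<lambda>x. F R x - rp v x) = norm (cl (F R) - v)" for R
    using cl_diff[OF F rp_L2, of R v] F by (simp add: norm_cl)
  have "((\<lambda>R. L2norm lborel (\<lambda>x. F R x - rp v x)) \<longlongrightarrow> 0) at_top"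
  proof (rule tendsto_sandwich[OF _ _ tendsto_const b])
    show "\<forall>\<^sub>F R in at_top. L2norm lborel (\<lambda>x. F R x - rp v x) \<le> b R"
      using eventually_ge_at_top[of 0] by eventually_elim (simp add: eq bd)
  qed simp
  then show ?thesis unfolding L2_lim_def using F by blast
qed

lemma L2_lim_bound:
  assumes "L2_lim F v" "u \<in> L2sp lborel" "\<forall>\<^sub>F R in at_top. L2norm lborel (\<lambda>x. F R x - u x) \<le> c"
  shows "L2norm lborel (\<lambda>x. v x - u x) \<le> c"
proof -
  have F: "F R \<in> L2sp lborel" "v \<in> L2sp lborel" for R using assms(1) by (auto simp: L2_lim_def)
  have "((\<lambda>R. L2norm lborel (\<lambda>x. F R x - v x) + c) \<longlongrightarrow> 0 + c) at_top"
    using assms(1) by (intro tendsto_intros) (simp add: L2_lim_def)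
  moreover have "\<forall>\<^sub>F R in at_top. L2norm lborel (\<lambda>x. v x - u x) \<le> L2norm lborel (\<lambda>x. F R x - v x) + c"
    using assms(3)
  proof eventually_elim
    fix R assume "L2norm lborel (\<lambda>x. F R x - u x) \<le> c"
    then show "L2norm lborel (\<lambda>x. v x - u x) \<le> L2norm lborel (\<lambda>x. F R x - v x) + c"
      using L2norm_triangle4[of "\<lambda>x. F R x - u x" "\<lambda>x. F R x - v x"] F assms(2) by simp
  qed
  ultimately show ?thesis by (intro tendsto_lowerbound) (auto simp: trivial_limit_at_top_linorder)
qed

section \<open>Integral operators with Bloch kernels\<close>

lemma L2inner_add_left: "f \<in> L2sp M \<Longrightarrow> g \<in> L2sp M \<Longrightarrow> h \<in> L2sp M \<Longrightarrow>
    L2inner M (\<lambda>x. f x + g x) h = L2inner M f h + L2inner M g h"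
  unfolding L2inner_def by (simp add: distrib_right L2inner_integrable)

lemma L2inner_cmult_left: "L2inner M (\<lambda>x. c * f x) h = c * L2inner M f h"
  unfolding L2inner_def by (simp add: mult.assoc)

lemma L2inner_cnj: "L2inner M f h = cnj (L2inner M h f)"
  unfolding L2inner_def by (subst Bochner_Integration.integral_cnj[symmetric]) (simp add: mult.commute)

lemma L2sp_sum: "finite I \<Longrightarrow> (\<And>i. i \<in> I \<Longrightarrow> f i \<in> L2sp M) \<Longrightarrow> (\<lambda>x. \<Sum>i\<in>I. f i x) \<in> L2sp M"
  by (induction I rule: finite_induct) auto

lemma L2inner_sum_left:
  assumes "finite I" "\<And>i. i \<in> I \<Longrightarrow> e i \<in> L2sp M" "h \<in> L2sp M"
  shows "L2inner M (\<lambda>x. \<Sum>i\<in>I. a i * e i x) h = (\<Sum>i\<in>I. a i * L2inner M (e i) h)"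
  using assms(1,2)
proof (induction I rule: finite_induct)
  case (insert i I)
  have "(\<lambda>x. \<Sum>i\<in>I. a i * e i x) \<in> L2sp M" using insert by (intro L2sp_sum) auto
  then show ?case using insert assms(3) by (simp add: L2inner_add_left L2inner_cmult_left)
qed (simp add: L2inner_def)

lemma L2norm_orthogonal_sum:
  assumes fin: "finite I" and e: "\<And>i. i \<in> I \<Longrightarrow> e i \<in> L2sp M"
    and orth: "\<And>i j. i \<in> I \<Longrightarrow> j \<in> I \<Longrightarrow> L2inner M (e i) (e j) = (if i = j then complex_of_real L else 0)"
  shows "(L2norm M (\<lambda>x. \<Sum>i\<in>I. a i * e i x))\<^sup>2 = L * (\<Sum>i\<in>I. (cmod (a i))\<^sup>2)"
proof -
  let ?S = "\<lambda>x. \<Sum>i\<in>I. a i * e i x"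
  have S: "?S \<in> L2sp M" using fin e by (intro L2sp_sum) auto
  have *: "L2inner M (e j) ?S = L * cnj (a j)" if j: "j \<in> I" for j
  proof -
    have "L2inner M ?S (e j) = (\<Sum>i\<in>I. a i * L2inner M (e i) (e j))"
      by (rule L2inner_sum_left[OF fin e e[OF j]])
    also have "\<dots> = (\<Sum>i\<in>I. if i = j then a i * L else 0)"
      by (rule sum.cong) (auto simp: orth j)
    also have "\<dots> = a j * L" using fin j by (simp add: sum.delta')
    finally show ?thesis by (subst L2inner_cnj) simp
  qed
  have "L2inner M ?S ?S = (\<Sum>i\<in>I. a i * L2inner M (e i) ?S)" by (rule L2inner_sum_left[OF fin e S])
  also have "\<dots> = (\<Sum>i\<in>I. L * complex_of_real ((cmod (a i))\<^sup>2))"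
    by (rule sum.cong) (auto simp only: * complex_norm_square[symmetric] mult.left_commute of_real_power)
  finally have "complex_of_real ((L2norm M ?S)\<^sup>2) = complex_of_real (L * (\<Sum>i\<in>I. (cmod (a i))\<^sup>2))"
    by (simp add: L2inner_self sum_distrib_left)
  then show ?thesis by (simp only: of_real_eq_iff)
qed

text \<open>Bessel for vectors of squared length L: pairing f with its own coefficient sum gives T
  <= sqrt(L T) |f|. The length absorbs the 2 pi of the exponentials on a Brillouin zone.\<close>

lemma L2_Bessel:
  assumes fin: "finite I" and e: "\<And>i. i \<in> I \<Longrightarrow> e i \<in> L2sp M" and f: "f \<in> L2sp M" and L: "0 \<le> L"
    and orth: "\<And>i j. i \<in> I \<Longrightarrow> j \<in> I \<Longrightarrow> L2inner M (e i) (e j) = (if i = j then complex_of_real L else 0)"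
  shows "(\<Sum>i\<in>I. (cmod (L2inner M f (e i)))\<^sup>2) \<le> L * (L2norm M f)\<^sup>2"
proof -
  define c where "c i = L2inner M f (e i)" for i
  let ?S = "\<lambda>x. \<Sum>i\<in>I. c i * e i x"
  define T where "T = (\<Sum>i\<in>I. (cmod (c i))\<^sup>2)"
  have T0: "T \<ge> 0" unfolding T_def by (intro sum_nonneg) auto
  have S: "?S \<in> L2sp M" using fin e by (intro L2sp_sum) auto
  have nS: "(L2norm M ?S)\<^sup>2 = L * T" unfolding T_def by (rule L2norm_orthogonal_sum[OF fin e orth])
  have "L2inner M ?S f = (\<Sum>i\<in>I. c i * L2inner M (e i) f)" by (rule L2inner_sum_left[OF fin e f])
  also have "\<dots> = (\<Sum>i\<in>I. complex_of_real ((cmod (c i))\<^sup>2))"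
    by (rule sum.cong) (auto simp: c_def L2inner_cnj[of M "e _" f] complex_norm_square[symmetric] simp flip: of_real_power)
  finally have "L2inner M ?S f = complex_of_real T" by (simp add: T_def)
  then have "T \<le> L2norm M ?S * L2norm M f" using L2inner_bound[OF S f] T0 by simp
  then have "T\<^sup>2 \<le> (L2norm M ?S * L2norm M f)\<^sup>2" using T0 by (intro power_mono) auto
  then have "T * T \<le> T * (L * (L2norm M f)\<^sup>2)" by (simp add: power_mult_distrib nS power2_eq_square[of T] mult.assoc mult.left_commute)
  then have "T \<le> L * (L2norm M f)\<^sup>2" using T0 L by (cases "T = 0") (auto simp: mult_le_cancel_left)
  then show ?thesis by (simp add: T_def c_def)
qed

definition cut :: "real set \<Rightarrow> cfun \<Rightarrow> cfun" where "cut S f k = indicator S k *\<^sub>R f k"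

lemma cmod_cut_le: "cmod (cut S f k) \<le> cmod (f k)" by (simp add: cut_def indicator_def)

lemma cut_measurable [measurable]:
  assumes [measurable]: "S \<in> sets borel" "f \<in> borel_measurable borel" shows "cut S f \<in> borel_measurable borel"
  unfolding cut_def[abs_def] by measurable

lemma cut_L2 [intro]: "f \<in> L2sp lborel \<Longrightarrow> S \<in> sets borel \<Longrightarrow> cut S f \<in> L2sp lborel"
  by (rule L2sp_bound[of _ _ f]) (use L2spD(1)[of f lborel] in \<open>auto simp: cmod_cut_le\<close>)

lemma L2norm_cut_le: "f \<in> L2sp lborel \<Longrightarrow> S \<in> sets borel \<Longrightarrow> L2norm lborel (cut S f) \<le> L2norm lborel f"
  by (rule L2norm_mono) (auto simp: cmod_cut_le)

section \<open>Exponentials, tilings and periodic folding\<close>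

lemma iexp_add: "iexp (a + b) = iexp a * iexp b" by (simp add: exp_add distrib_left)

lemma iexp_2pi_int: "iexp (2 * pi * of_int m) = 1"
  using exp_integer_2pi[of "of_int m"] by (simp add: mult_ac)

lemma iexp_measurable [measurable]: "iexp \<in> borel_measurable borel"
  by (intro borel_measurable_continuous_onI continuous_intros)

lemma iexp_integral:
  assumes "d \<noteq> 0" "a \<le> b"
  shows "has_bochner_integral lborel (\<lambda>x. indicator {a..b} x *\<^sub>R iexp (d * x)) ((iexp (d * b) - iexp (d * a)) / (\<i> * d))"
proof -
  have "has_bochner_integral lborel (\<lambda>x. indicator {a..b} x *\<^sub>R iexp (d * x))
    (iexp (d * b) / (\<i> * d) - iexp (d * a) / (\<i> * d))"
  proof (rule has_bochner_integral_FTC_Icc[OF assms(2)])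
    fix x
    show "((\<lambda>x. iexp (d * x) / (\<i> * d)) has_vector_derivative iexp (d * x)) (at x within {a..b})"
    proof -
      have "((\<lambda>z. exp (\<i> * of_real d * z) / (\<i> * of_real d)) has_field_derivative exp (\<i> * of_real d * of_real x)) (at (of_real x))"
        using assms(1) by (auto intro!: derivative_eq_intros)
      from has_vector_derivative_real_field[OF this] show ?thesis by (simp add: mult.assoc)
    qed
  qed (auto intro!: continuous_intros)
  then show ?thesis by (simp add: diff_divide_distrib)
qed

lemma AE_Ioc_Icc: "AE x in lborel. (x \<in> {a<..b}) = (x \<in> {a..b::real})"
proof -
  have "AE x in lborel. x \<noteq> a" by (rule AE_lborel_singleton)
  then show ?thesis by eventually_elim auto
qed

lemma LINT_Ioc_Icc: "f \<in> borel_measurable borel \<Longrightarrow>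
   (LINT x:{a<..b::real}|lborel. f x) = (LINT x:{a..b}|lborel. (f x :: complex))"
  using AE_Ioc_Icc[of a b] unfolding set_lebesgue_integral_def
  by (intro integral_cong_AE) (auto simp: indicator_def elim!: eventually_mono)

lemma iexp_orthogonal:
  assumes L: "L > 0"
  shows "(LINT k:{a<..a + L}|lborel. iexp (2 * pi / L * of_int m * k)) = (if m = 0 then complex_of_real L else 0)"
proof (cases "m = 0")
  case True
  then show ?thesis using L by (simp add: set_lebesgue_integral_def measure_def scaleR_conv_of_real)
next
  case False
  let ?d = "2 * pi / L * of_int m"
  have d: "?d \<noteq> 0" using False L by simp
  have "iexp (?d * (a + L)) = iexp (?d * a) * iexp (2 * pi * of_int m)"
    unfolding iexp_add[symmetric] using L by (simp add: distrib_left)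
  then have "iexp (?d * (a + L)) = iexp (?d * a)" unfolding iexp_2pi_int by simp
  moreover have "(LINT k:{a..a + L}|lborel. iexp (?d * k)) = (iexp (?d * (a + L)) - iexp (?d * a)) / (\<i> * ?d)"
    using iexp_integral[OF d, of a "a + L"] L unfolding set_lebesgue_integral_def
    by (intro has_bochner_integral_integral_eq) (simp add: mult.assoc)
  ultimately show ?thesis using False by (subst LINT_Ioc_Icc) (auto simp: mult.assoc)
qed

text \<open>Half-open intervals tile without overlap: y = a + z L lies only in the translate with
  index ceiling(z) - 1, and the large interval is the union of the 2N + 1 translates.\<close>

lemma indicator_tiles:
  fixes a L y :: real assumes L: "L > 0"
  shows "(indicator {a - real N * L<..a + (real N + 1) * L} y :: 'b::comm_semiring_1)
    = (\<Sum>m=-int N..int N. indicator {a<..a + L} (y - of_int m * L))"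
proof -
  define z where "z = (y - a) / L"
  have y: "y = a + z * L" using L by (simp add: z_def)
  have 1: "indicator {a<..a + L} (y - of_int m * L) = (if m = \<lceil>z\<rceil> - 1 then 1 else 0 :: 'b)" for m
  proof -
    have "y - of_int m * L \<in> {a<..a + L} \<longleftrightarrow> of_int m * L < z * L \<and> z * L \<le> (of_int m + 1) * L"
      by (auto simp: y algebra_simps)
    also have "\<dots> \<longleftrightarrow> of_int m < z \<and> z \<le> of_int m + 1" using L by (simp only: mult_less_cancel_right_pos mult_le_cancel_right_pos)
    also have "\<dots> \<longleftrightarrow> m = \<lceil>z\<rceil> - 1" by (auto simp: less_ceiling_iff ceiling_le_iff) (linarith)+
    finally show ?thesis by (simp add: indicator_def)
  qed
  have "y \<in> {a - real N * L<..a + (real N + 1) * L} \<longleftrightarrow> (- real N) * L < z * L \<and> z * L \<le> (real N + 1) * L"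
    by (auto simp: y algebra_simps)
  also have "\<dots> \<longleftrightarrow> - real N < z \<and> z \<le> real N + 1" using L by (simp only: mult_less_cancel_right_pos mult_le_cancel_right_pos)
  also have "\<dots> \<longleftrightarrow> \<lceil>z\<rceil> - 1 \<in> {-int N..int N}" by (auto simp: ceiling_le_iff) (linarith)+
  finally show ?thesis unfolding 1 by (simp add: indicator_def)
qed

lemma nn_fold:
  fixes f :: "real \<Rightarrow> ennreal"
  assumes [measurable]: "f \<in> borel_measurable borel" and L: "L > 0"
  shows "(\<integral>\<^sup>+y. f y * indicator {a - real N * L<..a + (real N + 1) * L} y \<partial>lborel)
    = (\<integral>\<^sup>+y. (\<Sum>m=-int N..int N. f (y + of_int m * L)) * indicator {a<..a + L} y \<partial>lborel)"
proof -
  have "(\<integral>\<^sup>+y. f y * indicator {a - real N * L<..a + (real N + 1) * L} y \<partial>lborel)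
    = (\<Sum>m=-int N..int N. \<integral>\<^sup>+y. f y * indicator {a<..a + L} (y - of_int m * L) \<partial>lborel)"
    unfolding indicator_tiles[OF L] sum_distrib_left by (rule nn_integral_sum) simp
  also have "\<dots> = (\<Sum>m=-int N..int N. \<integral>\<^sup>+y. f (y + of_int m * L) * indicator {a<..a + L} y \<partial>lborel)"
  proof (rule sum.cong)
    fix m
    show "(\<integral>\<^sup>+y. f y * indicator {a<..a + L} (y - of_int m * L) \<partial>lborel)
      = (\<integral>\<^sup>+y. f (y + of_int m * L) * indicator {a<..a + L} y \<partial>lborel)"
      by (subst nn_integral_real_affine[where c=1 and t="of_int m * L"]) (simp_all add: add.commute)
  qed simp
  also have "\<dots> = (\<integral>\<^sup>+y. (\<Sum>m=-int N..int N. f (y + of_int m * L)) * indicator {a<..a + L} y \<partial>lborel)"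
    unfolding sum_distrib_right by (rule nn_integral_sum[symmetric]) simp
  finally show ?thesis .
qed

text \<open>Integrability over the large interval is a conclusion, assembled from the pieces; in the
  application it is the pieces that are known to be integrable, for almost every x.\<close>

lemma int_fold:
  fixes g :: "real \<Rightarrow> complex"
  assumes L: "L > 0" and i: "\<And>m. m \<in> {-int N..int N} \<Longrightarrow> set_integrable lborel {a<..a + L} (\<lambda>k. g (k + of_int m * L))"
  shows "set_integrable lborel {a - real N * L<..a + (real N + 1) * L} g"
    "(LINT k:{a - real N * L<..a + (real N + 1) * L}|lborel. g k) = (\<Sum>m=-int N..int N. LINT k:{a<..a + L}|lborel. g (k + of_int m * L))"
proof -
  have eq: "indicat_real {a - real N * L<..a + (real N + 1) * L} y *\<^sub>R g y
    = (\<Sum>m=-int N..int N. indicat_real {a<..a + L} (y - of_int m * L) *\<^sub>R g y)" for y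
    unfolding indicator_tiles[OF L] by (simp add: scaleR_left.sum)
  have hb: "has_bochner_integral lborel (\<lambda>y. indicat_real {a<..a + L} (y - of_int m * L) *\<^sub>R g y)
      (LINT k:{a<..a + L}|lborel. g (k + of_int m * L))" if "m \<in> {-int N..int N}" for m
    using i[OF that] unfolding set_integrable_def set_lebesgue_integral_def
    by (subst lborel_has_bochner_integral_real_affine_iff[where c=1 and t="of_int m * L"])
      (simp_all add: add.commute has_bochner_integral_integrable)
  have "has_bochner_integral lborel (\<lambda>y. indicat_real {a - real N * L<..a + (real N + 1) * L} y *\<^sub>R g y)
     (\<Sum>m=-int N..int N. LINT k:{a<..a + L}|lborel. g (k + of_int m * L))"
    unfolding eq by (intro has_bochner_integral_sum hb)
  then show "set_integrable lborel {a - real N * L<..a + (real N + 1) * L} g"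
    "(LINT k:{a - real N * L<..a + (real N + 1) * L}|lborel. g k) = (\<Sum>m=-int N..int N. LINT k:{a<..a + L}|lborel. g (k + of_int m * L))"
    unfolding set_integrable_def set_lebesgue_integral_def by (auto simp: has_bochner_integral_iff)
qed

lemma nn_integral_tiles_le:
  fixes f :: "real \<Rightarrow> ennreal"
  assumes [measurable]: "f \<in> borel_measurable borel"
    and le: "\<And>N. (\<integral>\<^sup>+y. (\<Sum>m=-int N..int N. f (y + of_int m)) * indicator {0<..1} y \<partial>lborel) \<le> C"
  shows "(\<integral>\<^sup>+y. f y \<partial>lborel) \<le> C"
proof -
  let ?g = "\<lambda>N y. f y * indicator {- real N<..real N + 1} y"
  have inc: "incseq ?g"
    by (intro monoI le_funI mult_left_mono) (auto simp: indicator_def)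
  have "f y = (SUP N. ?g N y)" for y
  proof (rule antisym)
    obtain N where "\<bar>y\<bar> < real N" using reals_Archimedean2 by blast
    then have "f y \<le> ?g N y" by (auto simp: indicator_def)
    also have "\<dots> \<le> (SUP N. ?g N y)" by (rule SUP_upper) simp
    finally show "f y \<le> (SUP N. ?g N y)" .
  next
    have "?g N y \<le> f y" for N by (simp add: indicator_def)
    then show "(SUP N. ?g N y) \<le> f y" by (intro SUP_least)
  qed
  then have "(\<integral>\<^sup>+y. f y \<partial>lborel) = (\<integral>\<^sup>+y. (SUP N. ?g N y) \<partial>lborel)" by simp
  also have "\<dots> = (SUP N. \<integral>\<^sup>+y. ?g N y \<partial>lborel)"
    by (rule nn_integral_monotone_convergence_SUP[OF inc]) simp
  also have "\<dots> \<le> C"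
  proof (rule SUP_least)
    fix N
    show "(\<integral>\<^sup>+y. ?g N y \<partial>lborel) \<le> C" using nn_fold[of f 1 0 N] le[of N] by simp
  qed
  finally show ?thesis .
qed

lemma periodic_int: assumes per: "\<And>x. P (x + 1) = P (x::real)" shows "P (x + of_int m) = P x"
proof -
  have pern: "P (x + real n) = P x" for x n
  proof (induction n)
    case (Suc n)
    have "x + real (Suc n) = (x + real n) + 1" by simp
    then show ?case using per[of "x + real n"] Suc by (simp only:)
  qed simp
  show ?thesis
  proof (cases m rule: int_cases2)
    case (nonneg n) then show ?thesis using pern[of x n] by simp
  next
    case (nonpos n) then show ?thesis using pern[of "x - real n" n] by simp
  qed
qed

text \<open>The exceptional set is covered by countably many integer translates of one null
  set.\<close>

lemma AE_periodic:
  assumes ae: "AE x in lborel. x \<in> {0<..1} \<longrightarrow> P x" and per: "\<And>x. P (x + 1) = P (x::real)"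
  shows "AE x in lborel. P x"
proof -
  obtain N where N: "{x \<in> space lborel. \<not> (x \<in> {0<..1} \<longrightarrow> P x)} \<subseteq> N" "emeasure lborel N = 0" "N \<in> sets lborel"
    using ae by (rule AE_E)
  have N0: "AE x in lborel. x \<notin> N" using N by (intro AE_not_in) (auto simp: null_sets_def)
  have [measurable]: "N \<in> sets borel" using N by simp
  have "AE x in lborel. x + of_int m \<notin> N" for m
    using AE_borel_affine[of 1 "\<lambda>x. x \<notin> N" "of_int m"] N0 by (simp add: add.commute)
  then have "AE x in lborel. \<forall>m::int. x + of_int m \<notin> N" by (subst AE_all_countable) blast
  then show ?thesis
  proof eventually_elim
    fix x assume x: "\<forall>m::int. x + of_int m \<notin> N"
    define m where "m = 1 - \<lceil>x\<rceil>"
    have "x + of_int m \<in> {0<..1}" unfolding m_def using ceiling_correct[of x] by auto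
    then have "P (x + of_int m)" using N(1) x by auto
    then show "P x" using periodic_int[of P x m, OF per] by simp
  qed
qed

abbreviation BZ0 :: "real set" where "BZ0 \<equiv> {-pi<..pi}"

text \<open>For fixed x, periodicity of H makes the values W(x + m), m an integer, the Fourier
  coefficients on \<open>BZ0\<close> of k |-> e^(ikx) H x k. Bessel bounds their square sum by 2 pi
  times the squared norm of H x, and integrating x over one cell gives the norm over the
  line.\<close>

lemma packet_bound:
  assumes Hm: "(\<lambda>(x, k). H x k) \<in> borel_measurable (borel :: (real \<times> real) measure)"
    and per: "\<And>x k. H (x + 1) k = H x k" and B: "B \<ge> 0"
    and le: "(\<integral>\<^sup>+x. (\<integral>\<^sup>+k. ennreal ((cmod (cut BZ0 (H x) k))\<^sup>2) \<partial>lborel) * indicator {0<..1} x \<partial>lborel) \<le> ennreal B"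
  defines "W \<equiv> (\<lambda>x. LINT k:BZ0|lborel. iexp (k * x) * H x k)"
  shows "AE x in lborel. cut BZ0 (H x) \<in> L2sp lborel"
    "AE x in lborel. set_integrable lborel BZ0 (\<lambda>k. iexp (k * x) * H x k)"
    "W \<in> L2sp lborel" "L2norm lborel W \<le> sqrt (2 * pi * B)"
proof -
  have [measurable]: "(\<lambda>(x, k). H x k) \<in> borel_measurable (borel \<Otimes>\<^sub>M borel)"
    using Hm by (simp add: borel_prod)
  have cutm [measurable]: "(\<lambda>(x, k). cut BZ0 (H x) k) \<in> borel_measurable (borel \<Otimes>\<^sub>M borel)"
    unfolding cut_def[abs_def] by measurable
  have [measurable]: "W \<in> borel_measurable lborel"
    unfolding W_def set_lebesgue_integral_def by measurable
  let ?n = "\<lambda>x. (\<integral>\<^sup>+k. ennreal ((cmod (cut BZ0 (H x) k))\<^sup>2) \<partial>lborel)"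
  have "AE x in lborel. ?n x * indicator {0<..1} x \<noteq> \<infinity>"
    using le by (intro nn_integral_noteq_infinite) (auto simp: top_unique)
  have Hx: "H (x + 1) = H x" for x using per by auto
  from \<open>AE x in lborel. ?n x * indicator {0<..1} x \<noteq> \<infinity>\<close>
  have "AE x in lborel. x \<in> {0<..1} \<longrightarrow> cut BZ0 (H x) \<in> L2sp lborel"
  proof eventually_elim
    fix x :: real assume a: "?n x * indicator {0<..1} x \<noteq> \<infinity>"
    show "x \<in> {0<..1} \<longrightarrow> cut BZ0 (H x) \<in> L2sp lborel"
    proof
      assume "x \<in> {0<..1}"
      then have "?n x \<noteq> \<infinity>" using a by simp
      then have "?n x \<le> ennreal (enn2real (?n x))" by (simp add: less_top)
      then show "cut BZ0 (H x) \<in> L2sp lborel" by (rule L2sp_nnI(1)[rotated]) auto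
    qed
  qed
  then show L2: "AE x in lborel. cut BZ0 (H x) \<in> L2sp lborel"
    by (rule AE_periodic) (simp add: Hx)
  have int: "set_integrable lborel BZ0 (\<lambda>k. iexp (k * x) * H x k)" if "cut BZ0 (H x) \<in> L2sp lborel" for x
  proof -
    have "set_integrable lborel BZ0 (cut BZ0 (H x))"
      by (rule set_integrable_subset[OF L2_set_integrable_Icc(1)[OF that, of "-pi" pi]]) auto
    then have "integrable lborel (\<lambda>k. indicator BZ0 k *\<^sub>R H x k)"
      unfolding set_integrable_def cut_def by (simp flip: indicator_inter_arith)
    then have "integrable lborel (\<lambda>k. indicator BZ0 k *\<^sub>R (iexp (k * x) * H x k))"
      by (rule Bochner_Integration.integrable_bound) (auto simp: norm_mult)
    then show ?thesis by (simp add: set_integrable_def)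
  qed
  then show "AE x in lborel. set_integrable lborel BZ0 (\<lambda>k. iexp (k * x) * H x k)"
    using L2 by auto
  have bes: "(\<Sum>m=-int N..int N. (cmod (W (x + of_int m)))\<^sup>2) \<le> 2 * pi * (L2norm lborel (cut BZ0 (H x)))\<^sup>2"
    if L: "cut BZ0 (H x) \<in> L2sp lborel" for x N
  proof -
    define e where "e m = cut BZ0 (\<lambda>k. iexp (- (of_int m * k)))" for m :: int
    have eL: "e m \<in> L2sp lborel" for m
    proof (rule L2sp_bound[OF _ L2sp_indicator_Icc[of "-pi" pi]])
      show "e m \<in> borel_measurable lborel" unfolding e_def by measurable
      show "AE x in lborel. cmod (e m x) \<le> cmod (complex_of_real (indicator {-pi..pi} x))"
        by (rule AE_I2) (simp add: e_def cut_def indicator_def)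
    qed
    have orth: "L2inner lborel (e m) (e n) = (if m = n then complex_of_real (2 * pi) else 0)" for m n
    proof -
      have "e m k * cnj (e n k) = indicator BZ0 k *\<^sub>R iexp (of_int (n - m) * k)" for k
        by (simp add: e_def cut_def indicator_def exp_cnj algebra_simps flip: exp_add)
      then have "L2inner lborel (e m) (e n) = (LINT k:BZ0|lborel. iexp (of_int (n - m) * k))"
        by (simp add: L2inner_def set_lebesgue_integral_def)
      then show ?thesis using iexp_orthogonal[of "2 * pi" "-pi" "n - m"] by simp
    qed
    define f where "f k = iexp (k * x) * cut BZ0 (H x) k" for k
    have f: "f \<in> L2sp lborel" unfolding f_def
      by (rule L2sp_bdd_mult(1)[OF L, of _ 1]) auto
    have nf: "L2norm lborel f = L2norm lborel (cut BZ0 (H x))"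
      by (simp add: f_def L2norm_def norm_mult)
    have Hxm: "H (x + of_int m) k = H x k" for m k
      using periodic_int[of "\<lambda>x. H x k" x m] per by simp
    have "L2inner lborel f (e m) = W (x + of_int m)" for m
      unfolding L2inner_def W_def set_lebesgue_integral_def
      by (rule Bochner_Integration.integral_cong)
        (auto simp: f_def e_def cut_def indicator_def exp_cnj Hxm algebra_simps simp flip: exp_add)
    then show ?thesis
      using L2_Bessel[of "{-int N..int N}" e lborel f "2 * pi", OF _ eL f _ orth] by (simp add: nf)
  qed
  have "(\<integral>\<^sup>+y. ennreal ((cmod (W y))\<^sup>2) \<partial>lborel) \<le> ennreal (2 * pi) * ennreal B"
  proof (rule nn_integral_tiles_le)
    fix N
    have "(\<integral>\<^sup>+y. (\<Sum>m=-int N..int N. ennreal ((cmod (W (y + of_int m)))\<^sup>2)) * indicator {0<..1} y \<partial>lborel)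
      \<le> (\<integral>\<^sup>+y. ennreal (2 * pi) * (?n y * indicator {0<..1} y) \<partial>lborel)"
    proof (rule nn_integral_mono_AE, use L2 in eventually_elim)
      fix y assume L: "cut BZ0 (H y) \<in> L2sp lborel"
      have "(\<Sum>m=-int N..int N. ennreal ((cmod (W (y + of_int m)))\<^sup>2)) = ennreal (\<Sum>m=-int N..int N. (cmod (W (y + of_int m)))\<^sup>2)"
        by (rule sum_ennreal) simp
      also have "\<dots> \<le> ennreal (2 * pi * (L2norm lborel (cut BZ0 (H y)))\<^sup>2)" by (rule ennreal_leI[OF bes[OF L]])
      also have "\<dots> = ennreal (2 * pi) * ?n y" by (simp add: nn_L2norm[OF L] ennreal_mult)
      finally show "(\<Sum>m=-int N..int N. ennreal ((cmod (W (y + of_int m)))\<^sup>2)) * indicator {0<..1} y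
         \<le> ennreal (2 * pi) * (?n y * indicator {0<..1} y)"
        unfolding mult.assoc[symmetric] by (rule mult_right_mono) simp
    qed
    also have "\<dots> = ennreal (2 * pi) * (\<integral>\<^sup>+y. ?n y * indicator {0<..1} y \<partial>lborel)"
      by (rule nn_integral_cmult) measurable
    also have "\<dots> \<le> ennreal (2 * pi) * ennreal B" using le by (rule mult_left_mono) simp
    finally show "(\<integral>\<^sup>+y. (\<Sum>m=-int N..int N. ennreal ((cmod (W (y + of_int m)))\<^sup>2)) * indicator {0<..1} y \<partial>lborel)
      \<le> ennreal (2 * pi) * ennreal B" .
  qed simp
  also have "\<dots> = ennreal (2 * pi * B)" using B by (simp add: ennreal_mult)
  finally show "W \<in> L2sp lborel" "L2norm lborel W \<le> sqrt (2 * pi * B)"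
    using B L2sp_nnI[of W lborel "2 * pi * B"] by auto
qed

section \<open>Kernels that define contractions\<close>

lemma space_cell: "space cell = {0..1}" by (simp add: cell_def space_restrict_space)

lemma nn_integral_cell: assumes [measurable]: "f \<in> borel_measurable borel"
  shows "(\<integral>\<^sup>+x. f x \<partial>cell) = (\<integral>\<^sup>+x. f x * indicator {0<..1} x \<partial>lborel)"
proof -
  have "(\<integral>\<^sup>+x. f x \<partial>cell) = (\<integral>\<^sup>+x. f x * indicator {0..1} x \<partial>lborel)"
    unfolding cell_def by (rule nn_integral_restrict_space) simp
  also have "\<dots> = (\<integral>\<^sup>+x. f x * indicator {0<..1} x \<partial>lborel)"
    by (rule nn_integral_cong_AE) (use AE_Ioc_Icc[of 0 1] in \<open>auto simp: indicator_def elim!: eventually_mono\<close>)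
  finally show ?thesis .
qed

lemma measurable_cell: "f \<in> borel_measurable borel \<Longrightarrow> f \<in> borel_measurable cell"
  unfolding cell_def by (rule measurable_restrict_space1) simp

definition ktrunc :: "(real \<Rightarrow> real \<Rightarrow> complex) \<Rightarrow> cfun \<Rightarrow> real \<Rightarrow> cfun" where
  "ktrunc K f R x = complex_of_real (1 / sqrt (2 * pi)) * (LINT k:{-R..R}|lborel. f k * K x k)"

text \<open>The bound involves only the part of f inside [-R, R], so that packets can be estimated
  on their own frequency range. Integrability is asked for almost every x, since a Bloch kernel is
  controlled in mean over a cell and not pointwise.\<close>

definition contr_kernel :: "(real \<Rightarrow> real \<Rightarrow> complex) \<Rightarrow> bool" where
  "contr_kernel K \<longleftrightarrow> (\<lambda>(x, k). K x k) \<in> borel_measurable (borel :: (real \<times> real) measure) \<and>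
     (\<forall>f\<in>L2sp lborel. \<forall>R. (AE x in lborel. set_integrable lborel {-R..R} (\<lambda>k. f k * K x k)) \<and>
       ktrunc K f R \<in> L2sp lborel \<and> L2norm lborel (ktrunc K f R) \<le> L2norm lborel (cut {-R..R} f))"

text \<open>Folding k into \<open>BZ0\<close> by multiples of 2 pi leaves an integral over a single
  zone. After removing e^(ikx) each summand is 1-periodic in x, so \<open>packet_bound\<close>
  applies; in a cell the summands with different m are orthogonal and their squares add up to those
  of f. The factor 2 pi is cancelled by the normalisation 1 / sqrt (2 pi).\<close>

lemma bloch_contr_kernel:
  assumes Km: "(\<lambda>(x, k). K x k) \<in> borel_measurable (borel :: (real \<times> real) measure)"
    and qper: "\<And>x k. K (x + 1) k = iexp k * K x k"
    and KL: "\<And>k. (\<lambda>x. K x k) \<in> L2sp cell"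
    and orth: "\<And>k m n. k \<in> BZ0 \<Longrightarrow> L2inner cell (\<lambda>x. K x (k + of_int m * (2 * pi))) (\<lambda>x. K x (k + of_int n * (2 * pi)))
        = (if m = n then 1 else 0)"
  shows "contr_kernel K"
  unfolding contr_kernel_def
proof (intro conjI Km ballI allI)
  fix f R assume f: "f \<in> L2sp lborel"
  have [measurable]: "(\<lambda>(x, k). K x k) \<in> borel_measurable (borel \<Otimes>\<^sub>M borel)"
    using Km by (simp add: borel_prod)
  define g where "g = cut {-R..R} f"
  have g: "g \<in> L2sp lborel" unfolding g_def using f by auto
  have [measurable]: "f \<in> borel_measurable borel" "g \<in> borel_measurable borel"
    using L2spD(1)[OF f] L2spD(1)[OF g] by auto
  define G where "G = (L2norm lborel g)\<^sup>2"
  obtain N where N: "\<bar>R\<bar> < real N" using reals_Archimedean2 by blast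
  let ?I = "{-int N..int N}"
  let ?big = "{-pi - real N * (2 * pi)<..-pi + (real N + 1) * (2 * pi)}"
  \<comment> \<open>A crude choice of N: since 2 pi > 1, the 2N + 1 zones cover [-R, R] as soon as N
    > |R|.\<close>
  have big: "{-R..R} \<subseteq> ?big"
  proof
    fix y assume "y \<in> {-R..R}"
    then have "\<bar>y\<bar> < real N" using N by auto
    moreover have "real N * 1 \<le> real N * (2 * pi)" using pi_gt3 by (intro mult_left_mono) auto
    ultimately show "y \<in> ?big" using pi_gt3 by (auto simp: algebra_simps)
  qed
  define Hm where "Hm m x k = g (k + of_int m * (2 * pi)) * (iexp (- (k * x)) * K x (k + of_int m * (2 * pi)))" for m :: int and x k
  have Hm_meas: "(\<lambda>(x, k). Hm m x k) \<in> borel_measurable (borel :: (real \<times> real) measure)" for m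
    unfolding borel_prod[symmetric] Hm_def by measurable
  have Hm_per: "Hm m (x + 1) k = Hm m x k" for m x k
  proof -
    have "iexp (- (k * (x + 1))) * iexp (k + of_int m * (2 * pi)) = iexp (- (k * x)) * iexp (2 * pi * of_int m)"
      by (simp add: algebra_simps flip: exp_add)
    also have "\<dots> = iexp (- (k * x))" unfolding iexp_2pi_int by simp
    finally have "iexp (- (k * (x + 1))) * (iexp (k + of_int m * (2 * pi)) * K x (k + of_int m * (2 * pi))) = iexp (- (k * x)) * K x (k + of_int m * (2 * pi))"
      by (simp only: mult.assoc[symmetric])
    then show ?thesis by (simp only: Hm_def qper)
  qed
  \<comment> \<open>Stated for subsets J: singletons give integrability of each folded piece, the
    full index set gives the norm.\<close>
  have nnH: "(\<integral>\<^sup>+x. (\<integral>\<^sup>+k. ennreal ((cmod (cut BZ0 (\<lambda>k. \<Sum>m\<in>J. Hm m x k) k))\<^sup>2) \<partial>lborel) * indicator {0<..1} x \<partial>lborel)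
      \<le> ennreal G" if J: "J \<subseteq> ?I" for J
  proof -
    have finJ: "finite J" using J finite_subset by blast
    have [measurable]: "(\<lambda>(x, k). cut BZ0 (\<lambda>k. \<Sum>m\<in>J. Hm m x k) k) \<in> borel_measurable (borel \<Otimes>\<^sub>M borel)"
      unfolding cut_def Hm_def by measurable
    have "(\<integral>\<^sup>+x. (\<integral>\<^sup>+k. ennreal ((cmod (cut BZ0 (\<lambda>k. \<Sum>m\<in>J. Hm m x k) k))\<^sup>2) \<partial>lborel) * indicator {0<..1} x \<partial>lborel)
      = (\<integral>\<^sup>+x. (\<integral>\<^sup>+k. ennreal ((cmod (cut BZ0 (\<lambda>k. \<Sum>m\<in>J. Hm m x k) k))\<^sup>2) * indicator {0<..1} x \<partial>lborel) \<partial>lborel)"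
      by (intro nn_integral_cong nn_integral_multc[symmetric]) measurable
    also have "\<dots> = (\<integral>\<^sup>+k. (\<integral>\<^sup>+x. ennreal ((cmod (cut BZ0 (\<lambda>k. \<Sum>m\<in>J. Hm m x k) k))\<^sup>2) * indicator {0<..1} x \<partial>lborel) \<partial>lborel)"
      by (rule lborel_pair.Fubini') measurable
    also have "\<dots> = (\<integral>\<^sup>+k. (\<Sum>m\<in>J. ennreal ((cmod (g (k + of_int m * (2 * pi))))\<^sup>2)) * indicator BZ0 k \<partial>lborel)"
    proof (rule nn_integral_cong)
      fix k :: real
      show "(\<integral>\<^sup>+x. ennreal ((cmod (cut BZ0 (\<lambda>k. \<Sum>m\<in>J. Hm m x k) k))\<^sup>2) * indicator {0<..1} x \<partial>lborel)
        = (\<Sum>m\<in>J. ennreal ((cmod (g (k + of_int m * (2 * pi))))\<^sup>2)) * indicator BZ0 k"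
      proof (cases "k \<in> BZ0")
        case True
        let ?s = "\<lambda>x. \<Sum>m\<in>J. g (k + of_int m * (2 * pi)) * K x (k + of_int m * (2 * pi))"
        have sL: "?s \<in> L2sp cell" using finJ KL by (intro L2sp_sum) auto
        have "cmod (cut BZ0 (\<lambda>k. \<Sum>m\<in>J. Hm m x k) k) = cmod (?s x)" for x
        proof -
          have "(\<Sum>m\<in>J. Hm m x k) = iexp (- (k * x)) * ?s x"
            unfolding sum_distrib_left Hm_def by (rule sum.cong) (simp_all add: mult_ac)
          then have "cmod (\<Sum>m\<in>J. Hm m x k) = cmod (?s x)" by (simp only: norm_mult norm_exp_i_times mult_1)
          then show ?thesis using True by (simp add: cut_def)
        qed
        then have "(\<integral>\<^sup>+x. ennreal ((cmod (cut BZ0 (\<lambda>k. \<Sum>m\<in>J. Hm m x k) k))\<^sup>2) * indicator {0<..1} x \<partial>lborel)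
          = (\<integral>\<^sup>+x. ennreal ((cmod (?s x))\<^sup>2) \<partial>cell)"
          by (subst nn_integral_cell) simp_all
        also have "\<dots> = ennreal ((L2norm cell ?s)\<^sup>2)" by (rule nn_L2norm[OF sL])
        also have "(L2norm cell ?s)\<^sup>2 = 1 * (\<Sum>m\<in>J. (cmod (g (k + of_int m * (2 * pi))))\<^sup>2)"
          by (rule L2norm_orthogonal_sum[OF finJ KL]) (simp add: orth[OF True])
        also have "ennreal \<dots> = (\<Sum>m\<in>J. ennreal ((cmod (g (k + of_int m * (2 * pi))))\<^sup>2))"
          by (simp add: sum_ennreal)
        finally show ?thesis using True by simp
      qed (simp add: cut_def)
    qed
    also have "\<dots> \<le> (\<integral>\<^sup>+k. (\<Sum>m\<in>?I. ennreal ((cmod (g (k + of_int m * (2 * pi))))\<^sup>2)) * indicator {-pi<..-pi + 2 * pi} k \<partial>lborel)"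
      using J by (intro nn_integral_mono mult_mono sum_mono2) auto
    also have "\<dots> = (\<integral>\<^sup>+k. ennreal ((cmod (g k))\<^sup>2) * indicator ?big k \<partial>lborel)"
      by (rule nn_fold[symmetric]) auto
    also have "\<dots> \<le> (\<integral>\<^sup>+k. ennreal ((cmod (g k))\<^sup>2) \<partial>lborel)"
      by (intro nn_integral_mono) (simp add: indicator_def)
    also have "\<dots> = ennreal G" unfolding G_def by (rule nn_L2norm[OF g])
    finally show ?thesis .
  qed
  have G0: "G \<ge> 0" by (simp add: G_def)
  have part: "iexp (k * x) * Hm m x k = g (k + of_int m * (2 * pi)) * K x (k + of_int m * (2 * pi))" for m x k
  proof -
    have "iexp (k * x) * iexp (- (k * x)) = 1" by (simp flip: exp_add)
    then show ?thesis unfolding Hm_def by (simp add: mult.left_commute flip: mult.assoc)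
  qed
  have ints: "AE x in lborel. \<forall>m\<in>?I. set_integrable lborel BZ0 (\<lambda>k. g (k + of_int m * (2 * pi)) * K x (k + of_int m * (2 * pi)))"
  proof (rule AE_finite_allI)
    fix m assume m: "m \<in> ?I"
    have "AE x in lborel. set_integrable lborel BZ0 (\<lambda>k. iexp (k * x) * Hm m x k)"
      using nnH[of "{m}"] m by (intro packet_bound(2)[OF Hm_meas Hm_per G0]) auto
    then show "AE x in lborel. set_integrable lborel BZ0 (\<lambda>k. g (k + of_int m * (2 * pi)) * K x (k + of_int m * (2 * pi)))"
      unfolding part .
  qed simp
  have gf: "indicator {-R..R} k *\<^sub>R (f k * K x k) = indicator ?big k *\<^sub>R (g k * K x k)" for x k
    using big by (auto simp: g_def cut_def indicator_def)
  show "AE x in lborel. set_integrable lborel {-R..R} (\<lambda>k. f k * K x k)"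
    using ints
  proof eventually_elim
    fix x assume "\<forall>m\<in>?I. set_integrable lborel BZ0 (\<lambda>k. g (k + of_int m * (2 * pi)) * K x (k + of_int m * (2 * pi)))"
    then have "set_integrable lborel ?big (\<lambda>k. g k * K x k)"
      by (intro int_fold(1)) auto
    then show "set_integrable lborel {-R..R} (\<lambda>k. f k * K x k)"
      unfolding set_integrable_def gf .
  qed
  define H where "H x k = (\<Sum>m\<in>?I. Hm m x k)" for x k
  define W where "W x = (LINT k:BZ0|lborel. iexp (k * x) * H x k)" for x
  have H_meas: "(\<lambda>(x, k). H x k) \<in> borel_measurable (borel :: (real \<times> real) measure)"
    unfolding borel_prod[symmetric] H_def Hm_def by measurable
  have H_per: "H (x + 1) k = H x k" for x k by (simp add: H_def Hm_per)
  have W: "W \<in> L2sp lborel" "L2norm lborel W \<le> sqrt (2 * pi * G)"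
    using packet_bound(3,4)[OF H_meas H_per G0] nnH[of ?I] unfolding W_def[abs_def] H_def[abs_def] by auto
  have km [measurable]: "ktrunc K f R \<in> borel_measurable lborel"
    unfolding ktrunc_def[abs_def] set_lebesgue_integral_def by measurable
  have eq: "AE x in lborel. complex_of_real (1 / sqrt (2 * pi)) * W x = ktrunc K f R x"
    using ints
  proof eventually_elim
    fix x assume i: "\<forall>m\<in>?I. set_integrable lborel BZ0 (\<lambda>k. g (k + of_int m * (2 * pi)) * K x (k + of_int m * (2 * pi)))"
    have "(LINT k:{-R..R}|lborel. f k * K x k) = (LINT k:?big|lborel. g k * K x k)"
      unfolding set_lebesgue_integral_def gf ..
    also have "\<dots> = (\<Sum>m\<in>?I. LINT k:{-pi<..-pi + 2 * pi}|lborel. g (k + of_int m * (2 * pi)) * K x (k + of_int m * (2 * pi)))"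
      using i by (intro int_fold(2)) auto
    also have "\<dots> = (LINT k:BZ0|lborel. \<Sum>m\<in>?I. g (k + of_int m * (2 * pi)) * K x (k + of_int m * (2 * pi)))"
    proof -
      have b: "{-pi<..-pi + 2 * pi} = BZ0" by simp
      show ?thesis unfolding b
        using i unfolding set_lebesgue_integral_def set_integrable_def scaleR_sum_right
        by (intro Bochner_Integration.integral_sum[symmetric]) blast
    qed
    also have "\<dots> = W x" unfolding W_def H_def sum_distrib_left part ..
    finally show "complex_of_real (1 / sqrt (2 * pi)) * W x = ktrunc K f R x" by (simp add: ktrunc_def)
  qed
  have WL: "(\<lambda>x. complex_of_real (1 / sqrt (2 * pi)) * W x) \<in> L2sp lborel" by (rule L2sp_cmult[OF W(1)])
  show "ktrunc K f R \<in> L2sp lborel" by (rule L2sp_cong_AE[OF WL km eq])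
  have "L2norm lborel (ktrunc K f R) = L2norm lborel (\<lambda>x. complex_of_real (1 / sqrt (2 * pi)) * W x)"
    by (rule L2norm_cong_AE[symmetric, OF L2spD(1)[OF WL] km eq])
  also have "\<dots> = 1 / sqrt (2 * pi) * L2norm lborel W" unfolding L2norm_cmult by (simp add: norm_divide)
  also have "\<dots> \<le> 1 / sqrt (2 * pi) * sqrt (2 * pi * G)" using W(2) by (intro mult_left_mono) auto
  also have "\<dots> = L2norm lborel g" by (simp add: real_sqrt_mult G_def)
  finally show "L2norm lborel (ktrunc K f R) \<le> L2norm lborel (cut {-R..R} f)" by (simp add: g_def)
qed

lemma contr_kernelD:
  assumes "contr_kernel K"
  shows "(\<lambda>(x, k). K x k) \<in> borel_measurable (borel \<Otimes>\<^sub>M borel)"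
    and "f \<in> L2sp lborel \<Longrightarrow> AE x in lborel. set_integrable lborel {-R..R} (\<lambda>k. f k * K x k)"
    and "f \<in> L2sp lborel \<Longrightarrow> ktrunc K f R \<in> L2sp lborel"
    and "f \<in> L2sp lborel \<Longrightarrow> L2norm lborel (ktrunc K f R) \<le> L2norm lborel (cut {-R..R} f)"
  using assms unfolding contr_kernel_def borel_prod by auto

lemma ktrunc_contr: assumes "contr_kernel K" "f \<in> L2sp lborel"
  shows "L2norm lborel (ktrunc K f R) \<le> L2norm lborel f"
  using contr_kernelD(4)[OF assms, of R] L2norm_cut_le[OF assms(2), of "{-R..R}"] by simp

lemma ktrunc_diff: assumes K: "contr_kernel K" and f: "f \<in> L2sp lborel" and h: "h \<in> L2sp lborel"
  shows "AE x in lborel. ktrunc K (\<lambda>k. f k - h k) R x = ktrunc K f R x - ktrunc K h R x"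
  using contr_kernelD(2)[OF K f, of R] contr_kernelD(2)[OF K h, of R]
proof eventually_elim
  case (elim x)
  have "(\<lambda>k. (f k - h k) * K x k) = (\<lambda>k. f k * K x k - h k * K x k)" by (simp add: left_diff_distrib)
  then show ?case using set_integral_diff(2)[OF elim] by (simp add: ktrunc_def right_diff_distrib)
qed

lemma ktrunc_diff_norm: assumes K: "contr_kernel K" and f: "f \<in> L2sp lborel" and h: "h \<in> L2sp lborel"
  shows "L2norm lborel (\<lambda>x. ktrunc K f R x - ktrunc K h R x) \<le> L2norm lborel (\<lambda>k. f k - h k)"
proof -
  have "L2norm lborel (\<lambda>x. ktrunc K f R x - ktrunc K h R x) = L2norm lborel (ktrunc K (\<lambda>k. f k - h k) R)"
  proof (rule L2norm_cong_AE)
    show "(\<lambda>x. ktrunc K f R x - ktrunc K h R x) \<in> borel_measurable lborel"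
      by (rule L2spD(1)[OF L2sp_diff[OF contr_kernelD(3)[OF K f] contr_kernelD(3)[OF K h]]])
    show "ktrunc K (\<lambda>k. f k - h k) R \<in> borel_measurable lborel"
      by (rule L2spD(1)[OF contr_kernelD(3)[OF K L2sp_diff[OF f h]]])
  qed (use ktrunc_diff[OF K f h, of R] in \<open>auto elim: eventually_mono\<close>)
  also have "\<dots> \<le> L2norm lborel (\<lambda>k. f k - h k)" using f h by (intro ktrunc_contr[OF K]) auto
  finally show ?thesis .
qed

lemma cut_tail_tendsto: assumes f: "f \<in> L2sp lborel"
  shows "((\<lambda>R. L2norm lborel (cut (-{-R..R}) f)) \<longlongrightarrow> 0) at_top"
proof -
  have [measurable]: "f \<in> borel_measurable borel" using L2spD(1)[OF f] by simp
  have "((\<lambda>R. \<integral>k. (cmod (cut (-{-R..R}) f k))\<^sup>2 \<partial>lborel) \<longlongrightarrow> integral\<^sup>L lborel (\<lambda>k::real. 0)) at_top"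
  proof (rule integral_dominated_convergence_at_top[where w="\<lambda>k. (cmod (f k))\<^sup>2" and f="\<lambda>k. 0" and s="\<lambda>R k. (cmod (cut (-{-R..R}) f k))\<^sup>2" and M=lborel])
    show "integrable lborel (\<lambda>k. (cmod (f k))\<^sup>2)" using L2spD(2)[OF f] .
    show "\<forall>\<^sub>F R in at_top. AE k in lborel. norm ((cmod (cut (-{-R..R}) f k))\<^sup>2) \<le> (cmod (f k))\<^sup>2"
      by (auto intro!: always_eventually power_mono cmod_cut_le)
    show "AE k in lborel. ((\<lambda>R. (cmod (cut (-{-R..R}) f k))\<^sup>2) \<longlongrightarrow> 0) at_top"
    proof (rule AE_I2)
      fix k :: real
      have "\<forall>\<^sub>F R in at_top. (cmod (cut (-{-R..R}) f k))\<^sup>2 = 0"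
        using eventually_ge_at_top[of "\<bar>k\<bar>"] by eventually_elim (auto simp: cut_def indicator_def)
      then show "((\<lambda>R. (cmod (cut (-{-R..R}) f k))\<^sup>2) \<longlongrightarrow> 0) at_top" by (rule tendsto_eventually)
    qed
  qed auto
  then have "((\<lambda>R. sqrt (\<integral>k. (cmod (cut (-{-R..R}) f k))\<^sup>2 \<partial>lborel)) \<longlongrightarrow> sqrt 0) at_top"
    by (intro tendsto_real_sqrt) simp
  then show ?thesis by (simp add: L2norm_def)
qed

text \<open>Truncating at R amounts to truncating \<open>cut {-R..R} f\<close> at S, so the
  difference is one contraction applied to the tail of f.\<close>

lemma ktrunc_tail: assumes K: "contr_kernel K" and f: "f \<in> L2sp lborel" and R: "0 \<le> R" "R \<le> S"
  shows "L2norm lborel (\<lambda>x. ktrunc K f S x - ktrunc K f R x) \<le> L2norm lborel (cut (-{-R..R}) f)"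
proof -
  have "ktrunc K f R x = ktrunc K (cut {-R..R} f) S x" for x
    unfolding ktrunc_def set_lebesgue_integral_def using R
    by (intro arg_cong2[where f="(*)"] Bochner_Integration.integral_cong) (auto simp: cut_def indicator_def)
  then have "L2norm lborel (\<lambda>x. ktrunc K f S x - ktrunc K f R x) \<le> L2norm lborel (\<lambda>k. f k - cut {-R..R} f k)"
    using ktrunc_diff_norm[OF K f cut_L2[OF f], of "{-R..R}" S] by simp
  also have "(\<lambda>k. f k - cut {-R..R} f k) = cut (-{-R..R}) f" by (auto simp: cut_def indicator_def)
  finally show ?thesis .
qed

lemma ktrunc_L2_lim: assumes K: "contr_kernel K" and f: "f \<in> L2sp lborel"
  shows "\<exists>v. L2_lim (ktrunc K f) v"
  by (rule L2_lim_exists[OF contr_kernelD(3)[OF K f] cut_tail_tendsto[OF f] ktrunc_tail[OF K f]])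

lemma ktrunc_L2_lim_tail:
  assumes K: "contr_kernel K" and f: "f \<in> L2sp lborel" and v: "L2_lim (ktrunc K f) v" and R: "0 \<le> R"
  shows "L2norm lborel (\<lambda>x. v x - ktrunc K f R x) \<le> L2norm lborel (cut (-{-R..R}) f)"
  by (rule L2_lim_bound[OF v contr_kernelD(3)[OF K f] eventually_mono[OF eventually_ge_at_top[of R]]])
    (rule ktrunc_tail[OF K f R])

lemma ktrunc_L2_lim_diff:
  assumes K: "contr_kernel K" and f: "f \<in> L2sp lborel" "h \<in> L2sp lborel"
    and v: "L2_lim (ktrunc K f) v" "L2_lim (ktrunc K h) w"
  shows "L2norm lborel (\<lambda>x. v x - w x) \<le> L2norm lborel (\<lambda>k. f k - h k)"
proof -
  have wL: "w \<in> L2sp lborel" "v \<in> L2sp lborel" using v by (auto simp: L2_lim_def)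
  note kL = contr_kernelD(3)[OF K f(1)] contr_kernelD(3)[OF K f(2)]
  have "((\<lambda>R. L2norm lborel (\<lambda>x. ktrunc K f R x - v x) + L2norm lborel (\<lambda>k. f k - h k) + L2norm lborel (\<lambda>x. ktrunc K h R x - w x))
     \<longlongrightarrow> 0 + L2norm lborel (\<lambda>k. f k - h k) + 0) at_top"
    using v by (intro tendsto_intros) (auto simp: L2_lim_def)
  moreover have "L2norm lborel (\<lambda>x. v x - w x) \<le> L2norm lborel (\<lambda>x. ktrunc K f R x - v x) + L2norm lborel (\<lambda>k. f k - h k)
     + L2norm lborel (\<lambda>x. ktrunc K h R x - w x)" for R
  proof -
    have "L2norm lborel (\<lambda>x. v x - w x) = L2norm lborel (\<lambda>x. ((ktrunc K f R x - ktrunc K h R x) - (ktrunc K f R x - v x)) + (ktrunc K h R x - w x))"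
      by (simp add: algebra_simps)
    also have "\<dots> \<le> L2norm lborel (\<lambda>x. (ktrunc K f R x - ktrunc K h R x) - (ktrunc K f R x - v x)) + L2norm lborel (\<lambda>x. ktrunc K h R x - w x)"
      using kL wL by (intro L2norm_triangle) auto
    also have "L2norm lborel (\<lambda>x. (ktrunc K f R x - ktrunc K h R x) - (ktrunc K f R x - v x))
      \<le> L2norm lborel (\<lambda>x. ktrunc K f R x - ktrunc K h R x) + L2norm lborel (\<lambda>x. ktrunc K f R x - v x)"
      using kL wL by (intro L2norm_triangle4) auto
    finally show ?thesis using ktrunc_diff_norm[OF K f, of R] by simp
  qed
  ultimately show ?thesis by (intro tendsto_lowerbound[of _ "L2norm lborel (\<lambda>k. f k - h k)" at_top]) (auto simp: trivial_limit_at_top_linorder)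
qed

lemma L2_affine: assumes f: "f \<in> L2sp lborel" and c: "c \<noteq> 0"
  shows "(\<lambda>x. f (c * x)) \<in> L2sp lborel" "L2norm lborel (\<lambda>x. f (c * x)) = L2norm lborel f / sqrt \<bar>c\<bar>"
proof -
  have [measurable]: "f \<in> borel_measurable borel" using L2spD(1)[OF f] by simp
  show "(\<lambda>x. f (c * x)) \<in> L2sp lborel"
    using lborel_integrable_real_affine[OF L2spD(2)[OF f] c, of 0] by (simp add: L2sp_def)
  show "L2norm lborel (\<lambda>x. f (c * x)) = L2norm lborel f / sqrt \<bar>c\<bar>"
    using lborel_integral_real_affine[OF c, of "\<lambda>x. (cmod (f x))\<^sup>2" 0] c
    by (simp add: L2norm_def real_sqrt_mult)
qed

lemma AE_scale: assumes "AE x in lborel. P x" "c \<noteq> 0" shows "AE x in lborel. P (c * x :: real)"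
proof -
  obtain N where N: "{x \<in> space lborel. \<not> P x} \<subseteq> N" "emeasure lborel N = 0" "N \<in> sets lborel"
    using assms(1) by (rule AE_E)
  have N0: "AE x in lborel. x \<notin> N" using N by (intro AE_not_in) (auto simp: null_sets_def)
  have [measurable]: "N \<in> sets borel" using N by simp
  have "AE x in lborel. c * x \<notin> N"
    using AE_borel_affine[of c "\<lambda>x. x \<notin> N" 0] N0 assms(2) by simp
  then show ?thesis by eventually_elim (use N(1) in auto)
qed

text \<open>Substituting p = |e| k costs 1/|e|, while dilating f and dilating the output contribute
  sqrt |e| each, so the factors cancel. Only the frequency carries an absolute value: e = -1
  reflects x and yields the conjugate exponential, e > 0 gives the rescaled band kernel.\<close>

lemma contr_kernel_scale:
  assumes K: "contr_kernel K" and e: "e \<noteq> 0"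
  shows "contr_kernel (\<lambda>x k. K (x / e) (\<bar>e\<bar> * k))"
  unfolding contr_kernel_def
proof (intro conjI ballI allI)
  note [measurable] = contr_kernelD(1)[OF K]
  show "(\<lambda>(x, k). K (x / e) (\<bar>e\<bar> * k)) \<in> borel_measurable borel" unfolding borel_prod[symmetric] by measurable
  fix f R assume f: "f \<in> L2sp lborel"
  define a where "a = \<bar>e\<bar>"
  have a: "a > 0" using e by (simp add: a_def)
  define h where "h p = f (1 / a * p)" for p
  have h: "h \<in> L2sp lborel" unfolding h_def using f a by (intro L2_affine) auto
  have ind: "indicator {-R..R} k = indicat_real {-(a*R)..a*R} (a * k)" for k
    using a by (auto simp: indicator_def mult_le_cancel_left_pos[of a "-R" k, simplified])
  have fe: "indicator {-R..R} k *\<^sub>R (f k * K (x / e) (a * k)) = (\<lambda>p. indicator {-(a*R)..a*R} p *\<^sub>R (h p * K (x / e) p)) (0 + a * k)" for x k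
    using a by (simp add: ind h_def)
  have "AE x in lborel. set_integrable lborel {-(a*R)..a*R} (\<lambda>k. h k * K (1 / e * x) k)"
    using contr_kernelD(2)[OF K h, of "a * R"] e by (intro AE_scale) auto
  then show "AE x in lborel. set_integrable lborel {-R..R} (\<lambda>k. f k * K (x / e) (\<bar>e\<bar> * k))"
    unfolding set_integrable_def a_def[symmetric] fe
    by eventually_elim (use a in \<open>subst lborel_integrable_real_affine_iff; simp\<close>)
  have kt: "ktrunc (\<lambda>x k. K (x / e) (\<bar>e\<bar> * k)) f R x = complex_of_real (1 / a) * ktrunc K h (a * R) (1 / e * x)" for x
    using lborel_integral_real_affine[of a "\<lambda>p. indicator {-(a*R)..a*R} p *\<^sub>R (h p * K (x / e) p)" 0] a
    unfolding ktrunc_def set_lebesgue_integral_def a_def[symmetric] fe by (simp add: scaleR_conv_of_real)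
  note kL = contr_kernelD(3)[OF K h, of "a * R"]
  note kA = L2_affine[OF kL, of "1 / e"]
  show "ktrunc (\<lambda>x k. K (x / e) (\<bar>e\<bar> * k)) f R \<in> L2sp lborel"
    unfolding kt[abs_def] using kA(1) e by (intro L2sp_cmult) auto
  have "L2norm lborel (ktrunc (\<lambda>x k. K (x / e) (\<bar>e\<bar> * k)) f R) = 1 / a * (L2norm lborel (ktrunc K h (a * R)) / sqrt (1 / a))"
    unfolding kt[abs_def] L2norm_cmult using kA(2) e a by (simp add: a_def norm_divide)
  also have "\<dots> \<le> 1 / a * (L2norm lborel (cut {-(a*R)..a*R} h) / sqrt (1 / a))"
    using contr_kernelD(4)[OF K h, of "a * R"] a by (intro mult_left_mono divide_right_mono) auto
  also have "cut {-(a*R)..a*R} h = (\<lambda>p. cut {-R..R} f (1 / a * p))"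
    using a by (auto simp: cut_def h_def ind)
  also have "L2norm lborel (\<lambda>p. cut {-R..R} f (1 / a * p)) = L2norm lborel (cut {-R..R} f) / sqrt (1 / a)"
    using a f by (subst L2_affine(2)) auto
  also have "1 / a * (L2norm lborel (cut {-R..R} f) / sqrt (1 / a) / sqrt (1 / a)) = L2norm lborel (cut {-R..R} f)"
    using a by (simp add: real_sqrt_divide field_simps)
  finally show "L2norm lborel (ktrunc (\<lambda>x k. K (x / e) (\<bar>e\<bar> * k)) f R) \<le> L2norm lborel (cut {-R..R} f)" .
qed

text \<open>The Fourier kernel is a Bloch kernel with trivial Bloch functions: its translates by 2
  pi m differ by e^(2 pi i m x), an orthonormal system in the cell.\<close>

lemma contr_kernel_iexp: "contr_kernel (\<lambda>x k. iexp (k * x))"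
proof (rule bloch_contr_kernel)
  show "(\<lambda>(x, k). iexp (k * x)) \<in> borel_measurable borel" unfolding borel_prod[symmetric] by measurable
  show "iexp (k * (x + 1)) = iexp k * iexp (k * x)" for x k :: real
    by (simp add: algebra_simps flip: exp_add)
  have fc: "emeasure cell (space cell) = 1" by (simp add: cell_def emeasure_restrict_space space_restrict_space)
  show L: "(\<lambda>x. iexp (k * x)) \<in> L2sp cell" for k
  proof -
    have "finite_measure cell" by (rule finite_measureI) (simp add: fc)
    then have "integrable cell (\<lambda>x. 1 :: real)" by (rule finite_measure.integrable_const)
    moreover have "(\<lambda>x. iexp (k * x)) \<in> borel_measurable cell" by (rule measurable_cell) measurable
    ultimately show ?thesis by (simp add: L2sp_def)
  qed
  fix k :: real and m n :: int
  have "L2inner cell (\<lambda>x. iexp ((k + of_int m * (2 * pi)) * x)) (\<lambda>x. iexp ((k + of_int n * (2 * pi)) * x))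
    = (\<integral>x. iexp (2 * pi / 1 * of_int (m - n) * x) \<partial>cell)"
    unfolding L2inner_def by (rule Bochner_Integration.integral_cong)
      (auto simp: exp_cnj algebra_simps simp flip: exp_add)
  also have "\<dots> = (LINT x:{0..1}|lborel. iexp (2 * pi / 1 * of_int (m - n) * x))"
    unfolding cell_def set_lebesgue_integral_def by (rule integral_restrict_space) simp
  also have "\<dots> = (LINT x:{0<..0+1}|lborel. iexp (2 * pi / 1 * of_int (m - n) * x))"
    unfolding add_0_left by (rule LINT_Ioc_Icc[symmetric]) measurable
  also have "\<dots> = (if m - n = 0 then complex_of_real 1 else 0)" by (rule iexp_orthogonal) simp
  finally show "L2inner cell (\<lambda>x. iexp ((k + of_int m * (2 * pi)) * x)) (\<lambda>x. iexp ((k + of_int n * (2 * pi)) * x))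
    = (if m = n then 1 else 0)" by simp
qed

lemma contr_kernel_iexp_neg: "contr_kernel (\<lambda>x k. iexp (- (k * x)))"
  using contr_kernel_scale[OF contr_kernel_iexp, of "-1"] by simp

lemma fourier_trunc_eq: "fourier_trunc f R = ktrunc (\<lambda>x k. iexp (- (k * x))) f R"
  by (rule ext) (simp add: fourier_trunc_def ktrunc_def mult.commute)

lemma Phi_L2_lim: assumes "f \<in> L2sp lborel"
  shows "L2_lim (ktrunc (\<lambda>x k. iexp (- (k * x))) f) (Phi f)" "Phi f \<in> L2sp lborel"
proof -
  have "fourier_trunc f = ktrunc (\<lambda>x k. iexp (- (k * x))) f" using fourier_trunc_eq by blast
  then show l: "L2_lim (ktrunc (\<lambda>x k. iexp (- (k * x))) f) (Phi f)"
    unfolding Phi_def using someI_ex[OF ktrunc_L2_lim[OF contr_kernel_iexp_neg assms]] by simp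
  then show "Phi f \<in> L2sp lborel" by (simp add: L2_lim_def)
qed

section \<open>Fourier inversion\<close>

lemma ktrunc_lin: assumes K: "contr_kernel K" and f: "f \<in> L2sp lborel" and h: "h \<in> L2sp lborel"
  shows "AE x in lborel. ktrunc K (\<lambda>k. a * f k + b * h k) R x = a * ktrunc K f R x + b * ktrunc K h R x"
  using contr_kernelD(2)[OF K f, of R] contr_kernelD(2)[OF K h, of R]
proof eventually_elim
  case (elim x)
  have eq: "(\<lambda>k. (a * f k + b * h k) * K x k) = (\<lambda>k. a * (f k * K x k) + b * (h k * K x k))"
    by (simp add: algebra_simps)
  have "(LINT k:{-R..R}|lborel. (a * f k + b * h k) * K x k)
    = a * (LINT k:{-R..R}|lborel. f k * K x k) + b * (LINT k:{-R..R}|lborel. h k * K x k)"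
    unfolding eq using elim by (subst set_integral_add(2)) auto
  then show ?case by (simp add: ktrunc_def algebra_simps)
qed

lemma L2_lim_lin:
  assumes K: "contr_kernel K" and f: "f \<in> L2sp lborel" and h: "h \<in> L2sp lborel"
    and v: "L2_lim (ktrunc K f) v" and w: "L2_lim (ktrunc K h) w"
  shows "L2_lim (ktrunc K (\<lambda>k. a * f k + b * h k)) (\<lambda>x. a * v x + b * w x)"
proof -
  have vw: "v \<in> L2sp lborel" "w \<in> L2sp lborel" using v w by (auto simp: L2_lim_def)
  note kL = contr_kernelD(3)[OF K]
  have fh: "(\<lambda>k. a * f k + b * h k) \<in> L2sp lborel" using f h by auto
  have le: "L2norm lborel (\<lambda>x. ktrunc K (\<lambda>k. a * f k + b * h k) R x - (a * v x + b * w x))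
    \<le> cmod a * L2norm lborel (\<lambda>x. ktrunc K f R x - v x) + cmod b * L2norm lborel (\<lambda>x. ktrunc K h R x - w x)" for R
  proof -
    have d: "(\<lambda>x. a * (ktrunc K f R x - v x)) \<in> L2sp lborel" "(\<lambda>x. b * (ktrunc K h R x - w x)) \<in> L2sp lborel"
      using kL[OF f] kL[OF h] vw by auto
    have "L2norm lborel (\<lambda>x. ktrunc K (\<lambda>k. a * f k + b * h k) R x - (a * v x + b * w x))
      = L2norm lborel (\<lambda>x. a * (ktrunc K f R x - v x) + b * (ktrunc K h R x - w x))"
    proof (rule L2norm_cong_AE)
      show "(\<lambda>x. ktrunc K (\<lambda>k. a * f k + b * h k) R x - (a * v x + b * w x)) \<in> borel_measurable lborel"
        using kL[OF fh, of R] vw by (intro L2spD(1) L2sp_diff L2sp_add L2sp_cmult)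
      show "(\<lambda>x. a * (ktrunc K f R x - v x) + b * (ktrunc K h R x - w x)) \<in> borel_measurable lborel"
        by (rule L2spD(1)[OF L2sp_add[OF d]])
      show "AE x in lborel. ktrunc K (\<lambda>k. a * f k + b * h k) R x - (a * v x + b * w x)
          = a * (ktrunc K f R x - v x) + b * (ktrunc K h R x - w x)"
        using ktrunc_lin[OF K f h, of a b R] by eventually_elim (simp add: algebra_simps)
    qed
    also have "\<dots> \<le> L2norm lborel (\<lambda>x. a * (ktrunc K f R x - v x)) + L2norm lborel (\<lambda>x. b * (ktrunc K h R x - w x))"
      by (rule L2norm_triangle[OF d])
    finally show ?thesis by (simp add: L2norm_cmult)
  qed
  have "((\<lambda>R. cmod a * L2norm lborel (\<lambda>x. ktrunc K f R x - v x) + cmod b * L2norm lborel (\<lambda>x. ktrunc K h R x - w x))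
    \<longlongrightarrow> cmod a * 0 + cmod b * 0) at_top"
    using v w by (intro tendsto_intros) (auto simp: L2_lim_def)
  then have "((\<lambda>R. L2norm lborel (\<lambda>x. ktrunc K (\<lambda>k. a * f k + b * h k) R x - (a * v x + b * w x))) \<longlongrightarrow> 0) at_top"
    by - (rule Lim_null_comparison[OF always_eventually], simp_all add: le)
  then show ?thesis unfolding L2_lim_def using kL[OF fh] vw by (intro conjI allI L2sp_add L2sp_cmult) simp_all
qed

definition kop :: "(real \<Rightarrow> real \<Rightarrow> complex) \<Rightarrow> cfun \<Rightarrow> cfun" where
  "kop K f = (SOME v. L2_lim (ktrunc K f) v)"

lemma kop_lim: "contr_kernel K \<Longrightarrow> f \<in> L2sp lborel \<Longrightarrow> L2_lim (ktrunc K f) (kop K f)"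
  unfolding kop_def using someI_ex[OF ktrunc_L2_lim] by metis

lemma kop_L2: "contr_kernel K \<Longrightarrow> f \<in> L2sp lborel \<Longrightarrow> kop K f \<in> L2sp lborel"
  using kop_lim by (auto simp: L2_lim_def)

lemma kop_diff: "contr_kernel K \<Longrightarrow> f \<in> L2sp lborel \<Longrightarrow> h \<in> L2sp lborel \<Longrightarrow>
   L2norm lborel (\<lambda>x. kop K f x - kop K h x) \<le> L2norm lborel (\<lambda>k. f k - h k)"
  by (rule ktrunc_L2_lim_diff) (auto intro: kop_lim)

lemma L2norm_AE_eq: assumes "AE x in lborel. f x = h x" shows "L2norm lborel (\<lambda>x. f x - h x) = 0"
proof -
  have "(\<integral>x. (cmod (f x - h x))\<^sup>2 \<partial>lborel) = 0"
    using assms by (intro integral_eq_zero_AE) auto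
  then show ?thesis by (simp add: L2norm_def)
qed

lemma L2norm_eq_AE: assumes "f \<in> L2sp lborel" "h \<in> L2sp lborel" "L2norm lborel (\<lambda>x. f x - h x) \<le> 0"
  shows "AE x in lborel. f x = h x"
  using L2norm_zero_AE[of "\<lambda>x. f x - h x"] assms L2norm_nonneg[of lborel "\<lambda>x. f x - h x"]
  by (auto simp del: L2norm_nonneg elim: eventually_mono)

lemma kop_unique: "contr_kernel K \<Longrightarrow> f \<in> L2sp lborel \<Longrightarrow> L2_lim (ktrunc K f) v \<Longrightarrow> AE x in lborel. kop K f x = v x"
  using ktrunc_L2_lim_diff[of K f f "kop K f" v] kop_lim[of K f]
  by (intro L2norm_eq_AE) (auto simp: kop_L2 L2_lim_def L2norm_def)

lemma kop_cong: assumes K: "contr_kernel K" and f: "f \<in> L2sp lborel" "h \<in> L2sp lborel" and "AE x in lborel. f x = h x"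
  shows "AE x in lborel. kop K f x = kop K h x"
  using kop_diff[OF K f] L2norm_AE_eq[OF assms(4)] by (intro L2norm_eq_AE kop_L2[OF K] f) simp

lemma kop_lin: assumes K: "contr_kernel K" and f: "f \<in> L2sp lborel" "h \<in> L2sp lborel"
  shows "AE x in lborel. kop K (\<lambda>k. a * f k + b * h k) x = a * kop K f x + b * kop K h x"
  using f by (intro kop_unique[OF K] L2_lim_lin[OF K f] kop_lim[OF K]) auto

text \<open>On each bounded window f is integrable, and the sets over which its integral vanishes
  contain the half-open intervals and are closed under complements and countable disjoint unions,
  hence include all Borel sets.\<close>

lemma AE_zero_of_interval_integrals:
  fixes f :: "real \<Rightarrow> complex"
  assumes i: "\<And>a b. set_integrable lborel {a<..b} f"
    and z: "\<And>a b. a < b \<Longrightarrow> (LINT x:{a<..b}|lborel. f x) = 0"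
  shows "AE x in lborel. f x = 0"
proof -
  have "AE x in lborel. indicator {-real N<..real N} x *\<^sub>R f x = 0" for N
  proof -
    define g where "g x = indicator {-real N<..real N} x *\<^sub>R f x" for x
    have gi: "integrable lborel g" using i[of "-real N" "real N"] by (simp add: set_integrable_def g_def[abs_def])
    have z': "(LINT x:{a<..b}|lborel. f x) = 0" for a b
      using z[of a b] by (cases "a < b") (auto simp: set_lebesgue_integral_def)
    have sg: "set_integrable lborel A g" if "A \<in> sets borel" for A
      unfolding set_integrable_def using gi that by (intro integrable_mult_indicator) auto
    have int0: "integral\<^sup>L lborel g = 0" using z'[of "-real N" "real N"] by (simp add: g_def[abs_def] set_lebesgue_integral_def)
    have "(LINT x:A|lborel. g x) = 0" if A: "A \<in> sets borel" for A
    proof -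
      have "Int_stable (range (\<lambda>(a, b). {a<..b::real}))" by (auto simp: Int_stable_def)
      moreover have "range (\<lambda>(a, b). {a<..b::real}) \<subseteq> Pow UNIV" by simp
      moreover have "A \<in> sigma_sets UNIV (range (\<lambda>(a, b). {a<..b::real}))"
        using A by (subst (asm) borel_sigma_sets_Ioc) simp
      ultimately show ?thesis
      proof (induction rule: sigma_sets_induct_disjoint)
        case (basic A)
        then obtain a b where A: "A = {a<..b}" by auto
        have "(LINT x:A|lborel. g x) = (LINT x:{max a (-real N)<..min b (real N)}|lborel. f x)"
          unfolding set_lebesgue_integral_def g_def A
          by (rule Bochner_Integration.integral_cong) (auto simp: indicator_def)
        then show ?case using z' by simp
      next
        case empty show ?case by (simp add: set_lebesgue_integral_def)
      next
        case (compl A)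
        have A: "A \<in> sets borel" using compl by (subst borel_sigma_sets_Ioc) simp
        have "(LINT x:(UNIV - A)|lborel. g x) = integral\<^sup>L lborel g - (LINT x:A|lborel. g x)"
        proof -
          have e: "indicat_real (UNIV - A) x *\<^sub>R g x = g x - indicat_real A x *\<^sub>R g x" for x
            by (auto simp: indicator_def)
          show ?thesis unfolding set_lebesgue_integral_def e
            by (rule Bochner_Integration.integral_diff[OF gi sg[OF A, unfolded set_integrable_def]])
        qed
        then show ?case using compl int0 by simp
      next
        case (union A)
        have A: "A i \<in> sets borel" for i using union(2) by (subst borel_sigma_sets_Ioc) auto
        have "(LINT x:(\<Union>i. A i)|lborel. g x) = (\<Sum>i. LINT x:A i|lborel. g x)"
          using A union(1) sg by (intro lebesgue_integral_countable_add) (auto simp: disjoint_family_on_def)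
        then show ?case using union by simp
      qed
    qed
    then have "AE x in lborel. g x = 0"
      using gi by (intro sigma_finite_measure.density_unique_banach[OF sigma_finite_lborel]) (auto simp: set_lebesgue_integral_def)
    then show ?thesis by (simp add: g_def)
  qed
  then have "AE x in lborel. \<forall>N. indicator {-real N<..real N} x *\<^sub>R f x = 0" by (subst AE_all_countable) blast
  then show ?thesis
  proof eventually_elim
    fix x assume a: "\<forall>N. indicator {-real N<..real N} x *\<^sub>R f x = 0"
    obtain N where "\<bar>x\<bar> < real N" using reals_Archimedean2 by blast
    then show "f x = 0" using a[rule_format, of N] by (auto simp: indicator_def split: if_splits)
  qed
qed

text \<open>Levy's inversion formula for the probability measure with density f0 / c, where c is the
  total mass. The measure has no atoms, as the formula demands at the endpoints; mass zero is
  treated apart because it cannot be normalised.\<close>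

lemma levy_density:
  fixes f0 :: "real \<Rightarrow> real"
  assumes [measurable]: "f0 \<in> borel_measurable borel" and pos: "\<And>x. f0 x \<ge> 0" and i: "integrable lborel f0" and ab: "a \<le> b"
  shows "(\<lambda>T::nat. 1 / (2 * pi) * (CLBINT t=-T..T. (iexp (-(t * a)) - iexp (-(t * b))) / (\<i> * t) *
      (\<integral>x. f0 x *\<^sub>R iexp (t * x) \<partial>lborel))) \<longlonglongrightarrow> complex_of_real (LINT x:{a<..b}|lborel. f0 x)"
proof -
  define c where "c = integral\<^sup>L lborel f0"
  have c0: "c \<ge> 0" unfolding c_def by (rule Bochner_Integration.integral_nonneg) (rule pos)
  show ?thesis
  proof (cases "c = 0")
    case True
    then have ae: "AE x in lborel. f0 x = 0"
      unfolding c_def using i pos by (subst (asm) integral_nonneg_eq_0_iff_AE) auto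
    have 1: "(\<integral>x. f0 x *\<^sub>R iexp (t * x) \<partial>lborel) = 0" for t
      by (rule integral_eq_zero_AE) (use ae in auto)
    have 2: "(LINT x:{a<..b}|lborel. f0 x) = 0"
      unfolding set_lebesgue_integral_def by (rule integral_eq_zero_AE) (use ae in auto)
    show ?thesis unfolding 1 2 by simp
  next
    case False
    then have c: "c > 0" using c0 by simp
    define M where "M = density lborel (\<lambda>x. ennreal (f0 x / c))"
    have "emeasure M (space M) = (\<integral>\<^sup>+x. ennreal (f0 x / c) \<partial>lborel)"
      unfolding M_def by (subst emeasure_density) auto
    also have "\<dots> = ennreal (\<integral>x. f0 x / c \<partial>lborel)"
      using i pos c by (intro nn_integral_eq_integral) auto
    also have "\<dots> = 1" using c by (simp add: c_def)
    finally have "prob_space M" by (rule prob_spaceI)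
    then interpret M: real_distribution M
      unfolding real_distribution_def real_distribution_axioms_def by (simp add: M_def)
    have sing: "measure M {y} = 0" for y
    proof -
      have "emeasure M {y} = (\<integral>\<^sup>+x. ennreal (f0 x / c) * indicator {y} x \<partial>lborel)"
        unfolding M_def by (rule emeasure_density) auto
      also have "\<dots> = 0"
        by (subst nn_integral_0_iff_AE) (use AE_lborel_singleton[of y] in \<open>auto simp: indicator_def\<close>)
      finally show ?thesis by (simp add: measure_def)
    qed
    have ch: "char M t = (\<integral>x. f0 x *\<^sub>R iexp (t * x) \<partial>lborel) / c" for t
    proof -
      have "char M t = (\<integral>x. (f0 x / c) *\<^sub>R iexp (t * x) \<partial>lborel)"
        unfolding char_def M_def using pos c by (intro integral_density) auto
      also have "\<dots> = (\<integral>x. (1 / c) *\<^sub>R (f0 x *\<^sub>R iexp (t * x)) \<partial>lborel)" by (simp add: field_simps)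
      also have "\<dots> = (1 / c) *\<^sub>R (\<integral>x. f0 x *\<^sub>R iexp (t * x) \<partial>lborel)" by (rule integral_scaleR_right)
      finally show ?thesis by (simp add: scaleR_conv_of_real)
    qed
    have ms: "measure M {a<..b} = (LINT x:{a<..b}|lborel. f0 x) / c"
    proof -
      have "emeasure M {a<..b} = (\<integral>\<^sup>+x. ennreal (f0 x / c) * indicator {a<..b} x \<partial>lborel)"
        unfolding M_def by (rule emeasure_density) auto
      also have "\<dots> = (\<integral>\<^sup>+x. ennreal (indicator {a<..b} x *\<^sub>R (f0 x / c)) \<partial>lborel)"
        by (rule nn_integral_cong) (auto simp: indicator_def)
      also have "\<dots> = ennreal (\<integral>x. indicator {a<..b} x *\<^sub>R (f0 x / c) \<partial>lborel)"
        using pos c i by (intro nn_integral_eq_integral integrable_mult_indicator) auto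
      finally have "measure M {a<..b} = (\<integral>x. indicator {a<..b} x *\<^sub>R (f0 x / c) \<partial>lborel)"
        using pos c by (simp add: measure_def enn2real_ennreal Bochner_Integration.integral_nonneg)
      also have "\<dots> = (LINT x:{a<..b}|lborel. f0 x) / c"
        unfolding set_lebesgue_integral_def by (subst integral_divide_zero[symmetric]) simp
      finally show ?thesis .
    qed
    have "(\<lambda>T::nat. c * (1 / (2 * pi) * (CLBINT t=-T..T. (iexp (-(t * a)) - iexp (-(t * b))) / (\<i> * t) * char M t)))
       \<longlonglongrightarrow> c * complex_of_real (measure M {a<..b})"
      by (intro tendsto_mult_left M.Levy_Inversion[OF ab sing sing])
    then show ?thesis unfolding ch ms times_divide_eq_right interval_lebesgue_integral_divide
      using c by simp
  qed
qed

lemma fubini_dominated: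
  fixes f :: "real \<Rightarrow> real \<Rightarrow> complex"
  assumes fm: "(\<lambda>(x, y). f x y) \<in> borel_measurable (borel \<Otimes>\<^sub>M borel)"
    and u: "integrable lborel (u :: real \<Rightarrow> real)" and v: "integrable lborel (v :: real \<Rightarrow> real)"
    and le: "\<And>x y. cmod (f x y) \<le> u x * v y"
  shows "integrable (lborel \<Otimes>\<^sub>M lborel) (\<lambda>(x, y). f x y)"
    "(\<integral>x. \<integral>y. f x y \<partial>lborel \<partial>lborel) = (\<integral>y. \<integral>x. f x y \<partial>lborel \<partial>lborel)"
proof -
  have [measurable]: "(\<lambda>(x, y). f x y) \<in> borel_measurable (lborel \<Otimes>\<^sub>M lborel)"
    using fm by (subst measurable_cong_sets[of _ "borel \<Otimes>\<^sub>M borel" _ borel]) (auto intro!: sets_pair_measure_cong)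
  have fx: "integrable lborel (\<lambda>y. f x y)" for x
    by (rule Bochner_Integration.integrable_bound[OF integrable_mult_right[OF v, of "u x"]])
      (auto intro!: order_trans[OF le] abs_ge_self)
  show i: "integrable (lborel \<Otimes>\<^sub>M lborel) (\<lambda>(x, y). f x y)"
  proof (rule lborel_pair.Fubini_integrable)
    show "integrable lborel (\<lambda>x. \<integral>y. norm ((\<lambda>(x, y). f x y) (x, y)) \<partial>lborel)"
    proof (rule Bochner_Integration.integrable_bound[OF integrable_mult_left[OF u, of "integral\<^sup>L lborel v"]])
      have "norm (\<integral>y. cmod (f x y) \<partial>lborel) \<le> norm (u x * integral\<^sup>L lborel v)" for x
      proof -
        have "norm (\<integral>y. cmod (f x y) \<partial>lborel) = (\<integral>y. cmod (f x y) \<partial>lborel)"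
          by (simp add: Bochner_Integration.integral_nonneg)
        also have "\<dots> \<le> (\<integral>y. u x * v y \<partial>lborel)" using fx v le by (intro integral_mono) auto
        also have "\<dots> = u x * integral\<^sup>L lborel v" by simp
        also have "\<dots> \<le> norm (u x * integral\<^sup>L lborel v)" by simp
        finally show ?thesis .
      qed
      then show "AE x in lborel. norm (\<integral>y. norm ((\<lambda>(x, y). f x y) (x, y)) \<partial>lborel) \<le> norm (u x * integral\<^sup>L lborel v)"
        by simp
    qed measurable
  qed (use fx in auto)
  show "(\<integral>x. \<integral>y. f x y \<partial>lborel \<partial>lborel) = (\<integral>y. \<integral>x. f x y \<partial>lborel \<partial>lborel)"
    using lborel_pair.Fubini_integral[OF i] by simp
qed

abbreviation Kp :: "real \<Rightarrow> real \<Rightarrow> complex" where "Kp \<equiv> (\<lambda>x k. iexp (k * x))"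
abbreviation Kn :: "real \<Rightarrow> real \<Rightarrow> complex" where "Kn \<equiv> (\<lambda>x k. iexp (- (k * x)))"

text \<open>For a nonnegative compactly supported f0 the transform is, up to a factor and a
  reflection, a characteristic function. Levy's formula identifies the integrals of the inverse
  transform over all intervals with those of f0, which determines it almost everywhere.\<close>

lemma fourier_inverse_nonneg:
  fixes f0 :: "real \<Rightarrow> real"
  assumes [measurable]: "f0 \<in> borel_measurable borel" and pos: "\<And>x. f0 x \<ge> 0"
    and f: "(\<lambda>x. complex_of_real (f0 x)) \<in> L2sp lborel"
    and supp: "\<And>x. \<bar>x\<bar> > N \<Longrightarrow> f0 x = 0" and N: "N \<ge> 0"
  shows "AE x in lborel. kop Kp (kop Kn (\<lambda>x. complex_of_real (f0 x))) x = complex_of_real (f0 x)"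
proof -
  let ?f = "\<lambda>x. complex_of_real (f0 x)"
  define X where "X k = (\<integral>x. f0 x *\<^sub>R iexp (k * x) \<partial>lborel)" for k
  define fh where "fh k = complex_of_real (1 / sqrt (2 * pi)) * X (- k)" for k
  have ind: "indicator {-R..R} x *\<^sub>R ?f x = ?f x" if "R \<ge> N" for x R
  proof (cases "x \<in> {-R..R}")
    case False
    then have "\<bar>x\<bar> > N" using that by auto
    then show ?thesis using supp by simp
  qed simp
  \<comment> \<open>Beyond the support bound N the truncation changes nothing, so the L2 limit
    defining the transform is attained.\<close>
  have kt: "ktrunc Kn ?f R = fh" if "R \<ge> N" for R
  proof
    fix k
    have "(LINT x:{-R..R}|lborel. ?f x * iexp (- (x * k))) = X (- k)"
      unfolding set_lebesgue_integral_def X_def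
    proof (rule Bochner_Integration.integral_cong)
      fix x
      show "indicat_real {- R..R} x *\<^sub>R (?f x * iexp (- (x * k))) = f0 x *\<^sub>R iexp (- k * x)"
        using ind[OF that, of x] by (simp add: scaleR_conv_of_real mult.commute[of k] flip: mult.assoc)
    qed simp
    then show "ktrunc Kn ?f R k = fh k" by (simp add: ktrunc_def fh_def)
  qed
  have fhL: "fh \<in> L2sp lborel" using contr_kernelD(3)[OF contr_kernel_iexp_neg f, of N] kt[of N] by simp
  have "L2_lim (ktrunc Kn ?f) fh"
    unfolding L2_lim_def
  proof (intro conjI allI fhL contr_kernelD(3)[OF contr_kernel_iexp_neg f])
    show "((\<lambda>R. L2norm lborel (\<lambda>x. ktrunc Kn ?f R x - fh x)) \<longlongrightarrow> 0) at_top"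
      by (rule tendsto_eventually, rule eventually_mono[OF eventually_ge_at_top[of N]]) (simp only: kt, simp add: L2norm_def)
  qed
  then have ae1: "AE x in lborel. kop Kn ?f x = fh x" by (rule kop_unique[OF contr_kernel_iexp_neg f])
  define v where "v = kop Kp fh"
  have vl: "L2_lim (ktrunc Kp fh) v" unfolding v_def by (rule kop_lim[OF contr_kernel_iexp fhL])
  have vL: "v \<in> L2sp lborel" using vl by (simp add: L2_lim_def)
  have ae2: "AE x in lborel. kop Kp (kop Kn ?f) x = v x"
    unfolding v_def by (rule kop_cong[OF contr_kernel_iexp kop_L2[OF contr_kernel_iexp_neg f] fhL ae1])
  have fi: "integrable lborel f0"
  proof -
    have "integrable lborel ?f"
      using L2_set_integrable_Icc(1)[OF f, of "-N" N] unfolding set_integrable_def ind[OF order_refl] .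
    then show ?thesis using integrable_Re by fastforce
  qed
  have [measurable]: "X \<in> borel_measurable borel" unfolding X_def[abs_def] by measurable
  have [measurable]: "fh \<in> borel_measurable borel" unfolding fh_def[abs_def] by measurable
  have int_eq: "(LINT x:{a<..b}|lborel. v x) = (LINT x:{a<..b}|lborel. ?f x)" if ab: "a < b" for a b
  proof -
    let ?c = "complex_of_real (1 / sqrt (2 * pi))"
    let ?E = "\<lambda>k. (iexp (k * b) - iexp (k * a)) / (\<i> * k)"
    have si: "set_integrable lborel {a<..b} h" if "h \<in> L2sp lborel" for h
      by (rule set_integrable_subset[OF L2_set_integrable_Icc(1)[OF that, of a b]]) auto
    have lim1: "(\<lambda>n. LINT x:{a<..b}|lborel. ktrunc Kp fh (real n) x) \<longlonglongrightarrow> (LINT x:{a<..b}|lborel. v x)"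
    proof (rule LIM_zero_cancel, rule Lim_null_comparison[OF always_eventually], rule allI)
      fix n
      have kL: "ktrunc Kp fh (real n) \<in> L2sp lborel" by (rule contr_kernelD(3)[OF contr_kernel_iexp fhL])
      have dL: "(\<lambda>x. ktrunc Kp fh (real n) x - v x) \<in> L2sp lborel" using kL vL by auto
      have "norm ((LINT x:{a<..b}|lborel. ktrunc Kp fh (real n) x) - (LINT x:{a<..b}|lborel. v x))
        = norm (LINT x:{a<..b}|lborel. ktrunc Kp fh (real n) x - v x)"
        using si[OF kL] si[OF vL] by (simp add: set_integral_diff)
      also have "\<dots> = norm (LINT x:{a..b}|lborel. ktrunc Kp fh (real n) x - v x)"
        using L2spD(1)[OF dL] by (subst LINT_Ioc_Icc) auto
      also have "\<dots> \<le> (LINT x:{a..b}|lborel. cmod (ktrunc Kp fh (real n) x - v x))"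
        using L2_set_integrable_Icc(1)[OF dL] by (rule set_integral_norm_bound)
      also have "\<dots> \<le> sqrt (b - a) * L2norm lborel (\<lambda>x. ktrunc Kp fh (real n) x - v x)"
        using ab by (intro L2_set_integrable_Icc(2)[OF dL]) auto
      finally show "norm ((LINT x:{a<..b}|lborel. ktrunc Kp fh (real n) x) - (LINT x:{a<..b}|lborel. v x))
        \<le> sqrt (b - a) * L2norm lborel (\<lambda>x. ktrunc Kp fh (real n) x - v x)" .
    next
      have "(\<lambda>n. L2norm lborel (\<lambda>x. ktrunc Kp fh (real n) x - v x)) \<longlonglongrightarrow> 0"
        using vl filterlim_compose[OF _ filterlim_real_sequentially] unfolding L2_lim_def by blast
      then show "(\<lambda>n. sqrt (b - a) * L2norm lborel (\<lambda>x. ktrunc Kp fh (real n) x - v x)) \<longlonglongrightarrow> 0"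
        using tendsto_mult_left[of _ 0 _ "sqrt (b - a)"] by simp
    qed
    \<comment> \<open>Conjugation appears because the transform uses e^(-ikx) and the characteristic
      function e^(itx); f0 is real, so \<open>X (- k)\<close> is the conjugate of
      \<open>X k\<close>.\<close>
    have eq: "(LINT x:{a<..b}|lborel. ktrunc Kp fh (real n) x)
      = cnj (1 / (2 * pi) * (CLBINT t=-n..n. (iexp (-(t * a)) - iexp (-(t * b))) / (\<i> * t) * X t))" for n :: nat
    proof -
      have cc: "?c * (?c * cnj Z) = cnj (complex_of_real (1 / (2 * pi)) * Z)" for Z :: complex
      proof -
        have "?c * ?c = complex_of_real (1 / (2 * pi))" unfolding of_real_mult[symmetric] by simp
        then show ?thesis by (simp only: mult.assoc[symmetric]) simp
      qed
      let ?f2 = "\<lambda>x k. indicator {a<..b} x *\<^sub>R (indicator {-real n..real n} k *\<^sub>R (fh k * iexp (k * x)))"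
      have "(LINT x:{a<..b}|lborel. ktrunc Kp fh (real n) x) = ?c * (\<integral>x. \<integral>k. ?f2 x k \<partial>lborel \<partial>lborel)"
        unfolding set_lebesgue_integral_def ktrunc_def Bochner_Integration.integral_scaleR_right
        by (simp only: mult_scaleR_right[symmetric] Bochner_Integration.integral_mult_right_zero)
      also have "(\<integral>x. \<integral>k. ?f2 x k \<partial>lborel \<partial>lborel) = (\<integral>k. \<integral>x. ?f2 x k \<partial>lborel \<partial>lborel)"
      proof (rule fubini_dominated(2))
        show "(\<lambda>(x, k). ?f2 x k) \<in> borel_measurable (borel \<Otimes>\<^sub>M borel)" by measurable
        show "integrable lborel (indicator {a<..b} :: real \<Rightarrow> real)"
          using ab by (intro integrable_real_indicator) auto
        show "integrable lborel (\<lambda>k. indicator {-real n..real n} k *\<^sub>R cmod (fh k))"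
          using set_integrable_norm[OF L2_set_integrable_Icc(1)[OF fhL]] by (simp add: set_integrable_def)
        show "cmod (?f2 x k) \<le> indicator {a<..b} x * (indicator {-real n..real n} k *\<^sub>R cmod (fh k))" for x k
          by (simp add: norm_mult)
      qed
      also have "\<dots> = (\<integral>k. indicator {-real n..real n} k *\<^sub>R (fh k * ?E k) \<partial>lborel)"
      proof (rule integral_cong_AE)
        \<comment> \<open>The point k = 0 is excluded: there \<open>?E\<close> is a quotient by
          zero, whose value is 0 and not b - a.\<close>
        show "AE k in lborel. (\<integral>x. ?f2 x k \<partial>lborel) = indicator {-real n..real n} k *\<^sub>R (fh k * ?E k)"
          using AE_lborel_singleton[of 0]
        proof eventually_elim
          fix k :: real assume k: "k \<noteq> 0"
          have "(\<integral>x. ?f2 x k \<partial>lborel) = (\<integral>x. (indicator {-real n..real n} k *\<^sub>R fh k) * (indicator {a<..b} x *\<^sub>R iexp (k * x)) \<partial>lborel)"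
            by (rule Bochner_Integration.integral_cong) auto
          also have "\<dots> = (indicator {-real n..real n} k *\<^sub>R fh k) * (LINT x:{a<..b}|lborel. iexp (k * x))"
            unfolding set_lebesgue_integral_def by (rule Bochner_Integration.integral_mult_right_zero)
          also have "(LINT x:{a<..b}|lborel. iexp (k * x)) = (LINT x:{a..b}|lborel. iexp (k * x))"
            by (rule LINT_Ioc_Icc) measurable
          also have "\<dots> = ?E k"
            unfolding set_lebesgue_integral_def using k ab by (intro has_bochner_integral_integral_eq iexp_integral) auto
          finally show "(\<integral>x. ?f2 x k \<partial>lborel) = indicator {-real n..real n} k *\<^sub>R (fh k * ?E k)"
            by (simp only: mult_scaleR_left)
        qed
      qed measurable
      also have "\<dots> = ?c * (\<integral>k. indicator {-real n..real n} k *\<^sub>R (X (- k) * ?E k) \<partial>lborel)"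
        unfolding fh_def by (subst Bochner_Integration.integral_mult_right_zero[symmetric]) (simp add: mult_ac)
      also have "(\<integral>k. indicator {-real n..real n} k *\<^sub>R (X (- k) * ?E k) \<partial>lborel)
        = cnj (CLBINT t=-n..n. (iexp (-(t * a)) - iexp (-(t * b))) / (\<i> * t) * X t)"
      proof -
        have cX: "cnj (X t) = X (- t)" for t
          unfolding X_def by (subst Bochner_Integration.integral_cnj[symmetric]) (simp add: exp_cnj)
        have "(CLBINT t=-n..n. (iexp (-(t * a)) - iexp (-(t * b))) / (\<i> * t) * X t)
          = (LINT t:{-real n..real n}|lborel. (iexp (-(t * a)) - iexp (-(t * b))) / (\<i> * t) * X t)"
          by (subst interval_integral_Icc) auto
        also have "cnj \<dots> = (\<integral>k. indicator {-real n..real n} k *\<^sub>R (X (- k) * ?E k) \<partial>lborel)"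
          unfolding set_lebesgue_integral_def
        proof (subst Bochner_Integration.integral_cnj[symmetric], rule Bochner_Integration.integral_cong)
          fix t :: real
          have "cnj ((iexp (-(t * a)) - iexp (-(t * b))) / (\<i> * t)) = ?E t"
          proof -
            have g: "(A - B) / (- c) = (B - A) / c" for A B c :: complex
              by (cases "c = 0") (auto simp: field_simps)
            have "cnj ((iexp (-(t * a)) - iexp (-(t * b))) / (\<i> * t)) = (iexp (t * a) - iexp (t * b)) / (- (\<i> * t))"
              by (simp add: exp_cnj)
            then show ?thesis unfolding g .
          qed
          then show "cnj (indicator {-real n..real n} t *\<^sub>R ((iexp (-(t * a)) - iexp (-(t * b))) / (\<i> * t) * X t))
            = indicator {-real n..real n} t *\<^sub>R (X (- t) * ?E t)"
            by (simp only: complex_cnj_scaleR complex_cnj_mult cX mult.commute)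
        qed simp
        finally show ?thesis ..
      qed
      finally show ?thesis unfolding cc .
    qed
    have "(\<lambda>n::nat. cnj (1 / (2 * pi) * (CLBINT t=-n..n. (iexp (-(t * a)) - iexp (-(t * b))) / (\<i> * t) * X t)))
      \<longlonglongrightarrow> cnj (complex_of_real (LINT x:{a<..b}|lborel. f0 x))"
      unfolding X_def using levy_density[OF _ pos fi, of a b] ab by (intro tendsto_cnj) auto
    then have "(\<lambda>n. LINT x:{a<..b}|lborel. ktrunc Kp fh (real n) x) \<longlonglongrightarrow> complex_of_real (LINT x:{a<..b}|lborel. f0 x)"
      unfolding eq by simp
    then have "(LINT x:{a<..b}|lborel. v x) = complex_of_real (LINT x:{a<..b}|lborel. f0 x)"
      using LIMSEQ_unique lim1 by blast
    also have "\<dots> = (LINT x:{a<..b}|lborel. ?f x)" by (rule set_integral_complex_of_real[symmetric])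
    finally show ?thesis .
  qed
  have "AE x in lborel. v x - ?f x = 0"
  proof (rule AE_zero_of_interval_integrals)
    have si: "set_integrable lborel {a<..b} h" if "h \<in> L2sp lborel" for h and a b :: real
      by (rule set_integrable_subset[OF L2_set_integrable_Icc(1)[OF that, of a b]]) auto
    show "set_integrable lborel {a<..b} (\<lambda>x. v x - ?f x)" for a b using vL f by (intro si) auto
    show "(LINT x:{a<..b}|lborel. v x - ?f x) = 0" if "a < b" for a b
      using int_eq[OF that] si[OF vL] si[OF f] by (subst set_integral_diff(2)) auto
  qed
  with ae2 show ?thesis by eventually_elim simp
qed

text \<open>This class is closed under linear combinations and L2 limits, which is how inversion
  spreads from nonnegative compactly supported functions to all of L2.\<close>

definition inv_ok :: "cfun \<Rightarrow> bool" where
  "inv_ok f \<longleftrightarrow> f \<in> L2sp lborel \<and> (AE x in lborel. kop Kp (kop Kn f) x = f x)"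

lemma inv_ok_lin: assumes "inv_ok f" "inv_ok h" shows "inv_ok (\<lambda>x. a * f x + b * h x)"
proof -
  note kn = contr_kernel_iexp_neg and kp = contr_kernel_iexp
  have L: "f \<in> L2sp lborel" "h \<in> L2sp lborel" using assms by (auto simp: inv_ok_def)
  have fh: "(\<lambda>x. a * f x + b * h x) \<in> L2sp lborel" using L by auto
  have kL: "kop Kn f \<in> L2sp lborel" "kop Kn h \<in> L2sp lborel" using kop_L2[OF kn] L by blast+
  have "AE x in lborel. kop Kp (kop Kn (\<lambda>x. a * f x + b * h x)) x = kop Kp (\<lambda>k. a * kop Kn f k + b * kop Kn h k) x"
    using kL by (intro kop_cong[OF kp kop_L2[OF kn fh]] kop_lin[OF kn L]) auto
  with kop_lin[OF kp kL, of a b] assms fh show ?thesis unfolding inv_ok_def by auto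
qed

text \<open>Both transforms are contractions, so the inversion error of f is at most twice its
  distance to an h without error.\<close>

lemma inv_ok_limit:
  assumes f: "f \<in> L2sp lborel" and a: "\<And>e. e > 0 \<Longrightarrow> \<exists>h. inv_ok h \<and> L2norm lborel (\<lambda>x. f x - h x) < e"
  shows "inv_ok f"
proof -
  note kn = contr_kernel_iexp_neg and kp = contr_kernel_iexp
  have "L2norm lborel (\<lambda>x. kop Kp (kop Kn f) x - f x) \<le> 0 + e" if e: "e > 0" for e
  proof -
    obtain h where h: "inv_ok h" "L2norm lborel (\<lambda>x. f x - h x) < e / 2" using a[of "e/2"] e by auto
    have hL: "h \<in> L2sp lborel" using h by (simp add: inv_ok_def)
    note kL = kop_L2[OF kn f] kop_L2[OF kn hL]
    note kkL = kop_L2[OF kp kL(1)] kop_L2[OF kp kL(2)]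
    have "L2norm lborel (\<lambda>x. kop Kp (kop Kn f) x - f x)
      = L2norm lborel (\<lambda>x. (kop Kp (kop Kn f) x - kop Kp (kop Kn h) x) - (f x - h x))"
    proof (rule L2norm_cong_AE)
      show "(\<lambda>x. kop Kp (kop Kn f) x - f x) \<in> borel_measurable lborel"
        by (rule L2spD(1)[OF L2sp_diff[OF kkL(1) f]])
      show "(\<lambda>x. (kop Kp (kop Kn f) x - kop Kp (kop Kn h) x) - (f x - h x)) \<in> borel_measurable lborel"
        by (rule L2spD(1)[OF L2sp_diff[OF L2sp_diff[OF kkL] L2sp_diff[OF f hL]]])
      show "AE x in lborel. kop Kp (kop Kn f) x - f x = (kop Kp (kop Kn f) x - kop Kp (kop Kn h) x) - (f x - h x)"
        using h(1) unfolding inv_ok_def by (auto elim: eventually_mono)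
    qed
    also have "\<dots> \<le> L2norm lborel (\<lambda>x. kop Kp (kop Kn f) x - kop Kp (kop Kn h) x) + L2norm lborel (\<lambda>x. f x - h x)"
      by (rule L2norm_triangle4[OF L2sp_diff[OF kkL] L2sp_diff[OF f hL]])
    also have "L2norm lborel (\<lambda>x. kop Kp (kop Kn f) x - kop Kp (kop Kn h) x) \<le> L2norm lborel (\<lambda>x. f x - h x)"
      using kop_diff[OF kp kL] kop_diff[OF kn f hL] by simp
    finally show ?thesis using h(2) by simp
  qed
  then have "L2norm lborel (\<lambda>x. kop Kp (kop Kn f) x - f x) \<le> 0" by (rule field_le_epsilon)
  then show ?thesis unfolding inv_ok_def using f kop_L2[OF kp kop_L2[OF kn f]] by (auto intro: L2norm_eq_AE)
qed

theorem fourier_inverse: assumes f: "f \<in> L2sp lborel" shows "AE x in lborel. kop Kp (kop Kn f) x = f x"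
proof -
  have [measurable]: "f \<in> borel_measurable borel" using L2spD(1)[OF f] by simp
  have pos: "inv_ok (\<lambda>x. complex_of_real (indicator {-real n..real n} x * max 0 (p (f x))))"
    if p: "p \<in> borel_measurable borel" "\<And>z. \<bar>p z\<bar> \<le> cmod z" for p :: "complex \<Rightarrow> real" and n :: nat
  proof -
    note [measurable] = p(1)
    have L: "(\<lambda>x. complex_of_real (indicator {-real n..real n} x * max 0 (p (f x)))) \<in> L2sp lborel"
    proof (rule L2sp_bound[OF _ f])
      have "cmod (complex_of_real (indicator {-real n..real n} x * max 0 (p (f x)))) \<le> cmod (f x)" for x
        using p(2)[of "f x"] by (auto simp: indicator_def)
      then show "AE x in lborel. cmod (complex_of_real (indicator {-real n..real n} x * max 0 (p (f x)))) \<le> cmod (f x)" by blast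
    qed measurable
    then show ?thesis unfolding inv_ok_def
      by (intro conjI L fourier_inverse_nonneg[where N="real n"]) (auto simp: indicator_def)
  qed
  have cutok: "inv_ok (cut {-real n..real n} f)" for n
  proof -
    let ?P = "\<lambda>p x. complex_of_real (indicator {-real n..real n} x * max 0 (p (f x)))"
    \<comment> \<open>On the window f is the combination with coefficients 1, -1, i, -i of the
      positive and negative parts of Re f and Im f.\<close>
    have "inv_ok (?P Re)" "inv_ok (?P (\<lambda>z. - Re z))" "inv_ok (?P Im)" "inv_ok (?P (\<lambda>z. - Im z))"
      by (intro pos; simp add: abs_Re_le_cmod abs_Im_le_cmod)+
    from inv_ok_lin[OF inv_ok_lin[OF this(1,2), of 1 "-1"] inv_ok_lin[OF this(3,4), of "\<i>" "-\<i>"], of 1 1]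
    have "inv_ok (\<lambda>x. 1 * (1 * ?P Re x + -1 * ?P (\<lambda>z. - Re z) x) + 1 * (\<i> * ?P Im x + - \<i> * ?P (\<lambda>z. - Im z) x))" .
    moreover have "1 * (1 * ?P Re x + -1 * ?P (\<lambda>z. - Re z) x) + 1 * (\<i> * ?P Im x + - \<i> * ?P (\<lambda>z. - Im z) x) = cut {-real n..real n} f x" for x
      by (auto simp: cut_def indicator_def complex_eq_iff max_def)
    ultimately show ?thesis by simp
  qed
  have "inv_ok f"
  proof (rule inv_ok_limit[OF f])
    fix e :: real assume e: "e > 0"
    have "(\<lambda>n. L2norm lborel (cut (-{-real n..real n}) f)) \<longlonglongrightarrow> 0"
      by (rule filterlim_compose[OF cut_tail_tendsto[OF f] filterlim_real_sequentially])
    from LIMSEQ_D[OF this e] obtain n where "L2norm lborel (cut (-{-real n..real n}) f) < e" by auto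
    moreover have "(\<lambda>x. f x - cut {-real n..real n} f x) = cut (-{-real n..real n}) f"
      by (auto simp: cut_def indicator_def)
    ultimately show "\<exists>h. inv_ok h \<and> L2norm lborel (\<lambda>x. f x - h x) < e"
      using cutok[of n] by (intro exI[of _ "cut {-real n..real n} f"]) simp
  qed
  then show ?thesis by (simp add: inv_ok_def)
qed

text \<open>\<open>Phi f\<close> and \<open>kop Kn f\<close> are two choices of the same L2 limit
  and may differ on a null set, which the inverse transform does not see.\<close>

lemma Phi_inverse: assumes f: "f \<in> L2sp lborel" shows "L2_lim (ktrunc Kp (Phi f)) f"
proof -
  have "AE x in lborel. kop Kn f x = Phi f x"
    by (rule kop_unique[OF contr_kernel_iexp_neg f Phi_L2_lim(1)[OF f]])
  then have "AE x in lborel. kop Kp (kop Kn f) x = kop Kp (Phi f) x"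
    by (rule kop_cong[OF contr_kernel_iexp kop_L2[OF contr_kernel_iexp_neg f] Phi_L2_lim(2)[OF f]])
  with fourier_inverse[OF f] have ae: "AE x in lborel. kop Kp (Phi f) x = f x" by eventually_elim simp
  have l: "L2_lim (ktrunc Kp (Phi f)) (kop Kp (Phi f))"
    by (rule kop_lim[OF contr_kernel_iexp Phi_L2_lim(2)[OF f]])
  have "L2norm lborel (\<lambda>x. ktrunc Kp (Phi f) R x - kop Kp (Phi f) x) = L2norm lborel (\<lambda>x. ktrunc Kp (Phi f) R x - f x)" for R
  proof (rule L2norm_cong_AE)
    note kL = contr_kernelD(3)[OF contr_kernel_iexp Phi_L2_lim(2)[OF f], of R]
    show "(\<lambda>x. ktrunc Kp (Phi f) R x - kop Kp (Phi f) x) \<in> borel_measurable lborel"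
      by (rule L2spD(1)[OF L2sp_diff[OF kL kop_L2[OF contr_kernel_iexp Phi_L2_lim(2)[OF f]]]])
    show "(\<lambda>x. ktrunc Kp (Phi f) R x - f x) \<in> borel_measurable lborel"
      by (rule L2spD(1)[OF L2sp_diff[OF kL f]])
  qed (use ae in \<open>auto elim: eventually_mono\<close>)
  then show ?thesis using l f by (simp add: L2_lim_def)
qed

section \<open>Absolutely continuous functions\<close>

text \<open>Local absolute continuity in the normalisation of \<open>H1\<close> and
  \<open>H1per\<close>, freed from global integrability so that exponentials, cutoffs and sums of
  translates stay inside the class.\<close>

definition acf :: "cfun \<Rightarrow> cfun \<Rightarrow> bool" where
  "acf phi d \<longleftrightarrow> d \<in> borel_measurable borel \<and> (\<forall>a b. set_integrable lborel {a..b} d) \<and>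
     (\<forall>x. phi x = phi 0 + (LBINT y=0..x. d y))"

lemma acfD: assumes "acf phi d"
  shows "d \<in> borel_measurable borel" "set_integrable lborel {a..b} d"
  using assms by (auto simp: acf_def)

lemma iint_lborel: assumes "\<And>a b. set_integrable lborel {a..b} (d :: cfun)"
  shows "interval_lebesgue_integrable lborel (ereal a) (ereal b) d"
  using set_integrable_subset[OF assms[of a b], of "{a<..<b}"] set_integrable_subset[OF assms[of b a], of "{b<..<a}"]
  by (simp add: interval_lebesgue_integrable_def einterval_eq greaterThanLessThan_subseteq_atLeastAtMost_iff)

lemma acf_diff: assumes A: "acf phi d" and ab: "a \<le> b" shows "phi b - phi a = (LINT y:{a..b}|lborel. d y)"
proof -
  have i: "\<And>a b. set_integrable lborel {a..b} d" using A by (rule acfD)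
  have "phi b = phi 0 + (LBINT y=0..b. d y)" "phi a = phi 0 + (LBINT y=0..a. d y)" using A unfolding acf_def by blast+
  moreover have "(LBINT y=ereal 0..ereal a. d y) + (LBINT y=ereal a..ereal b. d y) = (LBINT y=ereal 0..ereal b. d y)"
    by (rule interval_integral_sum) (auto intro!: iint_lborel[OF i] simp flip: ereal_min ereal_max)
  moreover have "(LBINT y=ereal a..ereal b. d y) = (LINT y:{a..b}|lborel. d y)" using ab by (rule interval_integral_Icc)
  ultimately have "phi b = phi 0 + ((LBINT y=ereal 0..ereal a. d y) + (LINT y:{a..b}|lborel. d y))"
    "phi a = phi 0 + (LBINT y=ereal 0..ereal a. d y)" by (simp_all add: zero_ereal_def)
  then show ?thesis by (metis add.assoc add_diff_cancel_left')
qed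

lemma acfI:
  assumes "d \<in> borel_measurable borel" and i: "\<And>a b. set_integrable lborel {a..b} d"
    and d: "\<And>a b. a \<le> b \<Longrightarrow> phi b - phi a = (LINT y:{a..b}|lborel. d y)"
  shows "acf phi d"
  unfolding acf_def
proof (intro conjI allI assms(1) i)
  fix x
  show "phi x = phi 0 + (LBINT y=0..x. d y)"
  proof (cases "0 \<le> x")
    case True
    then show ?thesis using d[OF True] interval_integral_Icc[OF True, of d] by (simp add: zero_ereal_def algebra_simps)
  next
    case False
    then have "x \<le> 0" by simp
    moreover have "(LBINT y=ereal 0..ereal x. d y) = - (LBINT y=ereal x..ereal 0. d y)" by (rule interval_integral_endpoints_reverse)
    ultimately show ?thesis using d[of x 0] interval_integral_Icc[of x 0 d] by (simp add: zero_ereal_def algebra_simps)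
  qed
qed

lemma acf_continuous: assumes A: "acf phi d" shows "continuous_on UNIV phi"
proof -
  have "isCont phi x" for x
  proof -
    let ?a = "x - 1" and ?b = "x + 1"
    have "continuous_on {?a..?b} (\<lambda>y. integral {?a..y} d)"
      using set_borel_integral_eq_integral(1)[OF acfD(2)[OF A, of ?a ?b]] by (rule indefinite_integral_continuous_1)
    then have "continuous_on {?a..?b} (\<lambda>y. phi ?a + integral {?a..y} d)" by (intro continuous_intros)
    moreover have "phi ?a + integral {?a..y} d = phi y" if "y \<in> {?a..?b}" for y
      using acf_diff[OF A, of ?a y] set_borel_integral_eq_integral(2)[OF acfD(2)[OF A, of ?a y]] that by (simp add: algebra_simps)
    ultimately have "continuous_on {?a..?b} phi" by (rule continuous_on_eq)
    then show ?thesis by (rule continuous_on_interior) simp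
  qed
  then show ?thesis by (simp add: continuous_at_imp_continuous_on)
qed

lemma acf_measurable: "acf phi d \<Longrightarrow> phi \<in> borel_measurable borel"
  by (rule borel_measurable_continuous_onI[OF acf_continuous])

lemma set_integrable_bdd_mult:
  assumes i: "set_integrable lborel {a..b::real} (d::cfun)" and c: "continuous_on {a..b} psi" "psi \<in> borel_measurable borel"
  shows "set_integrable lborel {a..b} (\<lambda>x. d x * psi x)"
proof -
  obtain B where "\<forall>x\<in>{a..b}. cmod (psi x) \<le> B"
    using compact_imp_bounded[OF compact_continuous_image[OF c(1)]] unfolding bounded_iff by auto
  then have B: "\<And>x. x \<in> {a..b} \<Longrightarrow> cmod (psi x) \<le> B" by blast
  have m: "(\<lambda>x. indicator {a..b} x *\<^sub>R d x) \<in> borel_measurable lborel" using i by (auto simp: set_integrable_def)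
  have "(\<lambda>x. (indicator {a..b} x *\<^sub>R d x) * psi x) \<in> borel_measurable lborel" using m c(2) by measurable
  then have "integrable lborel (\<lambda>x. (indicator {a..b} x *\<^sub>R d x) * psi x)"
  proof (rule Bochner_Integration.integrable_bound[OF integrable_mult_right[OF i[unfolded set_integrable_def], of "complex_of_real B"]])
    show "AE x in lborel. norm (indicator {a..b} x *\<^sub>R d x * psi x) \<le> norm (complex_of_real B * indicator {a..b} x *\<^sub>R d x)"
      by (rule AE_I2) (auto simp: indicator_def norm_mult mult.commute[of "cmod (d _)"] intro!: mult_right_mono order_trans[OF B abs_ge_self])
  qed
  then show ?thesis by (simp add: set_integrable_def)
qed

lemma acf_mult: assumes A: "acf phi d" and B: "acf psi e"
  shows "acf (\<lambda>x. phi x * psi x) (\<lambda>x. d x * psi x + phi x * e x)"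
proof -
  note [measurable] = acfD(1)[OF A] acfD(1)[OF B] acf_measurable[OF A] acf_measurable[OF B]
  have i1: "set_integrable lborel {a..b} (\<lambda>x. d x * psi x)" for a b
    by (rule set_integrable_bdd_mult[OF acfD(2)[OF A] continuous_on_subset[OF acf_continuous[OF B]]]) auto
  have i2: "set_integrable lborel {a..b} (\<lambda>x. phi x * e x)" for a b
    using set_integrable_bdd_mult[OF acfD(2)[OF B] continuous_on_subset[OF acf_continuous[OF A]], of a b]
    by (simp add: mult.commute)
  show ?thesis
  proof (rule acfI)
    show "set_integrable lborel {a..b} (\<lambda>x. d x * psi x + phi x * e x)" for a b using i1 i2 by (rule set_integral_add)
    fix a b :: real assume ab: "a \<le> b"
    let ?I = "indicat_real {a..b}"
    \<comment> \<open>Integration by parts as Fubini on the triangle z <= y: integrating out z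
      produces d (psi - psi a), integrating out y produces (phi b - phi) e.\<close>
    define F where "F y z = (?I y *\<^sub>R d y) * ((?I z * (if z \<le> y then 1 else 0)) *\<^sub>R e z)" for y z
    have Fm: "(\<lambda>(y, z). F y z) \<in> borel_measurable (borel \<Otimes>\<^sub>M borel)"
      unfolding F_def by measurable
    have fub: "(\<integral>y. \<integral>z. F y z \<partial>lborel \<partial>lborel) = (\<integral>z. \<integral>y. F y z \<partial>lborel \<partial>lborel)"
    proof (rule fubini_dominated(2)[OF Fm])
      show "integrable lborel (\<lambda>y. ?I y *\<^sub>R cmod (d y))" "integrable lborel (\<lambda>y. ?I y *\<^sub>R cmod (e y))"
        using set_integrable_norm[OF acfD(2)[OF A]] set_integrable_norm[OF acfD(2)[OF B]] by (auto simp: set_integrable_def)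
      show "cmod (F y z) \<le> (?I y *\<^sub>R cmod (d y)) * (?I z *\<^sub>R cmod (e z))" for y z
        by (auto simp: F_def norm_mult indicator_def)
    qed
    have in1: "(\<integral>z. F y z \<partial>lborel) = ?I y *\<^sub>R (d y * psi y) - psi a * (?I y *\<^sub>R d y)" for y
    proof (cases "y \<in> {a..b}")
      case True
      have "(\<integral>z. F y z \<partial>lborel) = d y * (\<integral>z. (?I z * (if z \<le> y then 1 else 0)) *\<^sub>R e z \<partial>lborel)"
        unfolding F_def by (subst Bochner_Integration.integral_mult_right_zero) (use True in simp)
      also have "(\<integral>z. (?I z * (if z \<le> y then 1 else 0)) *\<^sub>R e z \<partial>lborel) = (LINT z:{a..y}|lborel. e z)"
        unfolding set_lebesgue_integral_def using True by (intro Bochner_Integration.integral_cong) (auto simp: indicator_def)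
      also have "\<dots> = psi y - psi a" using acf_diff[OF B, of a y] True by simp
      finally show ?thesis using True by (simp add: algebra_simps)
    qed (simp add: F_def)
    have in2: "(\<integral>y. F y z \<partial>lborel) = phi b * (?I z *\<^sub>R e z) - ?I z *\<^sub>R (phi z * e z)" for z
    proof (cases "z \<in> {a..b}")
      case True
      have "(\<integral>y. F y z \<partial>lborel) = (\<integral>y. (indicator {z..b} y *\<^sub>R d y) * e z \<partial>lborel)"
        unfolding F_def using True by (intro Bochner_Integration.integral_cong) (auto simp: indicator_def)
      also have "\<dots> = (LINT y:{z..b}|lborel. d y) * e z" unfolding set_lebesgue_integral_def
        by (rule Bochner_Integration.integral_mult_left_zero)
      also have "(LINT y:{z..b}|lborel. d y) = phi b - phi z" using acf_diff[OF A, of z b] True by simp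
      finally show ?thesis using True by (simp add: algebra_simps)
    qed (simp add: F_def)
    note I = i1[of a b, unfolded set_integrable_def] i2[of a b, unfolded set_integrable_def]
      acfD(2)[OF A, of a b, unfolded set_integrable_def] acfD(2)[OF B, of a b, unfolded set_integrable_def]
    have "(LINT y:{a..b}|lborel. d y * psi y) - psi a * (phi b - phi a) = phi b * (psi b - psi a) - (LINT z:{a..b}|lborel. phi z * e z)"
      using fub unfolding in1 in2 acf_diff[OF A ab] acf_diff[OF B ab] set_lebesgue_integral_def
        Bochner_Integration.integral_diff[OF I(1) integrable_mult_right[OF I(3)]]
        Bochner_Integration.integral_diff[OF integrable_mult_right[OF I(4)] I(2)]
        Bochner_Integration.integral_mult_right_zero .
    then show "phi b * psi b - phi a * psi a = (LINT y:{a..b}|lborel. d y * psi y + phi y * e y)"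
      using i1[of a b] i2[of a b] by (subst set_integral_add(2)) (auto simp: algebra_simps)
  qed measurable
qed

lemma acf_lin: assumes A: "acf phi d" and B: "acf psi e"
  shows "acf (\<lambda>x. p * phi x + q * psi x) (\<lambda>x. p * d x + q * e x)"
proof (rule acfI)
  note [measurable] = acfD(1)[OF A] acfD(1)[OF B]
  show "(\<lambda>x. p * d x + q * e x) \<in> borel_measurable borel" by measurable
  have i: "set_integrable lborel {a..b} (\<lambda>x. p * d x)" "set_integrable lborel {a..b} (\<lambda>x. q * e x)" for a b
    using acfD(2)[OF A] acfD(2)[OF B] by auto
  show "set_integrable lborel {a..b} (\<lambda>x. p * d x + q * e x)" for a b using i by (rule set_integral_add)
  show "p * phi b + q * psi b - (p * phi a + q * psi a) = (LINT y:{a..b}|lborel. p * d y + q * e y)" if "a \<le> b" for a b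
    using acf_diff[OF A that] acf_diff[OF B that] i[of a b] by (subst set_integral_add(2)) (auto simp: algebra_simps)
qed

lemma acf_C1:
  assumes d: "\<And>x. (phi has_vector_derivative d x) (at x)" and c: "continuous_on UNIV d"
  shows "acf phi d"
proof (rule acfI)
  show "d \<in> borel_measurable borel" by (rule borel_measurable_continuous_onI[OF c])
  have c': "continuous_on {a..b} d" for a b using c by (rule continuous_on_subset) simp
  show "set_integrable lborel {a..b} d" for a b
    unfolding set_integrable_def using borel_integrable_compact[OF _ c'[of a b]] by auto
  show "phi b - phi a = (LINT y:{a..b}|lborel. d y)" if "a \<le> b" for a b
    unfolding set_lebesgue_integral_def using that d c'
    by (intro integral_FTC_Icc[symmetric]) (auto intro: has_vector_derivative_at_within)
qed

lemma acf_cnj: assumes A: "acf phi d" shows "acf (\<lambda>x. cnj (phi x)) (\<lambda>x. cnj (d x))"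
proof (rule acfI)
  note [measurable] = acfD(1)[OF A]
  show "(\<lambda>x. cnj (d x)) \<in> borel_measurable borel" by measurable
  show "set_integrable lborel {a..b} (\<lambda>x. cnj (d x))" for a b
  proof -
    have "integrable lborel (\<lambda>x. cnj (indicator {a..b} x *\<^sub>R d x))"
      using acfD(2)[OF A, of a b] unfolding set_integrable_def by (rule integrable_bounded_linear[OF bounded_linear_cnj])
    then show ?thesis unfolding set_integrable_def complex_cnj_scaleR .
  qed
  show "cnj (phi b) - cnj (phi a) = (LINT y:{a..b}|lborel. cnj (d y))" if "a \<le> b" for a b
  proof -
    have "(LINT y:{a..b}|lborel. cnj (d y)) = cnj (LINT y:{a..b}|lborel. d y)"
      unfolding set_lebesgue_integral_def by (subst Bochner_Integration.integral_cnj[symmetric]) (simp add: complex_cnj_scaleR)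
    then show ?thesis by (simp add: acf_diff[OF A that, symmetric])
  qed
qed

lemma acf_shift: assumes A: "acf phi d" shows "acf (\<lambda>x. phi (x + c)) (\<lambda>x. d (x + c))"
proof (rule acfI)
  note [measurable] = acfD(1)[OF A]
  show "(\<lambda>x. d (x + c)) \<in> borel_measurable borel" by measurable
  have ind: "indicator {a..b} x *\<^sub>R d (x + c) = (\<lambda>y. indicat_real {a+c..b+c} y *\<^sub>R d y) (c + 1 * x)" for a b x
    by (auto simp: indicator_def add.commute)
  show "set_integrable lborel {a..b} (\<lambda>x. d (x + c))" for a b
    using lborel_integrable_real_affine[OF acfD(2)[OF A, of "a+c" "b+c", unfolded set_integrable_def], of 1 c]
    unfolding set_integrable_def ind by simp
  show "phi (b + c) - phi (a + c) = (LINT y:{a..b}|lborel. d (y + c))" if "a \<le> b" for a b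
    using acf_diff[OF A, of "a + c" "b + c"] that lborel_integral_real_affine[of 1 "\<lambda>y. indicat_real {a+c..b+c} y *\<^sub>R d y" c]
    unfolding set_lebesgue_integral_def ind by simp
qed

lemma H1_iff: "H1 phi d \<longleftrightarrow> phi \<in> L2sp lborel \<and> d \<in> L2sp lborel \<and> acf phi d"
  unfolding H1_def acf_def using L2_set_integrable_Icc(1) L2spD(1) by fastforce

lemma H1_lin: "H1 phi d \<Longrightarrow> H1 psi e \<Longrightarrow> H1 (\<lambda>x. p * phi x + q * psi x) (\<lambda>x. p * d x + q * e x)"
  unfolding H1_iff using acf_lin[of phi d psi e p q] by auto

lemma H1_diff: "H1 phi d \<Longrightarrow> H1 psi e \<Longrightarrow> H1 (\<lambda>x. phi x - psi x) (\<lambda>x. d x - e x)"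
  using H1_lin[of phi d psi e 1 "-1"] by simp

lemma set_integrable_const_Icc: "set_integrable lborel {a..b::real} (\<lambda>_. c :: real)"
  unfolding set_integrable_def by (intro integrable_scaleR_left integrable_real_indicator) (auto simp: emeasure_lborel_Icc_eq)

text \<open>For y in [x, x + 1] the values phi x and phi y differ by at most the L1 norm of d on
  that interval; averaging over y, Cauchy-Schwarz on an interval of length 1 gives constants equal
  to 1.\<close>

lemma H1_sobolev: assumes H: "H1 phi d" shows "cmod (phi x) \<le> L2norm lborel phi + L2norm lborel d"
proof -
  have L: "phi \<in> L2sp lborel" "d \<in> L2sp lborel" and A: "acf phi d" using H by (auto simp: H1_iff)
  define D where "D = (LINT y:{x..x+1}|lborel. cmod (d y))"
  have D: "D \<le> L2norm lborel d" using L2_set_integrable_Icc(2)[OF L(2), of x "x+1"] by (simp add: D_def)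
  have si: "set_integrable lborel {x..x+1} (\<lambda>y. cmod (d y))" "set_integrable lborel {x..x+1} (\<lambda>y. cmod (phi y))"
    using L2_set_integrable_Icc(1)[OF L(2)] L2_set_integrable_Icc(1)[OF L(1)] by (auto intro: set_integrable_norm)
  have le: "cmod (phi x) \<le> cmod (phi y) + D" if y: "y \<in> {x..x+1}" for y
  proof -
    have "phi x = phi y - (LINT z:{x..y}|lborel. d z)" using y by (simp add: acf_diff[OF A, of x y, symmetric])
    then have "cmod (phi x) \<le> cmod (phi y) + cmod (LINT z:{x..y}|lborel. d z)" using norm_triangle_ineq4 by metis
    also have "cmod (LINT z:{x..y}|lborel. d z) \<le> (LINT z:{x..y}|lborel. cmod (d z))"
      using acfD(2)[OF A] by (rule set_integral_norm_bound)
    also have "\<dots> \<le> D" unfolding D_def set_lebesgue_integral_def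
      using si(1) set_integrable_subset[OF si(1), of "{x..y}"] y
      by (intro integral_mono) (auto simp: set_integrable_def indicator_def)
    finally show ?thesis by simp
  qed
  have "cmod (phi x) = (LINT y:{x..x+1}|lborel. cmod (phi x))" by (simp add: set_lebesgue_integral_def)
  also have "\<dots> \<le> (LINT y:{x..x+1}|lborel. cmod (phi y) + D)"
    using le by (intro set_integral_mono set_integral_add(1) si(2) set_integrable_const_Icc)
  also have "\<dots> = (LINT y:{x..x+1}|lborel. cmod (phi y)) + D"
    using set_integral_add(2)[OF si(2) set_integrable_const_Icc, of D] by (simp add: set_lebesgue_integral_def)
  also have "\<dots> \<le> L2norm lborel phi + L2norm lborel d"
    using D L2_set_integrable_Icc(2)[OF L(1), of x "x+1"] by simp
  finally show ?thesis .
qed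

lemma open_null_empty: assumes "open (S :: real set)" "AE x in lborel. x \<notin> S" shows "S = {}"
proof (rule ccontr)
  assume "S \<noteq> {}"
  then obtain x e where x: "x \<in> S" "e > 0" "ball x e \<subseteq> S" using assms(1) by (metis ex_in_conv openE)
  have "{x - e<..<x + e} \<subseteq> S" using x(3) by (simp add: ball_eq_greaterThanLessThan)
  with assms(2) have "AE y in lborel. y \<notin> {x - e<..<x + e}" by (elim eventually_mono) blast
  then have "{x - e<..<x + e} \<in> null_sets lborel" by (subst AE_iff_null_sets) auto
  then show False using x(2) by (simp add: null_sets_def)
qed

text \<open>An open null set is empty, so continuous representatives that agree almost everywhere
  coincide; equal increments over all intervals then identify the derivatives.\<close>

lemma H1_unique: assumes H: "H1 phi d" "H1 psi e" and ae: "AE x in lborel. phi x = psi x"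
  shows "phi = psi" "AE x in lborel. d x = e x"
proof -
  have Hd: "H1 (\<lambda>x. phi x - psi x) (\<lambda>x. d x - e x)" by (rule H1_diff[OF H])
  then have A: "acf (\<lambda>x. phi x - psi x) (\<lambda>x. d x - e x)" by (simp add: H1_iff)
  have "open {x. phi x - psi x \<noteq> 0}"
    using acf_continuous[OF A] by (intro open_Collect_neq) auto
  then have "{x. phi x - psi x \<noteq> 0} = {}" using ae by (intro open_null_empty) auto
  then have z: "phi x - psi x = 0" for x by blast
  then show "phi = psi" by auto
  have "AE x in lborel. d x - e x = 0"
  proof (rule AE_zero_of_interval_integrals)
    show "set_integrable lborel {a<..b} (\<lambda>x. d x - e x)" for a b
      by (rule set_integrable_subset[OF acfD(2)[OF A, of a b]]) auto
    show "(LINT x:{a<..b}|lborel. d x - e x) = 0" if "a < b" for a b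
      using acf_diff[OF A, of a b] that z acfD(1)[OF A] by (subst LINT_Ioc_Icc) auto
  qed
  then show "AE x in lborel. d x = e x" by eventually_elim simp
qed

text \<open>The Sobolev bound upgrades L2 convergence to uniform convergence, so the limit has a
  genuine pointwise representative; passing to the limit in increments gives its derivative, and in
  interval integrals its agreement with p.\<close>

lemma H1_closed:
  assumes H: "\<And>n. H1 (f n) (d n)" and p: "p \<in> L2sp lborel" "q \<in> L2sp lborel"
    and lp: "(\<lambda>n. L2norm lborel (\<lambda>x. f n x - p x)) \<longlonglongrightarrow> 0" and lq: "(\<lambda>n. L2norm lborel (\<lambda>x. d n x - q x)) \<longlonglongrightarrow> 0"
  shows "\<exists>f'. H1 f' q \<and> (AE x in lborel. f' x = p x)"
proof -
  have L: "f n \<in> L2sp lborel" "d n \<in> L2sp lborel" and A: "acf (f n) (d n)" for n using H by (auto simp: H1_iff)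
  define r where "r n = L2norm lborel (\<lambda>x. f n x - p x) + L2norm lborel (\<lambda>x. d n x - q x)" for n
  have r0: "r \<longlonglongrightarrow> 0" unfolding r_def using tendsto_add[OF lp lq] by simp
  have le: "cmod (f n x - f m x) \<le> r n + r m" for n m x
  proof -
    have "cmod (f n x - f m x) \<le> L2norm lborel (\<lambda>x. f n x - f m x) + L2norm lborel (\<lambda>x. d n x - d m x)"
      by (rule H1_sobolev[OF H1_diff[OF H H]])
    moreover have "L2norm lborel (\<lambda>x. f n x - f m x) \<le> L2norm lborel (\<lambda>x. f n x - p x) + L2norm lborel (\<lambda>x. f m x - p x)"
      using L2norm_triangle4[of "\<lambda>x. f n x - p x" "\<lambda>x. f m x - p x"] L p by simp
    moreover have "L2norm lborel (\<lambda>x. d n x - d m x) \<le> L2norm lborel (\<lambda>x. d n x - q x) + L2norm lborel (\<lambda>x. d m x - q x)"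
      using L2norm_triangle4[of "\<lambda>x. d n x - q x" "\<lambda>x. d m x - q x"] L p by simp
    ultimately show ?thesis by (simp add: r_def)
  qed
  have "\<exists>l. (\<lambda>n. f n x) \<longlonglongrightarrow> l" for x
  proof -
    have "Cauchy (\<lambda>n. f n x)"
    proof (rule CauchyI)
      fix e :: real assume e: "e > 0"
      obtain N where N: "\<And>n. n \<ge> N \<Longrightarrow> norm (r n - 0) < e / 2" using LIMSEQ_D[OF r0, of "e/2"] e by auto
      have "norm (f m x - f n x) < e" if "m \<ge> N" "n \<ge> N" for m n
        using le[of m x n] N[OF that(1)] N[OF that(2)] by simp
      then show "\<exists>M. \<forall>m\<ge>M. \<forall>n\<ge>M. norm (f m x - f n x) < e" by blast
    qed
    then show ?thesis using Cauchy_convergent_iff convergent_def by blast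
  qed
  then obtain f' where f': "\<And>x. (\<lambda>n. f n x) \<longlonglongrightarrow> f' x" by metis
  have unif: "cmod (f n x - f' x) \<le> r n" for n x
  proof -
    have "(\<lambda>m. cmod (f n x - f m x)) \<longlonglongrightarrow> cmod (f n x - f' x)" by (intro tendsto_intros f')
    moreover have "(\<lambda>m. r n + r m) \<longlonglongrightarrow> r n + 0" by (intro tendsto_intros r0)
    ultimately show ?thesis using le by (auto intro!: LIMSEQ_le[of _ _ "\<lambda>m. r n + r m" "r n"])
  qed
  have [measurable]: "p \<in> borel_measurable borel" "q \<in> borel_measurable borel" "f n \<in> borel_measurable borel" for n
    using L2spD(1)[OF p(1)] L2spD(1)[OF p(2)] L2spD(1)[OF L(1)] by auto
  have [measurable]: "f' \<in> borel_measurable borel" by (rule borel_measurable_LIMSEQ_metric[OF _ f']) measurable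
  have tow: "(\<lambda>n. LINT x:{a..b}|lborel. h n x) \<longlonglongrightarrow> (LINT x:{a..b}|lborel. k x)"
    if ab: "a \<le> b" and hk: "\<And>n. h n \<in> L2sp lborel" "k \<in> L2sp lborel" and l: "(\<lambda>n. L2norm lborel (\<lambda>x. h n x - k x)) \<longlonglongrightarrow> 0"
    for a b and h :: "nat \<Rightarrow> cfun" and k
  proof (rule LIM_zero_cancel, rule Lim_null_comparison[OF always_eventually], rule allI)
    fix n
    have dL: "(\<lambda>x. h n x - k x) \<in> L2sp lborel" using hk by auto
    have "norm ((LINT x:{a..b}|lborel. h n x) - (LINT x:{a..b}|lborel. k x)) = norm (LINT x:{a..b}|lborel. h n x - k x)"
      using L2_set_integrable_Icc(1)[OF hk(1)] L2_set_integrable_Icc(1)[OF hk(2)] by (simp add: set_integral_diff)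
    also have "\<dots> \<le> (LINT x:{a..b}|lborel. cmod (h n x - k x))"
      using L2_set_integrable_Icc(1)[OF dL] by (rule set_integral_norm_bound)
    also have "\<dots> \<le> sqrt (b - a) * L2norm lborel (\<lambda>x. h n x - k x)" by (rule L2_set_integrable_Icc(2)[OF dL ab])
    finally show "norm ((LINT x:{a..b}|lborel. h n x) - (LINT x:{a..b}|lborel. k x)) \<le> sqrt (b - a) * L2norm lborel (\<lambda>x. h n x - k x)" .
  next
    show "(\<lambda>n. sqrt (b - a) * L2norm lborel (\<lambda>x. h n x - k x)) \<longlonglongrightarrow> 0"
      using tendsto_mult_left[OF l, of "sqrt (b - a)"] by simp
  qed
  have A': "acf f' q"
  proof (rule acfI)
    show "set_integrable lborel {a..b} q" for a b by (rule L2_set_integrable_Icc(1)[OF p(2)])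
    show "f' b - f' a = (LINT y:{a..b}|lborel. q y)" if ab: "a \<le> b" for a b
      using LIMSEQ_unique[OF tendsto_diff[OF f'[of b] f'[of a], unfolded acf_diff[OF A ab]] tow[OF ab L(2) p(2) lq]] .
  qed measurable
  have "AE x in lborel. f' x - p x = 0"
  proof (rule AE_zero_of_interval_integrals)
    have i: "set_integrable lborel {a..b} f'" for a b
      unfolding set_integrable_def using acf_continuous[OF A']
      by (intro borel_integrable_compact) (auto intro: continuous_on_subset)
    have si: "set_integrable lborel {a..b} (\<lambda>x. f' x - p x)" for a b
      using i L2_set_integrable_Icc(1)[OF p(1)] by (rule set_integral_diff)
    show "set_integrable lborel {a<..b} (\<lambda>x. f' x - p x)" for a b by (rule set_integrable_subset[OF si[of a b]]) auto
    show "(LINT x:{a<..b}|lborel. f' x - p x) = 0" if ab: "a < b" for a b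
    proof -
      have "(\<lambda>n. LINT x:{a..b}|lborel. f n x) \<longlonglongrightarrow> (LINT x:{a..b}|lborel. f' x)"
      proof (rule LIM_zero_cancel, rule Lim_null_comparison[OF always_eventually], rule allI)
        fix n
        have d: "set_integrable lborel {a..b} (\<lambda>x. f n x - f' x)"
          using L2_set_integrable_Icc(1)[OF L(1)] i by (rule set_integral_diff)
        have "norm ((LINT x:{a..b}|lborel. f n x) - (LINT x:{a..b}|lborel. f' x)) = norm (LINT x:{a..b}|lborel. f n x - f' x)"
          using L2_set_integrable_Icc(1)[OF L(1)] i by (simp add: set_integral_diff)
        also have "\<dots> \<le> (LINT x:{a..b}|lborel. cmod (f n x - f' x))" using d by (rule set_integral_norm_bound)
        also have "\<dots> \<le> (LINT x:{a..b}|lborel. r n)"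
          by (rule set_integral_mono[OF set_integrable_norm[OF d] set_integrable_const_Icc unif])
        also have "\<dots> = (b - a) * r n" using ab by (simp add: set_lebesgue_integral_def)
        finally show "norm ((LINT x:{a..b}|lborel. f n x) - (LINT x:{a..b}|lborel. f' x)) \<le> (b - a) * r n" .
      next
        show "(\<lambda>n. (b - a) * r n) \<longlonglongrightarrow> 0" using tendsto_mult_left[OF r0, of "b - a"] by simp
      qed
      from LIMSEQ_unique[OF this tow[OF _ L(1) p(1) lp]] ab
      have "(LINT x:{a..b}|lborel. f' x) = (LINT x:{a..b}|lborel. p x)" by simp
      then have "(LINT x:{a..b}|lborel. f' x - p x) = 0"
        using i L2_set_integrable_Icc(1)[OF p(1)] by (simp add: set_integral_diff)
      then show ?thesis by (subst LINT_Ioc_Icc) auto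
    qed
  qed
  then have ae: "AE x in lborel. f' x = p x" by eventually_elim simp
  have "f' \<in> L2sp lborel" by (rule L2sp_cong_AE[OF p(1)]) (use ae in \<open>auto elim: eventually_mono\<close>)
  then show ?thesis using A' p(2) ae by (auto simp: H1_iff)
qed

section \<open>The divergence form operator\<close>

text \<open>Squaring smooths the kink at 0; this is the source of the compactly supported C1 cutoffs
  and bumps.\<close>

lemma DERIV_max_square: "((\<lambda>y::real. (max 0 y)\<^sup>2) has_real_derivative 2 * max 0 y) (at y)"
proof -
  consider "y > 0" | "y < 0" | "y = 0" by linarith
  then show ?thesis
  proof cases
    case 1
    have "((\<lambda>y::real. y\<^sup>2) has_real_derivative 2 * y) (at y)" by (auto intro!: derivative_eq_intros)
    then show ?thesis using 1
      by (auto intro!: has_field_derivative_transform_within_open[of _ _ y "{0<..}" "\<lambda>y. (max 0 y)\<^sup>2"])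
  next
    case 2
    have "((\<lambda>y::real. 0) has_real_derivative 0) (at y)" by simp
    then show ?thesis using 2
      by (auto intro!: has_field_derivative_transform_within_open[of "\<lambda>_. 0" _ y "{..<0}" "\<lambda>y. (max 0 y)\<^sup>2"])
  next
    case 3
    have "((\<lambda>h::real. (max 0 (0 + h))\<^sup>2 / h) \<longlongrightarrow> 0) (at 0)"
    proof (rule Lim_null_comparison[OF always_eventually])
      show "\<forall>h::real. norm ((max 0 (0 + h))\<^sup>2 / h) \<le> \<bar>h\<bar>"
        by (auto simp: max_def power2_eq_square)
      show "((\<lambda>h::real. \<bar>h\<bar>) \<longlongrightarrow> 0) (at 0)" by (rule tendsto_rabs_zero) (rule tendsto_ident_at)
    qed
    then show ?thesis using 3 by (simp add: DERIV_def)
  qed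
qed

lemma L2sp_compact_support:
  assumes c: "continuous_on UNIV (f :: cfun)" and z: "\<And>x. x \<notin> {a..b} \<Longrightarrow> f x = 0"
  shows "f \<in> L2sp lborel"
proof -
  have "compact (f ` {a..b})" using c by (intro compact_continuous_image) (auto intro: continuous_on_subset)
  then obtain B where "\<forall>x\<in>{a..b}. cmod (f x) \<le> B"
    using compact_imp_bounded[OF \<open>compact (f ` {a..b})\<close>] unfolding bounded_iff by auto
  then have B: "x \<in> {a..b} \<Longrightarrow> cmod (f x) \<le> B" for x by blast
  show ?thesis
  proof (rule L2sp_bound[OF _ L2sp_cmult[OF L2sp_indicator_Icc[of a b], of "complex_of_real B"]])
    show "f \<in> borel_measurable lborel" using borel_measurable_continuous_onI[OF c] by simp
    show "AE x in lborel. cmod (f x) \<le> cmod (complex_of_real B * complex_of_real (indicator {a..b} x))"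
      by (rule AE_I2) (use B z in \<open>auto simp: indicator_def norm_mult intro: order_trans[OF _ abs_ge_self]\<close>)
  qed
qed

lemma acf_C1_real:
  fixes f d :: "real \<Rightarrow> real"
  assumes d: "\<And>x. (f has_real_derivative d x) (at x)" and c: "continuous_on UNIV d"
  shows "acf (\<lambda>x. complex_of_real (f x)) (\<lambda>x. complex_of_real (d x))"
proof (rule acf_C1)
  show "((\<lambda>x. complex_of_real (f x)) has_vector_derivative complex_of_real (d x)) (at x)" for x
    using bounded_linear.has_vector_derivative[OF bounded_linear_of_real d[of x, unfolded has_real_derivative_iff_has_vector_derivative]] .
  show "continuous_on UNIV (\<lambda>x. complex_of_real (d x))" using c by (intro continuous_intros)
qed

lemma H1_C1_compact_support:
  fixes f d :: "real \<Rightarrow> real"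
  assumes d: "\<And>x. (f has_real_derivative d x) (at x)" and c: "continuous_on UNIV d"
    and z: "\<And>x. x \<notin> {a..b} \<Longrightarrow> f x = 0" "\<And>x. x \<notin> {a..b} \<Longrightarrow> d x = 0"
  shows "H1 (\<lambda>x. complex_of_real (f x)) (\<lambda>x. complex_of_real (d x))"
proof -
  have "continuous_on UNIV f" using d by (auto intro!: continuous_at_imp_continuous_on DERIV_isCont)
  then show ?thesis unfolding H1_iff using c z
    by (intro conjI acf_C1_real[OF d c] L2sp_compact_support[of _ a b]) (auto intro!: continuous_intros)
qed

text \<open>With P the squared positive part of (x - a)(b - x), the function n P / (1 + n P) is C1
  with values between 0 and 1, vanishes where P does and tends to 1 elsewhere.\<close>

lemma interval_bump:
  assumes ab: "a < b"
  obtains f d :: "nat \<Rightarrow> real \<Rightarrow> real" where "\<And>n. H1 (\<lambda>x. complex_of_real (f n x)) (\<lambda>x. complex_of_real (d n x))"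
    "\<And>n x. 0 \<le> f n x \<and> f n x \<le> 1" "\<And>n x. x \<notin> {a<..<b} \<Longrightarrow> f n x = 0"
    "\<And>x. (\<lambda>n. f n x) \<longlonglongrightarrow> indicator {a<..<b} x"
proof
  define q where "q x = (x - a) * (b - x)" for x
  define P where "P x = (max 0 (q x))\<^sup>2" for x
  define P' where "P' x = 2 * max 0 (q x) * (a + b - 2 * x)" for x
  have P0: "P x \<ge> 0" for x by (simp add: P_def)
  have dP: "(P has_real_derivative P' x) (at x)" for x
  proof -
    have "(q has_real_derivative (a + b - 2 * x)) (at x)"
      unfolding q_def[abs_def] by (auto intro!: derivative_eq_intros)
    from DERIV_chain2[OF DERIV_max_square this] show ?thesis by (simp add: P_def[abs_def] P'_def)
  qed
  have q0: "q x \<le> 0" if "x \<notin> {a<..<b}" for x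
    unfolding q_def using that ab by (auto simp: mult_le_0_iff)
  have qp: "q x > 0" if "x \<in> {a<..<b}" for x unfolding q_def using that by auto
  let ?f = "\<lambda>n x. real n * P x / (1 + real n * P x)"
  let ?d = "\<lambda>n x. real n * P' x / (1 + real n * P x)\<^sup>2"
  have pos: "1 + real n * P x > 0" for n x using P0[of x] by (simp add: add_pos_nonneg)
  have cP: "continuous_on UNIV P" using dP by (auto intro!: continuous_at_imp_continuous_on DERIV_isCont)
  have cP': "continuous_on UNIV P'" unfolding P'_def q_def by (intro continuous_intros)
  show "H1 (\<lambda>x. complex_of_real (?f n x)) (\<lambda>x. complex_of_real (?d n x))" for n
  proof (rule H1_C1_compact_support[of _ _ a b])
    show "(?f n has_real_derivative ?d n x) (at x)" for x
    proof -
      have "(?f n has_real_derivative ((real n * P' x) * (1 + real n * P x) - (real n * P x) * (real n * P' x)) / ((1 + real n * P x) * (1 + real n * P x))) (at x)"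
        using pos[of n x] by (auto intro!: derivative_eq_intros dP)
      moreover have "((real n * P' x) * (1 + real n * P x) - (real n * P x) * (real n * P' x)) / ((1 + real n * P x) * (1 + real n * P x)) = ?d n x"
        by (simp add: power2_eq_square algebra_simps)
      ultimately show ?thesis by simp
    qed
    show "continuous_on UNIV (?d n)" using pos[of n] by (intro continuous_intros cP cP') (auto simp: less_imp_neq[symmetric])
    have "x \<notin> {a<..<b}" if "x \<notin> {a..b}" for x using that by auto
    then show "x \<notin> {a..b} \<Longrightarrow> ?f n x = 0" "x \<notin> {a..b} \<Longrightarrow> ?d n x = 0" for x
      using q0[of x] by (auto simp: P_def P'_def max_def)
  qed
  show "0 \<le> ?f n x \<and> ?f n x \<le> 1" for n x using pos[of n x] P0[of x] by (simp add: divide_le_eq)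
  show "?f n x = 0" if "x \<notin> {a<..<b}" for n x using q0[OF that] by (simp add: P_def max_def)
  show "(\<lambda>n. ?f n x) \<longlonglongrightarrow> indicator {a<..<b} x" for x
  proof (cases "x \<in> {a<..<b}")
    case False
    then show ?thesis using q0[OF False] by (simp add: P_def max_def)
  next
    case True
    then have Pp: "P x > 0" using qp[OF True] by (simp add: P_def max_def)
    have "(\<lambda>n. 1 - 1 / (1 + P x * real n)) \<longlonglongrightarrow> 1 - 0"
      by (intro tendsto_diff tendsto_const tendsto_divide_0[OF tendsto_const] filterlim_at_top_imp_at_infinity
          filterlim_tendsto_add_at_top[OF tendsto_const] filterlim_tendsto_pos_mult_at_top[OF tendsto_const Pp] filterlim_real_sequentially)
    moreover have "1 - 1 / (1 + P x * real n) = ?f n x" for n using pos[of n x] by (simp add: field_simps)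
    ultimately show ?thesis using True by simp
  qed
qed

section \<open>The form with bounded measurable coefficients\<close>

locale coefficients =
  fixes g omega :: "real \<Rightarrow> real" and g0 g1 w0 w1 :: real
  assumes g_meas [measurable]: "g \<in> borel_measurable borel" and g0: "0 < g0" and g_bounds: "\<And>x. g0 \<le> g x \<and> g x \<le> g1"
    and w_meas [measurable]: "omega \<in> borel_measurable borel" and w0: "0 < w0" and w_bounds: "\<And>x. w0 \<le> omega x \<and> omega x \<le> w1"
begin

lemma w_pos: "omega x > 0" using w0 w_bounds[of x] by linarith
lemma g_pos: "g x > 0" using g0 g_bounds[of x] by linarith

lemma w_L2: "f \<in> L2sp lborel \<Longrightarrow> (\<lambda>x. complex_of_real (omega x) * f x) \<in> L2sp lborel"
  by (rule L2sp_bdd_mult(1)[of _ _ _ w1]) (use w_pos w_bounds in \<open>auto simp: less_imp_le\<close>)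

lemma sg_L2: "f \<in> L2sp lborel \<Longrightarrow> (\<lambda>x. complex_of_real (sqrt (g x)) * f x) \<in> L2sp lborel"
  by (rule L2sp_bdd_mult(1)[of _ _ _ "sqrt g1"]) (use g_pos g_bounds in \<open>auto simp: less_imp_le\<close>)

lemma gg: "(complex_of_real (sqrt (g x)) * a) * cnj (complex_of_real (sqrt (g x)) * b) = complex_of_real (g x) * a * cnj b"
proof -
  have "complex_of_real (sqrt (g x)) * complex_of_real (sqrt (g x)) = complex_of_real (g x)"
    using g_pos[of x] by (simp flip: of_real_mult)
  then show ?thesis by (simp add: mult_ac)
qed

text \<open>Graph of S: omega phi |-> sqrt(g) phi', so that <Su, Sv> is the form of
  \<open>opA\<close>.\<close>

definition Gr :: "(l2 \<times> l2) set" where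
  "Gr = {(cl (\<lambda>x. complex_of_real (omega x) * phi x), cl (\<lambda>x. complex_of_real (sqrt (g x)) * d x)) | phi d. H1 phi d}"

lemma GrI: "H1 phi d \<Longrightarrow> (cl (\<lambda>x. complex_of_real (omega x) * phi x), cl (\<lambda>x. complex_of_real (sqrt (g x)) * d x)) \<in> Gr"
  unfolding Gr_def by auto

lemma subspace_Gr: "subspace Gr"
proof (rule subspaceI)
  have H0: "H1 (\<lambda>x. 0) (\<lambda>x. 0)" by (auto simp: H1_iff intro!: acfI) (auto simp: set_integrable_def set_lebesgue_integral_def)
  show "0 \<in> Gr" using GrI[OF H0] by (simp add: zero_prod_def zero_l2_def)
next
  fix a b assume "a \<in> Gr" "b \<in> Gr"
  then obtain phi d psi e where H: "H1 phi d" "H1 psi e"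
    and ab: "a = (cl (\<lambda>x. complex_of_real (omega x) * phi x), cl (\<lambda>x. complex_of_real (sqrt (g x)) * d x))"
      "b = (cl (\<lambda>x. complex_of_real (omega x) * psi x), cl (\<lambda>x. complex_of_real (sqrt (g x)) * e x))"
    unfolding Gr_def by blast
  have L: "phi \<in> L2sp lborel" "d \<in> L2sp lborel" "psi \<in> L2sp lborel" "e \<in> L2sp lborel" using H by (auto simp: H1_iff)
  show "a + b \<in> Gr"
    using GrI[OF H1_lin[OF H, of 1 1]] by (simp add: ab cl_add w_L2 sg_L2 L distrib_left)
next
  fix a r assume "a \<in> Gr"
  then obtain phi d where H: "H1 phi d"
    and a: "a = (cl (\<lambda>x. complex_of_real (omega x) * phi x), cl (\<lambda>x. complex_of_real (sqrt (g x)) * d x))"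
    unfolding Gr_def by blast
  have L: "phi \<in> L2sp lborel" "d \<in> L2sp lborel" using H by (auto simp: H1_iff)
  show "r *\<^sub>R a \<in> Gr"
    using GrI[OF H1_lin[OF H H, of "complex_of_real r" 0]] by (simp add: a cl_scaleR w_L2 sg_L2 L mult.left_commute)
qed

text \<open>The lower bounds on omega and g make division by omega and sqrt(g) bounded, so
  convergence in the graph is L2 convergence of phi and phi', and \<open>H1_closed\<close>
  applies.\<close>

lemma closed_Gr: "closed Gr"
  unfolding closed_sequential_limits
proof (intro allI impI)
  fix X and l :: "l2 \<times> l2" assume a: "(\<forall>n. X n \<in> Gr) \<and> X \<longlonglongrightarrow> l"
  have "\<exists>phi d. H1 phi d \<and> X n = (cl (\<lambda>x. complex_of_real (omega x) * phi x), cl (\<lambda>x. complex_of_real (sqrt (g x)) * d x))" for n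
    using a unfolding Gr_def by blast
  then obtain phi d where H: "\<And>n. H1 (phi n) (d n)"
    and X: "\<And>n. X n = (cl (\<lambda>x. complex_of_real (omega x) * phi n x), cl (\<lambda>x. complex_of_real (sqrt (g x)) * d n x))" by metis
  have L: "phi n \<in> L2sp lborel" "d n \<in> L2sp lborel" for n using H by (auto simp: H1_iff)
  obtain U S where l: "l = (U, S)" by fastforce
  define p where "p x = complex_of_real (1 / omega x) * rp U x" for x
  define q where "q x = complex_of_real (1 / sqrt (g x)) * rp S x" for x
  have bw: "AE x in lborel. cmod (complex_of_real (1 / omega x)) \<le> 1 / w0"
    by (rule AE_I2) (use w_bounds w_pos w0 in \<open>auto simp: norm_divide abs_of_pos intro!: frac_le\<close>)
  have bg: "AE x in lborel. cmod (complex_of_real (1 / sqrt (g x))) \<le> 1 / sqrt g0"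
    by (rule AE_I2) (use g_bounds g_pos g0 in \<open>auto simp: norm_divide abs_of_pos intro!: frac_le\<close>)
  have pL: "p \<in> L2sp lborel" unfolding p_def by (rule L2sp_bdd_mult(1)[OF rp_L2 _ bw]) measurable
  have qL: "q \<in> L2sp lborel" unfolding q_def by (rule L2sp_bdd_mult(1)[OF rp_L2 _ bg]) measurable
  have lU: "(\<lambda>n. norm (cl (\<lambda>x. complex_of_real (omega x) * phi n x) - U)) \<longlonglongrightarrow> 0"
    and lS: "(\<lambda>n. norm (cl (\<lambda>x. complex_of_real (sqrt (g x)) * d n x) - S)) \<longlonglongrightarrow> 0"
    using tendsto_fst[of X l sequentially] tendsto_snd[of X l sequentially] a unfolding X l
    by (auto simp: tendsto_norm_zero_iff LIM_zero_iff)
  have nU: "L2norm lborel (\<lambda>x. phi n x - p x) \<le> \<bar>1 / w0\<bar> * norm (cl (\<lambda>x. complex_of_real (omega x) * phi n x) - U)" for n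
  proof -
    have D: "(\<lambda>x. complex_of_real (omega x) * phi n x - rp U x) \<in> L2sp lborel" using w_L2[OF L(1)] by auto
    have "phi n x - p x = complex_of_real (1 / omega x) * (complex_of_real (omega x) * phi n x - rp U x)" for x
      using w_pos[of x] by (simp add: p_def field_simps)
    then have "L2norm lborel (\<lambda>x. phi n x - p x) \<le> \<bar>1 / w0\<bar> * L2norm lborel (\<lambda>x. complex_of_real (omega x) * phi n x - rp U x)"
      using L2sp_bdd_mult(2)[OF D _ bw] by simp
    also have "L2norm lborel (\<lambda>x. complex_of_real (omega x) * phi n x - rp U x) = norm (cl (\<lambda>x. complex_of_real (omega x) * phi n x) - U)"
      using cl_diff[OF w_L2[OF L(1)] rp_L2, of n U] norm_cl[OF D] by simp
    finally show ?thesis .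
  qed
  have nS: "L2norm lborel (\<lambda>x. d n x - q x) \<le> \<bar>1 / sqrt g0\<bar> * norm (cl (\<lambda>x. complex_of_real (sqrt (g x)) * d n x) - S)" for n
  proof -
    have D: "(\<lambda>x. complex_of_real (sqrt (g x)) * d n x - rp S x) \<in> L2sp lborel" using sg_L2[OF L(2)] by auto
    have "d n x - q x = complex_of_real (1 / sqrt (g x)) * (complex_of_real (sqrt (g x)) * d n x - rp S x)" for x
      using g_pos[of x] by (simp add: q_def field_simps)
    then have "L2norm lborel (\<lambda>x. d n x - q x) \<le> \<bar>1 / sqrt g0\<bar> * L2norm lborel (\<lambda>x. complex_of_real (sqrt (g x)) * d n x - rp S x)"
      using L2sp_bdd_mult(2)[OF D _ bg] by simp
    also have "L2norm lborel (\<lambda>x. complex_of_real (sqrt (g x)) * d n x - rp S x) = norm (cl (\<lambda>x. complex_of_real (sqrt (g x)) * d n x) - S)"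
      using cl_diff[OF sg_L2[OF L(2)] rp_L2, of n S] norm_cl[OF D] by simp
    finally show ?thesis .
  qed
  have "(\<lambda>n. L2norm lborel (\<lambda>x. phi n x - p x)) \<longlonglongrightarrow> 0"
    by (rule Lim_null_comparison[OF always_eventually, of _ "\<lambda>n. \<bar>1 / w0\<bar> * norm (cl (\<lambda>x. complex_of_real (omega x) * phi n x) - U)"])
      (use nU tendsto_mult_left[OF lU, of "\<bar>1 / w0\<bar>"] in auto)
  moreover have "(\<lambda>n. L2norm lborel (\<lambda>x. d n x - q x)) \<longlonglongrightarrow> 0"
    by (rule Lim_null_comparison[OF always_eventually, of _ "\<lambda>n. \<bar>1 / sqrt g0\<bar> * norm (cl (\<lambda>x. complex_of_real (sqrt (g x)) * d n x) - S)"])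
      (use nS tendsto_mult_left[OF lS, of "\<bar>1 / sqrt g0\<bar>"] in auto)
  ultimately obtain f' where f': "H1 f' q" "AE x in lborel. f' x = p x" using H1_closed[where f=phi and d=d, OF H pL qL] by blast
  have fL: "f' \<in> L2sp lborel" using f'(1) by (simp add: H1_iff)
  have "cl (\<lambda>x. complex_of_real (omega x) * f' x) = cl (rp U)"
  proof (rule cl_eqI[OF w_L2[OF fL] rp_L2])
    show "AE x in lborel. complex_of_real (omega x) * f' x = rp U x"
      using f'(2) by eventually_elim (use w_pos in \<open>simp add: p_def less_imp_neq[symmetric]\<close>)
  qed
  moreover have "complex_of_real (sqrt (g x)) * q x = rp S x" for x
    using g_pos[of x] by (simp add: q_def)
  ultimately show "l \<in> Gr" using GrI[OF f'(1)] by (simp add: l)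
qed

text \<open>Orthogonality to bumps makes all interval integrals of omega h vanish in the limit. The
  real inner product sees only real parts, hence the second test function i phi.\<close>

lemma dense_Gr:
  assumes h: "\<And>u s. (u, s) \<in> Gr \<Longrightarrow> inner h u = 0" shows "h = 0"
proof -
  define k where "k = rp h"
  have k: "k \<in> L2sp lborel" "h = cl k" by (auto simp: k_def)
  have [measurable]: "k \<in> borel_measurable borel" using L2spD(1)[OF k(1)] by simp
  have wk: "(\<lambda>x. complex_of_real (omega x) * k x) \<in> L2sp lborel" by (rule w_L2[OF k(1)])
  have z: "L2inner lborel k (\<lambda>x. complex_of_real (omega x) * phi x) = 0" if H: "H1 phi d" for phi d
  proof -
    have phiL: "phi \<in> L2sp lborel" using H by (simp add: H1_iff)
    have H': "H1 (\<lambda>x. \<i> * phi x) (\<lambda>x. \<i> * d x)" using H1_lin[OF H H, of "\<i>" 0] by simp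
    have i: "L2inner lborel k (\<lambda>x. complex_of_real (omega x) * (\<i> * phi x)) = - \<i> * L2inner lborel k (\<lambda>x. complex_of_real (omega x) * phi x)"
      unfolding L2inner_def by (subst Bochner_Integration.integral_mult_right_zero[symmetric]) (simp add: mult_ac)
    have "Re (L2inner lborel k (\<lambda>x. complex_of_real (omega x) * phi x)) = 0"
      using h[OF GrI[OF H]] inner_cl[OF k(1) w_L2[OF phiL]] k(2) by simp
    moreover have "Im (L2inner lborel k (\<lambda>x. complex_of_real (omega x) * phi x)) = 0"
      using h[OF GrI[OF H']] inner_cl[OF k(1) w_L2[of "\<lambda>x. \<i> * phi x"]] phiL k(2) i by simp
    ultimately show ?thesis by (simp add: complex_eq_iff)
  qed
  have "AE x in lborel. complex_of_real (omega x) * k x = 0"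
  proof (rule AE_zero_of_interval_integrals)
    have si: "set_integrable lborel {a..b} (\<lambda>x. complex_of_real (omega x) * k x)" for a b
      by (rule L2_set_integrable_Icc(1)[OF wk])
    show "set_integrable lborel {a<..b} (\<lambda>x. complex_of_real (omega x) * k x)" for a b
      by (rule set_integrable_subset[OF si[of a b]]) auto
    show "(LINT x:{a<..b}|lborel. complex_of_real (omega x) * k x) = 0" if ab: "a < b" for a b
    proof -
      obtain f d :: "nat \<Rightarrow> real \<Rightarrow> real" where f: "\<And>n. H1 (\<lambda>x. complex_of_real (f n x)) (\<lambda>x. complex_of_real (d n x))"
        "\<And>n x. 0 \<le> f n x \<and> f n x \<le> 1" "\<And>n x. x \<notin> {a<..<b} \<Longrightarrow> f n x = 0"
        "\<And>x. (\<lambda>n. f n x) \<longlonglongrightarrow> indicator {a<..<b} x" using interval_bump[OF ab] by metis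
      have [measurable]: "f n \<in> borel_measurable borel" for n
      proof -
        have "(\<lambda>x. Re (complex_of_real (f n x))) \<in> borel_measurable borel"
          using f(1)[of n] L2spD(1)[of "\<lambda>x. complex_of_real (f n x)" lborel] unfolding H1_iff by (intro measurable_compose[OF _ borel_measurable_Re]) auto
        then show ?thesis by simp
      qed
      have zn: "(\<integral>x. (complex_of_real (omega x) * k x) * complex_of_real (f n x) \<partial>lborel) = 0" for n
        using z[OF f(1)[of n]] by (simp add: L2inner_def mult_ac)
      have "(\<lambda>n. \<integral>x. (complex_of_real (omega x) * k x) * complex_of_real (f n x) \<partial>lborel)
        \<longlonglongrightarrow> (\<integral>x. (complex_of_real (omega x) * k x) * complex_of_real (indicator {a<..<b} x) \<partial>lborel)"
      proof (rule integral_dominated_convergence[where w="\<lambda>x. cmod (indicator {a..b} x *\<^sub>R (complex_of_real (omega x) * k x))"])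
        show "integrable lborel (\<lambda>x. cmod (indicator {a..b} x *\<^sub>R (complex_of_real (omega x) * k x)))"
          using si[of a b] unfolding set_integrable_def by (rule integrable_norm)
        show "AE x in lborel. (\<lambda>n. complex_of_real (omega x) * k x * complex_of_real (f n x))
           \<longlonglongrightarrow> complex_of_real (omega x) * k x * complex_of_real (indicator {a<..<b} x)"
          by (intro AE_I2 tendsto_intros f(4))
        show "AE x in lborel. norm (complex_of_real (omega x) * k x * complex_of_real (f n x))
           \<le> cmod (indicator {a..b} x *\<^sub>R (complex_of_real (omega x) * k x))" for n
        proof (rule AE_I2)
          fix x
          show "norm (complex_of_real (omega x) * k x * complex_of_real (f n x))
           \<le> cmod (indicator {a..b} x *\<^sub>R (complex_of_real (omega x) * k x))"
            using f(2)[of n x] f(3)[of x n] by (cases "x \<in> {a<..<b}") (auto simp: norm_mult intro!: mult_right_le_one_le)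
        qed
      qed measurable
      then have z0: "(\<integral>x. (complex_of_real (omega x) * k x) * complex_of_real (indicator {a<..<b} x) \<partial>lborel) = 0"
        unfolding zn by (simp add: LIMSEQ_const_iff)
      have "(LINT x:{a<..b}|lborel. complex_of_real (omega x) * k x)
        = (\<integral>x. (complex_of_real (omega x) * k x) * complex_of_real (indicator {a<..<b} x) \<partial>lborel)"
        unfolding set_lebesgue_integral_def
      proof (rule integral_cong_AE)
        show "AE x in lborel. indicator {a<..b} x *\<^sub>R (complex_of_real (omega x) * k x) =
           (complex_of_real (omega x) * k x) * complex_of_real (indicator {a<..<b} x)"
          using AE_lborel_singleton[of b] by eventually_elim (auto simp: indicator_def)
      qed measurable
      then show ?thesis using z0 by simp
    qed
  qed
  then have "AE x in lborel. k x = 0" by eventually_elim (metis less_irrefl mult_eq_0_iff of_real_eq_0_iff w_pos)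
  then show ?thesis using k by (simp add: zero_l2_def cl_eq_iff)
qed

sublocale cg: closed_graph_form Gr Il2
proof
  fix u s assume "(u, s) \<in> Gr"
  then obtain phi d where H: "H1 phi d"
    and a: "u = cl (\<lambda>x. complex_of_real (omega x) * phi x)" "s = cl (\<lambda>x. complex_of_real (sqrt (g x)) * d x)"
    unfolding Gr_def by blast
  have L: "phi \<in> L2sp lborel" "d \<in> L2sp lborel" using H by (auto simp: H1_iff)
  show "(Il2 u, Il2 s) \<in> Gr"
    using GrI[OF H1_lin[OF H H, of "\<i>" 0]] by (simp add: a Il2_cl w_L2 sg_L2 L mult.left_commute)
qed (use closed_Gr subspace_Gr dense_Gr Il2_props linear_add[OF Il2_props(1)] linear_scale[OF Il2_props(1)] in auto)

text \<open>\<open>opA\<close> asks for a complex identity for every choice of representatives, the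
  abstract operator for its real part with some representative. Testing with i psi recovers the
  imaginary part, and uniqueness of H1 derivatives makes the choice immaterial.\<close>

lemma opA_iff: assumes u: "u \<in> L2sp lborel" and w: "w \<in> L2sp lborel"
  shows "opA g omega u w \<longleftrightarrow> cg.A (cl u) (cl w)"
proof
  assume A: "opA g omega u w"
  then obtain phi d where H: "H1 phi d" and uphi: "AE x in lborel. u x = complex_of_real (omega x) * phi x"
    unfolding opA_def form_op_def by blast
  have L: "phi \<in> L2sp lborel" "d \<in> L2sp lborel" using H by (auto simp: H1_iff)
  have cu: "cl u = cl (\<lambda>x. complex_of_real (omega x) * phi x)" by (rule cl_eqI[OF u w_L2[OF L(1)] uphi])
  show "cg.A (cl u) (cl w)" unfolding cg.A_def
  proof (intro exI conjI allI impI)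
    show "(cl u, cl (\<lambda>x. complex_of_real (sqrt (g x)) * d x)) \<in> Gr" unfolding cu by (rule GrI[OF H])
    fix V r assume "(V, r) \<in> Gr"
    then obtain psi e where H': "H1 psi e" and V: "V = cl (\<lambda>x. complex_of_real (omega x) * psi x)"
      and r: "r = cl (\<lambda>x. complex_of_real (sqrt (g x)) * e x)" unfolding Gr_def by blast
    have L': "psi \<in> L2sp lborel" "e \<in> L2sp lborel" using H' by (auto simp: H1_iff)
    have "(\<integral>x. complex_of_real (g x) * d x * cnj (e x) \<partial>lborel) = L2inner lborel w (\<lambda>x. complex_of_real (omega x) * psi x)"
      using A H uphi H' w_L2[OF L'(1)] unfolding opA_def form_op_def by fastforce
    then show "inner (cl (\<lambda>x. complex_of_real (sqrt (g x)) * d x)) r = inner (cl w) V"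
      unfolding V r inner_cl[OF sg_L2[OF L(2)] sg_L2[OF L'(2)]] inner_cl[OF w w_L2[OF L'(1)]] L2inner_def gg
      by (simp only:)
  qed
next
  assume A: "cg.A (cl u) (cl w)"
  then obtain s where s: "(cl u, s) \<in> Gr" "\<And>v r. (v, r) \<in> Gr \<Longrightarrow> inner s r = inner (cl w) v" unfolding cg.A_def by blast
  from s(1) obtain phi d where H: "H1 phi d" and cu: "cl u = cl (\<lambda>x. complex_of_real (omega x) * phi x)"
    and sd: "s = cl (\<lambda>x. complex_of_real (sqrt (g x)) * d x)" unfolding Gr_def by blast
  have L: "phi \<in> L2sp lborel" "d \<in> L2sp lborel" using H by (auto simp: H1_iff)
  have uphi: "AE x in lborel. u x = complex_of_real (omega x) * phi x" using cu cl_eq_iff[OF u w_L2[OF L(1)]] by simp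
  have re: "Re (\<integral>x. complex_of_real (g x) * d x * cnj (e x) \<partial>lborel) = Re (L2inner lborel w (\<lambda>x. complex_of_real (omega x) * psi x))"
    if H': "H1 psi e" for psi e
  proof -
    have L': "psi \<in> L2sp lborel" "e \<in> L2sp lborel" using H' by (auto simp: H1_iff)
    have "inner (cl (\<lambda>x. complex_of_real (sqrt (g x)) * d x)) (cl (\<lambda>x. complex_of_real (sqrt (g x)) * e x))
      = inner (cl w) (cl (\<lambda>x. complex_of_real (omega x) * psi x))"
      using s(2)[OF GrI[OF H']] unfolding sd .
    then show ?thesis
      unfolding inner_cl[OF sg_L2[OF L(2)] sg_L2[OF L'(2)]] inner_cl[OF w w_L2[OF L'(1)]] L2inner_def gg .
  qed
  have full: "(\<integral>x. complex_of_real (g x) * d x * cnj (e x) \<partial>lborel) = L2inner lborel w (\<lambda>x. complex_of_real (omega x) * psi x)"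
    if H': "H1 psi e" for psi e
  proof -
    have Hi: "H1 (\<lambda>x. \<i> * psi x) (\<lambda>x. \<i> * e x)" using H1_lin[OF H' H', of "\<i>" 0] by simp
    have 1: "(\<integral>x. complex_of_real (g x) * d x * cnj (\<i> * e x) \<partial>lborel) = - \<i> * (\<integral>x. complex_of_real (g x) * d x * cnj (e x) \<partial>lborel)"
      by (subst Bochner_Integration.integral_mult_right_zero[symmetric]) (simp add: mult_ac)
    have 2: "L2inner lborel w (\<lambda>x. complex_of_real (omega x) * (\<i> * psi x)) = - \<i> * L2inner lborel w (\<lambda>x. complex_of_real (omega x) * psi x)"
      unfolding L2inner_def by (subst Bochner_Integration.integral_mult_right_zero[symmetric]) (simp add: mult_ac)
    have "Im (\<integral>x. complex_of_real (g x) * d x * cnj (e x) \<partial>lborel) = Im (L2inner lborel w (\<lambda>x. complex_of_real (omega x) * psi x))"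
      using re[OF Hi] unfolding 1 2 by simp
    with re[OF H'] show ?thesis by (simp add: complex_eq_iff)
  qed
  show "opA g omega u w" unfolding opA_def form_op_def
  proof (intro conjI u w ballI, safe)
    show "{(phi, dphi). H1 phi dphi \<and> (AE x in lborel. u x = complex_of_real (omega x) * phi x)} = {} \<Longrightarrow> False"
      using H uphi by blast
    fix v phi' d' psi e
    assume v: "v \<in> L2sp lborel" and H2: "H1 phi' d'" "AE x in lborel. u x = complex_of_real (omega x) * phi' x"
      and H3: "H1 psi e" "AE x in lborel. v x = complex_of_real (omega x) * psi x"
    have L3: "psi \<in> L2sp lborel" "e \<in> L2sp lborel" "d' \<in> L2sp lborel" using H2 H3 by (auto simp: H1_iff)
    have "AE x in lborel. phi x = phi' x"
      using uphi H2(2) by eventually_elim (use w_pos in \<open>simp add: less_imp_neq[symmetric]\<close>)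
    from H1_unique(2)[OF H H2(1) this] have dd: "AE x in lborel. d x = d' x" .
    have [measurable]: "d \<in> borel_measurable borel" "d' \<in> borel_measurable borel" "e \<in> borel_measurable borel" "psi \<in> borel_measurable borel"
      "v \<in> borel_measurable borel" "w \<in> borel_measurable borel"
      using L L3 v w by (auto dest: L2spD(1))
    have "(\<integral>x. complex_of_real (g x) * d' x * cnj (e x) \<partial>lborel) = (\<integral>x. complex_of_real (g x) * d x * cnj (e x) \<partial>lborel)"
    proof (rule integral_cong_AE)
      show "AE x in lborel. complex_of_real (g x) * d' x * cnj (e x) = complex_of_real (g x) * d x * cnj (e x)"
        using dd by eventually_elim simp
    qed measurable
    also have "\<dots> = L2inner lborel w (\<lambda>x. complex_of_real (omega x) * psi x)" by (rule full[OF H3(1)])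
    also have "\<dots> = L2inner lborel w v" unfolding L2inner_def
    proof (rule integral_cong_AE)
      show "AE x in lborel. w x * cnj (complex_of_real (omega x) * psi x) = w x * cnj (v x)"
        using H3(2) by eventually_elim simp
    qed measurable
    finally show "(\<integral>x. complex_of_real (g x) * d' x * cnj (e x) \<partial>lborel) = L2inner lborel w v" .
  qed
qed

lemma opA_L2: "opA g omega u w \<Longrightarrow> u \<in> L2sp lborel \<and> w \<in> L2sp lborel"
  by (simp add: opA_def form_op_def)

lemma opA_selfadjoint:
  assumes x: "x \<in> L2sp lborel" "x' \<in> L2sp lborel"
    and a: "\<And>z y. opA g omega z y \<Longrightarrow> L2inner lborel x y = L2inner lborel x' z"
  shows "opA g omega x x'"
proof -
  have "cg.A (cl x) (cl x')"
  proof (rule cg.A_selfadjoint)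
    fix Z Y assume A: "cg.A Z Y"
    then have "opA g omega (rp Z) (rp Y)" by (simp add: opA_iff)
    from a[OF this] show "inner (cl x) Y = inner (cl x') Z"
      using inner_cl[OF x(1) rp_L2[of Y]] inner_cl[OF x(2) rp_L2[of Z]] by simp
  qed
  then show ?thesis by (simp add: opA_iff x)
qed

theorem opA_group: "\<exists>U. unitary_group_of (opA g omega) U"
proof -
  define U where "U t u = rp (cg.Ut t (cl u))" for t u
  have UL: "U t u \<in> L2sp lborel" for t u by (simp add: U_def)
  have clU: "cl (U t u) = cg.Ut t (cl u)" for t u by (simp add: U_def)
  \<comment> \<open>A complex scalar acts as Re a + Im a I, so real linearity and commutation with
    \<open>Il2\<close> give complex linearity of the group.\<close>
  have Ilin: "cl (\<lambda>y. a * f y) = Re a *\<^sub>R cl f + Im a *\<^sub>R Il2 (cl f)" if "f \<in> L2sp lborel" for a f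
    using that by (simp add: cl_scaleR Il2_cl cl_add) (rule arg_cong[of _ _ cl], auto simp: fun_eq_iff complex_eq_iff)
  have "unitary_group_of (opA g omega) U" unfolding unitary_group_of_def
  proof (intro conjI allI ballI impI)
    fix t u assume u: "u \<in> L2sp lborel"
    show "U t u \<in> L2sp lborel" by (rule UL)
    show "L2norm lborel (U t u) = L2norm lborel u"
      using norm_cl[OF UL[of t u]] norm_cl[OF u] cg.Ut_norm[of t "cl u"] by (simp add: clU)
    show "AE x in lborel. U 0 u x = u x"
      using cl_eq_iff[OF UL u, of 0 u] by (simp add: clU cg.Ut_0)
    fix s
    show "AE x in lborel. U (s + t) u x = U s (U t u) x"
      using cl_eq_iff[OF UL UL, of "s + t" u s "U t u"] by (simp add: clU cg.Ut_group)
    have "((\<lambda>t. norm (cg.Ut t (cl u) - cg.Ut s (cl u))) \<longlongrightarrow> 0) (at s)"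
      using cg.Ut_cont[of "cl u" s] by (simp add: tendsto_norm_zero_iff LIM_zero_iff)
    moreover have "norm (cg.Ut t (cl u) - cg.Ut s (cl u)) = L2norm lborel (\<lambda>x. U t u x - U s u x)" for t
      using cl_diff[OF UL UL, of t u s u] norm_cl[OF L2sp_diff[OF UL UL], of t u s u] by (simp add: clU)
    ultimately show "((\<lambda>t. L2norm lborel (\<lambda>x. U t u x - U s u x)) \<longlongrightarrow> 0) (at s)" by simp
    fix a b v assume v: "v \<in> L2sp lborel"
    have "cl (U t (\<lambda>y. a * u y + b * v y)) = cl (\<lambda>x. a * U t u x + b * U t v x)"
      using u v by (simp add: clU Ilin UL cl_add[symmetric] cg.Ut_lin)
    then show "AE x in lborel. U t (\<lambda>y. a * u y + b * v y) x = a * U t u x + b * U t v x"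
      using UL by (subst (asm) cl_eq_iff) auto
  next
    fix u w assume A: "opA g omega u w"
    have u: "u \<in> L2sp lborel" and w: "w \<in> L2sp lborel" using opA_L2[OF A] by auto
    have "((\<lambda>h. norm ((1 / h) *\<^sub>R (cg.Ut h (cl u) - cl u) + Il2 (cl w))) \<longlongrightarrow> 0) (at 0)"
      using cg.Ut_generator[of "cl u" "cl w"] A u w by (intro tendsto_norm_zero) (simp add: opA_iff)
    moreover have "norm ((1 / h) *\<^sub>R (cg.Ut h (cl u) - cl u) + Il2 (cl w)) = L2norm lborel (\<lambda>x. (U h u x - u x) / complex_of_real h + \<i> * w x)" for h
    proof -
      have D: "(\<lambda>x. complex_of_real (1 / h) * (U h u x - u x)) \<in> L2sp lborel" "(\<lambda>x. \<i> * w x) \<in> L2sp lborel"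
        by (rule L2sp_cmult[OF L2sp_diff[OF UL u]], rule L2sp_cmult[OF w])
      have "(1 / h) *\<^sub>R (cg.Ut h (cl u) - cl u) + Il2 (cl w) = cl (\<lambda>x. complex_of_real (1 / h) * (U h u x - u x) + \<i> * w x)"
        using u w UL[of h u] D cl_add[OF D] by (simp add: clU[symmetric] cl_diff cl_scaleR Il2_cl)
      then show ?thesis using norm_cl[OF L2sp_add[OF D]] by simp
    qed
    ultimately show "((\<lambda>h. L2norm lborel (\<lambda>x. (U h u x - u x) / complex_of_real h + \<i> * w x)) \<longlongrightarrow> 0) (at 0)" by simp
  qed
  then show ?thesis by blast
qed

end

section \<open>Evolution of explicit curves\<close>

lemma unitary_groupD:
  assumes "unitary_group_of A U"
  shows "u \<in> L2sp lborel \<Longrightarrow> U t u \<in> L2sp lborel"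
    "u \<in> L2sp lborel \<Longrightarrow> L2norm lborel (U t u) = L2norm lborel u"
    "u \<in> L2sp lborel \<Longrightarrow> v \<in> L2sp lborel \<Longrightarrow> AE x in lborel. U t (\<lambda>y. a * u y + b * v y) x = a * U t u x + b * U t v x"
    "u \<in> L2sp lborel \<Longrightarrow> AE x in lborel. U 0 u x = u x"
    "u \<in> L2sp lborel \<Longrightarrow> AE x in lborel. U (s + t) u x = U s (U t u) x"
    "u \<in> L2sp lborel \<Longrightarrow> ((\<lambda>t. L2norm lborel (\<lambda>x. U t u x - U t0 u x)) \<longlongrightarrow> 0) (at t0)"
    "A u w \<Longrightarrow> ((\<lambda>h. L2norm lborel (\<lambda>x. (U h u x - u x) / complex_of_real h + \<i> * w x)) \<longlongrightarrow> 0) (at 0)"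
  using assms unfolding unitary_group_of_def by blast+

lemma unitary_group_isometry:
  assumes U: "unitary_group_of A U" and u: "u \<in> L2sp lborel" and v: "v \<in> L2sp lborel"
  shows "norm (cl (U t u) - cl (U t v)) = norm (cl u - cl v)"
proof -
  note L = unitary_groupD(1)[OF U u, of t] unitary_groupD(1)[OF U v, of t]
  have d: "(\<lambda>x. u x - v x) \<in> L2sp lborel" using u v by auto
  have "AE x in lborel. U t (\<lambda>y. 1 * u y + (-1) * v y) x = 1 * U t u x + (-1) * U t v x"
    by (rule unitary_groupD(3)[OF U u v])
  then have ae: "AE x in lborel. U t (\<lambda>y. u y - v y) x = U t u x - U t v x" by simp
  have "cl (U t u) - cl (U t v) = cl (U t (\<lambda>y. u y - v y))"
    unfolding cl_diff[OF L] using ae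
    by (intro cl_eqI L2sp_diff L unitary_groupD(1)[OF U d]) (auto elim: eventually_mono)
  then show ?thesis
    using norm_cl[OF unitary_groupD(1)[OF U d, of t]] unitary_groupD(2)[OF U d, of t] norm_cl[OF d] cl_diff[OF u v] by simp
qed

text \<open>The curve U(-s) v(s) is constant: v(s + h) and U(h) v(s) both move from v(s) by -i h
  w(s) up to o(h), so its increments are o(h) and its distance to v(0) has derivative zero. Only the
  defining properties of a group enter, so the conclusion holds for whichever group
  \<open>expA\<close> selects.\<close>

lemma unitary_group_curve:
  assumes U: "unitary_group_of A U" and A: "\<And>t. A (v t) (w t)"
    and v: "\<And>t. v t \<in> L2sp lborel" and w: "\<And>t. w t \<in> L2sp lborel"
    and der: "\<And>t. ((\<lambda>h. L2norm lborel (\<lambda>x. (v (t + h) x - v t x) / complex_of_real h + \<i> * w t x)) \<longlongrightarrow> 0) (at 0)"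
  shows "AE x in lborel. U t (v 0) x = v t x"
proof -
  note UL = unitary_groupD(1)[OF U]
  define D where "D s = cl (U (- s) (v s))" for s
  define nn where "nn s = norm (D s - cl (v 0))" for s
  have Ds: "D s = cl (U (- (s + h)) (U h (v s)))" for s h
    unfolding D_def using unitary_groupD(5)[OF U v, of "- (s + h)" h s] by (intro cl_eqI UL v) simp
  have Dd: "norm (D (s + h) - D s) = norm (cl (v (s + h)) - cl (U h (v s)))" for s h
    unfolding Ds[of s h] unfolding D_def by (rule unitary_group_isometry[OF U v UL[OF v]])
  \<comment> \<open>\<open>al\<close> and \<open>be\<close> are the errors of the two first-order
    expansions, of the given curve and of the group orbit; their sum times |h| bounds the increment
    of D.\<close>
  define al where "al s h = L2norm lborel (\<lambda>x. (v (s + h) x - v s x) / complex_of_real h + \<i> * w s x)" for s h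
  define be where "be s h = L2norm lborel (\<lambda>x. (U h (v s) x - v s x) / complex_of_real h + \<i> * w s x)" for s h
  have eq: "norm ((1 / h) *\<^sub>R (cl f - cl (v s)) + Il2 (cl (w s))) = L2norm lborel (\<lambda>x. (f x - v s x) / complex_of_real h + \<i> * w s x)"
    if f: "f \<in> L2sp lborel" for f h s
  proof -
    have d1: "(\<lambda>x. f x - v s x) \<in> L2sp lborel" by (rule L2sp_diff[OF f v])
    have d2: "(\<lambda>x. complex_of_real (1 / h) * (f x - v s x)) \<in> L2sp lborel" "(\<lambda>x. \<i> * w s x) \<in> L2sp lborel"
      by (rule L2sp_cmult[OF d1], rule L2sp_cmult[OF w])
    have "(1 / h) *\<^sub>R (cl f - cl (v s)) + Il2 (cl (w s)) = cl (\<lambda>x. complex_of_real (1 / h) * (f x - v s x) + \<i> * w s x)"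
      unfolding cl_diff[OF f v] cl_scaleR[OF d1] Il2_cl[OF w] cl_add[OF d2] ..
    then show ?thesis using norm_cl[OF L2sp_add[OF d2]] by simp
  qed
  have bound: "norm (D (s + h) - D s) \<le> \<bar>h\<bar> * (al s h + be s h)" if "h \<noteq> 0" for s h
  proof -
    let ?X = "(1 / h) *\<^sub>R (cl (v (s + h)) - cl (v s)) + Il2 (cl (w s))"
    let ?Y = "(1 / h) *\<^sub>R (cl (U h (v s)) - cl (v s)) + Il2 (cl (w s))"
    have "cl (v (s + h)) - cl (U h (v s)) = h *\<^sub>R (?X - ?Y)" using that by (simp add: algebra_simps)
    then have "norm (cl (v (s + h)) - cl (U h (v s))) = \<bar>h\<bar> * norm (?X - ?Y)" by simp
    also have "\<dots> \<le> \<bar>h\<bar> * (norm ?X + norm ?Y)" by (intro mult_left_mono norm_triangle_ineq4) simp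
    also have "\<dots> = \<bar>h\<bar> * (al s h + be s h)" unfolding eq[OF v] eq[OF UL[OF v]] al_def be_def ..
    finally show ?thesis unfolding Dd .
  qed
  have "DERIV nn s :> 0" for s
  proof -
    have lim: "((\<lambda>h. al s h + be s h) \<longlongrightarrow> 0 + 0) (at 0)"
      unfolding al_def be_def by (intro tendsto_add der unitary_groupD(7)[OF U A])
    have "norm ((nn (s + h) - nn s) / h) \<le> al s h + be s h" if "h \<noteq> 0" for h
    proof -
      have "\<bar>nn (s + h) - nn s\<bar> \<le> norm (D (s + h) - D s)"
        unfolding nn_def using norm_triangle_ineq3[of "D (s + h) - cl (v 0)" "D s - cl (v 0)"] by simp
      also have "\<dots> \<le> \<bar>h\<bar> * (al s h + be s h)" by (rule bound[OF that])
      finally show ?thesis using that by (simp add: divide_le_eq mult.commute)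
    qed
    then have "\<forall>\<^sub>F h in at 0. norm ((nn (s + h) - nn s) / h) \<le> al s h + be s h"
      by (simp add: eventually_at_filter)
    then have "((\<lambda>h. (nn (s + h) - nn s) / h) \<longlongrightarrow> 0) (at 0)" by (rule Lim_null_comparison) (use lim in simp)
    then show ?thesis by (simp add: DERIV_def)
  qed
  then have "nn t = nn 0" using DERIV_isconst_all by blast
  also have "nn 0 = 0"
  proof -
    have "D 0 = cl (v 0)" unfolding D_def using unitary_groupD(4)[OF U v, of 0] by (intro cl_eqI UL v) simp
    then show ?thesis by (simp add: nn_def)
  qed
  finally have D0: "cl (U (- t) (v t)) = cl (v 0)" by (simp add: nn_def D_def)
  have "norm (cl (U t (U (- t) (v t))) - cl (U t (v 0))) = 0"
    using unitary_group_isometry[OF U UL[OF v] v, of t "- t" t 0] by (simp add: D0)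
  then have "cl (U t (v 0)) = cl (U t (U (- t) (v t)))" by simp
  also have "\<dots> = cl (U (t + - t) (v t))"
    using unitary_groupD(5)[OF U v, of t "- t" t] by (intro cl_eqI UL v) (auto elim: eventually_mono)
  also have "\<dots> = cl (v t)" using unitary_groupD(4)[OF U v, of t] by (intro cl_eqI UL v) simp
  finally show ?thesis by (simp add: cl_eq_iff UL v)
qed

text \<open>The relation occurs only as the premise of the generator condition, so shrinking it
  preserves the group.\<close>

lemma unitary_group_mono:
  "unitary_group_of B U \<Longrightarrow> (\<And>u w. A u w \<Longrightarrow> B u w) \<Longrightarrow> unitary_group_of A U"
  unfolding unitary_group_of_def by blast

section \<open>Dilations and the rescaled group\<close>

lemma Tsc_L2: assumes u: "u \<in> L2sp lborel" and e: "eps > 0"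
  shows "Tsc eps u \<in> L2sp lborel" "L2norm lborel (Tsc eps u) = L2norm lborel u"
proof -
  have T: "Tsc eps u = (\<lambda>x. complex_of_real (sqrt eps) * u (eps * x))" by (auto simp: Tsc_def)
  note a = L2_affine[OF u, of eps]
  show "Tsc eps u \<in> L2sp lborel" unfolding T using a(1) e by (intro L2sp_cmult) auto
  show "L2norm lborel (Tsc eps u) = L2norm lborel u" unfolding T L2norm_cmult using a(2) e by simp
qed

lemma Tsc_inverse: "eps > 0 \<Longrightarrow> Tsc eps (Tsc (1 / eps) u) = u" "eps > 0 \<Longrightarrow> Tsc (1 / eps) (Tsc eps u) = u"
proof -
  assume e: "eps > 0"
  have "complex_of_real (sqrt eps) * complex_of_real (sqrt (1 / eps)) = 1"
    using e by (simp flip: of_real_mult real_sqrt_mult)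
  then show "Tsc eps (Tsc (1 / eps) u) = u" "Tsc (1 / eps) (Tsc eps u) = u"
    using e by (auto simp: Tsc_def fun_eq_iff simp flip: mult.assoc) (simp_all add: mult.commute)
qed

lemma Tsc_lin: "Tsc eps (\<lambda>y. a * u y + b * v y) = (\<lambda>y. a * Tsc eps u y + b * Tsc eps v y)"
  by (auto simp: Tsc_def algebra_simps)

lemma Tsc_AE: "AE x in lborel. u x = v x \<Longrightarrow> eps > 0 \<Longrightarrow> AE x in lborel. Tsc eps u x = Tsc eps v x"
  unfolding Tsc_def using AE_scale[of "\<lambda>x. u x = v x" eps] by (auto elim: eventually_mono)

lemma filterlim_at_scale: "c \<noteq> 0 \<Longrightarrow> filterlim (\<lambda>t::real. t / c) (at (t0 / c)) (at t0)"
  by (rule filterlim_atI) (auto intro!: tendsto_intros simp: eventually_at_filter)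

text \<open>Conjugation by the unitary dilation and the time change t / eps^2 are dictated by A_eps
  = eps^-2 T^-1 A T.\<close>

lemma opAeps_group:
  assumes U: "unitary_group_of (opA g omega) U" and e: "eps > 0"
  shows "unitary_group_of (opAeps g omega eps) (\<lambda>t u. Tsc (1 / eps) (U (t / eps\<^sup>2) (Tsc eps u)))"
  unfolding unitary_group_of_def
proof (intro conjI allI ballI impI)
  have e': "1 / eps > 0" "eps\<^sup>2 \<noteq> 0" using e by auto
  note UL = unitary_groupD(1)[OF U]
  fix t u assume u: "u \<in> L2sp lborel"
  note Tu = Tsc_L2[OF u e]
  show "Tsc (1 / eps) (U (t / eps\<^sup>2) (Tsc eps u)) \<in> L2sp lborel" by (rule Tsc_L2(1)[OF UL[OF Tu(1)] e'(1)])
  show "L2norm lborel (Tsc (1 / eps) (U (t / eps\<^sup>2) (Tsc eps u))) = L2norm lborel u"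
    using Tsc_L2(2)[OF UL[OF Tu(1)] e'(1)] unitary_groupD(2)[OF U Tu(1)] Tu(2) by simp
  show "AE x in lborel. Tsc (1 / eps) (U (0 / eps\<^sup>2) (Tsc eps u)) x = u x"
    using Tsc_AE[OF unitary_groupD(4)[OF U Tu(1)] e'(1)] by (simp add: Tsc_inverse[OF e])
  fix s
  show "AE x in lborel. Tsc (1 / eps) (U ((s + t) / eps\<^sup>2) (Tsc eps u)) x
    = Tsc (1 / eps) (U (s / eps\<^sup>2) (Tsc eps (Tsc (1 / eps) (U (t / eps\<^sup>2) (Tsc eps u))))) x"
    using Tsc_AE[OF unitary_groupD(5)[OF U Tu(1), of "s / eps\<^sup>2" "t / eps\<^sup>2"] e'(1)]
    by (simp add: Tsc_inverse[OF e] add_divide_distrib)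
  have "L2norm lborel (\<lambda>x. Tsc (1 / eps) (U (t / eps\<^sup>2) (Tsc eps u)) x - Tsc (1 / eps) (U (s / eps\<^sup>2) (Tsc eps u)) x)
    = L2norm lborel (\<lambda>x. U (t / eps\<^sup>2) (Tsc eps u) x - U (s / eps\<^sup>2) (Tsc eps u) x)" for t
    using Tsc_L2(2)[OF L2sp_diff[OF UL[OF Tu(1)] UL[OF Tu(1)]] e'(1), of "t / eps\<^sup>2" "s / eps\<^sup>2"]
    by (simp add: Tsc_def[abs_def] right_diff_distrib)
  moreover have "((\<lambda>t. L2norm lborel (\<lambda>x. U (t / eps\<^sup>2) (Tsc eps u) x - U (s / eps\<^sup>2) (Tsc eps u) x)) \<longlongrightarrow> 0) (at s)"
    by (rule filterlim_compose[OF unitary_groupD(6)[OF U Tu(1)] filterlim_at_scale[OF e'(2)]])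
  ultimately show "((\<lambda>t. L2norm lborel (\<lambda>x. Tsc (1 / eps) (U (t / eps\<^sup>2) (Tsc eps u)) x - Tsc (1 / eps) (U (s / eps\<^sup>2) (Tsc eps u)) x)) \<longlongrightarrow> 0) (at s)"
    by simp
  fix a b v assume v: "v \<in> L2sp lborel"
  show "AE x in lborel. Tsc (1 / eps) (U (t / eps\<^sup>2) (Tsc eps (\<lambda>y. a * u y + b * v y))) x
    = a * Tsc (1 / eps) (U (t / eps\<^sup>2) (Tsc eps u)) x + b * Tsc (1 / eps) (U (t / eps\<^sup>2) (Tsc eps v)) x"
    using Tsc_AE[OF unitary_groupD(3)[OF U Tu(1) Tsc_L2(1)[OF v e], of "t / eps\<^sup>2" a b] e'(1)]
    by (simp add: Tsc_lin)
next
  have e': "1 / eps > 0" "eps\<^sup>2 \<noteq> 0" using e by auto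
  note UL = unitary_groupD(1)[OF U]
  fix u w assume A: "opAeps g omega eps u w"
  then have A': "opA g omega (Tsc eps u) (\<lambda>x. complex_of_real (eps\<^sup>2) * Tsc eps w x)" by (simp add: opAeps_def)
  let ?z = "\<lambda>h x. (U h (Tsc eps u) x - Tsc eps u x) / complex_of_real h + \<i> * (complex_of_real (eps\<^sup>2) * Tsc eps w x)"
  have L: "Tsc eps u \<in> L2sp lborel" "(\<lambda>x. complex_of_real (eps\<^sup>2) * Tsc eps w x) \<in> L2sp lborel"
    using A' unfolding opA_def form_op_def by auto
  have zL: "?z h \<in> L2sp lborel" for h
  proof -
    have "(\<lambda>x. complex_of_real (1 / h) * (U h (Tsc eps u) x - Tsc eps u x) + \<i> * (complex_of_real (eps\<^sup>2) * Tsc eps w x)) \<in> L2sp lborel"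
      by (intro L2sp_add L2sp_cmult[OF L2sp_diff[OF UL[OF L(1)] L(1)]] L2sp_cmult[OF L(2)])
    then show ?thesis by simp
  qed
  have "L2norm lborel (\<lambda>x. (Tsc (1 / eps) (U (h / eps\<^sup>2) (Tsc eps u)) x - u x) / complex_of_real h + \<i> * w x)
    = 1 / eps\<^sup>2 * L2norm lborel (?z (h / eps\<^sup>2))" for h
  proof -
    have "(Tsc (1 / eps) (U (h / eps\<^sup>2) (Tsc eps u)) x - u x) / complex_of_real h + \<i> * w x
      = complex_of_real (1 / eps\<^sup>2) * Tsc (1 / eps) (?z (h / eps\<^sup>2)) x" for x
    proof -
      have "u x = Tsc (1 / eps) (Tsc eps u) x" "w x = Tsc (1 / eps) (Tsc eps w) x" by (simp_all add: Tsc_inverse[OF e])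
      then show ?thesis using e by (simp only: Tsc_def[of "1 / eps"]) (simp add: field_simps)
    qed
    then have eq: "(\<lambda>x. (Tsc (1 / eps) (U (h / eps\<^sup>2) (Tsc eps u)) x - u x) / complex_of_real h + \<i> * w x)
      = (\<lambda>x. complex_of_real (1 / eps\<^sup>2) * Tsc (1 / eps) (?z (h / eps\<^sup>2)) x)" by (rule ext)
    show ?thesis unfolding eq L2norm_cmult Tsc_L2(2)[OF zL e'(1)] norm_of_real by simp
  qed
  moreover have "((\<lambda>h. L2norm lborel (?z (h / eps\<^sup>2))) \<longlongrightarrow> 0) (at 0)"
    using filterlim_compose[OF unitary_groupD(7)[OF U A'] filterlim_at_scale[OF e'(2), of 0, simplified]] by simp
  ultimately show "((\<lambda>h. L2norm lborel (\<lambda>x. (Tsc (1 / eps) (U (h / eps\<^sup>2) (Tsc eps u)) x - u x) / complex_of_real h + \<i> * w x)) \<longlongrightarrow> 0) (at 0)"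
    using tendsto_mult_left[of _ 0 _ "1 / eps\<^sup>2"] by simp
qed

lemma expA_group: "\<exists>U. unitary_group_of A U \<Longrightarrow> unitary_group_of A (expA A)"
  unfolding expA_def by (erule someI_ex)

text \<open>A cutoff supported in [-(n + 1), n + 1], tending to 1 pointwise, with derivative of
  order 1 / (n + 1); the outer square makes it C1 at the ends of the support.\<close>

definition eta :: "nat \<Rightarrow> real \<Rightarrow> real" where "eta n x = (max 0 (1 - (x / real (Suc n))\<^sup>2))\<^sup>2"
definition eta' :: "nat \<Rightarrow> real \<Rightarrow> real" where
  "eta' n x = 2 * max 0 (1 - (x / real (Suc n))\<^sup>2) * (- (2 * x / (real (Suc n))\<^sup>2))"

lemma eta_deriv: "(eta n has_real_derivative eta' n x) (at x)"
proof -
  have "((\<lambda>x. 1 - (x / real (Suc n))\<^sup>2) has_real_derivative (- (2 * x / (real (Suc n))\<^sup>2))) (at x)"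
    by (auto intro!: derivative_eq_intros simp: power2_eq_square)
  from DERIV_chain2[OF DERIV_max_square this] show ?thesis by (simp add: eta_def[abs_def] eta'_def)
qed

lemma eta_cont: "continuous_on UNIV (eta n)" "continuous_on UNIV (eta' n)"
  unfolding eta_def[abs_def] eta'_def[abs_def] by (intro continuous_intros; simp)+

lemma eta_zero: assumes "\<bar>x\<bar> \<ge> real (Suc n)" shows "eta n x = 0" "eta' n x = 0"
proof -
  have "1 \<le> \<bar>x\<bar> / real (Suc n)" using assms by (simp add: le_divide_eq)
  then have "1 \<le> (\<bar>x\<bar> / real (Suc n))\<^sup>2" by (rule one_le_power)
  then have "1 - (x / real (Suc n))\<^sup>2 \<le> 0" by (simp add: power_divide)
  then have "max 0 (1 - (x / real (Suc n))\<^sup>2) = 0" by simp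
  then show "eta n x = 0" "eta' n x = 0" by (simp_all only: eta_def eta'_def)
    simp_all
qed

lemma eta_le: "0 \<le> eta n x" "eta n x \<le> 1"
proof -
  have "max 0 (1 - (x / real (Suc n))\<^sup>2) \<le> 1" by simp
  then show "eta n x \<le> 1" unfolding eta_def by (intro power_le_one) auto
  show "0 \<le> eta n x" by (simp add: eta_def)
qed

lemma eta'_le: "\<bar>eta' n x\<bar> \<le> 4 / real (Suc n)"
proof (cases "\<bar>x\<bar> \<ge> real (Suc n)")
  case True then show ?thesis using eta_zero(2)[OF True] by simp
next
  case False
  have "\<bar>eta' n x\<bar> = 2 * max 0 (1 - (x / real (Suc n))\<^sup>2) * (2 * \<bar>x\<bar> / (real (Suc n))\<^sup>2)"
    by (simp add: eta'_def abs_mult)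
  also have "\<dots> \<le> 2 * 1 * (2 * real (Suc n) / (real (Suc n))\<^sup>2)"
    using False by (intro mult_mono divide_right_mono) auto
  also have "\<dots> = 4 / real (Suc n)" by (simp add: power2_eq_square del: of_nat_Suc)
  finally show ?thesis .
qed

lemma eta_lim: "(\<lambda>n. eta n x) \<longlonglongrightarrow> 1"
proof -
  have "(\<lambda>n. x / real (Suc n)) \<longlonglongrightarrow> 0"
    using tendsto_mult_left[OF LIMSEQ_Suc[OF lim_inverse_n], of x] by (simp add: divide_inverse)
  then have "(\<lambda>n. (max 0 (1 - (x / real (Suc n))\<^sup>2))\<^sup>2) \<longlonglongrightarrow> (max 0 (1 - 0\<^sup>2))\<^sup>2"
    by (intro tendsto_intros)
  then show ?thesis by (simp add: eta_def)
qed

lemma eta_measurable [measurable]: "eta n \<in> borel_measurable borel" "eta' n \<in> borel_measurable borel"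
  using eta_cont by (auto intro: borel_measurable_continuous_onI)

lemma acf_eta: "acf (\<lambda>x. complex_of_real (eta n x)) (\<lambda>x. complex_of_real (eta' n x))"
  by (rule acf_C1_real[OF eta_deriv eta_cont(2)])

lemma eta_limit_integral:
  assumes f: "integrable lborel (f :: cfun)"
  shows "(\<lambda>n. \<integral>x. complex_of_real (eta n x) * f x \<partial>lborel) \<longlonglongrightarrow> integral\<^sup>L lborel f"
proof (rule integral_dominated_convergence[where w="\<lambda>x. cmod (f x)"])
  have [measurable]: "f \<in> borel_measurable borel" using f by auto
  show "(\<lambda>x. complex_of_real (eta n x) * f x) \<in> borel_measurable lborel" for n by measurable
  show "AE x in lborel. (\<lambda>n. complex_of_real (eta n x) * f x) \<longlonglongrightarrow> f x"
  proof (rule AE_I2)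
    fix x
    have "(\<lambda>n. complex_of_real (eta n x) * f x) \<longlonglongrightarrow> complex_of_real 1 * f x"
      by (intro tendsto_intros eta_lim)
    then show "(\<lambda>n. complex_of_real (eta n x) * f x) \<longlonglongrightarrow> f x" by simp
  qed
  show "AE x in lborel. norm (complex_of_real (eta n x) * f x) \<le> cmod (f x)" for n
    using eta_le by (auto simp: norm_mult intro!: mult_left_le_one_le)
qed (use f in auto)

text \<open>With the cutoff the boundary terms vanish exactly; the error carries
  \<open>eta'\<close>, which is O(1/n) against an integrable function.\<close>

lemma H1_by_parts:
  assumes F: "H1 f f'" and P: "H1 psi e"
  shows "(\<integral>x. f' x * cnj (psi x) + f x * cnj (e x) \<partial>lborel) = 0"
proof -
  have L: "f \<in> L2sp lborel" "f' \<in> L2sp lborel" "psi \<in> L2sp lborel" "e \<in> L2sp lborel" using F P by (auto simp: H1_iff)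
  have A: "acf f f'" "acf psi e" using F P by (auto simp: H1_iff)
  let ?D = "\<lambda>x. f' x * cnj (psi x) + f x * cnj (e x)"
  have Di: "integrable lborel ?D" using L by (intro Bochner_Integration.integrable_add L2inner_integrable)
  have fp: "integrable lborel (\<lambda>x. f x * cnj (psi x))" using L by (intro L2inner_integrable)
  have [measurable]: "f \<in> borel_measurable borel" "psi \<in> borel_measurable borel" using L by (auto dest: L2spD(1))
  have AA: "acf (\<lambda>x. complex_of_real (eta n x) * (f x * cnj (psi x)))
     (\<lambda>x. complex_of_real (eta' n x) * (f x * cnj (psi x)) + complex_of_real (eta n x) * ?D x)" for n
    by (rule acf_mult[OF acf_eta acf_mult[OF A(1) acf_cnj[OF A(2)]]])
  have e'i: "integrable lborel (\<lambda>x. complex_of_real (eta' n x) * (f x * cnj (psi x)))" for n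
  proof (rule Bochner_Integration.integrable_bound[OF integrable_mult_right[OF fp, of "complex_of_real (4 / real (Suc n))"]])
    show "AE x in lborel. norm (complex_of_real (eta' n x) * (f x * cnj (psi x))) \<le> norm (complex_of_real (4 / real (Suc n)) * (f x * cnj (psi x)))"
      unfolding norm_mult[of "complex_of_real _"] norm_of_real using eta'_le
      by (intro AE_I2 mult_right_mono order_trans[OF eta'_le abs_ge_self]) simp
  qed measurable
  have ei: "integrable lborel (\<lambda>x. complex_of_real (eta n x) * ?D x)" for n
    by (rule Bochner_Integration.integrable_bound[OF Di])
      (use Di eta_le in \<open>auto simp: norm_mult intro!: mult_left_le_one_le\<close>)
  have z: "(\<integral>x. complex_of_real (eta n x) * ?D x \<partial>lborel) = - (\<integral>x. complex_of_real (eta' n x) * (f x * cnj (psi x)) \<partial>lborel)" for n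
  proof -
    let ?N = "real (Suc n)"
    let ?T = "\<lambda>x. complex_of_real (eta' n x) * (f x * cnj (psi x)) + complex_of_real (eta n x) * ?D x"
    have "(LINT x:{-?N..?N}|lborel. ?T x) = 0"
      using acf_diff[OF AA[of n], of "-?N" ?N] eta_zero(1)[of n ?N] eta_zero(1)[of n "-?N"] by simp
    moreover have "(LINT x:{-?N..?N}|lborel. ?T x) = (\<integral>x. ?T x \<partial>lborel)"
      unfolding set_lebesgue_integral_def
    proof (rule Bochner_Integration.integral_cong)
      fix x
      show "indicat_real {-?N..?N} x *\<^sub>R ?T x = ?T x"
        using eta_zero[of n x] by (cases "x \<in> {-?N..?N}") auto
    qed simp
    moreover have "(\<integral>x. ?T x \<partial>lborel) = (\<integral>x. complex_of_real (eta' n x) * (f x * cnj (psi x)) \<partial>lborel) + (\<integral>x. complex_of_real (eta n x) * ?D x \<partial>lborel)"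
      by (rule Bochner_Integration.integral_add[OF e'i ei])
    ultimately show ?thesis by (simp add: add_eq_0_iff)
  qed
  have "(\<lambda>n. \<integral>x. complex_of_real (eta n x) * ?D x \<partial>lborel) \<longlonglongrightarrow> 0"
  proof (rule Lim_null_comparison[OF always_eventually], rule allI)
    fix n
    have "norm (\<integral>x. complex_of_real (eta n x) * ?D x \<partial>lborel) \<le> (\<integral>x. norm (complex_of_real (eta' n x) * (f x * cnj (psi x))) \<partial>lborel)"
      unfolding z norm_minus_cancel by (rule integral_norm_bound)
    also have "\<dots> \<le> (\<integral>x. 4 / real (Suc n) * cmod (f x * cnj (psi x)) \<partial>lborel)"
    proof (rule integral_mono)
      show "integrable lborel (\<lambda>x. norm (complex_of_real (eta' n x) * (f x * cnj (psi x))))" using e'i by (rule integrable_norm)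
      show "integrable lborel (\<lambda>x. 4 / real (Suc n) * cmod (f x * cnj (psi x)))"
        by (rule integrable_mult_right[OF integrable_norm[OF fp]])
      show "norm (complex_of_real (eta' n x) * (f x * cnj (psi x))) \<le> 4 / real (Suc n) * cmod (f x * cnj (psi x))" for x
        unfolding norm_mult[of "complex_of_real _"] norm_of_real by (intro mult_right_mono eta'_le) simp
    qed
    also have "\<dots> = 4 * (\<integral>x. cmod (f x * cnj (psi x)) \<partial>lborel) * (1 / real (Suc n))" by simp
    finally show "norm (\<integral>x. complex_of_real (eta n x) * ?D x \<partial>lborel) \<le> 4 * (\<integral>x. cmod (f x * cnj (psi x)) \<partial>lborel) * (1 / real (Suc n))" .
  next
    show "(\<lambda>n. 4 * (\<integral>x. cmod (f x * cnj (psi x)) \<partial>lborel) * (1 / real (Suc n))) \<longlonglongrightarrow> 0"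
      using tendsto_mult_left[OF LIMSEQ_Suc[OF lim_inverse_n']] by fastforce
  qed
  then show ?thesis using LIMSEQ_unique eta_limit_integral[OF Di] by blast
qed

text \<open>Integration by parts turns the second derivative into the form with g = b0 and omega =
  1. This inclusion of relations lets \<open>unitary_group_mono\<close> transfer the group.\<close>

lemma opAhom_opA: assumes A: "opAhom b0 u w" shows "opA (\<lambda>_. b0) (\<lambda>_. 1) u w"
proof -
  obtain phi d1 d2 where u: "u \<in> L2sp lborel" and w: "w \<in> L2sp lborel" and H: "H1 phi d1" "H1 d1 d2"
    and ae: "AE x in lborel. u x = phi x" "AE x in lborel. w x = - complex_of_real b0 * d2 x"
    using A unfolding opAhom_def by blast
  show ?thesis unfolding opA_def form_op_def
  proof (intro conjI u w ballI, safe)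
    show "{(phi, dphi). H1 phi dphi \<and> (AE x in lborel. u x = complex_of_real 1 * phi x)} = {} \<Longrightarrow> False"
      using H ae by auto
    fix v f d psi e
    assume v: "v \<in> L2sp lborel" and H2: "H1 f d" "AE x in lborel. u x = complex_of_real 1 * f x"
      and H3: "H1 psi e" "AE x in lborel. v x = complex_of_real 1 * psi x"
    have L: "psi \<in> L2sp lborel" "e \<in> L2sp lborel" "d \<in> L2sp lborel" "d1 \<in> L2sp lborel" "d2 \<in> L2sp lborel"
      using H H2 H3 by (auto simp: H1_iff)
    have [measurable]: "psi \<in> borel_measurable borel" "e \<in> borel_measurable borel" "d \<in> borel_measurable borel" "d1 \<in> borel_measurable borel" "d2 \<in> borel_measurable borel"
      "v \<in> borel_measurable borel" "w \<in> borel_measurable borel" using L v w by (auto dest: L2spD(1))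
    have "AE x in lborel. f x = phi x" using H2(2) ae(1) by eventually_elim simp
    from H1_unique(2)[OF H2(1) H(1) this] have dd: "AE x in lborel. d x = d1 x" .
    have i: "integrable lborel (\<lambda>x. d2 x * cnj (psi x))" "integrable lborel (\<lambda>x. d1 x * cnj (e x))"
      using L by (auto intro: L2inner_integrable)
    have bp: "(\<integral>x. d1 x * cnj (e x) \<partial>lborel) = - (\<integral>x. d2 x * cnj (psi x) \<partial>lborel)"
      using H1_by_parts[OF H(2) H3(1)] unfolding Bochner_Integration.integral_add[OF i] by (simp add: add_eq_0_iff)
    have "(\<integral>x. complex_of_real b0 * d x * cnj (e x) \<partial>lborel) = (\<integral>x. complex_of_real b0 * (d1 x * cnj (e x)) \<partial>lborel)"
    proof (rule integral_cong_AE)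
      show "AE x in lborel. complex_of_real b0 * d x * cnj (e x) = complex_of_real b0 * (d1 x * cnj (e x))"
        using dd by eventually_elim simp
    qed measurable
    also have "\<dots> = (\<integral>x. - complex_of_real b0 * (d2 x * cnj (psi x)) \<partial>lborel)"
      unfolding Bochner_Integration.integral_mult_right_zero bp by simp
    also have "\<dots> = L2inner lborel w v" unfolding L2inner_def
    proof (rule integral_cong_AE)
      show "AE x in lborel. - complex_of_real b0 * (d2 x * cnj (psi x)) = w x * cnj (v x)"
        using ae(2) H3(2) by eventually_elim simp
    qed measurable
    finally show "(\<integral>x. complex_of_real b0 * d x * cnj (e x) \<partial>lborel) = L2inner lborel w v" .
  qed
qed

lemma opAhom_group: assumes "b0 > 0" shows "unitary_group_of (opAhom b0) (expA (opAhom b0))"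
proof -
  interpret coefficients "\<lambda>_. b0" "\<lambda>_. 1" b0 b0 1 1 by standard (use assms in auto)
  obtain U where "unitary_group_of (opA (\<lambda>_. b0) (\<lambda>_. 1)) U" using opA_group by blast
  then have "unitary_group_of (opAhom b0) U" by (rule unitary_group_mono) (rule opAhom_opA)
  then show ?thesis by (intro expA_group) blast
qed

section \<open>Bloch waves\<close>

lemma form_opD:
  assumes "form_op M R a u w"
  shows "u \<in> L2sp M" "R u \<noteq> {}" "v \<in> L2sp M \<Longrightarrow> r \<in> R u \<Longrightarrow> p \<in> R v \<Longrightarrow> a r p = L2inner M w v"
  using assms unfolding form_op_def by blast+

lemma periodic_borel_measurable:
  fixes f :: cfun
  assumes f: "f \<in> borel_measurable cell" and per: "\<And>x. f (x + 1) = f x"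
  shows "f \<in> borel_measurable borel"
proof -
  define h where "h x = indicat_real {0..1} x *\<^sub>R f x" for x
  have [measurable]: "h \<in> borel_measurable borel"
    using f unfolding cell_def h_def by (subst (asm) borel_measurable_restrict_space_iff) auto
  have "f = (\<lambda>x. h (x - of_int \<lfloor>x\<rfloor>))"
  proof
    fix x
    have "f x = f (x - of_int \<lfloor>x\<rfloor>)" using periodic_int[of f "x - of_int \<lfloor>x\<rfloor>" "\<lfloor>x\<rfloor>", OF per] by simp
    have "0 \<le> x - of_int \<lfloor>x\<rfloor>" "x - of_int \<lfloor>x\<rfloor> \<le> 1" by linarith+
    then have "x - of_int \<lfloor>x\<rfloor> \<in> {0..1}" by (simp only: atLeastAtMost_iff)
    with \<open>f x = f (x - of_int \<lfloor>x\<rfloor>)\<close> show "f x = h (x - of_int \<lfloor>x\<rfloor>)" by (simp add: h_def)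
  qed
  moreover have "(\<lambda>x. h (x - of_int \<lfloor>x\<rfloor>)) \<in> borel_measurable borel" by measurable
  ultimately show ?thesis by simp
qed

text \<open>Half-open, hence exactly 2N + 1 unit cells; for N = n + 1 it contains every point where
  \<open>eta n\<close> is nonzero.\<close>

abbreviation win :: "nat \<Rightarrow> real set" where "win N \<equiv> {- real N<..real N + 1}"

text \<open>Periodic functions repeat their cell norm in each of the 2N + 1 cells. This growth like
  sqrt(N) is what the decay 1/N of \<open>eta'\<close> has to beat later.\<close>

lemma periodic_cut:
  assumes f: "f \<in> L2sp cell" and per: "\<And>x. f (x + 1) = f x"
  shows "cut (win N) f \<in> L2sp lborel" "L2norm lborel (cut (win N) f) = sqrt (2 * real N + 1) * L2norm cell f"
proof -
  have [measurable]: "f \<in> borel_measurable borel" by (rule periodic_borel_measurable[OF L2spD(1)[OF f] per])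
  have "(\<integral>\<^sup>+x. ennreal ((cmod (cut (win N) f x))\<^sup>2) \<partial>lborel) = (\<integral>\<^sup>+x. ennreal ((cmod (f x))\<^sup>2) * indicator (win N) x \<partial>lborel)"
    by (rule nn_integral_cong) (auto simp: cut_def indicator_def)
  also have "\<dots> = (\<integral>\<^sup>+y. (\<Sum>m=-int N..int N. ennreal ((cmod (f (y + of_int m)))\<^sup>2)) * indicator {0<..1} y \<partial>lborel)"
    using nn_fold[of "\<lambda>x. ennreal ((cmod (f x))\<^sup>2)" 1 0 N] by simp
  also have "\<dots> = (\<integral>\<^sup>+y. ennreal (2 * real N + 1) * (ennreal ((cmod (f y))\<^sup>2) * indicator {0<..1} y) \<partial>lborel)"
  proof (rule nn_integral_cong)
    fix y
    have "(\<Sum>m=-int N..int N. ennreal ((cmod (f (y + of_int m)))\<^sup>2)) = (\<Sum>m=-int N..int N. ennreal ((cmod (f y))\<^sup>2))"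
      using periodic_int[of f y, OF per] by simp
    also have "\<dots> = of_nat (2 * N + 1) * ennreal ((cmod (f y))\<^sup>2)" by (simp add: nat_add_distrib nat_mult_distrib)
    also have "(of_nat (2 * N + 1) :: ennreal) = ennreal (2 * real N + 1)" by (simp add: ennreal_of_nat_eq_real_of_nat)
    finally show "(\<Sum>m=-int N..int N. ennreal ((cmod (f (y + of_int m)))\<^sup>2)) * indicator {0<..1} y = ennreal (2 * real N + 1) * (ennreal ((cmod (f y))\<^sup>2) * indicator {0<..1} y)"
      by (simp add: mult.assoc)
  qed
  also have "\<dots> = ennreal (2 * real N + 1) * (\<integral>\<^sup>+y. ennreal ((cmod (f y))\<^sup>2) \<partial>cell)"
    by (subst nn_integral_cmult) (auto simp: nn_integral_cell)
  also have "\<dots> = ennreal ((2 * real N + 1) * (L2norm cell f)\<^sup>2)" unfolding nn_L2norm[OF f] by (simp add: ennreal_mult)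
  finally have eq: "(\<integral>\<^sup>+x. ennreal ((cmod (cut (win N) f x))\<^sup>2) \<partial>lborel) = ennreal ((2 * real N + 1) * (L2norm cell f)\<^sup>2)" .
  show L: "cut (win N) f \<in> L2sp lborel"
    by (rule L2sp_nnI(1)[of _ _ "(2 * real N + 1) * (L2norm cell f)\<^sup>2"]) (auto simp: eq)
  have "(L2norm lborel (cut (win N) f))\<^sup>2 = (2 * real N + 1) * (L2norm cell f)\<^sup>2"
    using eq unfolding nn_L2norm[OF L] by simp
  then have "sqrt ((L2norm lborel (cut (win N) f))\<^sup>2) = sqrt ((2 * real N + 1) * (L2norm cell f)\<^sup>2)" by (rule arg_cong)
  then show "L2norm lborel (cut (win N) f) = sqrt (2 * real N + 1) * L2norm cell f" by (simp add: real_sqrt_mult)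
qed

lemma periodic_set_integrable:
  assumes f: "f \<in> L2sp cell" and per: "\<And>x. f (x + 1) = f x"
  shows "set_integrable lborel {a..b} f"
proof -
  obtain N where N: "\<bar>a\<bar> + \<bar>b\<bar> < real N" using reals_Archimedean2 by blast
  then have "{a..b} \<subseteq> win N" by auto
  then have "indicat_real {a..b} x *\<^sub>R cut (win N) f x = indicat_real {a..b} x *\<^sub>R f x" for x by (auto simp: cut_def indicator_def)
  then show ?thesis using L2_set_integrable_Icc(1)[OF periodic_cut(1)[OF f per, of N], of a b] by (simp only: set_integrable_def)
qed

text \<open>Only used for compactly supported \<open>f\<close>: otherwise the index set may be infinite and the sum is 0.\<close>

definition periodization :: "cfun \<Rightarrow> cfun" where
  "periodization f x = (\<Sum>m\<in>{m::int. f (x + of_int m) \<noteq> 0}. f (x + of_int m))"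

lemma periodization_eq:
  assumes z: "\<And>x. \<bar>x\<bar> > real N \<Longrightarrow> f x = 0" and x: "\<bar>x\<bar> \<le> real X"
  shows "periodization f x = (\<Sum>m=-int (N + X)..int (N + X). f (x + of_int m))"
  unfolding periodization_def
proof (rule sum.mono_neutral_left)
  show "{m::int. f (x + of_int m) \<noteq> 0} \<subseteq> {-int (N + X)..int (N + X)}"
  proof
    fix m :: int assume "m \<in> {m. f (x + of_int m) \<noteq> 0}"
    then have "\<bar>x + of_int m\<bar> \<le> real N" using z[of "x + of_int m"] by (auto simp: not_less[symmetric])
    then have "\<bar>real_of_int m\<bar> \<le> real (N + X)" using x by simp
    then show "m \<in> {-int (N + X)..int (N + X)}" by auto
  qed
qed auto

lemma periodization_periodic: "periodization f (x + 1) = periodization f x"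
  unfolding periodization_def
  by (rule sum.reindex_bij_witness[of _ "\<lambda>m. m - 1" "\<lambda>m. m + 1"]) (auto simp: algebra_simps)

lemma acf_zero: "acf (\<lambda>x. 0) (\<lambda>x. 0)"
  by (rule acfI) (auto simp: set_integrable_def set_lebesgue_integral_def)

lemma acf_add: "acf phi d \<Longrightarrow> acf psi e \<Longrightarrow> acf (\<lambda>x. phi x + psi x) (\<lambda>x. d x + e x)"
  using acf_lin[of phi d psi e 1 1] by simp

lemma acf_sum: "finite J \<Longrightarrow> (\<And>j. j \<in> J \<Longrightarrow> acf (f j) (d j)) \<Longrightarrow> acf (\<lambda>x. \<Sum>j\<in>J. f j x) (\<lambda>x. \<Sum>j\<in>J. d j x)"
  by (induction J rule: finite_induct) (auto intro: acf_zero acf_add)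

lemma L2sp_cong_space: "(\<And>x. x \<in> space M \<Longrightarrow> f x = h x) \<Longrightarrow> f \<in> L2sp M \<longleftrightarrow> h \<in> L2sp M"
  unfolding L2sp_def mem_Collect_eq
  by (intro conj_cong measurable_cong Bochner_Integration.integrable_cong) auto

lemma L2sp_cell: assumes f: "f \<in> L2sp lborel" shows "f \<in> L2sp cell"
proof -
  have [measurable]: "f \<in> borel_measurable borel" using L2spD(1)[OF f] by simp
  have "(\<integral>\<^sup>+x. ennreal ((cmod (f x))\<^sup>2) \<partial>cell) \<le> (\<integral>\<^sup>+x. ennreal ((cmod (f x))\<^sup>2) \<partial>lborel)"
    by (subst nn_integral_cell) (auto intro!: nn_integral_mono simp: indicator_def)
  also have "\<dots> = ennreal ((L2norm lborel f)\<^sup>2)" by (rule nn_L2norm[OF f])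
  finally show ?thesis by (intro L2sp_nnI(1)[of _ _ "(L2norm lborel f)\<^sup>2"]) (auto intro: measurable_cell)
qed

lemma L2sp_shift: "f \<in> L2sp lborel \<Longrightarrow> (\<lambda>x. f (x + c)) \<in> L2sp lborel"
proof -
  assume f: "f \<in> L2sp lborel"
  have [measurable]: "f \<in> borel_measurable borel" using L2spD(1)[OF f] by simp
  show ?thesis using lborel_integrable_real_affine[OF L2spD(2)[OF f], of 1 c] by (simp add: L2sp_def add.commute)
qed

lemma periodization_L2_cell:
  assumes f: "f \<in> L2sp lborel" and z: "\<And>x. \<bar>x\<bar> > real N \<Longrightarrow> f x = 0"
  shows "periodization f \<in> L2sp cell"
proof -
  have "periodization f x = (\<Sum>m=-int (N + 1)..int (N + 1). f (x + of_int m))" if "x \<in> space cell" for x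
    using that periodization_eq[OF z, where X=1 and x=x] by (simp add: space_cell)
  moreover have "(\<lambda>x. \<Sum>m=-int (N + 1)..int (N + 1). f (x + of_int m)) \<in> L2sp cell"
    by (intro L2sp_cell L2sp_sum L2sp_shift f) simp
  ultimately show ?thesis by (subst L2sp_cong_space)
qed

lemma periodization_H1per:
  assumes A: "acf f d" and L: "d \<in> L2sp lborel"
    and z: "\<And>x. \<bar>x\<bar> > real N \<Longrightarrow> f x = 0" "\<And>x. \<bar>x\<bar> > real N \<Longrightarrow> d x = 0"
  shows "H1per (periodization f) (periodization d)"
  unfolding H1per_def
proof (intro conjI allI periodization_periodic periodization_L2_cell[OF L z(2)])
  fix x
  obtain X where X: "\<bar>x\<bar> \<le> real X" using real_arch_simple by blast
  let ?J = "{-int (N + X)..int (N + X)}"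
  have eq: "periodization f y = (\<Sum>m\<in>?J. f (y + of_int m))" "periodization d y = (\<Sum>m\<in>?J. d (y + of_int m))" if "\<bar>y\<bar> \<le> real X" for y
    using periodization_eq[OF z(1) that] periodization_eq[OF z(2) that] by auto
  have "acf (\<lambda>x. \<Sum>m\<in>?J. f (x + of_int m)) (\<lambda>x. \<Sum>m\<in>?J. d (x + of_int m))"
    by (intro acf_sum acf_shift A) simp
  then have "(\<Sum>m\<in>?J. f (x + of_int m)) = (\<Sum>m\<in>?J. f (0 + of_int m)) + (LBINT y=0..x. (\<Sum>m\<in>?J. d (y + of_int m)))"
    unfolding acf_def by blast
  also have "(LBINT y=0..x. (\<Sum>m\<in>?J. d (y + of_int m))) = (LBINT y=0..x. periodization d y)"
  proof (rule interval_integral_cong)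
    fix y assume "y \<in> einterval (min 0 (ereal x)) (max 0 (ereal x))"
    then have "\<bar>y\<bar> \<le> real X" using X by (auto simp: einterval_def min_def max_def zero_ereal_def split: if_splits)
    then show "(\<Sum>m\<in>?J. d (y + of_int m)) = periodization d y" using eq(2) by simp
  qed
  finally show "periodization f x = periodization f 0 + (LBINT y=0..x. periodization d y)" using eq(1)[OF X] eq(1)[of 0] by simp
qed

text \<open>Each term of the periodization, paired with the periodic F over the cell, is an integral
  over one translate of the cell; the indices up to N + 1 in modulus reach the whole support of
  f.\<close>

lemma cell_unfold:
  assumes Fper: "\<And>x. F (x + 1) = F x" and z: "\<And>x. \<bar>x\<bar> > real N \<Longrightarrow> f x = 0"
    and i: "integrable lborel (\<lambda>x. F x * cnj (f x))"
  shows "(\<integral>x. F x * cnj (periodization f x) \<partial>cell) = (\<integral>x. F x * cnj (f x) \<partial>lborel)"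
proof -
  let ?h = "\<lambda>x. F x * cnj (f x)"
  let ?J = "{-int (N + 1)..int (N + 1)}"
  have [measurable]: "?h \<in> borel_measurable borel" using i by auto
  have Fp: "F (x + of_int m) = F x" for x m using periodic_int[of F x m] Fper by simp
  have hs: "integrable lborel (\<lambda>x. ?h (x + of_int m))" for m
    using lborel_integrable_real_affine[OF i, of 1 "of_int m"] by (simp add: add.commute)
  have si: "set_integrable lborel {0<..0 + 1} (\<lambda>x. ?h (x + of_int m * 1))" for m
    unfolding set_integrable_def using hs[of m] by (intro integrable_mult_indicator) auto
  have "(\<integral>x. F x * cnj (periodization f x) \<partial>cell) = (LINT x:{0..1}|lborel. F x * cnj (periodization f x))"
    unfolding cell_def set_lebesgue_integral_def by (rule integral_restrict_space) simp
  also have "\<dots> = (LINT x:{0..1}|lborel. \<Sum>m\<in>?J. ?h (x + of_int m))"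
    unfolding set_lebesgue_integral_def
  proof (rule Bochner_Integration.integral_cong)
    fix x
    show "indicat_real {0..1} x *\<^sub>R (F x * cnj (periodization f x)) = indicat_real {0..1} x *\<^sub>R (\<Sum>m\<in>?J. ?h (x + of_int m))"
    proof (cases "x \<in> {0..1}")
      case True
      then have "periodization f x = (\<Sum>m\<in>?J. f (x + of_int m))" using periodization_eq[OF z, where X=1 and x=x] by simp
      then show ?thesis by (simp add: Fp sum_distrib_left)
    qed simp
  qed simp
  also have "\<dots> = (LINT x:{0<..1}|lborel. \<Sum>m\<in>?J. ?h (x + of_int m))" by (rule LINT_Ioc_Icc[symmetric]) measurable
  also have "\<dots> = (\<Sum>m\<in>?J. LINT x:{0<..0 + 1}|lborel. ?h (x + of_int m * 1))"
  proof -
    have b: "{0<..0 + 1} = {0<..1::real}" by simp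
    show ?thesis using si unfolding set_lebesgue_integral_def set_integrable_def scaleR_sum_right b mult_1_right
      by (intro Bochner_Integration.integral_sum) blast
  qed
  also have "\<dots> = (LINT x:{0 - real (N + 1) * 1<..0 + (real (N + 1) + 1) * 1}|lborel. ?h x)"
    using si by (intro int_fold(2)[symmetric]) auto
  also have "\<dots> = integral\<^sup>L lborel ?h"
    unfolding set_lebesgue_integral_def
  proof (rule Bochner_Integration.integral_cong)
    fix x
    show "indicat_real {0 - real (N + 1) * 1<..0 + (real (N + 1) + 1) * 1} x *\<^sub>R ?h x = ?h x"
    proof (cases "\<bar>x\<bar> > real N")
      case False then show ?thesis by (auto simp: indicator_def)
    qed (simp add: z)
  qed simp
  finally show ?thesis .
qed

lemma acf_iexp: "acf (\<lambda>x. iexp (p * x)) (\<lambda>x. \<i> * p * iexp (p * x))"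
proof (rule acf_C1)
  fix x
  have "((\<lambda>z. exp (\<i> * of_real p * z)) has_field_derivative \<i> * p * exp (\<i> * of_real p * of_real x)) (at (of_real x))"
    by (auto intro!: derivative_eq_intros)
  from has_vector_derivative_real_field[OF this]
  show "((\<lambda>x. iexp (p * x)) has_vector_derivative \<i> * p * iexp (p * x)) (at x)" by (simp add: mult.assoc)
qed (intro continuous_intros)

section \<open>Bloch functions and the commutator estimate\<close>

locale periodic_coefficients = coefficients +
  assumes g_per: "\<And>x. g (x + 1) = g x" and w_per: "\<And>x. omega (x + 1) = omega x"
begin

definition bloch :: "real \<Rightarrow> real \<Rightarrow> cfun \<Rightarrow> bool" where
  "bloch p E phi \<longleftrightarrow> opAk g omega p phi (\<lambda>x. complex_of_real E * phi x) \<and> (\<forall>x. phi (x + 1) = phi x) \<and>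
     phi \<in> borel_measurable borel \<and> L2norm cell phi = 1"

text \<open>The cell problem yields a 1-periodic profile f with phi = omega f almost everywhere on
  the line and the weak equation for its shifted derivative d + ipf. Testing with phi itself shows
  that the energy is E, whence the bound sqrt(E / g0).\<close>

lemma bloch_obtain:
  assumes B: "bloch p E phi"
  obtains f d where "H1per f d" "acf f d" "AE x in lborel. phi x = complex_of_real (omega x) * f x"
    "\<forall>v psi e. v \<in> L2sp cell \<longrightarrow> H1per psi e \<longrightarrow> (AE x in cell. v x = complex_of_real (omega x) * psi x) \<longrightarrow>
      (\<integral>x. complex_of_real (g x) * (d x + \<i> * p * f x) * cnj (e x + \<i> * p * psi x) \<partial>cell) = E * L2inner cell phi v"
    "f \<in> L2sp cell" "L2norm cell f \<le> 1 / w0" "(\<lambda>x. d x + \<i> * p * f x) \<in> L2sp cell" "L2norm cell (\<lambda>x. d x + \<i> * p * f x) \<le> sqrt (E / g0)"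
    "phi \<in> L2sp cell"
proof -
  have per: "\<And>x. phi (x + 1) = phi x" and [measurable]: "phi \<in> borel_measurable borel" and n1: "L2norm cell phi = 1"
    using B by (auto simp: bloch_def)
  let ?R = "\<lambda>u. {(f, d). H1per f d \<and> (AE x in cell. u x = complex_of_real (omega x) * f x)}"
  let ?a = "\<lambda>(f, d) (psi, e). \<integral>x. complex_of_real (g x) * (d x + \<i> * p * f x) * cnj (e x + \<i> * p * psi x) \<partial>cell"
  have fo: "form_op cell ?R ?a phi (\<lambda>x. complex_of_real E * phi x)"
    using B unfolding bloch_def opAk_def by blast
  have pc: "phi \<in> L2sp cell" and ne: "?R phi \<noteq> {}"
    using form_opD(1,2)[OF fo] .
  have form: "(\<integral>x. complex_of_real (g x) * (d x + \<i> * p * f x) * cnj (e x + \<i> * p * psi x) \<partial>cell) = L2inner cell (\<lambda>x. complex_of_real E * phi x) v"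
    if "H1per f d" "AE x in cell. phi x = complex_of_real (omega x) * f x" "v \<in> L2sp cell" "H1per psi e"
      "AE x in cell. v x = complex_of_real (omega x) * psi x" for f d v psi e
    using form_opD(3)[OF fo, of v "(f, d)" "(psi, e)"] that by simp
  from ne have "\<exists>r. r \<in> ?R phi" by (simp only: ex_in_conv simp_thms)
  then obtain r where r: "r \<in> ?R phi" by (elim exE)
  obtain f d where fd: "r = (f, d)" by (cases r)
  have H: "H1per f d" and ae: "AE x in cell. phi x = complex_of_real (omega x) * f x" using r by (simp_all add: fd)
  have fper: "\<And>x. f (x + 1) = f x" and dper: "\<And>x. d (x + 1) = d x" and dL: "d \<in> L2sp cell"
    using H unfolding H1per_def by blast+
  have dB [measurable]: "d \<in> borel_measurable borel" by (rule periodic_borel_measurable[OF L2spD(1)[OF dL] dper])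
  have A: "acf f d" unfolding acf_def using dB periodic_set_integrable[OF dL dper] H unfolding H1per_def by blast
  have [measurable]: "f \<in> borel_measurable borel" by (rule acf_measurable[OF A])
  have aeL: "AE x in lborel. phi x = complex_of_real (omega x) * f x"
  proof (rule AE_periodic)
    show "AE x in lborel. x \<in> {0<..1} \<longrightarrow> phi x = complex_of_real (omega x) * f x"
      using ae unfolding cell_def by (subst (asm) AE_restrict_space_iff) (auto elim: eventually_mono)
  qed (simp add: per fper w_per)
  have wc: "AE x in cell. cmod (complex_of_real (1 / omega x)) \<le> 1 / w0"
    by (rule AE_I2) (use w_bounds w_pos w0 in \<open>auto simp: norm_divide abs_of_pos intro!: frac_le\<close>)
  have wm: "(\<lambda>x. complex_of_real (1 / omega x)) \<in> borel_measurable cell" by (rule measurable_cell) measurable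
  note b1 = L2sp_bdd_mult[OF pc wm wc]
  have feq: "AE x in cell. complex_of_real (1 / omega x) * phi x = f x"
    using ae by eventually_elim (use w_pos in \<open>simp add: less_imp_neq[symmetric]\<close>)
  have fm: "f \<in> borel_measurable cell" by (rule measurable_cell) measurable
  have fL: "f \<in> L2sp cell" by (rule L2sp_cong_AE[OF b1(1) fm feq])
  have "L2norm cell f = L2norm cell (\<lambda>x. complex_of_real (1 / omega x) * phi x)"
    by (rule L2norm_cong_AE[symmetric, OF L2spD(1)[OF b1(1)] fm feq])
  also have "\<dots> \<le> 1 / w0" using b1(2) w0 by (simp add: n1)
  finally have nf: "L2norm cell f \<le> 1 / w0" .
  let ?D = "\<lambda>x. d x + \<i> * p * f x"
  have DL: "?D \<in> L2sp cell" using dL fL by auto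
  have "(\<integral>x. complex_of_real (g x) * ?D x * cnj (?D x) \<partial>cell) = L2inner cell (\<lambda>x. complex_of_real E * phi x) phi"
    by (rule form[OF H ae pc H ae])
  also have "\<dots> = complex_of_real E" unfolding L2inner_cmult_left L2inner_self n1 by simp
  finally have e1: "(\<integral>x. complex_of_real (g x) * ?D x * cnj (?D x) \<partial>cell) = complex_of_real E" .
  have "(\<integral>x. complex_of_real (g x) * ?D x * cnj (?D x) \<partial>cell) = complex_of_real (\<integral>x. g x * (cmod (?D x))\<^sup>2 \<partial>cell)"
    unfolding integral_complex_of_real[symmetric] mult.assoc complex_norm_square[symmetric] by simp
  then have "complex_of_real (\<integral>x. g x * (cmod (?D x))\<^sup>2 \<partial>cell) = complex_of_real E" using e1 by simp
  then have e2: "(\<integral>x. g x * (cmod (?D x))\<^sup>2 \<partial>cell) = E" by (simp only: of_real_eq_iff)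
  have gm: "g \<in> borel_measurable cell" unfolding cell_def by (rule measurable_restrict_space1) simp
  have gi: "integrable cell (\<lambda>x. g x * (cmod (?D x))\<^sup>2)"
  proof (rule Bochner_Integration.integrable_bound[OF integrable_mult_right[OF L2spD(2)[OF DL], of g1]])
    show "(\<lambda>x. g x * (cmod (?D x))\<^sup>2) \<in> borel_measurable cell"
      using gm L2spD(1)[OF DL] by measurable
    show "AE x in cell. norm (g x * (cmod (?D x))\<^sup>2) \<le> norm (g1 * (cmod (?D x))\<^sup>2)"
      using g_bounds g_pos by (intro AE_I2) (auto simp: abs_mult abs_of_pos intro!: mult_right_mono order_trans[OF _ abs_ge_self])
  qed
  have "(\<integral>x. g0 * (cmod (?D x))\<^sup>2 \<partial>cell) \<le> (\<integral>x. g x * (cmod (?D x))\<^sup>2 \<partial>cell)"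
    using L2spD(2)[OF DL] gi g_bounds by (intro integral_mono integrable_mult_right mult_right_mono) auto
  then have "g0 * (L2norm cell ?D)\<^sup>2 \<le> E" unfolding e2 L2norm_sq by simp
  then have "(L2norm cell ?D)\<^sup>2 \<le> E / g0" using g0 by (simp add: field_simps)
  then have nD: "L2norm cell ?D \<le> sqrt (E / g0)" by (rule real_le_rsqrt)
  have "(\<integral>x. complex_of_real (g x) * (d x + \<i> * p * f x) * cnj (e x + \<i> * p * psi x) \<partial>cell) = E * L2inner cell phi v"
    if "v \<in> L2sp cell" "H1per psi e" "AE x in cell. v x = complex_of_real (omega x) * psi x" for v psi e
    using form[OF H ae that] unfolding L2inner_cmult_left .
  then have "\<forall>v psi e. v \<in> L2sp cell \<longrightarrow> H1per psi e \<longrightarrow> (AE x in cell. v x = complex_of_real (omega x) * psi x) \<longrightarrow>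
      (\<integral>x. complex_of_real (g x) * (d x + \<i> * p * f x) * cnj (e x + \<i> * p * psi x) \<partial>cell) = E * L2inner cell phi v"
    by (intro allI impI)
  from that[OF H A aeL this fL nf DL nD pc] show thesis .
qed

definition bwave :: "real \<Rightarrow> cfun \<Rightarrow> cfun" where "bwave p phi x = iexp (p * x) * phi x"

text \<open>The Bloch wave solves the eigenvalue equation but is not in L2, so it is paired with z
  through the cutoff. Both equations contain the same term with \<open>eta\<close>; their difference
  keeps only \<open>eta'\<close>, of size 4 / (n + 1), against periodic functions whose norm on the
  window grows like sqrt(2 (n + 1) + 1).\<close>

lemma bloch_commutator:
  assumes B: "bloch p E phi" and A: "opA g omega z y" and H: "H1 zt dz" and zz: "AE x in lborel. z x = complex_of_real (omega x) * zt x"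
  shows "cmod ((\<integral>x. complex_of_real (eta n x) * (y x * cnj (bwave p phi x)) \<partial>lborel)
      - E * (\<integral>x. complex_of_real (eta n x) * (z x * cnj (bwave p phi x)) \<partial>lborel))
    \<le> g1 * (4 / real (Suc n)) * (sqrt (2 * real (Suc n) + 1) * (L2norm lborel dz * (1 / w0) + L2norm lborel zt * sqrt (E / g0)))"
proof -
  let ?N = "Suc n"
  obtain f d where Hp: "H1per f d" and Af: "acf f d" and aeL: "AE x in lborel. phi x = complex_of_real (omega x) * f x"
    and form0: "\<forall>v psi e. v \<in> L2sp cell \<longrightarrow> H1per psi e \<longrightarrow> (AE x in cell. v x = complex_of_real (omega x) * psi x) \<longrightarrow>
      (\<integral>x. complex_of_real (g x) * (d x + \<i> * p * f x) * cnj (e x + \<i> * p * psi x) \<partial>cell) = E * L2inner cell phi v"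
    and fL: "f \<in> L2sp cell" and nf: "L2norm cell f \<le> 1 / w0"
    and DL: "(\<lambda>x. d x + \<i> * p * f x) \<in> L2sp cell" and nD: "L2norm cell (\<lambda>x. d x + \<i> * p * f x) \<le> sqrt (E / g0)"
    and pc: "phi \<in> L2sp cell" by (rule bloch_obtain[OF B]) (rule that)
  note form = form0[rule_format]
  define D where "D x = d x + \<i> * p * f x" for x
  have DL': "D \<in> L2sp cell" and nD': "L2norm cell D \<le> sqrt (E / g0)" using DL nD by (simp_all add: D_def[abs_def])
  have fper: "\<And>x. f (x + 1) = f x" and dper: "\<And>x. d (x + 1) = d x" using Hp unfolding H1per_def by blast+
  have Dper: "\<And>x. D (x + 1) = D x" by (simp add: D_def fper dper)
  have phiper: "\<And>x. phi (x + 1) = phi x" and [measurable]: "phi \<in> borel_measurable borel" using B by (auto simp: bloch_def)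
  have zL: "z \<in> L2sp lborel" "y \<in> L2sp lborel" using opA_L2[OF A] by auto
  have L: "zt \<in> L2sp lborel" "dz \<in> L2sp lborel" and Az: "acf zt dz" using H by (auto simp: H1_iff)
  have [measurable]: "f \<in> borel_measurable borel" "d \<in> borel_measurable borel" "D \<in> borel_measurable borel"
    "zt \<in> borel_measurable borel" "dz \<in> borel_measurable borel" "y \<in> borel_measurable borel" "z \<in> borel_measurable borel"
    using acf_measurable[OF Af] acfD(1)[OF Af] L2spD(1)[OF L(1)] L2spD(1)[OF L(2)] L2spD(1)[OF zL(1)] L2spD(1)[OF zL(2)]
    by (auto simp: D_def[abs_def])
  define e where "e x = iexp (p * x)" for x
  have ne: "cmod (e x) = 1" for x by (simp add: e_def)
  have [measurable]: "e \<in> borel_measurable borel" unfolding e_def by measurable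
  let ?W = "win ?N"
  have etaW: "x \<notin> ?W \<Longrightarrow> eta n x = 0 \<and> eta' n x = 0" for x using eta_zero[of n x] by auto
  define fc where "fc = cut ?W f"
  define Dc where "Dc = cut ?W D"
  have fcL: "fc \<in> L2sp lborel" and nfc: "L2norm lborel fc \<le> sqrt (2 * real ?N + 1) * (1 / w0)"
    unfolding fc_def periodic_cut(2)[OF fL fper] by (rule periodic_cut(1)[OF fL fper], intro mult_left_mono nf, simp)
  have DcL: "Dc \<in> L2sp lborel" and nDc: "L2norm lborel Dc \<le> sqrt (2 * real ?N + 1) * sqrt (E / g0)"
    unfolding Dc_def periodic_cut(2)[OF DL' Dper] by (rule periodic_cut(1)[OF DL' Dper], intro mult_left_mono nD', simp)
  have [measurable]: "fc \<in> borel_measurable borel" "Dc \<in> borel_measurable borel" by (auto simp: fc_def Dc_def)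
  have efc: "complex_of_real (eta n x) * f x = complex_of_real (eta n x) * fc x" "complex_of_real (eta' n x) * f x = complex_of_real (eta' n x) * fc x"
    "complex_of_real (eta n x) * D x = complex_of_real (eta n x) * Dc x" "complex_of_real (eta' n x) * D x = complex_of_real (eta' n x) * Dc x" for x
    using etaW[of x] by (auto simp: fc_def Dc_def cut_def indicator_def)
  have be: "cmod (complex_of_real (eta n x) * e x) \<le> 1" "cmod (complex_of_real (eta' n x) * e x) \<le> 4 / real ?N" for x
    using eta_le[of n x] eta'_le[of n x] by (auto simp: norm_mult ne)
  have g1: "g1 \<ge> 0" using g_pos[of 0] g_bounds[of 0] by linarith
  have mult_L2: "h \<in> L2sp lborel \<Longrightarrow> b \<in> borel_measurable borel \<Longrightarrow> (\<And>x. cmod (b x) \<le> c) \<Longrightarrow> (\<lambda>x. b x * h x) \<in> L2sp lborel" for h b c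
    by (rule L2sp_bdd_mult(1)[of h lborel b c]) auto
  \<comment> \<open>the equation for \<open>z\<close> tested with the truncated Bloch wave\<close>
  define psi where "psi x = complex_of_real (eta n x) * (e x * f x)" for x
  define dpsi where "dpsi x = complex_of_real (eta' n x) * (e x * f x) + complex_of_real (eta n x) * (e x * D x)" for x
  have Apsi: "acf psi dpsi"
  proof -
    have "acf psi (\<lambda>x. complex_of_real (eta' n x) * (e x * f x) + complex_of_real (eta n x) * (\<i> * p * e x * f x + e x * d x))"
      unfolding psi_def[abs_def] e_def by (rule acf_mult[OF acf_eta acf_mult[OF acf_iexp Af]])
    moreover have "\<i> * p * e x * f x + e x * d x = e x * D x" for x by (simp add: D_def algebra_simps)
    ultimately show ?thesis by (simp add: dpsi_def[abs_def])
  qed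
  have psiL: "psi \<in> L2sp lborel"
  proof -
    have "psi x = (complex_of_real (eta n x) * e x) * fc x" for x using efc(1)[of x] by (simp add: psi_def mult_ac) 
    then have "psi = (\<lambda>x. (complex_of_real (eta n x) * e x) * fc x)" by (rule ext)
    moreover have "(\<lambda>x. (complex_of_real (eta n x) * e x) * fc x) \<in> L2sp lborel"
      by (rule mult_L2[OF fcL _ be(1)]) measurable
    ultimately show ?thesis by (simp only:)
  qed
  have dpsi_eq: "dpsi x = (complex_of_real (eta' n x) * e x) * fc x + (complex_of_real (eta n x) * e x) * Dc x" for x
    using efc(2)[of x] efc(3)[of x] by (auto simp: dpsi_def mult_ac)
  have dpsiL: "dpsi \<in> L2sp lborel"
    unfolding dpsi_eq[abs_def] by (intro L2sp_add mult_L2[OF fcL _ be(2)] mult_L2[OF DcL _ be(1)]) measurable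
  have Hpsi: "H1 psi dpsi" using Apsi psiL dpsiL by (simp add: H1_iff)
  have eq1: "(\<integral>x. complex_of_real (g x) * dz x * cnj (dpsi x) \<partial>lborel) = L2inner lborel y (\<lambda>x. complex_of_real (omega x) * psi x)"
  proof -
    let ?R = "\<lambda>u. {(f, d). H1 f d \<and> (AE x in lborel. u x = complex_of_real (omega x) * f x)}"
    let ?a = "\<lambda>(f, d) (psi, e). \<integral>x. complex_of_real (g x) * d x * cnj (e x) \<partial>lborel"
    have "form_op lborel ?R ?a z y" using A unfolding opA_def by blast
    from form_opD(3)[OF this, of "\<lambda>x. complex_of_real (omega x) * psi x" "(zt, dz)" "(psi, dpsi)"]
    show ?thesis using H zz Hpsi w_L2[OF psiL] by simp
  qed
  have ynb: "L2inner lborel y (\<lambda>x. complex_of_real (omega x) * psi x) = (\<integral>x. complex_of_real (eta n x) * (y x * cnj (bwave p phi x)) \<partial>lborel)"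
    unfolding L2inner_def
  proof (rule integral_cong_AE)
    have [measurable]: "psi \<in> borel_measurable borel" using L2spD(1)[OF psiL] by simp
    show "(\<lambda>x. y x * cnj (complex_of_real (omega x) * psi x)) \<in> borel_measurable lborel" by measurable
    show "(\<lambda>x. complex_of_real (eta n x) * (y x * cnj (bwave p phi x))) \<in> borel_measurable lborel" unfolding bwave_def by measurable
    show "AE x in lborel. y x * cnj (complex_of_real (omega x) * psi x) = complex_of_real (eta n x) * (y x * cnj (bwave p phi x))"
      using aeL by eventually_elim (simp add: psi_def bwave_def e_def)
  qed
  \<comment> \<open>the cell equation for \<open>phi\<close> tested with the periodization of the truncated \<open>zt\<close>\<close>
  define chi where "chi x = complex_of_real (eta n x) * zt x" for x
  define dchi where "dchi x = complex_of_real (eta' n x) * zt x + complex_of_real (eta n x) * dz x" for x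
  have Achi: "acf chi dchi" unfolding chi_def[abs_def] dchi_def[abs_def] by (rule acf_mult[OF acf_eta Az])
  have eb: "cmod (complex_of_real (eta n x)) \<le> 1" "cmod (complex_of_real (eta' n x)) \<le> 4 / real ?N" for x
    using eta_le[of n x] eta'_le[of n x] by auto
  have chiL: "chi \<in> L2sp lborel" unfolding chi_def[abs_def] by (rule mult_L2[OF L(1) _ eb(1)]) measurable
  have dchiL: "dchi \<in> L2sp lborel" unfolding dchi_def[abs_def]
    by (intro L2sp_add mult_L2[OF L(1) _ eb(2)] mult_L2[OF L(2) _ eb(1)]) measurable
  have [measurable]: "chi \<in> borel_measurable borel" "dchi \<in> borel_measurable borel" using L2spD(1)[OF chiL] L2spD(1)[OF dchiL] by auto
  define ec where "ec x = iexp (- p * x)" for x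
  have nec: "cmod (ec x) \<le> 1" for x by (simp add: ec_def)
  have cec: "cnj (ec x) = e x" for x by (simp add: ec_def e_def exp_cnj)
  have [measurable]: "ec \<in> borel_measurable borel" unfolding ec_def by measurable
  define ka where "ka x = ec x * chi x" for x
  define dka where "dka x = ec x * dchi x - \<i> * p * (ec x * chi x)" for x
  have Aka: "acf ka dka"
  proof -
    have "acf ka (\<lambda>x. \<i> * (- p) * iexp (- p * x) * chi x + ec x * dchi x)"
      unfolding ka_def[abs_def] ec_def using acf_mult[OF acf_iexp[of "-p"] Achi] by simp
    then show ?thesis by (simp add: dka_def[abs_def] ec_def algebra_simps)
  qed
  have zo: "chi x = 0" "dchi x = 0" "ka x = 0" "dka x = 0" "ec x * dchi x = 0" if "\<bar>x\<bar> > real ?N" for x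
    using eta_zero[of n x] that by (simp_all add: chi_def dchi_def ka_def dka_def)
  have kaL: "ka \<in> L2sp lborel" unfolding ka_def[abs_def] by (rule mult_L2[OF chiL _ nec]) measurable
  have ecd: "(\<lambda>x. ec x * dchi x) \<in> L2sp lborel" by (rule mult_L2[OF dchiL _ nec]) measurable
  have dkaL: "dka \<in> L2sp lborel" unfolding dka_def[abs_def] using kaL ecd
    by (intro L2sp_diff L2sp_cmult) (auto simp: ka_def[abs_def])
  have Hpz: "H1per (periodization ka) (periodization dka)" by (rule periodization_H1per[OF Aka dkaL zo(3,4)])
  have pzk: "periodization ka \<in> L2sp cell" by (rule periodization_L2_cell[OF kaL zo(3)])
  have wcell: "(\<lambda>x. complex_of_real (omega x) * periodization ka x) \<in> L2sp cell"
    by (rule L2sp_bdd_mult(1)[OF pzk, of _ w1])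
      (use w_pos w_bounds in \<open>auto simp: less_imp_le intro!: measurable_cell AE_I2\<close>)
  \<comment> \<open>The factor e^(-ipx) turns the shifted derivative d/dx + ip into a plain one, so
    only e^(-ipx) times the derivative of \<open>chi\<close> survives.\<close>
  have pzsum: "periodization dka x + \<i> * p * periodization ka x = periodization (\<lambda>x. ec x * dchi x) x" for x
  proof -
    obtain X where X: "\<bar>x\<bar> \<le> real X" using real_arch_simple by blast
    let ?J = "{-int (?N + X)..int (?N + X)}"
    have 1: "periodization dka x = (\<Sum>m\<in>?J. dka (x + of_int m))" by (rule periodization_eq[OF zo(4) X])
    have 2: "periodization ka x = (\<Sum>m\<in>?J. ka (x + of_int m))" by (rule periodization_eq[OF zo(3) X])
    have 3: "periodization (\<lambda>x. ec x * dchi x) x = (\<Sum>m\<in>?J. ec (x + of_int m) * dchi (x + of_int m))" by (rule periodization_eq[OF zo(5) X])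
    show ?thesis unfolding 1 2 3 sum_distrib_left sum.distrib[symmetric] by (rule sum.cong) (auto simp: dka_def ka_def)
  qed
  have eq2: "(\<integral>x. complex_of_real (g x) * D x * cnj (periodization (\<lambda>x. ec x * dchi x) x) \<partial>cell) = E * L2inner cell phi (\<lambda>x. complex_of_real (omega x) * periodization ka x)"
    using form[OF wcell Hpz] unfolding pzsum D_def by simp
  \<comment> \<open>The window is open on the left, so vanishing is also required at |x| = n + 1,
    where the cutoff is zero.\<close>
  have supp_cut: "h x * cnj (k x) = cut ?W h x * cnj (k x)" if "\<And>x. \<bar>x\<bar> > real ?N \<Longrightarrow> k x = 0" "\<And>x. \<bar>x\<bar> = real ?N \<Longrightarrow> k x = 0" for h k :: cfun and x
  proof (cases "x \<in> ?W")
    case False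
    then have "\<bar>x\<bar> \<ge> real ?N" by (auto simp del: of_nat_Suc)
    then have "k x = 0" using that[of x] by (cases "\<bar>x\<bar> = real ?N") (auto simp del: of_nat_Suc)
    then show ?thesis by simp
  qed (simp add: cut_def)
  have zo': "ec x * dchi x = 0" "ka x = 0" if "\<bar>x\<bar> = real ?N" for x
    using eta_zero[of n x] that by (simp_all add: chi_def dchi_def ka_def)
  have gD: "integrable lborel (\<lambda>x. complex_of_real (g x) * D x * cnj (ec x * dchi x))"
  proof -
    have "integrable lborel (\<lambda>x. (complex_of_real (g x) * Dc x) * cnj (ec x * dchi x))"
      by (rule L2inner_integrable[OF mult_L2[OF DcL, of _ g1] ecd])
        (use g_bounds g_pos in \<open>auto simp: less_imp_le\<close>)
    moreover have "(complex_of_real (g x) * Dc x) * cnj (ec x * dchi x) = complex_of_real (g x) * D x * cnj (ec x * dchi x)" for x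
      using supp_cut[of "\<lambda>x. ec x * dchi x" D x, OF zo(5) zo'(1)] unfolding Dc_def by (auto simp: mult.assoc)
    ultimately show ?thesis by (simp only:)
  qed
  have u1: "(\<integral>x. complex_of_real (g x) * D x * cnj (periodization (\<lambda>x. ec x * dchi x) x) \<partial>cell) = (\<integral>x. complex_of_real (g x) * D x * cnj (ec x * dchi x) \<partial>lborel)"
    by (rule cell_unfold[where N="?N", OF _ zo(5) gD]) (simp_all add: g_per Dper)
  have phc: "cut ?W phi \<in> L2sp lborel" by (rule periodic_cut(1)[OF pc phiper])
  have pk: "integrable lborel (\<lambda>x. phi x * complex_of_real (omega x) * cnj (ka x))"
  proof -
    have "integrable lborel (\<lambda>x. (complex_of_real (omega x) * cut ?W phi x) * cnj (ka x))"
      by (rule L2inner_integrable[OF w_L2[OF phc] kaL])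
    moreover have "(complex_of_real (omega x) * cut ?W phi x) * cnj (ka x) = phi x * complex_of_real (omega x) * cnj (ka x)" for x
      using supp_cut[of ka phi x, OF zo(3) zo'(2)] by (auto simp: mult_ac)
    ultimately show ?thesis by (simp only:)
  qed
  have u2: "L2inner cell phi (\<lambda>x. complex_of_real (omega x) * periodization ka x) = (\<integral>x. phi x * complex_of_real (omega x) * cnj (ka x) \<partial>lborel)"
    using cell_unfold[of "\<lambda>x. phi x * complex_of_real (omega x)" ?N ka, OF _ zo(3) pk]
    by (simp add: L2inner_def phiper w_per mult.assoc)
  have eq3: "(\<integral>x. complex_of_real (g x) * D x * cnj (ec x * dchi x) \<partial>lborel) = E * (\<integral>x. phi x * complex_of_real (omega x) * cnj (ka x) \<partial>lborel)"
    using eq2 unfolding u1 u2 .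
  have eq4: "(\<integral>x. complex_of_real (g x) * dchi x * cnj (e x * D x) \<partial>lborel) = E * (\<integral>x. complex_of_real (eta n x) * (z x * cnj (bwave p phi x)) \<partial>lborel)"
  proof -
    have "(\<integral>x. complex_of_real (g x) * dchi x * cnj (e x * D x) \<partial>lborel) = cnj (\<integral>x. complex_of_real (g x) * D x * cnj (ec x * dchi x) \<partial>lborel)"
      by (subst Bochner_Integration.integral_cnj[symmetric]) (simp add: cec[symmetric] mult_ac)
    also have "\<dots> = E * (\<integral>x. cnj (phi x * complex_of_real (omega x) * cnj (ka x)) \<partial>lborel)"
      unfolding eq3 Bochner_Integration.integral_cnj complex_cnj_mult[of "complex_of_real E"] complex_cnj_complex_of_real ..
    also have "(\<integral>x. cnj (phi x * complex_of_real (omega x) * cnj (ka x)) \<partial>lborel) = (\<integral>x. complex_of_real (eta n x) * (z x * cnj (bwave p phi x)) \<partial>lborel)"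
    proof (rule integral_cong_AE)
      have [measurable]: "ka \<in> borel_measurable borel" using L2spD(1)[OF kaL] by simp
      show "(\<lambda>x. cnj (phi x * complex_of_real (omega x) * cnj (ka x))) \<in> borel_measurable lborel" by measurable
      show "(\<lambda>x. complex_of_real (eta n x) * (z x * cnj (bwave p phi x))) \<in> borel_measurable lborel" unfolding bwave_def by measurable
      have ee: "cnj (e x) = ec x" for x by (simp add: ec_def e_def exp_cnj)
      have bw: "bwave p phi x = e x * phi x" for x by (simp add: bwave_def e_def)
      show "AE x in lborel. cnj (phi x * complex_of_real (omega x) * cnj (ka x)) = complex_of_real (eta n x) * (z x * cnj (bwave p phi x))"
        using zz by eventually_elim (simp add: bw ka_def chi_def ee mult_ac)
    qed
    finally show ?thesis .
  qed
  \<comment> \<open>the difference of the two equations only involves \<open>eta'\<close>\<close>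
  define I1 where "I1 = (\<integral>x. (complex_of_real (g x * eta' n x) * dz x) * cnj (e x * fc x) \<partial>lborel)"
  define I2 where "I2 = (\<integral>x. (complex_of_real (g x * eta n x) * dz x) * cnj (e x * Dc x) \<partial>lborel)"
  define I3 where "I3 = (\<integral>x. (complex_of_real (g x * eta' n x) * zt x) * cnj (e x * Dc x) \<partial>lborel)"
  have gb: "cmod (complex_of_real (g x * eta' n x)) \<le> g1 * (4 / real ?N)" "cmod (complex_of_real (g x * eta n x)) \<le> g1 * 1" for x
    unfolding norm_of_real abs_mult using g_bounds[of x] g_pos[of x] eta'_le[of n x] eta_le[of n x] g1
    by - (rule mult_mono; simp del: of_nat_Suc)+
  have M: "(\<lambda>x. complex_of_real (g x * eta' n x) * dz x) \<in> L2sp lborel" "(\<lambda>x. complex_of_real (g x * eta n x) * dz x) \<in> L2sp lborel"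
    "(\<lambda>x. complex_of_real (g x * eta' n x) * zt x) \<in> L2sp lborel"
    by (rule mult_L2[OF L(2) _ gb(1)], measurable, rule mult_L2[OF L(2) _ gb(2)], measurable, rule mult_L2[OF L(1) _ gb(1)], measurable)
  have eM: "(\<lambda>x. e x * fc x) \<in> L2sp lborel" "(\<lambda>x. e x * Dc x) \<in> L2sp lborel"
    by (rule mult_L2[OF fcL, of _ 1], measurable, simp add: ne, rule mult_L2[OF DcL, of _ 1], measurable, simp add: ne)
  have s1: "(\<integral>x. complex_of_real (g x) * dz x * cnj (dpsi x) \<partial>lborel) = I1 + I2"
    unfolding I1_def I2_def
    by (subst Bochner_Integration.integral_add[OF L2inner_integrable[OF M(1) eM(1)] L2inner_integrable[OF M(2) eM(2)], symmetric])
      (auto intro!: Bochner_Integration.integral_cong simp: dpsi_eq algebra_simps)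
  have s2: "(\<integral>x. complex_of_real (g x) * dchi x * cnj (e x * D x) \<partial>lborel) = I3 + I2"
  proof -
    have "complex_of_real (g x) * dchi x * cnj (e x * D x) = (complex_of_real (g x * eta' n x) * zt x) * cnj (e x * Dc x) + (complex_of_real (g x * eta n x) * dz x) * cnj (e x * Dc x)" for x
      using etaW[of x] by (cases "x \<in> ?W") (auto simp: dchi_def Dc_def cut_def algebra_simps)
    then show ?thesis unfolding I3_def I2_def
      using Bochner_Integration.integral_add[OF L2inner_integrable[OF M(3) eM(2)] L2inner_integrable[OF M(2) eM(2)]] by simp
  qed
  have diff: "(\<integral>x. complex_of_real (eta n x) * (y x * cnj (bwave p phi x)) \<partial>lborel) - E * (\<integral>x. complex_of_real (eta n x) * (z x * cnj (bwave p phi x)) \<partial>lborel) = I1 - I3"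
    using eq1 eq4 unfolding ynb s1 s2 by (metis add_diff_cancel_right)
  let ?c = "g1 * (4 / real ?N)"
  have c0: "?c \<ge> 0" using g1 by simp
  have n_e: "L2norm lborel (\<lambda>x. e x * h x) = L2norm lborel h" for h by (simp add: L2norm_def norm_mult ne)
  have nM: "L2norm lborel (\<lambda>x. complex_of_real (g x * eta' n x) * h x) \<le> ?c * L2norm lborel h" if "h \<in> L2sp lborel" for h
  proof -
    have "L2norm lborel (\<lambda>x. complex_of_real (g x * eta' n x) * h x) \<le> \<bar>?c\<bar> * L2norm lborel h"
      by (rule L2sp_bdd_mult(2)[OF that _ AE_I2[OF gb(1)]]) measurable
    then show ?thesis unfolding abs_of_nonneg[OF c0] .
  qed
  have b1: "cmod I1 \<le> (?c * L2norm lborel dz) * (sqrt (2 * real ?N + 1) * (1 / w0))"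
  proof -
    have "cmod I1 \<le> L2norm lborel (\<lambda>x. complex_of_real (g x * eta' n x) * dz x) * L2norm lborel (\<lambda>x. e x * fc x)"
      using L2inner_bound[OF M(1) eM(1)] by (simp add: L2inner_def I1_def)
    also have "\<dots> \<le> (?c * L2norm lborel dz) * (sqrt (2 * real ?N + 1) * (1 / w0))"
      unfolding n_e by (intro mult_mono nM L nfc mult_nonneg_nonneg c0) auto
    finally show ?thesis .
  qed
  have b3: "cmod I3 \<le> (?c * L2norm lborel zt) * (sqrt (2 * real ?N + 1) * sqrt (E / g0))"
  proof -
    have "cmod I3 \<le> L2norm lborel (\<lambda>x. complex_of_real (g x * eta' n x) * zt x) * L2norm lborel (\<lambda>x. e x * Dc x)"
      using L2inner_bound[OF M(3) eM(2)] by (simp add: L2inner_def I3_def)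
    also have "\<dots> \<le> (?c * L2norm lborel zt) * (sqrt (2 * real ?N + 1) * sqrt (E / g0))"
      unfolding n_e by (intro mult_mono nM L nDc mult_nonneg_nonneg c0) auto
    finally show ?thesis .
  qed
  have "cmod (I1 - I3) \<le> cmod I1 + cmod I3" by (rule norm_triangle_ineq4)
  also have "\<dots> \<le> (?c * L2norm lborel dz) * (sqrt (2 * real ?N + 1) * (1 / w0)) + (?c * L2norm lborel zt) * (sqrt (2 * real ?N + 1) * sqrt (E / g0))"
    using b1 b3 by (rule add_mono)
  also have "\<dots> = ?c * (sqrt (2 * real ?N + 1) * (L2norm lborel dz * (1 / w0) + L2norm lborel zt * sqrt (E / g0)))"
    by (simp add: distrib_left mult_ac)
  finally show ?thesis unfolding diff .
qed

end

section \<open>Wave packets in the operator domain\<close>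

text \<open>The cutoff makes the pairing absolutely integrable in (k, x): on its window b has norm
  at most B for each k, and G is integrable on [-R, R], so Fubini applies.\<close>

lemma packet_pairing:
  assumes bm: "(\<lambda>(x, k). b x k) \<in> borel_measurable (borel \<Otimes>\<^sub>M borel)"
    and y: "y \<in> L2sp lborel" and G: "G \<in> L2sp lborel"
    and bL: "\<And>k. k \<in> {-R..R} \<Longrightarrow> cut (win (Suc n)) (\<lambda>x. b x k) \<in> L2sp lborel"
    and bM: "\<And>k. k \<in> {-R..R} \<Longrightarrow> L2norm lborel (cut (win (Suc n)) (\<lambda>x. b x k)) \<le> B"
  defines "T \<equiv> (\<lambda>k. \<integral>x. complex_of_real (eta n x) * (b x k * cnj (y x)) \<partial>lborel)"
  shows "set_integrable lborel {-R..R} (\<lambda>k. G k * T k)"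
    "(\<integral>x. complex_of_real (eta n x) * ((LINT k:{-R..R}|lborel. G k * b x k) * cnj (y x)) \<partial>lborel) = (LINT k:{-R..R}|lborel. G k * T k)"
proof -
  note [measurable] = bm
  have [measurable]: "y \<in> borel_measurable borel" "G \<in> borel_measurable borel" using L2spD(1)[OF y] L2spD(1)[OF G] by auto
  let ?I = "indicat_real {-R..R}"
  define f where "f k x = (?I k *\<^sub>R G k) * (complex_of_real (eta n x) * (b x k * cnj (y x)))" for k x
  have fm: "(\<lambda>(k, x). f k x) \<in> borel_measurable (lborel \<Otimes>\<^sub>M lborel)" unfolding f_def by measurable
  have cutb: "complex_of_real (eta n x) * b x k = complex_of_real (eta n x) * cut (win (Suc n)) (\<lambda>x. b x k) x" for x k
    using eta_zero(1)[of n x] by (cases "x \<in> win (Suc n)") (auto simp: cut_def)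
  have fk: "integrable lborel (f k) \<and> (\<integral>x. cmod (f k x) \<partial>lborel) \<le> (?I k *\<^sub>R cmod (G k)) * (B * L2norm lborel y)" for k
  proof (cases "k \<in> {-R..R}")
    case False
    then have "f k = (\<lambda>x. 0)" by (simp add: f_def[abs_def])
    then show ?thesis using False by simp
  next
    case True
    define c where "c = cut (win (Suc n)) (\<lambda>x. b x k)"
    have cL: "c \<in> L2sp lborel" and cM: "L2norm lborel c \<le> B" using bL[OF True] bM[OF True] by (auto simp: c_def)
    have [measurable]: "c \<in> borel_measurable borel" using L2spD(1)[OF cL] by simp
    have fe: "f k x = G k * (complex_of_real (eta n x) * (c x * cnj (y x)))" for x
      using True cutb[of x k] by (simp add: f_def c_def flip: mult.assoc)
    note ci = L2_integrable_mult(1,2)[OF cL L2sp_cnj[OF y]]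
    have i: "integrable lborel (\<lambda>x. complex_of_real (eta n x) * (c x * cnj (y x)))"
      by (rule Bochner_Integration.integrable_bound[OF ci(1)])
        (use eta_le in \<open>auto simp: norm_mult intro!: mult_left_le_one_le\<close>)
    have 1: "integrable lborel (f k)" using integrable_mult_right[OF i, of "G k"] by (simp add: fe[abs_def])
    have "(\<integral>x. cmod (f k x) \<partial>lborel) \<le> (\<integral>x. cmod (G k) * (cmod (c x) * cmod (cnj (y x))) \<partial>lborel)"
    proof (rule integral_mono)
      show "integrable lborel (\<lambda>x. cmod (f k x))" using 1 by (rule integrable_norm)
      show "integrable lborel (\<lambda>x. cmod (G k) * (cmod (c x) * cmod (cnj (y x))))"
        using integrable_norm[OF ci(1)] by (simp add: norm_mult)
      show "cmod (f k x) \<le> cmod (G k) * (cmod (c x) * cmod (cnj (y x)))" for x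
        unfolding fe norm_mult norm_of_real using eta_le[of n x]
        by (intro mult_left_mono mult_left_le_one_le) auto
    qed
    also have "\<dots> = cmod (G k) * (\<integral>x. cmod (c x) * cmod (cnj (y x)) \<partial>lborel)" by simp
    also have "\<dots> \<le> cmod (G k) * (L2norm lborel c * L2norm lborel (\<lambda>x. cnj (y x)))" using ci(2) by (intro mult_left_mono) auto
    also have "\<dots> \<le> cmod (G k) * (B * L2norm lborel y)" unfolding L2norm_cnj by (intro mult_left_mono mult_right_mono cM) simp_all
    finally show ?thesis using 1 True by simp
  qed
  have i: "integrable (lborel \<Otimes>\<^sub>M lborel) (\<lambda>(k, x). f k x)"
  proof (rule lborel_pair.Fubini_integrable[OF fm])
    have gi: "integrable lborel (\<lambda>k. (?I k *\<^sub>R cmod (G k)) * (B * L2norm lborel y))"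
      using set_integrable_norm[OF L2_set_integrable_Icc(1)[OF G]] by (intro integrable_mult_left) (simp add: set_integrable_def)
    have "integrable lborel (\<lambda>k. \<integral>x. cmod (f k x) \<partial>lborel)"
    proof (rule Bochner_Integration.integrable_bound[OF gi])
      show "(\<lambda>k. \<integral>x. cmod (f k x) \<partial>lborel) \<in> borel_measurable lborel" using fm by measurable
      show "AE k in lborel. norm (\<integral>x. cmod (f k x) \<partial>lborel) \<le> norm ((?I k *\<^sub>R cmod (G k)) * (B * L2norm lborel y))"
        using fk by (intro AE_I2) (simp add: Bochner_Integration.integral_nonneg abs_of_nonneg order_trans[OF _ abs_ge_self])
    qed
    then show "integrable lborel (\<lambda>k. \<integral>x. norm ((\<lambda>(k, x). f k x) (k, x)) \<partial>lborel)" by simp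
    show "AE k in lborel. integrable lborel (\<lambda>x. (\<lambda>(k, x). f k x) (k, x))" using fk by simp
  qed
  have fx: "(\<integral>x. f k x \<partial>lborel) = ?I k *\<^sub>R (G k * T k)" for k
    unfolding f_def T_def by (subst Bochner_Integration.integral_mult_right_zero) simp
  show "set_integrable lborel {-R..R} (\<lambda>k. G k * T k)"
    using lborel_pair.integrable_fst'[OF i] by (simp add: fx set_integrable_def)
  have "(\<integral>k. f k x \<partial>lborel) = complex_of_real (eta n x) * ((LINT k:{-R..R}|lborel. G k * b x k) * cnj (y x))" for x
  proof -
    have "(\<integral>k. f k x \<partial>lborel) = (\<integral>k. (complex_of_real (eta n x) * cnj (y x)) * (?I k *\<^sub>R (G k * b x k)) \<partial>lborel)"
      unfolding f_def by (rule Bochner_Integration.integral_cong) (auto simp: mult_ac)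
    also have "\<dots> = (complex_of_real (eta n x) * cnj (y x)) * (LINT k:{-R..R}|lborel. G k * b x k)"
      unfolding set_lebesgue_integral_def by (rule Bochner_Integration.integral_mult_right_zero)
    finally show ?thesis by (simp add: mult_ac)
  qed
  then have "(\<integral>x. complex_of_real (eta n x) * ((LINT k:{-R..R}|lborel. G k * b x k) * cnj (y x)) \<partial>lborel) = (\<integral>x. \<integral>k. f k x \<partial>lborel \<partial>lborel)"
    by simp
  also have "\<dots> = (\<integral>k. \<integral>x. f k x \<partial>lborel \<partial>lborel)" using lborel_pair.Fubini_integral[OF i] by simp
  also have "\<dots> = (LINT k:{-R..R}|lborel. G k * T k)" unfolding fx set_lebesgue_integral_def ..
  finally show "(\<integral>x. complex_of_real (eta n x) * ((LINT k:{-R..R}|lborel. G k * b x k) * cnj (y x)) \<partial>lborel) = (LINT k:{-R..R}|lborel. G k * T k)" .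
qed

lemma commutator_rate: "(\<lambda>n. (4 / real (Suc n)) * sqrt (2 * real (Suc n) + 1)) \<longlonglongrightarrow> 0"
proof -
  have eq: "(4 / real (Suc n)) * sqrt (2 * real (Suc n) + 1) = 4 * sqrt (2 * (1 / real (Suc n)) + (1 / real (Suc n))\<^sup>2)" for n
  proof -
    have "2 * (1 / real (Suc n)) + (1 / real (Suc n))\<^sup>2 = (2 * real (Suc n) + 1) / (real (Suc n))\<^sup>2"
      by (simp add: field_simps power2_eq_square del: of_nat_Suc)
    then show ?thesis by (simp add: real_sqrt_divide del: of_nat_Suc)
  qed
  have "(\<lambda>n. 4 * sqrt (2 * (1 / real (Suc n)) + (1 / real (Suc n))\<^sup>2)) \<longlonglongrightarrow> 4 * sqrt (2 * 0 + 0\<^sup>2)"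
    by (intro tendsto_intros LIMSEQ_Suc[OF lim_1_over_n])
  then show ?thesis unfolding eq by simp
qed

context periodic_coefficients
begin

text \<open>By \<open>opA_selfadjoint\<close> it is enough that <V, y> = <W, z> whenever A z = y.
  The cutoff and Fubini reduce this to single Bloch waves, where the commutator bound of order
  n^(-1/2), uniform in k because e k <= Em, disappears in the limit.\<close>

theorem packet_opA:
  assumes pm: "(\<lambda>(x, p). phi x p) \<in> borel_measurable (borel :: (real \<times> real) measure)"
    and bl: "\<And>k. k \<in> {-R..R} \<Longrightarrow> bloch (eps * k) (e k) (\<lambda>x. phi x (eps * k))"
    and eM: "\<And>k. k \<in> {-R..R} \<Longrightarrow> e k \<le> Em"
    and G: "G \<in> L2sp lborel" and eG: "(\<lambda>k. complex_of_real (e k) * G k) \<in> L2sp lborel"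
  defines "V \<equiv> (\<lambda>x. LINT k:{-R..R}|lborel. G k * bwave (eps * k) (\<lambda>x. phi x (eps * k)) x)"
    and "W \<equiv> (\<lambda>x. LINT k:{-R..R}|lborel. (complex_of_real (e k) * G k) * bwave (eps * k) (\<lambda>x. phi x (eps * k)) x)"
  assumes V: "V \<in> L2sp lborel" and W: "W \<in> L2sp lborel"
  shows "opA g omega V W"
proof (rule opA_selfadjoint[OF V W])
  fix z y assume A: "opA g omega z y"
  have zy: "z \<in> L2sp lborel" "y \<in> L2sp lborel" using opA_L2[OF A] by auto
  obtain zt dz where H: "H1 zt dz" and zz: "AE x in lborel. z x = complex_of_real (omega x) * zt x"
    using form_opD(2)[OF A[unfolded opA_def]] by auto
  define b where "b x k = bwave (eps * k) (\<lambda>x. phi x (eps * k)) x" for x k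
  have [measurable]: "(\<lambda>(x, p). phi x p) \<in> borel_measurable (borel \<Otimes>\<^sub>M borel)" using pm by (simp add: borel_prod)
  have bm: "(\<lambda>(x, k). b x k) \<in> borel_measurable (borel \<Otimes>\<^sub>M borel)" unfolding b_def bwave_def by measurable
  have bcut: "cut (win N) (\<lambda>x. b x k) \<in> L2sp lborel \<and> L2norm lborel (cut (win N) (\<lambda>x. b x k)) \<le> sqrt (2 * real N + 1)"
    if k: "k \<in> {-R..R}" for k N
  proof -
    have B: "bloch (eps * k) (e k) (\<lambda>x. phi x (eps * k))" by (rule bl[OF k])
    have pL: "(\<lambda>x. phi x (eps * k)) \<in> L2sp cell" by (rule bloch_obtain[OF B])
    have pp: "\<And>x. phi (x + 1) (eps * k) = phi x (eps * k)" and n1: "L2norm cell (\<lambda>x. phi x (eps * k)) = 1" using B by (auto simp: bloch_def)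
    note c = periodic_cut[OF pL pp, of N]
    have eq: "cut (win N) (\<lambda>x. b x k) = (\<lambda>x. iexp (eps * k * x) * cut (win N) (\<lambda>x. phi x (eps * k)) x)"
      by (auto simp: cut_def b_def bwave_def)
    have "(\<lambda>x. iexp (eps * k * x) * cut (win N) (\<lambda>x. phi x (eps * k)) x) \<in> L2sp lborel"
      by (rule L2sp_bdd_mult(1)[OF c(1), of _ 1]) auto
    moreover have "L2norm lborel (\<lambda>x. iexp (eps * k * x) * cut (win N) (\<lambda>x. phi x (eps * k)) x) = L2norm lborel (cut (win N) (\<lambda>x. phi x (eps * k)))"
      unfolding L2norm_def norm_mult norm_exp_i_times mult_1 ..
    ultimately show ?thesis unfolding eq using c(2) n1 by simp
  qed
  define T1 where "T1 n k = (\<integral>x. complex_of_real (eta n x) * (b x k * cnj (y x)) \<partial>lborel)" for n k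
  define T2 where "T2 n k = (\<integral>x. complex_of_real (eta n x) * (b x k * cnj (z x)) \<partial>lborel)" for n k
  have X: "set_integrable lborel {-R..R} (\<lambda>k. G k * T1 n k)"
    "(\<integral>x. complex_of_real (eta n x) * (V x * cnj (y x)) \<partial>lborel) = (LINT k:{-R..R}|lborel. G k * T1 n k)" for n
    using packet_pairing[OF bm zy(2) G, of R n "sqrt (2 * real (Suc n) + 1)"] bcut unfolding T1_def V_def b_def[symmetric] by blast+
  have Y: "set_integrable lborel {-R..R} (\<lambda>k. (complex_of_real (e k) * G k) * T2 n k)"
    "(\<integral>x. complex_of_real (eta n x) * (W x * cnj (z x)) \<partial>lborel) = (LINT k:{-R..R}|lborel. (complex_of_real (e k) * G k) * T2 n k)" for n
    using packet_pairing[OF bm zy(1) eG, of R n "sqrt (2 * real (Suc n) + 1)"] bcut unfolding T2_def W_def b_def[symmetric] by blast+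
  let ?C = "L2norm lborel dz * (1 / w0) + L2norm lborel zt * sqrt (Em / g0)"
  define r where "r n = g1 * ((4 / real (Suc n)) * sqrt (2 * real (Suc n) + 1)) * ?C" for n
  have g1: "g1 \<ge> 0" using g_pos[of 0] g_bounds[of 0] by linarith
  have comm: "cmod (T1 n k - e k * T2 n k) \<le> r n" if k: "k \<in> {-R..R}" for n k
  proof -
    have c: "T1 n k = cnj (\<integral>x. complex_of_real (eta n x) * (y x * cnj (b x k)) \<partial>lborel)"
      "T2 n k = cnj (\<integral>x. complex_of_real (eta n x) * (z x * cnj (b x k)) \<partial>lborel)"
      unfolding T1_def T2_def by (subst Bochner_Integration.integral_cnj[symmetric], simp add: mult_ac)+
    have "T1 n k - e k * T2 n k = cnj ((\<integral>x. complex_of_real (eta n x) * (y x * cnj (b x k)) \<partial>lborel) - e k * (\<integral>x. complex_of_real (eta n x) * (z x * cnj (b x k)) \<partial>lborel))"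
      unfolding c by (simp only: complex_cnj_diff complex_cnj_mult complex_cnj_complex_of_real)
    then have "cmod (T1 n k - e k * T2 n k) = cmod ((\<integral>x. complex_of_real (eta n x) * (y x * cnj (b x k)) \<partial>lborel) - e k * (\<integral>x. complex_of_real (eta n x) * (z x * cnj (b x k)) \<partial>lborel))"
      by (simp only: complex_mod_cnj)
    also have "\<dots> \<le> g1 * (4 / real (Suc n)) * (sqrt (2 * real (Suc n) + 1) * (L2norm lborel dz * (1 / w0) + L2norm lborel zt * sqrt (e k / g0)))"
      unfolding b_def by (rule bloch_commutator[OF bl[OF k] A H zz])
    also have "\<dots> \<le> g1 * (4 / real (Suc n)) * (sqrt (2 * real (Suc n) + 1) * ?C)"
      using eM[OF k] g0 g1 by (intro mult_left_mono add_left_mono real_sqrt_le_mono divide_right_mono) auto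
    also have "\<dots> = r n" by (simp add: r_def)
    finally show ?thesis .
  qed
  have Gi: "set_integrable lborel {-R..R} (\<lambda>k. cmod (G k))" using L2_set_integrable_Icc(1)[OF G] by (rule set_integrable_norm)
  define J where "J = (LINT k:{-R..R}|lborel. cmod (G k))"
  have bd: "cmod ((\<integral>x. complex_of_real (eta n x) * (V x * cnj (y x)) \<partial>lborel) - (\<integral>x. complex_of_real (eta n x) * (W x * cnj (z x)) \<partial>lborel)) \<le> r n * J" for n
  proof -
    have "(LINT k:{-R..R}|lborel. G k * T1 n k) - (LINT k:{-R..R}|lborel. (complex_of_real (e k) * G k) * T2 n k)
      = (LINT k:{-R..R}|lborel. G k * T1 n k - (complex_of_real (e k) * G k) * T2 n k)"
      by (rule set_integral_diff(2)[OF X(1) Y(1), symmetric])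
    also have "cmod \<dots> \<le> (LINT k:{-R..R}|lborel. cmod (G k * T1 n k - (complex_of_real (e k) * G k) * T2 n k))"
      by (rule set_integral_norm_bound[OF set_integral_diff(1)[OF X(1) Y(1)]])
    also have "\<dots> \<le> (LINT k:{-R..R}|lborel. r n * cmod (G k))"
    proof (rule set_integral_mono)
      show "set_integrable lborel {-R..R} (\<lambda>k. cmod (G k * T1 n k - (complex_of_real (e k) * G k) * T2 n k))"
        by (rule set_integrable_norm[OF set_integral_diff(1)[OF X(1) Y(1)]])
      show "set_integrable lborel {-R..R} (\<lambda>k. r n * cmod (G k))" using Gi by simp
      fix k assume k: "k \<in> {-R..R}"
      have "G k * T1 n k - (complex_of_real (e k) * G k) * T2 n k = (T1 n k - e k * T2 n k) * G k" by (simp add: algebra_simps)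
      then show "cmod (G k * T1 n k - (complex_of_real (e k) * G k) * T2 n k) \<le> r n * cmod (G k)"
        using comm[OF k, of n] by (simp add: norm_mult mult_right_mono)
    qed
    also have "\<dots> = r n * J" by (simp add: J_def)
    finally show ?thesis unfolding X(2) Y(2) .
  qed
  have "r \<longlonglongrightarrow> g1 * 0 * ?C" unfolding r_def by (intro tendsto_intros commutator_rate)
  then have r0: "(\<lambda>n. r n * J) \<longlonglongrightarrow> 0" using tendsto_mult_right[of r 0 sequentially J] by simp
  have "(\<lambda>n. (\<integral>x. complex_of_real (eta n x) * (V x * cnj (y x)) \<partial>lborel) - (\<integral>x. complex_of_real (eta n x) * (W x * cnj (z x)) \<partial>lborel)) \<longlonglongrightarrow> 0"
    by (rule Lim_null_comparison[OF always_eventually r0]) (use bd in auto)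
  moreover have "(\<lambda>n. (\<integral>x. complex_of_real (eta n x) * (V x * cnj (y x)) \<partial>lborel) - (\<integral>x. complex_of_real (eta n x) * (W x * cnj (z x)) \<partial>lborel))
    \<longlonglongrightarrow> L2inner lborel V y - L2inner lborel W z"
    unfolding L2inner_def by (intro tendsto_diff eta_limit_integral L2inner_integrable V W zy)
  ultimately show "L2inner lborel V y = L2inner lborel W z" using LIMSEQ_unique by fastforce
qed

end

section \<open>Packets evolving by scalar phases\<close>

definition phase :: "(real \<Rightarrow> real) \<Rightarrow> real \<Rightarrow> cfun \<Rightarrow> cfun" where
  "phase lam t G k = iexp (- (t * lam k)) * G k"

lemma phase_L2:
  assumes G: "G \<in> L2sp lborel" and [measurable]: "lam \<in> borel_measurable borel"
  shows "phase lam t G \<in> L2sp lborel"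
  unfolding phase_def[abs_def] by (rule L2sp_bdd_mult(1)[OF G, of _ 1]) auto

lemma ktrunc_lin_L2norm:
  assumes K: "contr_kernel K" and f: "f \<in> L2sp lborel" "h \<in> L2sp lborel" "p \<in> L2sp lborel"
  shows "L2norm lborel (\<lambda>x. (ktrunc K f R x - ktrunc K h R x) * a + b * ktrunc K p R x) \<le> L2norm lborel (\<lambda>k. (f k - h k) * a + b * p k)"
proof -
  have d: "(\<lambda>k. f k - h k) \<in> L2sp lborel" by (rule L2sp_diff[OF f(1,2)])
  have m: "(\<lambda>k. a * (f k - h k) + b * p k) \<in> L2sp lborel" by (intro L2sp_add L2sp_cmult d f)
  note kL = contr_kernelD(3)[OF K]
  have "L2norm lborel (\<lambda>x. a * (ktrunc K f R x - ktrunc K h R x) + b * ktrunc K p R x) = L2norm lborel (ktrunc K (\<lambda>k. a * (f k - h k) + b * p k) R)"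
  proof (rule L2norm_cong_AE)
    show "(\<lambda>x. a * (ktrunc K f R x - ktrunc K h R x) + b * ktrunc K p R x) \<in> borel_measurable lborel"
      by (intro L2spD(1) L2sp_add L2sp_cmult L2sp_diff kL f)
    show "ktrunc K (\<lambda>k. a * (f k - h k) + b * p k) R \<in> borel_measurable lborel" by (intro L2spD(1) kL m)
    show "AE x in lborel. a * (ktrunc K f R x - ktrunc K h R x) + b * ktrunc K p R x = ktrunc K (\<lambda>k. a * (f k - h k) + b * p k) R x"
      using ktrunc_lin[OF K d f(3), of a b R] ktrunc_diff[OF K f(1,2), of R] by eventually_elim simp
  qed
  also have "\<dots> \<le> L2norm lborel (\<lambda>k. a * (f k - h k) + b * p k)" by (rule ktrunc_contr[OF K m])
  finally show ?thesis by (simp add: mult.commute[of a])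
qed

text \<open>The contraction property moves the difference quotient to the frequency side, where a
  bounded multiplier leaves a second-order Taylor remainder of size at most |h| L^2, pointwise in
  k.\<close>

lemma ktrunc_curve:
  assumes K: "contr_kernel K" and G: "G \<in> L2sp lborel" and [measurable]: "lam \<in> borel_measurable borel"
    and lb: "\<And>k. \<bar>lam k\<bar> \<le> L"
  shows "((\<lambda>h. L2norm lborel (\<lambda>x. (ktrunc K (phase lam (t + h) G) R x - ktrunc K (phase lam t G) R x) / complex_of_real h
      + \<i> * ktrunc K (\<lambda>k. complex_of_real (lam k) * phase lam t G k) R x)) \<longlongrightarrow> 0) (at 0)"
proof -
  have pL: "phase lam t G \<in> L2sp lborel" for t by (rule phase_L2[OF G]) measurable
  have lL: "(\<lambda>k. complex_of_real (lam k) * phase lam t G k) \<in> L2sp lborel"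
    by (rule L2sp_bdd_mult(1)[OF pL, of _ L]) (use lb in auto)
  have le: "L2norm lborel (\<lambda>x. (ktrunc K (phase lam (t + h) G) R x - ktrunc K (phase lam t G) R x) / complex_of_real h
      + \<i> * ktrunc K (\<lambda>k. complex_of_real (lam k) * phase lam t G k) R x) \<le> (\<bar>h\<bar> * L\<^sup>2) * L2norm lborel G" if h: "h \<noteq> 0" for h
  proof -
    have "L2norm lborel (\<lambda>x. (ktrunc K (phase lam (t + h) G) R x - ktrunc K (phase lam t G) R x) / complex_of_real h
      + \<i> * ktrunc K (\<lambda>k. complex_of_real (lam k) * phase lam t G k) R x)
      \<le> L2norm lborel (\<lambda>k. (phase lam (t + h) G k - phase lam t G k) * (1 / complex_of_real h) + \<i> * (complex_of_real (lam k) * phase lam t G k))"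
      using ktrunc_lin_L2norm[OF K pL[of "t + h"] pL[of t] lL, where R = R and a = "1 / complex_of_real h" and b = "\<i>"] by simp
    also have "\<dots> \<le> L2norm lborel (\<lambda>k. complex_of_real (\<bar>h\<bar> * L\<^sup>2) * G k)"
    proof (rule L2norm_mono)
      show "(\<lambda>k. (phase lam (t + h) G k - phase lam t G k) * (1 / complex_of_real h) + \<i> * (complex_of_real (lam k) * phase lam t G k)) \<in> L2sp lborel"
        using L2sp_add[OF L2sp_cmult[OF L2sp_diff[OF pL[of "t + h"] pL[of t]], of "1 / complex_of_real h"] L2sp_cmult[OF lL, of "\<i>"]]
        by (simp add: mult.commute)
      show "(\<lambda>k. complex_of_real (\<bar>h\<bar> * L\<^sup>2) * G k) \<in> L2sp lborel" by (rule L2sp_cmult[OF G])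
      show "AE k in lborel. cmod ((phase lam (t + h) G k - phase lam t G k) * (1 / complex_of_real h) + \<i> * (complex_of_real (lam k) * phase lam t G k))
         \<le> cmod (complex_of_real (\<bar>h\<bar> * L\<^sup>2) * G k)"
      proof (rule AE_I2)
        fix k
        let ?x = "- (h * lam k)"
        have e: "iexp (- ((t + h) * lam k)) = iexp (- (t * lam k)) * iexp ?x" by (simp add: algebra_simps flip: exp_add)
        have eq: "(phase lam (t + h) G k - phase lam t G k) * (1 / complex_of_real h) + \<i> * (complex_of_real (lam k) * phase lam t G k)
          = (iexp (- (t * lam k)) * G k) * ((iexp ?x - (1 + \<i> * ?x)) / complex_of_real h)"
          unfolding phase_def e using h by (simp add: field_simps)
        have "cmod (iexp ?x - (\<Sum>j\<le>1. (\<i> * ?x) ^ j / fact j)) \<le> \<bar>?x\<bar> ^ (Suc 1) / fact (Suc 1)" by (rule iexp_approx1)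
        then have "cmod (iexp ?x - (1 + \<i> * ?x)) \<le> (h * lam k)\<^sup>2 / 2" by (simp add: power2_eq_square)
        also have "\<dots> \<le> h\<^sup>2 * L\<^sup>2"
        proof -
          have "(lam k)\<^sup>2 \<le> L\<^sup>2" using lb[of k] by (metis abs_ge_zero abs_le_square_iff abs_of_nonneg order_trans)
          then have "h\<^sup>2 * (lam k)\<^sup>2 \<le> h\<^sup>2 * L\<^sup>2" by (intro mult_left_mono) auto
          moreover have "0 \<le> h\<^sup>2 * (lam k)\<^sup>2" by simp
          ultimately show ?thesis unfolding power_mult_distrib by linarith
        qed
        finally have "cmod ((iexp ?x - (1 + \<i> * ?x)) / complex_of_real h) \<le> h\<^sup>2 * L\<^sup>2 / \<bar>h\<bar>"
          by (simp add: norm_divide divide_right_mono)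
        also have "\<dots> = \<bar>h\<bar> * L\<^sup>2" using h by (simp add: power2_eq_square field_simps abs_mult_self_eq flip: abs_mult)
        finally have "cmod ((iexp ?x - (1 + \<i> * ?x)) / complex_of_real h) \<le> \<bar>h\<bar> * L\<^sup>2" .
        from mult_left_mono[OF this norm_ge_zero[of "G k"]]
        have "cmod (iexp (- (t * lam k)) * G k) * cmod ((iexp ?x - (1 + \<i> * ?x)) / complex_of_real h) \<le> (\<bar>h\<bar> * L\<^sup>2) * cmod (G k)"
          by (simp only: norm_mult[of "iexp _"] norm_exp_i_times mult_1 mult.commute[of "\<bar>h\<bar> * L\<^sup>2"])
        also have "\<dots> = cmod (complex_of_real (\<bar>h\<bar> * L\<^sup>2) * G k)"
          by (simp only: norm_mult norm_of_real abs_mult abs_idempotent abs_power2)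
        finally show "cmod ((phase lam (t + h) G k - phase lam t G k) * (1 / complex_of_real h) + \<i> * (complex_of_real (lam k) * phase lam t G k))
         \<le> cmod (complex_of_real (\<bar>h\<bar> * L\<^sup>2) * G k)"
          by (simp only: eq norm_mult)
      qed
    qed
    also have "\<dots> = (\<bar>h\<bar> * L\<^sup>2) * L2norm lborel G" unfolding L2norm_cmult by (simp add: abs_mult norm_mult norm_power)
    finally show ?thesis .
  qed
  have lim: "((\<lambda>h. (\<bar>h\<bar> * L\<^sup>2) * L2norm lborel G) \<longlongrightarrow> (\<bar>0\<bar> * L\<^sup>2) * L2norm lborel G) (at (0::real))"
    by (intro tendsto_intros)
  show ?thesis
  proof (rule Lim_null_comparison)
    show "((\<lambda>h. (\<bar>h\<bar> * L\<^sup>2) * L2norm lborel G) \<longlongrightarrow> 0) (at (0::real))" using lim by simp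
    show "\<forall>\<^sub>F h in at 0. norm (L2norm lborel (\<lambda>x. (ktrunc K (phase lam (t + h) G) R x - ktrunc K (phase lam t G) R x) / complex_of_real h
      + \<i> * ktrunc K (\<lambda>k. complex_of_real (lam k) * phase lam t G k) R x)) \<le> (\<bar>h\<bar> * L\<^sup>2) * L2norm lborel G"
      using le by (simp add: eventually_at_filter)
  qed
qed

text \<open>Differentiation under the integral in integrated form: Fubini, and the fundamental
  theorem for each single exponential.\<close>

lemma acf_ktrunc_Kp:
  assumes G: "G \<in> L2sp lborel" and G': "G' \<in> L2sp lborel" and eq: "\<And>k. k \<in> {-R..R} \<Longrightarrow> G' k = \<i> * complex_of_real k * G k"
  shows "H1 (ktrunc Kp G R) (ktrunc Kp G' R)"
proof -
  note kL = contr_kernelD(3)[OF contr_kernel_iexp]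
  have [measurable]: "G \<in> borel_measurable borel" "G' \<in> borel_measurable borel" using L2spD(1)[OF G] L2spD(1)[OF G'] by auto
  let ?c = "complex_of_real (1 / sqrt (2 * pi))"
  have si: "set_integrable lborel {-R..R} (\<lambda>k. G k * Kp x k)" for x
  proof -
    have "integrable lborel (\<lambda>k. indicator {-R..R} k *\<^sub>R (G k * Kp x k))"
      by (rule Bochner_Integration.integrable_bound[OF L2_set_integrable_Icc(1)[OF G, unfolded set_integrable_def, of "-R" R]])
        (auto simp: norm_mult)
    then show ?thesis by (simp add: set_integrable_def)
  qed
  have "acf (ktrunc Kp G R) (ktrunc Kp G' R)"
  proof (rule acfI)
    show "ktrunc Kp G' R \<in> borel_measurable borel" using L2spD(1)[OF kL[OF G', of R]] by simp
    show "set_integrable lborel {a..b} (ktrunc Kp G' R)" for a b by (rule L2_set_integrable_Icc(1)[OF kL[OF G']])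
    fix a b :: real assume ab: "a \<le> b"
    let ?f = "\<lambda>x k. indicat_real {a..b} x *\<^sub>R (indicat_real {-R..R} k *\<^sub>R (G' k * Kp x k))"
    have "(LINT x:{a..b}|lborel. ktrunc Kp G' R x) = ?c * (\<integral>x. \<integral>k. ?f x k \<partial>lborel \<partial>lborel)"
      unfolding set_lebesgue_integral_def ktrunc_def Bochner_Integration.integral_scaleR_right
      by (simp only: mult_scaleR_right[symmetric] Bochner_Integration.integral_mult_right_zero)
    also have "(\<integral>x. \<integral>k. ?f x k \<partial>lborel \<partial>lborel) = (\<integral>k. \<integral>x. ?f x k \<partial>lborel \<partial>lborel)"
    proof (rule fubini_dominated(2))
      show "(\<lambda>(x, k). ?f x k) \<in> borel_measurable (borel \<Otimes>\<^sub>M borel)" by measurable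
      show "integrable lborel (indicator {a..b} :: real \<Rightarrow> real)" by (intro integrable_real_indicator) (auto simp: emeasure_lborel_Icc_eq)
      show "integrable lborel (\<lambda>k. indicator {-R..R} k *\<^sub>R cmod (G' k))"
        using set_integrable_norm[OF L2_set_integrable_Icc(1)[OF G']] by (simp add: set_integrable_def)
      show "cmod (?f x k) \<le> indicator {a..b} x * (indicator {-R..R} k *\<^sub>R cmod (G' k))" for x k
        by (simp add: norm_mult)
    qed
    also have "\<dots> = (\<integral>k. indicator {-R..R} k *\<^sub>R (G k * Kp b k) - indicator {-R..R} k *\<^sub>R (G k * Kp a k) \<partial>lborel)"
    proof (rule Bochner_Integration.integral_cong)
      fix k
      show "(\<integral>x. ?f x k \<partial>lborel) = indicator {-R..R} k *\<^sub>R (G k * Kp b k) - indicator {-R..R} k *\<^sub>R (G k * Kp a k)"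
      proof (cases "k \<in> {-R..R}")
        case True
        have "(\<integral>x. ?f x k \<partial>lborel) = (\<integral>x. G k * (indicat_real {a..b} x *\<^sub>R (\<i> * complex_of_real k * Kp x k)) \<partial>lborel)"
          using True by (intro Bochner_Integration.integral_cong) (auto simp: eq[OF True] mult_ac)
        also have "\<dots> = G k * (LINT x:{a..b}|lborel. \<i> * complex_of_real k * Kp x k)"
          unfolding set_lebesgue_integral_def by (rule Bochner_Integration.integral_mult_right_zero)
        also have "(LINT x:{a..b}|lborel. \<i> * complex_of_real k * Kp x k) = Kp b k - Kp a k"
          by (rule acf_diff[OF acf_iexp[of k] ab, symmetric])
        finally show ?thesis using True by (simp add: right_diff_distrib)
      qed simp
    qed simp
    also have "\<dots> = (LINT k:{-R..R}|lborel. G k * Kp b k) - (LINT k:{-R..R}|lborel. G k * Kp a k)"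
      unfolding set_lebesgue_integral_def using si unfolding set_integrable_def
      by (intro Bochner_Integration.integral_diff)
    finally show "ktrunc Kp G R b - ktrunc Kp G R a = (LINT y:{a..b}|lborel. ktrunc Kp G' R y)"
      by (simp add: ktrunc_def right_diff_distrib)
  qed
  then show ?thesis using kL[OF G] kL[OF G'] by (simp add: H1_iff)
qed

lemma opAhom_packet:
  assumes G: "G \<in> L2sp lborel" and lam: "\<And>k. k \<in> {-R..R} \<Longrightarrow> lam k = b0 * k\<^sup>2" and lG: "(\<lambda>k. complex_of_real (lam k) * G k) \<in> L2sp lborel"
  shows "opAhom b0 (ktrunc Kp G R) (ktrunc Kp (\<lambda>k. complex_of_real (lam k) * G k) R)"
proof -
  note kL = contr_kernelD(3)[OF contr_kernel_iexp]
  have [measurable]: "G \<in> borel_measurable borel" using L2spD(1)[OF G] by simp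
  \<comment> \<open>The multipliers ik and -k^2 of the first two derivatives, cut to [-R, R] so that
    the products stay in L2.\<close>
  define G1 where "G1 k = complex_of_real (indicator {-R..R} k * k) * (\<i> * G k)" for k
  define G2 where "G2 k = complex_of_real (indicator {-R..R} k * k\<^sup>2) * (- G k)" for k
  have G1L: "G1 \<in> L2sp lborel" unfolding G1_def
    by (rule L2sp_bdd_mult(1)[OF L2sp_cmult[OF G], of _ "\<bar>R\<bar>"]) (auto simp: indicator_def)
  have G2L: "G2 \<in> L2sp lborel" unfolding G2_def
    by (rule L2sp_bdd_mult(1)[OF L2sp_minus[OF G], of _ "R\<^sup>2"]) (auto simp: indicator_def norm_power power2_le_iff_abs_le abs_le_iff intro!: power_mono)
  have H1: "H1 (ktrunc Kp G R) (ktrunc Kp G1 R)"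
    by (rule acf_ktrunc_Kp[OF G G1L]) (simp add: G1_def)
  have H2: "H1 (ktrunc Kp G1 R) (ktrunc Kp G2 R)"
    by (rule acf_ktrunc_Kp[OF G1L G2L]) (simp add: G1_def G2_def power2_eq_square mult_ac)
  have eq: "ktrunc Kp (\<lambda>k. complex_of_real (lam k) * G k) R x = - complex_of_real b0 * ktrunc Kp G2 R x" for x
  proof -
    have "(LINT k:{-R..R}|lborel. complex_of_real (lam k) * G k * Kp x k) = (\<integral>k. - complex_of_real b0 * (indicat_real {-R..R} k *\<^sub>R (G2 k * Kp x k)) \<partial>lborel)"
      unfolding set_lebesgue_integral_def
      by (rule Bochner_Integration.integral_cong) (auto simp: indicator_def G2_def lam)
    also have "\<dots> = - complex_of_real b0 * (LINT k:{-R..R}|lborel. G2 k * Kp x k)"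
      unfolding set_lebesgue_integral_def by (rule Bochner_Integration.integral_mult_right_zero)
    finally show ?thesis by (simp add: ktrunc_def)
  qed
  show ?thesis unfolding opAhom_def
    using kL[OF G] kL[OF lG] H1 H2 eq by blast
qed

section \<open>Band kernels\<close>

text \<open>Continuity in k allows the supremum to be taken over a countable dense subset;
  compactness bounds it.\<close>

lemma compact_SUP_measurable:
  fixes h :: "real \<Rightarrow> real \<Rightarrow> real"
  assumes S: "compact S" "S \<noteq> {}" and cont: "\<And>x. continuous_on S (h x)"
    and m: "\<And>k. k \<in> S \<Longrightarrow> (\<lambda>x. h x k) \<in> borel_measurable borel"
  shows "(\<lambda>x. SUP k\<in>S. h x k) \<in> borel_measurable borel" "k \<in> S \<Longrightarrow> h x k \<le> (SUP k\<in>S. h x k)"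
proof -
  obtain T where T: "countable T" "T \<subseteq> S" "S \<subseteq> closure T" using separable by blast
  have cl: "closure T = S" using T closure_minimal[OF T(2) compact_imp_closed[OF S(1)]] by blast
  then have T0: "T \<noteq> {}" using S(2) by auto
  have bdd: "bdd_above (h x ` S)" for x
    using compact_imp_bounded[OF compact_continuous_image[OF cont S(1)]] by (rule bounded_imp_bdd_above)
  have bT: "bdd_above (h x ` T)" for x using bdd T(2) by (rule bdd_above_mono[OF _ image_mono])
  have "(SUP k\<in>S. h x k) = (SUP k\<in>T. h x k)" for x
  proof (rule antisym)
    show "(SUP k\<in>S. h x k) \<le> (SUP k\<in>T. h x k)"
    proof (rule cSUP_least[OF S(2)])
      fix k assume "k \<in> S"
      then show "h x k \<le> (SUP k\<in>T. h x k)"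
        using continuous_le_on_closure[of T "h x" k "SUP k\<in>T. h x k"] cSUP_upper[OF _ bT] cont unfolding cl by blast
    qed
    show "(SUP k\<in>T. h x k) \<le> (SUP k\<in>S. h x k)" by (rule cSUP_subset_mono[OF T0 bdd T(2)]) simp
  qed
  moreover have "(\<lambda>x. SUP k\<in>T. h x k) \<in> borel_measurable borel"
    by (rule borel_measurable_cSUP[OF T(1)]) (use m T(2) bT in auto)
  ultimately show "(\<lambda>x. SUP k\<in>S. h x k) \<in> borel_measurable borel" by simp
  show "k \<in> S \<Longrightarrow> h x k \<le> (SUP k\<in>S. h x k)" by (rule cSUP_upper[OF _ bdd])
qed

text \<open>A sequential limit of difference quotients is what shows that the derivative depends
  measurably on a parameter.\<close>

lemma vector_derivative_LIMSEQ:
  fixes f :: "real \<Rightarrow> complex"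
  assumes d: "f differentiable (at k within S)" and y: "y \<longlonglongrightarrow> k" "\<And>n. y n \<in> S" "\<And>n. y n \<noteq> k"
  shows "(\<lambda>n. (f (y n) - f k) / complex_of_real (y n - k)) \<longlonglongrightarrow> vector_derivative f (at k within S)"
proof -
  let ?D = "vector_derivative f (at k within S)"
  have "(f has_vector_derivative ?D) (at k within S)" using d by (simp add: vector_derivative_works)
  then have l: "((\<lambda>y. norm ((f y - f k) - (y - k) *\<^sub>R ?D) / norm (y - k)) \<longlongrightarrow> 0) (at k within S)"
    unfolding has_vector_derivative_def has_derivative_iff_norm by blast
  have "filterlim y (at k within S) sequentially"
    unfolding filterlim_at using y by auto
  from filterlim_compose[OF l this]
  have l2: "(\<lambda>n. norm ((f (y n) - f k) - (y n - k) *\<^sub>R ?D) / norm (y n - k)) \<longlonglongrightarrow> 0" .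
  have "norm ((f (y n) - f k) / complex_of_real (y n - k) - ?D) = norm ((f (y n) - f k) - (y n - k) *\<^sub>R ?D) / norm (y n - k)" for n
  proof -
    have "(f (y n) - f k) / complex_of_real (y n - k) - ?D = ((f (y n) - f k) - (y n - k) *\<^sub>R ?D) / complex_of_real (y n - k)"
      using y(3)[of n] by (simp add: field_simps scaleR_conv_of_real flip: of_real_diff)
    then show ?thesis by (simp only: norm_divide norm_of_real real_norm_def)
  qed
  then have "(\<lambda>n. norm ((f (y n) - f k) / complex_of_real (y n - k) - ?D)) \<longlonglongrightarrow> 0" using l2 by simp
  then have "(\<lambda>n. (f (y n) - f k) / complex_of_real (y n - k) - ?D) \<longlonglongrightarrow> 0" by (rule tendsto_norm_zero_cancel)
  then show ?thesis by (simp add: LIM_zero_iff)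
qed

text \<open>
  Measurability matters here: \<open>esssup\<close> of a non-measurable function is the top element, which
  \<open>real_of_ereal\<close> sends to 0, so \<open>ess_sup\<close> would not bound anything.
\<close>

lemma C1norm_measurable:
  fixes h :: "real \<Rightarrow> real \<Rightarrow> complex"
  assumes kap: "0 < kap"
    and m: "\<And>k. k \<in> {-kap..kap} \<Longrightarrow> (\<lambda>x. h x k) \<in> borel_measurable borel"
    and d: "\<And>x k. k \<in> {-kap..kap} \<Longrightarrow> h x differentiable (at k within {-kap..kap})"
    and c: "\<And>x. continuous_on {-kap..kap} (\<lambda>k. vector_derivative (h x) (at k within {-kap..kap}))"
  shows "(\<lambda>x. C1norm kap (h x)) \<in> borel_measurable borel"
    "k \<in> {-kap..kap} \<Longrightarrow> cmod (h x k) \<le> C1norm kap (h x)"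
proof -
  let ?S = "{-kap..kap}"
  let ?D = "\<lambda>x k. vector_derivative (h x) (at k within ?S)"
  have S: "compact ?S" "?S \<noteq> {}" using kap by auto
  have hc: "continuous_on ?S (\<lambda>k. cmod (h x k))" for x
    using d by (intro continuous_on_norm differentiable_imp_continuous_on) (simp add: differentiable_on_def)
  have dm: "(\<lambda>x. ?D x k) \<in> borel_measurable borel" if k: "k \<in> ?S" for k
  proof -
    \<comment> \<open>Approaches k from the side that stays inside the interval: from the left for k
      > 0, from the right otherwise, with steps of at most kap.\<close>
    define y where "y n = k + (if k > 0 then -1 else 1) * (kap * (1 / real (Suc n)))" for n
    have yb: "0 < kap * (1 / real (Suc n))" "kap * (1 / real (Suc n)) \<le> kap" for n using kap by (auto simp: field_simps)
    have yS: "y n \<in> ?S" "y n \<noteq> k" for n using yb[of n] k unfolding y_def by (auto split: if_splits)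
    have "y \<longlonglongrightarrow> k + (if k > 0 then -1 else 1) * (kap * 0)"
      unfolding y_def by (intro tendsto_intros LIMSEQ_Suc[OF lim_1_over_n])
    then have yk: "y \<longlonglongrightarrow> k" by simp
    have ym: "(\<lambda>x. (h x (y n) - h x k) / complex_of_real (y n - k)) \<in> borel_measurable borel" for n
      using m[OF yS(1)] m[OF k] by measurable
    show ?thesis
      by (rule borel_measurable_LIMSEQ_metric[OF ym]) (rule vector_derivative_LIMSEQ[OF d[OF k] yk yS])
  qed
  have nm: "(\<lambda>x. cmod (h x k)) \<in> borel_measurable borel" "(\<lambda>x. cmod (?D x k)) \<in> borel_measurable borel" if "k \<in> ?S" for k
    using m[OF that] dm[OF that] by measurable
  note A = compact_SUP_measurable[where h = "\<lambda>x k. cmod (h x k)", OF S hc nm(1)]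
  note B = compact_SUP_measurable[where h = "\<lambda>x k. cmod (?D x k)", OF S continuous_on_norm[OF c] nm(2)]
  show "(\<lambda>x. C1norm kap (h x)) \<in> borel_measurable borel"
    unfolding C1norm_def by (rule borel_measurable_add[OF A(1) B(1)])
  assume k: "k \<in> ?S"
  show "cmod (h x k) \<le> C1norm kap (h x)"
  proof -
    have "cmod (h x k) \<le> (SUP k\<in>?S. cmod (h x k))" by (rule A(2)) (use k in auto)
    moreover have "cmod (?D x k) \<le> (SUP k\<in>?S. cmod (?D x k))" by (rule B(2)) (use k in auto)
    ultimately show ?thesis using norm_ge_zero[of "?D x k"] unfolding C1norm_def by linarith
  qed
qed

text \<open>The essential supremum lies between 0 and c as an extended real, so
  \<open>real_of_ereal\<close> does not collapse an infinite value to 0; nonnegativity uses that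
  Lebesgue measure is not zero.\<close>

lemma ess_sup_AE:
  assumes h: "h \<in> borel_measurable borel" and nn: "\<And>x. 0 \<le> h x" and b: "AE x in lborel. h x \<le> c"
  shows "AE x in lborel. h x \<le> ess_sup h" "0 \<le> ess_sup h"
proof -
  let ?e = "esssup lborel (\<lambda>x. ereal (h x))"
  have hm: "(\<lambda>x. ereal (h x)) \<in> borel_measurable lborel" using h by simp
  have le: "?e \<le> ereal c" by (rule esssup_I[OF hm]) (use b in simp)
  have ae: "AE x in lborel. ereal (h x) \<le> ?e" by (rule esssup_AE)
  have "0 \<le> ?e"
  proof (rule ccontr)
    assume "\<not> 0 \<le> ?e"
    then have "\<not> ereal (h x) \<le> ?e" for x using nn[of x] by (meson ereal_less_eq(5) order_trans)
    then have "AE x in (lborel :: real measure). False" using ae by simp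
    then have "emeasure lborel (space lborel :: real set) = 0" using ae_filter_eq_bot_iff[of "lborel :: real measure"] by (simp add: trivial_limit_def)
    then show False by simp
  qed
  then obtain r where r: "?e = ereal r" "0 \<le> r" using le by (cases ?e) auto
  then show "AE x in lborel. h x \<le> ess_sup h" "0 \<le> ess_sup h" using ae by (simp_all add: ess_sup_def)
qed

text \<open>Differences of Bloch functions have no orthogonality to offer. With frequencies in one
  zone only, the pointwise bound by 1 replaces it, while \<open>packet_bound\<close> still exploits
  the exponentials across cells.\<close>

lemma bounded_contr_kernel:
  assumes vm: "(\<lambda>(x, p). v x p) \<in> borel_measurable (borel :: (real \<times> real) measure)"
    and per: "\<And>x p. v (x + 1) p = v x p" and le: "AE x in lborel. \<forall>p. cmod (v x p) \<le> 1"
    and supp: "\<And>x p. p \<notin> BZ0 \<Longrightarrow> v x p = 0"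
  shows "contr_kernel (\<lambda>x p. iexp (p * x) * v x p)"
  unfolding contr_kernel_def
proof (intro conjI ballI allI)
  have [measurable]: "(\<lambda>(x, p). v x p) \<in> borel_measurable (borel \<Otimes>\<^sub>M borel)" using vm by (simp add: borel_prod)
  have "(\<lambda>(x, p). iexp (p * x) * v x p) \<in> borel_measurable (borel \<Otimes>\<^sub>M borel)" by measurable
  then show "(\<lambda>(x, p). iexp (p * x) * v x p) \<in> borel_measurable borel" by (simp add: borel_prod)
  fix f R assume f: "f \<in> L2sp lborel"
  have [measurable]: "f \<in> borel_measurable borel" using L2spD(1)[OF f] by simp
  define H where "H x p = cut {-R..R} f p * v x p" for x p
  have cL: "cut {-R..R} f \<in> L2sp lborel" using f by auto
  have "(\<lambda>(x, p). H x p) \<in> borel_measurable (borel \<Otimes>\<^sub>M borel)" unfolding H_def cut_def by measurable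
  then have Hm: "(\<lambda>(x, p). H x p) \<in> borel_measurable borel" by (simp add: borel_prod)
  let ?B = "(L2norm lborel (cut {-R..R} f))\<^sup>2"
  have ae: "AE x in lborel. (\<integral>\<^sup>+k. ennreal ((cmod (cut BZ0 (H x) k))\<^sup>2) \<partial>lborel) \<le> ennreal ?B"
    using le
  proof eventually_elim
    fix x assume x: "\<forall>p. cmod (v x p) \<le> 1"
    have "(\<integral>\<^sup>+k. ennreal ((cmod (cut BZ0 (H x) k))\<^sup>2) \<partial>lborel) \<le> (\<integral>\<^sup>+k. ennreal ((cmod (cut {-R..R} f k))\<^sup>2) \<partial>lborel)"
    proof (intro nn_integral_mono ennreal_leI power_mono)
      fix k
      have "cmod (cut BZ0 (H x) k) \<le> cmod (H x k)" by (rule cmod_cut_le)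
      also have "\<dots> \<le> cmod (cut {-R..R} f k) * 1" unfolding H_def norm_mult using x by (intro mult_left_mono) auto
      finally show "cmod (cut BZ0 (H x) k) \<le> cmod (cut {-R..R} f k)" by simp
    qed simp
    then show "(\<integral>\<^sup>+k. ennreal ((cmod (cut BZ0 (H x) k))\<^sup>2) \<partial>lborel) \<le> ennreal ?B" unfolding nn_L2norm[OF cL] .
  qed
  have B: "(\<integral>\<^sup>+x. (\<integral>\<^sup>+k. ennreal ((cmod (cut BZ0 (H x) k))\<^sup>2) \<partial>lborel) * indicator {0<..1} x \<partial>lborel) \<le> ennreal ?B"
  proof -
    have "(\<integral>\<^sup>+x. (\<integral>\<^sup>+k. ennreal ((cmod (cut BZ0 (H x) k))\<^sup>2) \<partial>lborel) * indicator {0<..1} x \<partial>lborel) \<le> (\<integral>\<^sup>+x. ennreal ?B * indicator {0<..1} (x::real) \<partial>lborel)"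
      by (rule nn_integral_mono_AE) (use ae in \<open>auto elim!: eventually_mono simp: indicator_def\<close>)
    also have "\<dots> = ennreal ?B" by (subst nn_integral_cmult_indicator) auto
    finally show ?thesis .
  qed
  note P = packet_bound[OF Hm _ _ B]
  have Hper: "H (x + 1) k = H x k" for x k by (simp add: H_def per)
  have ind: "indicator BZ0 k *\<^sub>R (iexp (k * x) * H x k) = indicator {-R..R} k *\<^sub>R (f k * (iexp (k * x) * v x k))" for x k
    using supp[of k x] by (cases "k \<in> BZ0") (auto simp: H_def cut_def mult_ac)
  have W: "(LINT k:BZ0|lborel. iexp (k * x) * H x k) = (LINT k:{-R..R}|lborel. f k * (iexp (k * x) * v x k))" for x
    unfolding set_lebesgue_integral_def ind ..
  show "AE x in lborel. set_integrable lborel {-R..R} (\<lambda>k. f k * (iexp (k * x) * v x k))"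
    using P(2)[OF Hper] unfolding set_integrable_def ind by simp
  have kt: "ktrunc (\<lambda>x p. iexp (p * x) * v x p) f R = (\<lambda>x. complex_of_real (1 / sqrt (2 * pi)) * (LINT k:BZ0|lborel. iexp (k * x) * H x k))"
    unfolding ktrunc_def[abs_def] W ..
  have L: "(\<lambda>x. LINT k:BZ0|lborel. iexp (k * x) * H x k) \<in> L2sp lborel" using P(3)[OF Hper] by simp
  show "ktrunc (\<lambda>x p. iexp (p * x) * v x p) f R \<in> L2sp lborel" unfolding kt by (rule L2sp_cmult[OF L])
  have "L2norm lborel (ktrunc (\<lambda>x p. iexp (p * x) * v x p) f R) \<le> (1 / sqrt (2 * pi)) * sqrt (2 * pi * ?B)"
    unfolding kt L2norm_cmult using P(4)[OF Hper] by (simp add: norm_divide divide_right_mono)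
  also have "\<dots> = L2norm lborel (cut {-R..R} f)" by (simp add: real_sqrt_mult L2norm_def)
  finally show "L2norm lborel (ktrunc (\<lambda>x p. iexp (p * x) * v x p) f R) \<le> L2norm lborel (cut {-R..R} f)" .
qed

section \<open>Brillouin zones\<close>

lemma BZ_Suc: "BZ (Suc n) = {- real (Suc n) * pi<..- real n * pi} \<union> {real n * pi<..real (Suc n) * pi}"
  by (auto simp: BZ_def)

lemma BZ_ex: "\<exists>n. k \<in> BZ (Suc n)"
proof (cases "k > 0")
  case True
  define n where "n = nat (\<lceil>k / pi\<rceil> - 1)"
  have "\<lceil>k / pi\<rceil> \<ge> 1" using True by (simp add: le_ceiling_iff)
  then have "real n = of_int \<lceil>k / pi\<rceil> - 1" by (simp add: n_def)
  then have "real n < k / pi" "k / pi \<le> real n + 1" by linarith+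
  then have "k \<in> BZ (Suc n)" by (simp add: BZ_Suc field_simps)
  then show ?thesis ..
next
  case False
  define n where "n = nat \<lfloor>- k / pi\<rfloor>"
  have "\<lfloor>- k / pi\<rfloor> \<ge> 0" using False by (simp add: field_simps)
  then have "real n = of_int \<lfloor>- k / pi\<rfloor>" by (simp add: n_def)
  then have "real n \<le> - k / pi" "- k / pi < real n + 1" by linarith+
  then have "k \<in> BZ (Suc n)" by (simp add: BZ_Suc field_simps)
  then show ?thesis ..
qed

lemma BZ_unique: assumes "k \<in> BZ (Suc m)" "k \<in> BZ (Suc n)" shows "m = n"
proof -
  have m: "(- (real m * pi) - pi < k \<and> k \<le> - (real m * pi)) \<or> (real m * pi < k \<and> k \<le> real m * pi + pi)"
    and n: "(- (real n * pi) - pi < k \<and> k \<le> - (real n * pi)) \<or> (real n * pi < k \<and> k \<le> real n * pi + pi)"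
    using assms by (auto simp: BZ_Suc algebra_simps)
  have nn: "0 \<le> real m * pi" "0 \<le> real n * pi" by auto
  have "real m * pi < real n * pi + pi" "real n * pi < real m * pi + pi" using m n nn by linarith+
  then have "real m * pi < (real n + 1) * pi" "real n * pi < (real m + 1) * pi" by (auto simp: algebra_simps)
  then show ?thesis by simp
qed

text \<open>Counted from 0, so that \<open>zone k + s\<close> is the band that \<open>Ups\<close>
  uses at k.\<close>

definition zone :: "real \<Rightarrow> nat" where "zone k = (THE n. k \<in> BZ (Suc n))"

lemma zone_iff: "zone k = n \<longleftrightarrow> k \<in> BZ (Suc n)"
  unfolding zone_def using BZ_ex[of k] BZ_unique[of k] by (metis theI)

lemma zone_0: "\<bar>p\<bar> < pi \<Longrightarrow> zone p = 0"
  by (auto simp: zone_iff BZ_def)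

lemma zone_measurable [measurable]: "zone \<in> borel \<rightarrow>\<^sub>M count_space UNIV"
proof -
  have "zone -` {n} = BZ (Suc n)" for n using zone_iff by auto
  then show ?thesis by (simp add: measurable_count_space_eq2_countable BZ_Suc)
qed

text \<open>In the zone with zero-based index j, two points of the same half differ by less than pi,
  points of opposite halves by an amount strictly between 2 j pi and (2 j + 2) pi; neither range
  contains a nonzero multiple of 2 pi. The half-open ends keep the inequalities strict.\<close>

lemma zone_shift: assumes "zone (k + of_int m * (2 * pi)) = zone (k + of_int n * (2 * pi))" shows "m = n"
proof -
  define a b j where "a = k + of_int m * (2 * pi)" and "b = k + of_int n * (2 * pi)" and "j = zone a"
  have ab: "a - b = of_int (2 * (m - n)) * pi" by (simp add: a_def b_def algebra_simps)
  have A: "(- (real j * pi) - pi < a \<and> a \<le> - (real j * pi)) \<or> (real j * pi < a \<and> a \<le> real j * pi + pi)"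
    and B: "(- (real j * pi) - pi < b \<and> b \<le> - (real j * pi)) \<or> (real j * pi < b \<and> b \<le> real j * pi + pi)"
    using zone_iff[of a j] zone_iff[of b j] assms by (auto simp: BZ_Suc algebra_simps j_def a_def b_def)
  have E: "of_int (2 * int j) * pi = 2 * (real j * pi)" "of_int (2 * int j + 2) * pi = 2 * (real j * pi) + 2 * pi"
    "of_int (-1) * pi = - pi" "of_int 1 * pi = pi" by (auto simp: algebra_simps)
  consider "- pi < a - b \<and> a - b < pi"
    | "2 * (real j * pi) < a - b \<and> a - b < 2 * (real j * pi) + 2 * pi"
    | "2 * (real j * pi) < b - a \<and> b - a < 2 * (real j * pi) + 2 * pi" using A B by linarith
  then show ?thesis
  proof cases
    case 1
    have "of_int (-1) * pi < of_int (2 * (m - n)) * pi" "of_int (2 * (m - n)) * pi < of_int 1 * pi"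
      unfolding ab[symmetric] E using 1 by blast+
    then have "- 1 < 2 * (m - n)" "2 * (m - n) < 1" unfolding mult_less_cancel_right_pos[OF pi_gt_zero] of_int_less_iff .
    then show ?thesis by presburger
  next
    case 2
    have "of_int (2 * int j) * pi < of_int (2 * (m - n)) * pi" "of_int (2 * (m - n)) * pi < of_int (2 * int j + 2) * pi"
      unfolding ab[symmetric] E using 2 by blast+
    then have "2 * int j < 2 * (m - n)" "2 * (m - n) < 2 * int j + 2" unfolding mult_less_cancel_right_pos[OF pi_gt_zero] of_int_less_iff .
    then show ?thesis by presburger
  next
    case 3
    have ba: "b - a = of_int (2 * (n - m)) * pi" using ab by (simp add: algebra_simps)
    have "of_int (2 * int j) * pi < of_int (2 * (n - m)) * pi" "of_int (2 * (n - m)) * pi < of_int (2 * int j + 2) * pi"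
      unfolding ba[symmetric] E using 3 by blast+
    then have "2 * int j < 2 * (n - m)" "2 * (n - m) < 2 * int j + 2" unfolding mult_less_cancel_right_pos[OF pi_gt_zero] of_int_less_iff .
    then show ?thesis by presburger
  qed
qed

section \<open>The unfolded band kernel\<close>

locale bloch_family = periodic_coefficients +
  fixes E :: "nat \<Rightarrow> real \<Rightarrow> real" and phis :: "nat \<Rightarrow> real \<Rightarrow> real \<Rightarrow> complex"
  assumes eig: "\<And>l k. l \<ge> 1 \<Longrightarrow> bloch k (E l k) (\<lambda>x. phis l x k)"
    and quasi: "\<And>l x k. l \<ge> 1 \<Longrightarrow> iexp (x * (k + 2 * pi)) * phis l x (k + 2 * pi) = iexp (x * k) * phis l x k"
    and orth: "\<And>l m k. l \<ge> 1 \<Longrightarrow> m \<ge> 1 \<Longrightarrow> L2inner cell (\<lambda>x. phis l x k) (\<lambda>x. phis m x k) = (if l = m then 1 else 0)"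
    and phis_meas: "\<And>l. (\<lambda>(x, k). phis l x k) \<in> borel_measurable borel"
begin

lemma phis_per: "l \<ge> 1 \<Longrightarrow> phis l (x + 1) k = phis l x k"
  using eig[of l k] by (simp add: bloch_def)

lemma phis_cell: "l \<ge> 1 \<Longrightarrow> (\<lambda>x. phis l x k) \<in> L2sp cell"
  by (rule bloch_obtain[OF eig])

lemma quasi_int: assumes l: "l \<ge> 1" shows "iexp (x * (k + of_int m * (2 * pi))) * phis l x (k + of_int m * (2 * pi)) = iexp (x * k) * phis l x k"
proof -
  define P where "P y = iexp (x * (y * (2 * pi) + k)) * phis l x (y * (2 * pi) + k)" for y
  have "P (y + 1) = P y" for y
    using quasi[OF l, of x "y * (2 * pi) + k"] by (simp add: P_def algebra_simps)
  from periodic_int[of P, OF this, of 0 m] show ?thesis by (simp add: P_def add.commute)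
qed

text \<open>The profile phi / omega has a continuous periodic, hence bounded, representative, and
  omega is bounded.\<close>

lemma phis_essentially_bounded: assumes l: "l \<ge> 1"
  shows "\<exists>c. AE x in lborel. cmod (phis l x k) \<le> c"
proof -
  obtain f d where H: "H1per f d" and A: "acf f d" and ae: "AE x in lborel. phis l x k = complex_of_real (omega x) * f x"
    by (rule bloch_obtain[OF eig[OF l, of k]])
  have per: "\<And>x. f (x + 1) = f x" using H unfolding H1per_def by blast
  have "continuous_on {0..1} f" using acf_continuous[OF A] by (rule continuous_on_subset) simp
  then have "bounded (f ` {0..1})" by (intro compact_imp_bounded compact_continuous_image) auto
  then obtain B where B: "\<And>x. x \<in> {0..1} \<Longrightarrow> cmod (f x) \<le> B" unfolding bounded_iff by blast
  have fB: "cmod (f x) \<le> B" for x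
  proof -
    have "f x = f (frac x)" using periodic_int[of f "frac x" "\<lfloor>x\<rfloor>", OF per] by (simp add: frac_def)
    then show ?thesis using B[of "frac x"] frac_lt_1[of x] by simp
  qed
  have "AE x in lborel. cmod (phis l x k) \<le> w1 * B"
    using ae
  proof eventually_elim
    fix x assume "phis l x k = complex_of_real (omega x) * f x"
    then have "cmod (phis l x k) = omega x * cmod (f x)" using w_pos[of x] by (simp add: norm_mult)
    also have "\<dots> \<le> w1 * B" using w_bounds[of x] w0 fB[of x] by (intro mult_mono) auto
    finally show "cmod (phis l x k) \<le> w1 * B" .
  qed
  then show ?thesis by blast
qed

text \<open>The extended zone scheme: the zone of k selects the band. The translates k + 2 pi m of
  one quasimomentum then carry different bands, hence orthogonal Bloch functions.\<close>

definition band_kernel :: "nat \<Rightarrow> real \<Rightarrow> real \<Rightarrow> complex" where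
  "band_kernel s x k = iexp (k * x) * phis (zone k + s) x k"

lemma band_kernel_contr: assumes s: "s \<ge> 1" shows "contr_kernel (band_kernel s)"
proof (rule bloch_contr_kernel)
  have [measurable]: "(\<lambda>(x, k). phis l x k) \<in> borel_measurable (borel \<Otimes>\<^sub>M borel)" for l using phis_meas by (simp add: borel_prod)
  have "(\<lambda>z. (\<lambda>(x, k). phis (zone (snd z) + s) x k) z) \<in> borel_measurable (borel \<Otimes>\<^sub>M borel)"
    by (rule measurable_compose_countable[where f = "\<lambda>n z. (\<lambda>(x, k). phis (n + s) x k) z"]) measurable
  then have [measurable]: "(\<lambda>(x, k). phis (zone k + s) x k) \<in> borel_measurable (borel \<Otimes>\<^sub>M borel)"
    by (simp add: case_prod_beta)
  have "(\<lambda>(x, k). band_kernel s x k) \<in> borel_measurable (borel \<Otimes>\<^sub>M borel)" unfolding band_kernel_def by measurable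
  then show "(\<lambda>(x, k). band_kernel s x k) \<in> borel_measurable borel" by (simp add: borel_prod)
  show "band_kernel s (x + 1) k = iexp k * band_kernel s x k" for x k
    using phis_per[of "zone k + s" x k] s by (simp add: band_kernel_def distrib_left exp_add)
  show "(\<lambda>x. band_kernel s x k) \<in> L2sp cell" for k
    unfolding band_kernel_def using s
    by (intro L2sp_bdd_mult(1)[OF phis_cell, of _ _ 1] measurable_cell) auto
  fix k :: real and m n :: int
  let ?p = "k + of_int m * (2 * pi)" and ?q = "k + of_int n * (2 * pi)"
  \<comment> \<open>Quasi-periodicity in k brings both factors back to the common quasimomentum k,
    where eigenfunctions of different bands are orthonormal.\<close>
  have e: "band_kernel s x ?p * cnj (band_kernel s x ?q) = phis (zone ?p + s) x k * cnj (phis (zone ?q + s) x k)" for x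
  proof -
    have "band_kernel s x ?p = iexp (x * k) * phis (zone ?p + s) x k" "band_kernel s x ?q = iexp (x * k) * phis (zone ?q + s) x k"
      using quasi_int[of "zone ?p + s" x k m] quasi_int[of "zone ?q + s" x k n] s by (simp_all only: band_kernel_def mult.commute[of _ x])
    moreover have "iexp (x * k) * cnj (iexp (x * k)) = 1" by (simp add: exp_cnj flip: exp_add)
    ultimately show ?thesis by (simp add: mult_ac)
  qed
  have "L2inner cell (\<lambda>x. band_kernel s x ?p) (\<lambda>x. band_kernel s x ?q) = L2inner cell (\<lambda>x. phis (zone ?p + s) x k) (\<lambda>x. phis (zone ?q + s) x k)"
    unfolding L2inner_def e ..
  also have "\<dots> = (if m = n then 1 else 0)"
    using orth[of "zone ?p + s" "zone ?q + s" k] s zone_shift[of k m n] by auto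
  finally show "L2inner cell (\<lambda>x. band_kernel s x ?p) (\<lambda>x. band_kernel s x ?q) = (if m = n then 1 else 0)" .
qed

text \<open>For each k exactly one zone indicator is nonzero, so the series over bands has a single
  term.\<close>

lemma Ups_trunc_eq:
  assumes e: "eps > 0"
  shows "Ups_trunc phis s eps f = ktrunc (\<lambda>x k. band_kernel s (x / eps) (\<bar>eps\<bar> * k)) (Phi f)"
proof -
  have "(\<Sum>n. (let j = n + s in iexp (k * x) * phis j (x / eps) (eps * k) * complex_of_real (indicator (BZ (j - s + 1)) (eps * k))))
     = band_kernel s (x / eps) (\<bar>eps\<bar> * k)" for x k
  proof -
    have "(\<Sum>n. (let j = n + s in iexp (k * x) * phis j (x / eps) (eps * k) * complex_of_real (indicator (BZ (j - s + 1)) (eps * k))))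
      = (\<Sum>n\<in>{zone (eps * k)}. (let j = n + s in iexp (k * x) * phis j (x / eps) (eps * k) * complex_of_real (indicator (BZ (j - s + 1)) (eps * k))))"
      by (rule suminf_finite) (auto simp: Let_def indicator_def simp flip: zone_iff)
    also have "\<dots> = iexp (k * x) * phis (zone (eps * k) + s) (x / eps) (eps * k)"
      using zone_iff[of "eps * k" "zone (eps * k)"] by (simp add: Let_def)
    finally show ?thesis using e by (simp add: band_kernel_def)
  qed
  then show ?thesis by (simp add: fun_eq_iff Ups_trunc_def ktrunc_def)
qed

end

section \<open>The band-edge estimate\<close>

lemma Hq_bound:
  assumes f: "f \<in> Hq q" and h: "h \<in> L2sp lborel" and A: "0 \<le> A"
    and le: "\<And>k. cmod (h k) \<le> A * ((1 + k\<^sup>2) powr (q / 2) * cmod (Phi f k))"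
  shows "L2norm lborel h \<le> A * Hq_norm q f"
proof -
  have fL: "f \<in> L2sp lborel" and fi: "integrable lborel (\<lambda>k. (1 + k\<^sup>2) powr q * (cmod (Phi f k))\<^sup>2)" using f by (auto simp: Hq_def)
  have [measurable]: "Phi f \<in> borel_measurable borel" using L2spD(1)[OF Phi_L2_lim(2)[OF fL]] by simp
  define w where "w k = complex_of_real ((1 + k\<^sup>2) powr (q / 2)) * Phi f k" for k
  have w2: "(cmod (w k))\<^sup>2 = (1 + k\<^sup>2) powr q * (cmod (Phi f k))\<^sup>2" for k
  proof -
    have "1 + k\<^sup>2 > 0" by (rule add_pos_nonneg) auto
    then have "((1 + k\<^sup>2) powr (q / 2))\<^sup>2 = (1 + k\<^sup>2) powr q" by (simp add: powr_power)
    then show ?thesis by (simp add: w_def norm_mult power_mult_distrib)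
  qed
  have wL: "w \<in> L2sp lborel" unfolding L2sp_def using fi w2 by (simp add: w_def[abs_def])
  have "L2norm lborel h \<le> L2norm lborel (\<lambda>k. complex_of_real A * w k)"
  proof (rule L2norm_mono[OF h L2sp_cmult[OF wL]], rule AE_I2)
    show "cmod (h k) \<le> cmod (complex_of_real A * w k)" for k
      using le[of k] A by (simp add: w_def norm_mult)
  qed
  also have "\<dots> = A * L2norm lborel w" using A by (simp add: L2norm_cmult)
  also have "L2norm lborel w = Hq_norm q f" unfolding L2norm_def Hq_norm_def w2 ..
  finally show ?thesis .
qed

text \<open>From r |k| > 1 follows r (1 + k^2) >= 1, whether r is large or small; then take the
  power q/2. Used with r = eps / kap on the frequencies beyond the cut.\<close>

lemma powr_weight_tail:
  fixes q r k :: real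
  assumes q: "0 \<le> q" and r: "r > 0" and k: "1 < r * \<bar>k\<bar>"
  shows "1 \<le> r powr (q / 2) * (1 + k\<^sup>2) powr (q / 2)"
proof -
  have "1 \<le> r * (1 + k\<^sup>2)"
  proof (cases "r \<ge> 1")
    case True
    then show ?thesis using mult_mono[of 1 r 1 "1 + k\<^sup>2"] by simp
  next
    case False
    have "\<bar>k\<bar> \<ge> 1"
    proof (rule ccontr)
      assume "\<not> 1 \<le> \<bar>k\<bar>"
      then have "r * \<bar>k\<bar> \<le> 1 * 1" using False r by (intro mult_mono) auto
      then show False using k by simp
    qed
    then have "\<bar>k\<bar> * 1 \<le> \<bar>k\<bar> * \<bar>k\<bar>" by (intro mult_left_mono) auto
    then have "r * \<bar>k\<bar> \<le> r * (1 + k\<^sup>2)" using r by (intro mult_left_mono) (auto simp: power2_eq_square)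
    then show ?thesis using k by linarith
  qed
  then have "1 \<le> (r * (1 + k\<^sup>2)) powr (q / 2)" using q by (intro ge_one_powr_ge_zero) auto
  also have "\<dots> = r powr (q / 2) * (1 + k\<^sup>2) powr (q / 2)" by (rule powr_mult)
  finally show ?thesis .
qed

text \<open>The bound min 2 y <= 2 (y/2)^(q/4) interpolates between the trivial estimate 2 and the
  linear one. Then k^4 <= (1 + k^2)^2 converts the growth in k into the Sobolev weight.\<close>

lemma powr_weight_phase:
  fixes q y a k eps :: real
  assumes q: "0 \<le> q" "q \<le> 2" and a: "0 \<le> a" and eps: "0 < eps" and y: "0 \<le> y" "y \<le> 2 * (a * (eps\<^sup>2 * k^4))"
  shows "min 2 y \<le> 2 * a powr (q / 4) * eps powr (q / 2) * (1 + k\<^sup>2) powr (q / 2)"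
proof -
  have pos: "1 + k\<^sup>2 > 0" by (rule add_pos_nonneg) auto
  have m: "min 2 y \<le> 2 * (y / 2) powr (q / 4)"
  proof (cases "y \<le> 2")
    case True
    show ?thesis
    proof (cases "y = 0")
      case False
      have "(y / 2) powr 1 \<le> (y / 2) powr (q / 4)" using True y q False by (intro powr_mono') auto
      then show ?thesis using y True by simp
    qed simp
  next
    case False
    have "1 \<le> (y / 2) powr (q / 4)" using False q by (intro ge_one_powr_ge_zero) auto
    then show ?thesis by simp
  qed
  have "k ^ 4 \<le> (1 + k\<^sup>2)\<^sup>2" by (simp add: power2_eq_square power4_eq_xxxx algebra_simps)
  then have "a * (eps\<^sup>2 * k ^ 4) \<le> a * (eps\<^sup>2 * (1 + k\<^sup>2)\<^sup>2)" using a by (intro mult_left_mono) auto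
  then have "y / 2 \<le> a * (eps\<^sup>2 * (1 + k\<^sup>2)\<^sup>2)" using y by linarith
  then have "(y / 2) powr (q / 4) \<le> (a * (eps\<^sup>2 * (1 + k\<^sup>2)\<^sup>2)) powr (q / 4)" using y q by (intro powr_mono2) auto
  also have "\<dots> = a powr (q / 4) * ((eps\<^sup>2) powr (q / 4) * ((1 + k\<^sup>2)\<^sup>2) powr (q / 4))" using a by (simp add: powr_mult)
  also have "(eps\<^sup>2) powr (q / 4) = eps powr (q / 2)" using eps by (simp add: powr_powr flip: powr_numeral)
  also have "((1 + k\<^sup>2)\<^sup>2) powr (q / 4) = (1 + k\<^sup>2) powr (q / 2)" using pos powr_numeral[of "1 + k\<^sup>2" "Num.Bit0 Num.One"] by (simp add: powr_powr flip: powr_numeral)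
  finally show ?thesis using m by (simp add: mult_ac)
qed

text \<open>Split z = eps |k| as z^(1 - q/2) z^(q/2) and use z <= kap in the first factor, whose
  exponent is nonnegative because q <= 2.\<close>

lemma powr_weight_linear:
  fixes q kap k eps :: real
  assumes q: "0 \<le> q" "q \<le> 2" and kap: "0 < kap" and eps: "0 < eps" and k: "eps * \<bar>k\<bar> \<le> kap"
  shows "eps * \<bar>k\<bar> \<le> kap powr (1 - q / 2) * eps powr (q / 2) * (1 + k\<^sup>2) powr (q / 2)"
proof (cases "k = 0")
  case False
  have k1: "\<bar>k\<bar> \<le> 1 + k\<^sup>2"
  proof -
    have "0 \<le> (\<bar>k\<bar> - 1)\<^sup>2" by simp
    also have "(\<bar>k\<bar> - 1)\<^sup>2 = \<bar>k\<bar> * \<bar>k\<bar> - 2 * \<bar>k\<bar> + 1" by (simp only: power2_eq_square algebra_simps)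
    also have "\<bar>k\<bar> * \<bar>k\<bar> = k\<^sup>2" by (simp add: power2_eq_square)
    finally have "2 * \<bar>k\<bar> \<le> 1 + k\<^sup>2" by linarith
    then show ?thesis using abs_ge_zero[of k] by linarith
  qed
  let ?z = "eps * \<bar>k\<bar>"
  have z: "?z > 0" using False eps by simp
  have "?z = ?z powr (1 - q / 2) * ?z powr (q / 2)" using z by (simp flip: powr_add)
  also have "\<dots> \<le> kap powr (1 - q / 2) * ?z powr (q / 2)" using k z q by (intro mult_right_mono powr_mono2) auto
  also have "?z powr (q / 2) = eps powr (q / 2) * \<bar>k\<bar> powr (q / 2)" using eps by (simp add: powr_mult)
  also have "kap powr (1 - q / 2) * (eps powr (q / 2) * \<bar>k\<bar> powr (q / 2)) \<le> kap powr (1 - q / 2) * (eps powr (q / 2) * (1 + k\<^sup>2) powr (q / 2))"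
    using k1 q by (intro mult_left_mono powr_mono2) auto
  finally show ?thesis by (simp add: mult_ac)
qed simp

section \<open>Evolution and splitting of packets\<close>

lemma LINT_mult_right: "(LINT k:A|lborel. a * f k) = a * (LINT k:A|lborel. (f k :: complex))"
  unfolding set_lebesgue_integral_def mult_scaleR_right[symmetric] by (rule Bochner_Integration.integral_mult_right_zero)

lemma unitary_group_L2norm_diff:
  assumes U: "unitary_group_of A U" and u: "u \<in> L2sp lborel" and v: "v \<in> L2sp lborel"
  shows "L2norm lborel (\<lambda>x. U t u x - U t v x) = L2norm lborel (\<lambda>x. u x - v x)"
  using unitary_group_isometry[OF U u v, of t] unitary_groupD(1)[OF U u, of t] unitary_groupD(1)[OF U v, of t] u v
  by (simp add: cl_diff norm_cl L2sp_diff)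

lemma phase_0: "phase lam 0 F = F" by (simp add: phase_def fun_eq_iff)

lemma cmod_phase: "cmod (phase lam t F k) = cmod (F k)" by (simp add: phase_def norm_mult)

text \<open>The packet with its phase is a differentiable curve of domain elements, so
  \<open>unitary_group_curve\<close> identifies it with the group orbit; boundedness of lam provides
  the derivative in norm.\<close>

lemma packet_evolution:
  assumes U: "unitary_group_of A U" and K: "contr_kernel K" and F: "F \<in> L2sp lborel"
    and lamm: "lam \<in> borel_measurable borel" and lb: "\<And>k. \<bar>lam k\<bar> \<le> L"
    and A: "\<And>H. H \<in> L2sp lborel \<Longrightarrow> (\<lambda>k. complex_of_real (lam k) * H k) \<in> L2sp lborel \<Longrightarrow>
      A (ktrunc K H R) (ktrunc K (\<lambda>k. complex_of_real (lam k) * H k) R)"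
  shows "AE x in lborel. U t (ktrunc K F R) x = ktrunc K (phase lam t F) R x"
proof -
  have pL: "phase lam t F \<in> L2sp lborel" for t by (rule phase_L2[OF F lamm])
  have lL: "(\<lambda>k. complex_of_real (lam k) * phase lam t F k) \<in> L2sp lborel" for t
    by (rule L2sp_bdd_mult(1)[OF pL, of _ L]) (use lb lamm in auto)
  note kL = contr_kernelD(3)[OF K]
  have "AE x in lborel. U t (ktrunc K (phase lam 0 F) R) x = ktrunc K (phase lam t F) R x"
    by (rule unitary_group_curve[OF U, where v = "\<lambda>t. ktrunc K (phase lam t F) R"])
      (rule A[OF pL lL] kL[OF pL] kL[OF lL] ktrunc_curve[OF K F lamm lb])+
  then show ?thesis by (simp only: phase_0)
qed

context bloch_family
begin

lemma phis_borel: "l \<ge> 1 \<Longrightarrow> (\<lambda>x. phis l x k) \<in> borel_measurable borel"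
  using eig[of l k] by (simp add: bloch_def)

text \<open>After dilation the packet consists of Bloch waves with quasimomentum eps k, whose
  eigenvalue eps^2 lam k matches the factor eps^2 in \<open>opAeps\<close>.\<close>

lemma opAeps_packet:
  assumes s: "s \<ge> 1" and e: "eps > 0" and K: "contr_kernel K"
    and Ke: "\<And>x k. k \<in> {-R..R} \<Longrightarrow> K x k = iexp (k * x) * phis s (x / eps) (eps * k)"
    and lb: "\<And>k. \<bar>lam k\<bar> \<le> L" and lamE: "\<And>k. k \<in> {-R..R} \<Longrightarrow> E s (eps * k) = eps\<^sup>2 * lam k"
    and H: "H \<in> L2sp lborel" and lH: "(\<lambda>k. complex_of_real (lam k) * H k) \<in> L2sp lborel"
  shows "opAeps g omega eps (ktrunc K H R) (ktrunc K (\<lambda>k. complex_of_real (lam k) * H k) R)"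
proof -
  define a where "a = complex_of_real (sqrt eps) * complex_of_real (1 / sqrt (2 * pi))"
  have T: "Tsc eps (ktrunc K h R) = (\<lambda>x. LINT k:{-R..R}|lborel. (a * h k) * bwave (eps * k) (\<lambda>x. phis s x (eps * k)) x)" for h
  proof
    fix x
    have "(LINT k:{-R..R}|lborel. (a * h k) * bwave (eps * k) (\<lambda>x. phis s x (eps * k)) x) = (LINT k:{-R..R}|lborel. a * (h k * K (eps * x) k))"
      by (rule set_lebesgue_integral_cong) (use e in \<open>auto simp: Ke bwave_def mult_ac\<close>)
    then show "Tsc eps (ktrunc K h R) x = (LINT k:{-R..R}|lborel. (a * h k) * bwave (eps * k) (\<lambda>x. phis s x (eps * k)) x)"
      by (simp add: LINT_mult_right Tsc_def ktrunc_def a_def)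
  qed
  let ?e = "\<lambda>k. eps\<^sup>2 * lam k"
  have T2: "(\<lambda>x. complex_of_real (eps\<^sup>2) * Tsc eps (ktrunc K (\<lambda>k. complex_of_real (lam k) * H k) R) x)
    = (\<lambda>x. LINT k:{-R..R}|lborel. (complex_of_real (?e k) * (a * H k)) * bwave (eps * k) (\<lambda>x. phis s x (eps * k)) x)"
    unfolding T LINT_mult_right[symmetric] by (simp add: mult_ac)
  note kL = contr_kernelD(3)[OF K]
  note TL = Tsc_L2(1)[OF kL[OF H, of R] e, unfolded T] L2sp_cmult[OF Tsc_L2(1)[OF kL[OF lH, of R] e], of "complex_of_real (eps\<^sup>2)", unfolded T2]
  show ?thesis unfolding opAeps_def T2 unfolding T
  proof (rule packet_opA[where phi = "phis s" and Em = "eps\<^sup>2 * L"])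
    show "(\<lambda>(x, p). phis s x p) \<in> borel_measurable borel" by (rule phis_meas)
    show "bloch (eps * k) (?e k) (\<lambda>x. phis s x (eps * k))" if "k \<in> {-R..R}" for k
      using eig[OF s, of "eps * k"] lamE[OF that] by simp
    show "?e k \<le> eps\<^sup>2 * L" for k using lb[of k] by (intro mult_left_mono) auto
    show "(\<lambda>k. a * H k) \<in> L2sp lborel" by (rule L2sp_cmult[OF H])
    show "(\<lambda>k. complex_of_real (?e k) * (a * H k)) \<in> L2sp lborel"
      using L2sp_cmult[OF lH, of "complex_of_real (eps\<^sup>2) * a"] by (simp add: mult_ac)
  qed (rule TL)+
qed

lemma opAeps_unitary_group: "eps > 0 \<Longrightarrow> unitary_group_of (opAeps g omega eps) (expA (opAeps g omega eps))"
  using opA_group opAeps_group expA_group by blast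

lemma band_kernel_small:
  assumes e: "eps > 0" and k: "k \<in> {-(kap / eps)..kap / eps}" and kap: "kap < pi"
  shows "eps * k \<in> {-kap..kap}" "band_kernel s (x / eps) (\<bar>eps\<bar> * k) = iexp (k * x) * phis s (x / eps) (eps * k)"
proof -
  show 1: "eps * k \<in> {-kap..kap}" using k e by (auto simp: field_simps)
  have "zone (eps * k) = 0" using 1 kap by (intro zone_0) auto
  then show "band_kernel s (x / eps) (\<bar>eps\<bar> * k) = iexp (k * x) * phis s (x / eps) (eps * k)" using e by (simp add: band_kernel_def)
qed

text \<open>Normalised by M so as to be bounded by 1. For p = 0 or M = 0 division by zero gives 0,
  which agrees with a numerator bounded by M |p|.\<close>

definition diff_quotient :: "nat \<Rightarrow> real \<Rightarrow> real \<Rightarrow> real \<Rightarrow> real \<Rightarrow> complex" where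
  "diff_quotient s kap M x p = indicator {-kap..kap} p *\<^sub>R ((phis s x p - phis s x 0) / complex_of_real (M * \<bar>p\<bar>))"

lemma diff_quotient_kernel:
  assumes s: "s \<ge> 1" and M: "0 \<le> M" and kap: "kap < pi"
    and b: "AE x in lborel. \<forall>p\<in>{-kap..kap}. cmod (phis s x p - phis s x 0) \<le> M * \<bar>p\<bar>"
  shows "contr_kernel (\<lambda>x p. iexp (p * x) * diff_quotient s kap M x p)"
proof (rule bounded_contr_kernel)
  have [measurable]: "(\<lambda>(x, k). phis s x k) \<in> borel_measurable (borel \<Otimes>\<^sub>M borel)" using phis_meas by (simp add: borel_prod)
  have [measurable]: "(\<lambda>x. phis s x 0) \<in> borel_measurable borel" by (rule phis_borel[OF s])
  have "(\<lambda>(x, p). diff_quotient s kap M x p) \<in> borel_measurable (borel \<Otimes>\<^sub>M borel)" unfolding diff_quotient_def by measurable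
  then show "(\<lambda>(x, p). diff_quotient s kap M x p) \<in> borel_measurable borel" by (simp add: borel_prod)
  show "diff_quotient s kap M (x + 1) p = diff_quotient s kap M x p" for x p by (simp add: diff_quotient_def phis_per[OF s])
  show "p \<notin> BZ0 \<Longrightarrow> diff_quotient s kap M x p = 0" for x p using kap by (auto simp: diff_quotient_def indicator_def)
  show "AE x in lborel. \<forall>p. cmod (diff_quotient s kap M x p) \<le> 1"
    using b
  proof eventually_elim
    fix x assume x: "\<forall>p\<in>{-kap..kap}. cmod (phis s x p - phis s x 0) \<le> M * \<bar>p\<bar>"
    show "\<forall>p. cmod (diff_quotient s kap M x p) \<le> 1"
    proof
      fix p
      have "cmod (phis s x p - phis s x 0) / (M * \<bar>p\<bar>) \<le> 1" if "p \<in> {-kap..kap}"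
        using x[rule_format, OF that] M by (cases "M * \<bar>p\<bar> = 0") (simp_all add: divide_le_eq_1)
      then show "cmod (diff_quotient s kap M x p) \<le> 1"
        using M by (auto simp: diff_quotient_def indicator_def norm_divide norm_mult)
    qed
  qed
qed

text \<open>Replacing the Bloch function at eps k by the one at 0 leaves a packet with kernel
  \<open>diff_quotient\<close>, again a contraction; the small factor M |eps k| moves into the
  amplitude H'.\<close>

lemma packet_split:
  assumes s: "s \<ge> 1" and e: "eps > 0" and M: "0 \<le> M" and kap: "kap < pi"
    and b: "AE x in lborel. \<forall>p\<in>{-kap..kap}. cmod (phis s x p - phis s x 0) \<le> M * \<bar>p\<bar>"
    and H: "H \<in> L2sp lborel"
  defines "R \<equiv> kap / eps" and "K \<equiv> \<lambda>x k. band_kernel s (x / eps) (\<bar>eps\<bar> * k)"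
    and "Q \<equiv> \<lambda>x k. iexp (\<bar>eps\<bar> * k * (x / eps)) * diff_quotient s kap M (x / eps) (\<bar>eps\<bar> * k)"
    and "H' \<equiv> cut {-(kap / eps)..kap / eps} (\<lambda>k. complex_of_real (M * \<bar>eps * k\<bar>) * H k)"
  shows "contr_kernel Q" "H' \<in> L2sp lborel"
    "AE x in lborel. ktrunc K H R x = phis s (x / eps) 0 * ktrunc Kp H R x + ktrunc Q H' R x"
proof -
  have Kc: "contr_kernel K" unfolding K_def by (rule contr_kernel_scale[OF band_kernel_contr[OF s]]) (use e in simp)
  show Q: "contr_kernel Q" unfolding Q_def by (rule contr_kernel_scale[OF diff_quotient_kernel[OF s M kap b]]) (use e in simp)
  have [measurable]: "H \<in> borel_measurable borel" using L2spD(1)[OF H] by simp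
  have "(\<lambda>k. complex_of_real (indicator {-R..R} k * (M * \<bar>eps * k\<bar>)) * H k) \<in> L2sp lborel"
  proof (rule L2sp_bdd_mult(1)[OF H, of _ "M * \<bar>kap\<bar>"])
    show "AE k in lborel. cmod (complex_of_real (indicator {-R..R} k * (M * \<bar>eps * k\<bar>))) \<le> M * \<bar>kap\<bar>"
    proof (rule AE_I2)
      fix k
      show "cmod (complex_of_real (indicator {-R..R} k * (M * \<bar>eps * k\<bar>))) \<le> M * \<bar>kap\<bar>"
      proof (cases "k \<in> {-R..R}")
        case True
        then have "\<bar>eps * k\<bar> \<le> \<bar>kap\<bar>" using band_kernel_small(1)[OF e _ kap, of k] unfolding R_def by auto
        then show ?thesis unfolding norm_of_real using True M by (simp add: abs_mult mult_left_mono)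
      qed (use M in simp)
    qed
  qed simp
  then show H'L: "H' \<in> L2sp lborel" unfolding H'_def cut_def R_def by (simp add: scaleR_conv_of_real mult_ac)
  have b': "AE x in lborel. \<forall>p\<in>{-kap..kap}. cmod (phis s (1 / eps * x) p - phis s (1 / eps * x) 0) \<le> M * \<bar>p\<bar>"
    by (rule AE_scale[OF b]) (use e in simp)
  show "AE x in lborel. ktrunc K H R x = phis s (x / eps) 0 * ktrunc Kp H R x + ktrunc Q H' R x"
    using b' contr_kernelD(2)[OF contr_kernel_iexp H, of R] contr_kernelD(2)[OF Q H'L, of R]
  proof eventually_elim
    fix x
    assume x: "\<forall>p\<in>{-kap..kap}. cmod (phis s (1 / eps * x) p - phis s (1 / eps * x) 0) \<le> M * \<bar>p\<bar>"
      and i1: "set_integrable lborel {-R..R} (\<lambda>k. H k * Kp x k)" and i2: "set_integrable lborel {-R..R} (\<lambda>k. H' k * Q x k)"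
    have "(LINT k:{-R..R}|lborel. H k * K x k) = (LINT k:{-R..R}|lborel. phis s (x / eps) 0 * (H k * Kp x k) + H' k * Q x k)"
    proof (rule set_lebesgue_integral_cong)
      show "\<forall>k. k \<in> {-R..R} \<longrightarrow> H k * K x k = phis s (x / eps) 0 * (H k * Kp x k) + H' k * Q x k"
      proof (intro allI impI)
        fix k assume k: "k \<in> {-R..R}"
        note sm = band_kernel_small[OF e k[unfolded R_def] kap]
        have le: "cmod (phis s (x / eps) (eps * k) - phis s (x / eps) 0) \<le> M * \<bar>eps * k\<bar>" using x sm(1) by simp
        have "complex_of_real (M * \<bar>eps * k\<bar>) * diff_quotient s kap M (x / eps) (eps * k) = phis s (x / eps) (eps * k) - phis s (x / eps) 0"
          using le sm(1) by (cases "M * \<bar>eps * k\<bar> = 0") (auto simp: diff_quotient_def)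
        moreover have "H' k * Q x k = iexp (k * x) * H k * (complex_of_real (M * \<bar>eps * k\<bar>) * diff_quotient s kap M (x / eps) (eps * k))"
          using k e unfolding H'_def Q_def cut_def R_def by (simp add: mult_ac)
        ultimately have "H' k * Q x k = iexp (k * x) * H k * (phis s (x / eps) (eps * k) - phis s (x / eps) 0)" by (simp only:)
        then show "H k * K x k = phis s (x / eps) 0 * (H k * Kp x k) + H' k * Q x k"
          unfolding K_def sm(2) by (simp only: algebra_simps)
      qed
    qed simp
    also have "\<dots> = (LINT k:{-R..R}|lborel. phis s (x / eps) 0 * (H k * Kp x k)) + (LINT k:{-R..R}|lborel. H' k * Q x k)"
      by (rule set_integral_add(2)[OF set_integrable_mult_right[OF i1] i2])
    finally show "ktrunc K H R x = phis s (x / eps) 0 * ktrunc Kp H R x + ktrunc Q H' R x"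
      unfolding ktrunc_def LINT_mult_right by (simp add: algebra_simps)
  qed
qed

end

context bloch_family
begin

text \<open>The error is a sum of four terms: the high frequencies under each of the two groups (A1
  and A4, by unitarity), the phase difference (A2) and the change of Bloch function (A3). The factor
  1 + P arises because the high frequencies count once for A_eps and once multiplied by the
  band-edge function.\<close>

theorem band_edge_estimate:
  assumes s: "s \<ge> 1" and b0: "0 < b0" and kap: "0 < kap" "kap < pi"
    and gm: "gam \<in> borel_measurable borel" and gb: "\<And>p. p \<in> {-kap..kap} \<Longrightarrow> \<bar>gam p\<bar> \<le> D"
    and Es: "\<And>p. p \<in> {-kap..kap} \<Longrightarrow> E s p = sigma0 + b0 * p\<^sup>2 + p^4 * gam p"
    and P: "AE x in lborel. cmod (phis s x 0) \<le> P" "0 \<le> P"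
    and M: "AE x in lborel. \<forall>p\<in>{-kap..kap}. cmod (phis s x p - phis s x 0) \<le> M * \<bar>p\<bar>" "0 \<le> M"
    and e: "0 < eps" and q: "0 \<le> q" "q \<le> 2" and f: "f \<in> Hq q"
  shows "L2norm lborel (\<lambda>x. expA (opAeps g omega eps) t (Ups phis s eps f) x
       - exp (- \<i> * complex_of_real (t * sigma0 / eps\<^sup>2)) * phis s (x / eps) 0 * expA (opAhom b0) t f x)
    \<le> ((1 + P) * kap powr (- q / 2) + P * (2 * (D / 2) powr (q / 4) * \<bar>t\<bar> powr (q / 4)) + M * kap powr (1 - q / 2))
       * eps powr (q / 2) * Hq_norm q f"
proof -
  define c R F where "c = exp (- \<i> * complex_of_real (t * sigma0 / eps\<^sup>2))" and "R = kap / eps" and "F = Phi f"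
  define K where "K x k = band_kernel s (x / eps) (\<bar>eps\<bar> * k)" for x k
  define Q where "Q x k = iexp (\<bar>eps\<bar> * k * (x / eps)) * diff_quotient s kap M (x / eps) (\<bar>eps\<bar> * k)" for x k
  \<comment> \<open>E(eps k) / eps^2 on [-R, R], set to zero elsewhere so that the multiplier is
    bounded on the whole line.\<close>
  define lam where "lam k = indicator {-R..R} k * (sigma0 / eps\<^sup>2 + b0 * k\<^sup>2 + eps\<^sup>2 * k^4 * gam (eps * k))" for k
  define lam0 where "lam0 k = indicator {-R..R} k * (b0 * k\<^sup>2)" for k
  let ?A = "opAeps g omega eps"
  let ?Ah = "opAhom b0"
  let ?ph = "\<lambda>x. phis s (x / eps) 0"
  have fL: "f \<in> L2sp lborel" using f by (simp add: Hq_def)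
  have FL: "F \<in> L2sp lborel" unfolding F_def by (rule Phi_L2_lim(2)[OF fL])
  have R: "0 \<le> R" using kap e by (simp add: R_def)
  have Kc: "contr_kernel K" unfolding K_def by (rule contr_kernel_scale[OF band_kernel_contr[OF s]]) (use e in simp)
  have Ke: "K x k = iexp (k * x) * phis s (x / eps) (eps * k)" and ek: "eps * k \<in> {-kap..kap}" if "k \<in> {-R..R}" for x k
    using band_kernel_small[OF e that[unfolded R_def] kap(2)] unfolding K_def by auto
  have lamm: "lam \<in> borel_measurable borel" "lam0 \<in> borel_measurable borel" unfolding lam_def[abs_def] lam0_def[abs_def] using gm by measurable
  have D0: "0 \<le> D" using gb[of 0] kap by force
  have R2: "k\<^sup>2 \<le> R\<^sup>2" if "k \<in> {-R..R}" for k using that by (intro abs_le_square_iff[THEN iffD1]) auto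
  have R4: "k^4 \<le> R^4" if "k \<in> {-R..R}" for k
    using power_mono[OF R2[OF that], of 2] by (simp flip: power_mult)
  have lamb: "\<bar>lam k\<bar> \<le> \<bar>sigma0 / eps\<^sup>2\<bar> + b0 * R\<^sup>2 + eps\<^sup>2 * R^4 * D" (is "_ \<le> ?L") for k
  proof (cases "k \<in> {-R..R}")
    case True
    have "\<bar>eps\<^sup>2 * k^4 * gam (eps * k)\<bar> \<le> eps\<^sup>2 * R^4 * D"
      unfolding abs_mult using R4[OF True] gb[OF ek[OF True]] by (intro mult_mono) auto
    moreover have "\<bar>b0 * k\<^sup>2\<bar> \<le> b0 * R\<^sup>2" using b0 R2[OF True] by (simp add: abs_mult)
    ultimately have "\<bar>sigma0 / eps\<^sup>2 + b0 * k\<^sup>2 + eps\<^sup>2 * k^4 * gam (eps * k)\<bar> \<le> ?L" by linarith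
    then show ?thesis using True by (simp add: lam_def)
  next
    case False
    then show ?thesis using b0 D0 by (simp add: lam_def)
  qed
  have lam0b: "\<bar>lam0 k\<bar> \<le> b0 * R\<^sup>2" for k
    using b0 R2[of k] by (cases "k \<in> {-R..R}") (auto simp: lam0_def abs_mult)
  have lamE: "E s (eps * k) = eps\<^sup>2 * lam k" if k: "k \<in> {-R..R}" for k
    using Es[OF ek[OF k]] k e by (simp add: lam_def power_mult_distrib field_simps power2_eq_square power4_eq_xxxx)
  note UA = opAeps_unitary_group[OF e] and Uh = opAhom_group[OF b0]
  define p p0 where "p = phase lam t F" and "p0 = phase lam0 t F"
  have pL: "p \<in> L2sp lborel" "p0 \<in> L2sp lborel" unfolding p_def p0_def by (rule phase_L2[OF FL lamm(1)] phase_L2[OF FL lamm(2)])+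
  have evA: "AE x in lborel. expA ?A t (ktrunc K F R) x = ktrunc K p R x"
    unfolding p_def by (rule packet_evolution[OF UA Kc FL lamm(1) lamb]) (rule opAeps_packet[OF s e Kc Ke lamb lamE])
  have evh: "AE x in lborel. expA ?Ah t (ktrunc Kp F R) x = ktrunc Kp p0 R x"
    unfolding p0_def by (rule packet_evolution[OF Uh contr_kernel_iexp FL lamm(2) lam0b]) (rule opAhom_packet, auto simp: lam0_def)
  define H' where "H' = cut {-R..R} (\<lambda>k. complex_of_real (M * \<bar>eps * k\<bar>) * p k)"
  note split = packet_split[OF s e M(2) kap(2) M(1) pL(1), folded R_def, folded H'_def Q_def K_def]
  define m where "m k = 1 * p k + (- c) * p0 k" for k
  have mL: "m \<in> L2sp lborel" unfolding m_def[abs_def] by (intro L2sp_add L2sp_cmult pL)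
  note kL = contr_kernelD(3)
  have V: "L2_lim (ktrunc K F) (Ups phis s eps f)"
  proof -
    have eq: "Ups_trunc phis s eps f = ktrunc K F" unfolding Ups_trunc_eq[OF e] K_def[abs_def] F_def ..
    show ?thesis unfolding Ups_def eq by (rule someI_ex[OF ktrunc_L2_lim[OF Kc FL]])
  qed
  have VL: "Ups phis s eps f \<in> L2sp lborel" using V by (simp add: L2_lim_def)
  have tail: "L2norm lborel (cut (- {-R..R}) F) \<le> (kap powr (- q / 2) * eps powr (q / 2)) * Hq_norm q f"
  proof (rule Hq_bound[OF f])
    show "cut (- {-R..R}) F \<in> L2sp lborel" using FL by auto
    fix k
    show "cmod (cut (- {-R..R}) F k) \<le> (kap powr (- q / 2) * eps powr (q / 2)) * ((1 + k\<^sup>2) powr (q / 2) * cmod (Phi f k))"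
    proof (cases "k \<in> {-R..R}")
      case False
      then have "R < \<bar>k\<bar>" by auto
      then have "kap < \<bar>k\<bar> * eps" using e by (simp add: R_def divide_less_eq)
      then have "1 < eps / kap * \<bar>k\<bar>" using kap by (simp add: field_simps)
      then have "1 \<le> (eps / kap) powr (q / 2) * (1 + k\<^sup>2) powr (q / 2)" using q e kap by (intro powr_weight_tail) auto
      also have "(eps / kap) powr (q / 2) = kap powr (- q / 2) * eps powr (q / 2)" using powr_minus_divide[of kap "q / 2"] by (simp add: powr_divide)
      finally have "1 \<le> kap powr (- q / 2) * eps powr (q / 2) * (1 + k\<^sup>2) powr (q / 2)" .
      from mult_left_mono[OF this norm_ge_zero[of "F k"]] show ?thesis using False by (simp add: cut_def F_def mult_ac)
    qed (simp add: cut_def)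
  qed simp
  define Y where "Y = 2 * (D / 2) powr (q / 4) * \<bar>t\<bar> powr (q / 4)"
  have mb: "L2norm lborel (cut {-R..R} m) \<le> (Y * eps powr (q / 2)) * Hq_norm q f"
  proof (rule Hq_bound[OF f])
    show "cut {-R..R} m \<in> L2sp lborel" using mL by auto
    show "0 \<le> Y * eps powr (q / 2)" by (simp add: Y_def)
    fix k
    show "cmod (cut {-R..R} m k) \<le> (Y * eps powr (q / 2)) * ((1 + k\<^sup>2) powr (q / 2) * cmod (Phi f k))"
    proof (cases "k \<in> {-R..R}")
      case True
      define z where "z = - (t * (eps\<^sup>2 * k^4 * gam (eps * k)))"
      \<comment> \<open>The quartic remainder of the dispersion relation is isolated in z; sigma0
        goes into c and b0 k^2 into the homogenized phase.\<close>
      have ph: "iexp (- (t * lam k)) = c * iexp (- (t * lam0 k)) * iexp z"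
        using True unfolding c_def z_def lam_def lam0_def by (simp add: algebra_simps flip: exp_add)
      have "m k = (c * iexp (- (t * lam0 k)) * F k) * (iexp z - 1)"
        unfolding m_def p_def p0_def phase_def ph by (simp add: algebra_simps)
      moreover have "cmod c = 1" unfolding c_def by simp
      ultimately have cm: "cmod (m k) = cmod (F k) * cmod (iexp z - 1)" by (simp add: norm_mult)
      have "cmod (iexp z - 1) \<le> 2" using norm_triangle_ineq4[of "iexp z" 1] by simp
      moreover have "cmod (iexp z - (\<Sum>j\<le>0. (\<i> * z) ^ j / fact j)) \<le> \<bar>z\<bar> ^ (Suc 0) / fact (Suc 0)" by (rule iexp_approx1)
      ultimately have "cmod (iexp z - 1) \<le> min 2 \<bar>z\<bar>" by simp
      also have "\<dots> \<le> 2 * (\<bar>t\<bar> * (D / 2)) powr (q / 4) * eps powr (q / 2) * (1 + k\<^sup>2) powr (q / 2)"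
      proof (rule powr_weight_phase[OF q _ e])
        have "\<bar>z\<bar> = \<bar>t\<bar> * (eps\<^sup>2 * k^4) * \<bar>gam (eps * k)\<bar>" by (simp add: z_def abs_mult)
        also have "\<dots> \<le> \<bar>t\<bar> * (eps\<^sup>2 * k^4) * D" by (intro mult_left_mono gb ek True) auto
        finally show "\<bar>z\<bar> \<le> 2 * (\<bar>t\<bar> * (D / 2) * (eps\<^sup>2 * k ^ 4))" by (simp add: mult_ac)
      qed (use D0 in auto)
      also have "2 * (\<bar>t\<bar> * (D / 2)) powr (q / 4) = Y" unfolding powr_mult by (simp add: Y_def)
      finally have "cmod (iexp z - 1) \<le> Y * eps powr (q / 2) * (1 + k\<^sup>2) powr (q / 2)" .
      from mult_left_mono[OF this norm_ge_zero[of "F k"]] show ?thesis using True cm by (simp add: cut_def F_def mult_ac)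
    next
      case False
      then show ?thesis by (simp add: cut_def Y_def)
    qed
  qed
  have H'b: "L2norm lborel H' \<le> (M * (kap powr (1 - q / 2) * eps powr (q / 2))) * Hq_norm q f"
  proof (rule Hq_bound[OF f split(2)])
    show "0 \<le> M * (kap powr (1 - q / 2) * eps powr (q / 2))" using M by simp
    fix k
    show "cmod (H' k) \<le> (M * (kap powr (1 - q / 2) * eps powr (q / 2))) * ((1 + k\<^sup>2) powr (q / 2) * cmod (Phi f k))"
    proof (cases "k \<in> {-R..R}")
      case True
      have "eps * \<bar>k\<bar> \<le> kap" using ek[OF True] e by (auto simp: abs_if)
      from powr_weight_linear[OF q kap(1) e this]
      have "(M * cmod (F k)) * (eps * \<bar>k\<bar>) \<le> (M * cmod (F k)) * (kap powr (1 - q / 2) * eps powr (q / 2) * (1 + k\<^sup>2) powr (q / 2))"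
        using M by (intro mult_left_mono) auto
      moreover have "cmod (H' k) = (M * cmod (F k)) * (eps * \<bar>k\<bar>)"
        using True M e by (simp add: H'_def cut_def p_def norm_mult cmod_phase abs_mult)
      ultimately show ?thesis by (simp add: F_def mult_ac)
    qed (use M in \<open>simp add: H'_def cut_def\<close>)
  qed
  define A1 where "A1 x = expA ?A t (Ups phis s eps f) x - expA ?A t (ktrunc K F R) x" for x
  define A2 where "A2 x = ?ph x * ktrunc Kp m R x" for x
  define A3 where "A3 = ktrunc Q H' R"
  define A4 where "A4 x = (- c * ?ph x) * (expA ?Ah t f x - expA ?Ah t (ktrunc Kp F R) x)" for x
  have phm: "?ph \<in> borel_measurable lborel" using phis_borel[OF s, of 0] by measurable
  have Pe: "AE x in lborel. cmod (?ph x) \<le> P" using AE_scale[OF P(1), of "1 / eps"] e by simp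
  have Pc: "AE x in lborel. cmod (- c * ?ph x) \<le> P"
  proof -
    have "cmod (- c * ?ph x) = cmod (?ph x)" for x by (simp add: norm_mult c_def)
    then show ?thesis using Pe by simp
  qed
  note UL = unitary_groupD(1)
  note kF = kL[OF Kc FL, of R] and kpF = kL[OF contr_kernel_iexp FL, of R] and kpm = kL[OF contr_kernel_iexp mL, of R]
  have dL: "(\<lambda>x. expA ?Ah t f x - expA ?Ah t (ktrunc Kp F R) x) \<in> L2sp lborel" by (intro L2sp_diff UL[OF Uh] fL kpF)
  have L1: "A1 \<in> L2sp lborel" unfolding A1_def by (intro L2sp_diff UL[OF UA] VL kF)
  have n1: "L2norm lborel A1 \<le> L2norm lborel (cut (- {-R..R}) F)"
    unfolding A1_def unitary_group_L2norm_diff[OF UA VL kF] by (rule ktrunc_L2_lim_tail[OF Kc FL V R])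
  have L2: "A2 \<in> L2sp lborel" unfolding A2_def by (rule L2sp_bdd_mult(1)[OF kpm phm Pe])
  have "L2norm lborel A2 \<le> \<bar>P\<bar> * L2norm lborel (ktrunc Kp m R)" unfolding A2_def by (rule L2sp_bdd_mult(2)[OF kpm phm Pe])
  also have "\<dots> \<le> P * L2norm lborel (cut {-R..R} m)" using P(2) contr_kernelD(4)[OF contr_kernel_iexp mL, of R] by (simp add: mult_left_mono)
  finally have n2: "L2norm lborel A2 \<le> P * L2norm lborel (cut {-R..R} m)" .
  have L3: "A3 \<in> L2sp lborel" unfolding A3_def by (rule kL[OF split(1,2)])
  have n3: "L2norm lborel A3 \<le> L2norm lborel H'" unfolding A3_def by (rule ktrunc_contr[OF split(1,2)])
  have cm: "(\<lambda>x. - c * ?ph x) \<in> borel_measurable lborel" using phm by measurable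
  have L4: "A4 \<in> L2sp lborel" unfolding A4_def by (rule L2sp_bdd_mult(1)[OF dL cm Pc])
  have "L2norm lborel A4 \<le> \<bar>P\<bar> * L2norm lborel (\<lambda>x. expA ?Ah t f x - expA ?Ah t (ktrunc Kp F R) x)"
    unfolding A4_def by (rule L2sp_bdd_mult(2)[OF dL cm Pc])
  also have "\<dots> \<le> P * L2norm lborel (cut (- {-R..R}) F)"
    unfolding unitary_group_L2norm_diff[OF Uh fL kpF]
    using P(2) ktrunc_L2_lim_tail[OF contr_kernel_iexp FL Phi_inverse[OF fL, folded F_def] R] by (simp add: mult_left_mono)
  finally have n4: "L2norm lborel A4 \<le> P * L2norm lborel (cut (- {-R..R}) F)" .
  let ?X = "\<lambda>x. expA ?A t (Ups phis s eps f) x - c * ?ph x * expA ?Ah t f x"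
  have "L2norm lborel ?X = L2norm lborel (\<lambda>x. (A1 x + A2 x) + (A3 x + A4 x))"
  proof (rule L2norm_cong_AE)
    have "(\<lambda>x. (c * ?ph x) * expA ?Ah t f x) \<in> L2sp lborel"
      by (rule L2sp_bdd_mult(1)[OF UL[OF Uh fL], of _ P]) (use phm Pc in auto)
    then show "?X \<in> borel_measurable lborel" by (intro L2spD(1) L2sp_diff UL[OF UA VL])
    show "(\<lambda>x. (A1 x + A2 x) + (A3 x + A4 x)) \<in> borel_measurable lborel" by (intro L2spD(1) L2sp_add L1 L2 L3 L4)
    show "AE x in lborel. ?X x = (A1 x + A2 x) + (A3 x + A4 x)"
      using evA evh split(3) ktrunc_lin[OF contr_kernel_iexp pL(1) pL(2), of 1 "- c" R]
    proof eventually_elim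
      fix x
      assume a: "expA ?A t (ktrunc K F R) x = ktrunc K p R x" "expA ?Ah t (ktrunc Kp F R) x = ktrunc Kp p0 R x"
        "ktrunc K p R x = ?ph x * ktrunc Kp p R x + ktrunc Q H' R x"
        "ktrunc Kp (\<lambda>k. 1 * p k + - c * p0 k) R x = 1 * ktrunc Kp p R x + - c * ktrunc Kp p0 R x"
      show "?X x = (A1 x + A2 x) + (A3 x + A4 x)"
        unfolding A1_def A2_def A3_def A4_def m_def[abs_def] a by (simp add: algebra_simps)
    qed
  qed
  also have "\<dots> \<le> (L2norm lborel A1 + L2norm lborel A2) + (L2norm lborel A3 + L2norm lborel A4)"
    by (intro order_trans[OF L2norm_triangle] add_mono L2norm_triangle L2sp_add L1 L2 L3 L4)
  also have "\<dots> \<le> (1 + P) * L2norm lborel (cut (- {-R..R}) F) + P * L2norm lborel (cut {-R..R} m) + L2norm lborel H'"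
    using n1 n2 n3 n4 by (simp add: algebra_simps)
  also have "\<dots> \<le> (1 + P) * ((kap powr (- q / 2) * eps powr (q / 2)) * Hq_norm q f)
      + P * ((Y * eps powr (q / 2)) * Hq_norm q f) + (M * (kap powr (1 - q / 2) * eps powr (q / 2))) * Hq_norm q f"
    using P(2) by (intro add_mono mult_left_mono tail mb H'b) auto
  also have "\<dots> = ((1 + P) * kap powr (- q / 2) + P * Y + M * kap powr (1 - q / 2)) * eps powr (q / 2) * Hq_norm q f"
    by (simp add: algebra_simps)
  finally show ?thesis unfolding c_def Y_def .
qed

end

section \<open>From the stated setting to the estimate\<close>

lemma setting_bloch_family:
  assumes S: "setting gc omega E phis"
  obtains g0 g1 w0 w1 where "bloch_family (\<lambda>y. (omega y)\<^sup>2 * gc y) omega g0 g1 w0 w1 E phis"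
proof -
  note S1 = S[unfolded setting_def, THEN conjunct2, THEN conjunct2]
  note S2 = S1[THEN conjunct2, THEN conjunct2, THEN conjunct2]
  obtain a0 a1 where a: "0 < a0" "\<And>x. a0 \<le> gc x" "\<And>x. gc x \<le> a1" using S1[THEN conjunct1] by blast
  obtain w0 w1 where w: "0 < w0" "\<And>x. w0 \<le> omega x" "\<And>x. omega x \<le> w1" using S2[THEN conjunct1] by blast
  have m: "gc \<in> borel_measurable lborel" "omega \<in> borel_measurable lborel"
    and per: "\<And>x. gc (x + 1) = gc x" "\<And>x. omega (x + 1) = omega x"
    and pm: "\<And>l. (\<lambda>(x, k). phis l x k) \<in> borel_measurable borel" using S unfolding setting_def by blast+
  have sp: "opAk (\<lambda>x. (omega x)\<^sup>2 * gc x) omega k (\<lambda>x. phis l x k) (\<lambda>x. complex_of_real (E l k) * phis l x k)"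
    "phis l (x + 1) k = phis l x k"
    "iexp (x * (k + 2 * pi)) * phis l x (k + 2 * pi) = iexp (x * k) * phis l x k"
    "m \<ge> 1 \<Longrightarrow> L2inner cell (\<lambda>x. phis l x k) (\<lambda>x. phis m x k) = (if l = m then 1 else 0)"
    if "l \<ge> 1" for l m k x using S that unfolding setting_def by blast+
  have w2: "w0\<^sup>2 \<le> (omega x)\<^sup>2" "(omega x)\<^sup>2 \<le> w1\<^sup>2" for x
    using w(1) w(2,3)[of x] by (auto intro!: power_mono)
  interpret periodic_coefficients "\<lambda>y. (omega y)\<^sup>2 * gc y" omega "w0\<^sup>2 * a0" "w1\<^sup>2 * a1" w0 w1
  proof
    show "(\<lambda>y. (omega y)\<^sup>2 * gc y) \<in> borel_measurable borel" "omega \<in> borel_measurable borel" using m by auto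
    show "0 < w0\<^sup>2 * a0" "0 < w0" using w a by auto
    show "w0\<^sup>2 * a0 \<le> (omega x)\<^sup>2 * gc x \<and> (omega x)\<^sup>2 * gc x \<le> w1\<^sup>2 * a1" for x
      using w2[of x] a(1) a(2,3)[of x] by (auto intro!: mult_mono)
    show "w0 \<le> omega x \<and> omega x \<le> w1" for x using w by blast
  qed (simp_all add: per)
  have "bloch_family (\<lambda>y. (omega y)\<^sup>2 * gc y) omega (w0\<^sup>2 * a0) (w1\<^sup>2 * a1) w0 w1 E phis"
  proof
    fix l k assume l: "(1::nat) \<le> l"
    have "L2norm cell (\<lambda>x. phis l x k) = 1"
    proof -
      have "complex_of_real ((L2norm cell (\<lambda>x. phis l x k))\<^sup>2) = 1" using L2inner_self[of cell "\<lambda>x. phis l x k"] sp(4)[OF l l, of k] by simp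
      then have "(L2norm cell (\<lambda>x. phis l x k))\<^sup>2 = 1" by (simp only: of_real_eq_1_iff)
      moreover have "0 \<le> L2norm cell (\<lambda>x. phis l x k)" by (simp add: L2norm_def)
      ultimately show ?thesis by (simp add: power2_eq_1_iff)
    qed
    moreover have "(\<lambda>x. phis l x k) \<in> borel_measurable borel"
    proof -
      have "(\<lambda>(x, k). phis l x k) \<in> borel_measurable (borel \<Otimes>\<^sub>M borel)" using pm[of l] by (simp add: borel_prod)
      from measurable_compose[OF measurable_Pair2'[of k borel] this] show ?thesis by simp
    qed
    ultimately show "bloch k (E l k) (\<lambda>x. phis l x k)" unfolding bloch_def using sp(1,2)[OF l] by blast
  qed (use sp pm in blast)+
  then show thesis by (rule that)
qed

text \<open>The essential supremum bounds something only for a measurable function. For nonzero k,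
  theta0 is a difference quotient of measurable functions; at k = 0 it is a limit of such, by
  continuity in k.\<close>

lemma expansions_theta0_bound:
  assumes S: "setting gc omega E phis" and s: "s \<ge> 1"
    and X: "expansions E phis s sigma0 b0 gam0 theta0 gamt0 kap"
  shows "AE x in lborel. \<forall>p\<in>{-kap..kap}. cmod (phis s x p - phis s x 0) \<le> Mnorm kap theta0 * \<bar>p\<bar>" "0 \<le> Mnorm kap theta0"
proof -
  obtain g0 g1 w0 w1 where "bloch_family (\<lambda>y. (omega y)\<^sup>2 * gc y) omega g0 g1 w0 w1 E phis" by (rule setting_bloch_family[OF S])
  then interpret bloch_family "\<lambda>y. (omega y)\<^sup>2 * gc y" omega g0 g1 w0 w1 E phis .
  have kap: "0 < kap" "kap < pi" and th: "\<And>x k. \<bar>k\<bar> < pi \<Longrightarrow> phis s x k = phis s x 0 + complex_of_real k * theta0 x k"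
    and d: "\<And>x k. k \<in> {-kap..kap} \<Longrightarrow> theta0 x differentiable (at k within {-kap..kap})"
    and c: "\<And>x. continuous_on {-kap..kap} (\<lambda>k. vector_derivative (theta0 x) (at k within {-kap..kap}))"
    using X unfolding expansions_def by blast+
  obtain b where b: "AE x in lborel. C1norm kap (theta0 x) \<le> b" using X unfolding expansions_def by blast
  have m1: "(\<lambda>x. theta0 x k) \<in> borel_measurable borel" if k: "k \<in> {-kap..kap}" "k \<noteq> 0" for k
  proof -
    have "\<bar>k\<bar> < pi" using k kap by auto
    then have "theta0 x k = (phis s x k - phis s x 0) / complex_of_real k" for x using th[of k x] k(2) by simp
    then show ?thesis using phis_borel[OF s, of k] phis_borel[OF s, of 0] by simp
  qed
  have m: "(\<lambda>x. theta0 x k) \<in> borel_measurable borel" if k: "k \<in> {-kap..kap}" for k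
  proof (cases "k = 0")
    case True
    define y where "y n = kap * (1 / real (Suc n))" for n
    have y: "y n \<in> {-kap..kap}" "y n \<noteq> 0" for n
    proof -
      have "0 < y n" "y n \<le> kap" unfolding y_def using kap(1) by (auto simp: field_simps)
      then show "y n \<in> {-kap..kap}" "y n \<noteq> 0" by auto
    qed
    have "y \<longlonglongrightarrow> kap * 0" unfolding y_def by (intro tendsto_intros LIMSEQ_Suc[OF lim_1_over_n])
    then have y0: "y \<longlonglongrightarrow> 0" by simp
    have "continuous_on {-kap..kap} (theta0 x)" for x
      using d by (intro differentiable_imp_continuous_on) (simp add: differentiable_on_def)
    then have "(\<lambda>n. theta0 x (y n)) \<longlonglongrightarrow> theta0 x 0" for x
      by (rule continuous_on_tendsto_compose[OF _ y0]) (use y(1) kap in auto)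
    then show ?thesis unfolding True by (intro borel_measurable_LIMSEQ_metric[OF m1[OF y]])
  qed (rule m1[OF k])
  have Cm: "(\<lambda>x. C1norm kap (theta0 x)) \<in> borel_measurable borel" by (rule C1norm_measurable(1)[OF kap(1) m d c])
  have Cb: "cmod (theta0 x p) \<le> C1norm kap (theta0 x)" if "p \<in> {-kap..kap}" for x p
    by (rule C1norm_measurable(2)[OF kap(1) m d c]) (use that in auto)
  have nn: "0 \<le> C1norm kap (theta0 x)" for x using order_trans[OF norm_ge_zero Cb[of 0 x]] kap by auto
  note es = ess_sup_AE[OF Cm nn b, folded Mnorm_def]
  show "0 \<le> Mnorm kap theta0" by (rule es(2))
  show "AE x in lborel. \<forall>p\<in>{-kap..kap}. cmod (phis s x p - phis s x 0) \<le> Mnorm kap theta0 * \<bar>p\<bar>"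
    using es(1)
  proof eventually_elim
    fix x assume x: "C1norm kap (theta0 x) \<le> Mnorm kap theta0"
    show "\<forall>p\<in>{-kap..kap}. cmod (phis s x p - phis s x 0) \<le> Mnorm kap theta0 * \<bar>p\<bar>"
    proof
      fix p assume p: "p \<in> {-kap..kap}"
      have "phis s x p - phis s x 0 = complex_of_real p * theta0 x p" using th[of p x] p kap by auto
      then have "cmod (phis s x p - phis s x 0) = \<bar>p\<bar> * cmod (theta0 x p)" by (simp add: norm_mult)
      also have "\<dots> \<le> \<bar>p\<bar> * Mnorm kap theta0" using Cb[OF p, of x] x by (intro mult_left_mono) auto
      finally show "cmod (phis s x p - phis s x 0) \<le> Mnorm kap theta0 * \<bar>p\<bar>" by (simp add: mult.commute)
    qed
  qed
qed

theorem theorem1: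
  "\<exists>C :: real \<Rightarrow> real \<Rightarrow> real \<Rightarrow> real \<Rightarrow> real \<Rightarrow> real.
   \<forall>gc omega E phis s sigma0 b0 gam0 theta0 gamt0 kap.
     setting gc omega E phis \<and> condition1 E s \<and>
     expansions E phis s sigma0 b0 gam0 theta0 gamt0 kap \<and> gam0 0 \<noteq> 0 \<longrightarrow>
     (\<forall>(t::real) (q::real) f (eps::real).
        t \<noteq> 0 \<and> 0 \<le> q \<and> q \<le> 2 \<and> f \<in> Hq q \<and> 0 < eps \<and>
        eps * \<bar>t\<bar> powr (-1/2) \<le> (2*pi) powr (-1/2) * sqrt \<bar>gam0 0\<bar> * kap\<^sup>2 \<longrightarrow>
        L2norm lborel (\<lambda>x.
            expA (opAeps (\<lambda>y. (omega y)\<^sup>2 * gc y) omega eps) t (Ups phis s eps f) x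
          - exp (- \<i> * complex_of_real (t * sigma0 / eps\<^sup>2)) * phis s (x / eps) 0
              * expA (opAhom b0) t f x)
        \<le> C q kap (ess_sup (\<lambda>x. cmod (phis s x 0))) \<bar>gam0 0\<bar> (Mnorm kap theta0)
            * (1 + \<bar>t\<bar> powr (q/4)) * eps powr (q/2) * Hq_norm q f)"
proof -
  \<comment> \<open>The three error constants with D = 3/2 |gam0 0|, the bound for gam0 on
    [-kap, kap]. The power |t|^(q/4) belongs to the phase error; the common factor 1 + |t|^(q/4)
    dominates both it and 1.\<close>
  define C :: "real \<Rightarrow> real \<Rightarrow> real \<Rightarrow> real \<Rightarrow> real \<Rightarrow> real" where
    "C q kap P G M = (1 + P) * kap powr (- q / 2) + P * (2 * (3 / 2 * G / 2) powr (q / 4)) + M * kap powr (1 - q / 2)" for q kap P G M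
  show ?thesis
  proof (rule exI[of _ C], intro allI impI, elim conjE)
    fix gc omega E phis s sigma0 b0 gam0 theta0 gamt0 kap t q f eps
    assume S: "setting gc omega E phis" and c1: "condition1 E s"
      and X: "expansions E phis s sigma0 b0 gam0 theta0 gamt0 kap"
      and q: "0 \<le> q" "q \<le> (2::real)" and f: "f \<in> Hq q" and e: "0 < (eps::real)"
    have s: "s \<ge> 1" using c1 by (simp add: condition1_def)
    obtain g0 g1 w0 w1 where "bloch_family (\<lambda>y. (omega y)\<^sup>2 * gc y) omega g0 g1 w0 w1 E phis" by (rule setting_bloch_family[OF S])
    then interpret bloch_family "\<lambda>y. (omega y)\<^sup>2 * gc y" omega g0 g1 w0 w1 E phis .
    \<comment> \<open>gam0 is known to be continuous on [-pi, pi]; extending it by zero makes it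
      Borel measurable on the line.\<close>
    define P M gam where "P = ess_sup (\<lambda>x. cmod (phis s x 0))" and "M = Mnorm kap theta0"
      and "gam p = indicator {-pi..pi} p *\<^sub>R gam0 p" for p
    have b0: "0 < b0" and kap: "0 < kap" "kap < pi" and gc: "continuous_on {-pi..pi} gam0"
      and Es: "\<And>k. \<bar>k\<bar> \<le> pi \<Longrightarrow> E s k = sigma0 + b0 * k\<^sup>2 + k^4 * gam0 k"
      and gb: "\<And>k. \<bar>k\<bar> \<le> kap \<Longrightarrow> \<bar>gam0 k\<bar> \<le> 3/2 * \<bar>gam0 0\<bar>"
      using X unfolding expansions_def by blast+
    have gm: "gam \<in> borel_measurable borel" unfolding gam_def by (rule borel_measurable_continuous_on_indicator[OF _ gc]) simp
    have ge: "gam p = gam0 p" if "p \<in> {-kap..kap}" for p using that kap by (auto simp: gam_def indicator_def)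
    obtain c where "AE x in lborel. cmod (phis s x 0) \<le> c" using phis_essentially_bounded[OF s] by blast
    from ess_sup_AE[OF borel_measurable_norm[THEN measurable_compose[OF phis_borel[OF s, of 0]]] norm_ge_zero this]
    have P: "AE x in lborel. cmod (phis s x 0) \<le> P" "0 \<le> P" by (simp_all add: P_def)
    note M = expansions_theta0_bound[OF S s X, folded M_def]
    have "L2norm lborel (\<lambda>x. expA (opAeps (\<lambda>y. (omega y)\<^sup>2 * gc y) omega eps) t (Ups phis s eps f) x
       - exp (- \<i> * complex_of_real (t * sigma0 / eps\<^sup>2)) * phis s (x / eps) 0 * expA (opAhom b0) t f x)
      \<le> ((1 + P) * kap powr (- q / 2) + P * (2 * (3 / 2 * \<bar>gam0 0\<bar> / 2) powr (q / 4) * \<bar>t\<bar> powr (q / 4)) + M * kap powr (1 - q / 2))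
       * eps powr (q / 2) * Hq_norm q f"
    proof (rule band_edge_estimate[OF s b0 kap gm _ _ P M e q f])
      fix p assume p: "p \<in> {-kap..kap}"
      show "\<bar>gam p\<bar> \<le> 3 / 2 * \<bar>gam0 0\<bar>" unfolding ge[OF p] by (rule gb) (use p in auto)
      show "E s p = sigma0 + b0 * p\<^sup>2 + p ^ 4 * gam p" unfolding ge[OF p] by (rule Es) (use p kap in auto)
    qed
    also have "\<dots> \<le> (C q kap P \<bar>gam0 0\<bar> M * (1 + \<bar>t\<bar> powr (q / 4))) * eps powr (q / 2) * Hq_norm q f"
    proof (intro mult_right_mono)
      have "0 \<le> (1 + P) * kap powr (- q / 2)" "0 \<le> M * kap powr (1 - q / 2)" "0 \<le> P * (2 * (3 / 2 * \<bar>gam0 0\<bar> / 2) powr (q / 4))"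
        and tt: "0 \<le> \<bar>t\<bar> powr (q / 4)" using P M by auto
      from this(1-3)[THEN mult_nonneg_nonneg[OF _ tt]] this(3)
      show "(1 + P) * kap powr (- q / 2) + P * (2 * (3 / 2 * \<bar>gam0 0\<bar> / 2) powr (q / 4) * \<bar>t\<bar> powr (q / 4)) + M * kap powr (1 - q / 2)
        \<le> C q kap P \<bar>gam0 0\<bar> M * (1 + \<bar>t\<bar> powr (q / 4))" unfolding C_def by (simp add: algebra_simps)
      show "0 \<le> Hq_norm q f" by (simp add: Hq_norm_def)
    qed simp
    finally show "L2norm lborel (\<lambda>x. expA (opAeps (\<lambda>y. (omega y)\<^sup>2 * gc y) omega eps) t (Ups phis s eps f) x
          - exp (- \<i> * complex_of_real (t * sigma0 / eps\<^sup>2)) * phis s (x / eps) 0 * expA (opAhom b0) t f x)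
        \<le> C q kap (ess_sup (\<lambda>x. cmod (phis s x 0))) \<bar>gam0 0\<bar> (Mnorm kap theta0)
            * (1 + \<bar>t\<bar> powr (q/4)) * eps powr (q/2) * Hq_norm q f" unfolding P_def M_def .
  qed
qed

end
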